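(* Let $\varphi:\mathbb{R}\to(0,+\infty)$ be a continuous function with $\int_{\mathbb{R}}\varphi(t)\,dt=1$. Let $G$ be a countable group and $F:G\to\mathbb{R}$ a bounded function such that $c_g:h\mapsto F(g^{-1}h)-F(h)$ belongs to $\ell^2(G)$ for all $g\in G$. Define the probability measures $\mu_g$ on $\mathbb{R}$ by $d\mu_g(t)=\varphi(t+F(g))\,dt$ and let $G\curvearrowright(X,\mu)=\prod_{g\in G}(\mathbb{R},\mu_g)$ be the Bernoulli action. Consider the following two conditions. 1. The function $\log\varphi$ is Lipschitz with constant $M\ge0$. 2. The function $\log\varphi$ is differentiable and $(\log\varphi)'$ is Lipschitz with constant $M\ge0$. In both cases, $G\curvearrowright(X,\mu)$ is nonsingular. In case 1, if $\delta(c)>9M^2/2$, the action $G\curvearrowright(X,\mu)$ is weakly mixing and it is of stable type III$_1$, unless $c$ is a coboundary, in which case it is of type II$_1$. In case 2, if $\delta(c)>6M$ and if $\int_{\mathbb{R}}|t|^\alpha\varphi(t)\,dt<+\infty$ for some $\alpha>2$, the same conclusions hold: $G\curvearrowright(X,\mu)$ is weakly mixing and it is of stable type III$_1$, unless $c$ is a coboundary, in which case it is of type II$_1$.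
   Context: Bernoulli action: $(g\cdot x)_h=x_{g^{-1}h}$ on $X=\mathbb{R}^G$ with the product measure $\mu=\prod_{g\in G}\mu_g$; it is nonsingular if each $g$ preserves the $\mu$-null sets. The Poincar\'e exponent of the $1$-cocycle $c$ is $\delta(c)=\limsup_{s\to+\infty}\frac{\log|\{g\in G\mid\|c_g\|_2^2\le s\}|}{s}$. The cocycle $c$ is a coboundary if $F$ equals a constant plus a square summable function. A nonsingular action is weakly mixing if it is ergodic and its diagonal product with every ergodic probability measure preserving (pmp) action $G\curvearrowright(Y,\eta)$ is ergodic. A weakly mixing action is of stable type III$_1$ if all these diagonal products $G\curvearrowright X\times Y$ are of type III$_1$. An ergodic nonsingular action $G\curvearrowright(X,\mu)$ is of type III$_1$ if its Maharam extension $G\curvearrowright X\times\mathbb{R}$, $g\cdot(x,t)=(g\cdot x,t+\log\frac{d(g^{-1}\mu)}{d\mu}(x))$ (with $g^{-1}\mu$ the push forward of $\mu$ under $x\mapsto g^{-1}\cdot x$) is ergodic. It is of type II$_1$ if $\mu$ is nonatomic and equivalent to an invariant probability measure. *)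

theory Defs
  imports "HOL-Probability.Probability" "HOL-Algebra.Group_Action"
begin

text \<open>
  Throughout, an action of \<open>G\<close> on (the underlying set of) a measure space \<open>M\<close> is an action in the
  sense of \<^locale>\<open>group_action\<close>; in particular each \<open>a g\<close> is extensional on \<open>space M\<close>.
\<close>

definition nonsingular_action ::
    "('g, 'b) monoid_scheme \<Rightarrow> 'x measure \<Rightarrow> ('g \<Rightarrow> 'x \<Rightarrow> 'x) \<Rightarrow> bool" where
  "nonsingular_action G M a \<longleftrightarrow>
     group_action G (space M) a \<and>
     (\<forall>g\<in>carrier G. a g \<in> measurable M M \<and>
        (\<forall>A\<in>sets M. a g -` A \<inter> space M \<in> null_sets M \<longleftrightarrow> A \<in> null_sets M))"

definition pmp_action ::
    "('g, 'b) monoid_scheme \<Rightarrow> 'x measure \<Rightarrow> ('g \<Rightarrow> 'x \<Rightarrow> 'x) \<Rightarrow> bool" where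
  "pmp_action G M a \<longleftrightarrow>
     prob_space M \<and> group_action G (space M) a \<and>
     (\<forall>g\<in>carrier G. a g \<in> measurable M M \<and> distr M M (a g) = M)"

text \<open>
  Invariance of a set is understood modulo null sets.  For countable \<open>G\<close> this yields the same notion
  as strict invariance, and it also makes sense for the Maharam extension below, whose maps depend
  on a choice of Radon-Nikodym derivatives and hence form an action only almost everywhere.
\<close>

definition ergodic ::
    "('g, 'b) monoid_scheme \<Rightarrow> 'x measure \<Rightarrow> ('g \<Rightarrow> 'x \<Rightarrow> 'x) \<Rightarrow> bool" where
  "ergodic G M a \<longleftrightarrow>
     (\<forall>A\<in>sets M. (\<forall>g\<in>carrier G. AE x in M. a g x \<in> A \<longleftrightarrow> x \<in> A) \<longrightarrow>
        (AE x in M. x \<in> A) \<or> (AE x in M. x \<notin> A))"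

definition diagonal_action ::
    "'x measure \<Rightarrow> ('g \<Rightarrow> 'x \<Rightarrow> 'x) \<Rightarrow> 'y measure \<Rightarrow> ('g \<Rightarrow> 'y \<Rightarrow> 'y) \<Rightarrow> 'g \<Rightarrow> 'x \<times> 'y \<Rightarrow> 'x \<times> 'y" where
  "diagonal_action M a N b g = (\<lambda>p\<in>space (M \<Otimes>\<^sub>M N). (a g (fst p), b g (snd p)))"

text \<open>
  HOL cannot quantify over all types inside a formula, so the type carrying the auxiliary pmp action
  is a parameter of the two notions below.  In a theorem where it is a free type variable, the
  auxiliary action ranges over all probability spaces.
\<close>

definition weakly_mixing ::
    "'y itself \<Rightarrow> ('g, 'b) monoid_scheme \<Rightarrow> 'x measure \<Rightarrow> ('g \<Rightarrow> 'x \<Rightarrow> 'x) \<Rightarrow> bool" where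
  "weakly_mixing (_ :: 'y itself) G M a \<longleftrightarrow>
     nonsingular_action G M a \<and> ergodic G M a \<and>
     (\<forall>(N :: 'y measure) b. pmp_action G N b \<and> ergodic G N b \<longrightarrow>
        ergodic G (M \<Otimes>\<^sub>M N) (diagonal_action M a N b))"

definition maharam_extension ::
    "('g, 'b) monoid_scheme \<Rightarrow> 'x measure \<Rightarrow> ('g \<Rightarrow> 'x \<Rightarrow> 'x) \<Rightarrow> 'g \<Rightarrow> 'x \<times> real \<Rightarrow> 'x \<times> real" where
  "maharam_extension G M a g = (\<lambda>(x, t).
     (a g x, t + ln (enn2real (RN_deriv M (distr M M (a (inv\<^bsub>G\<^esub> g))) x))))"

text \<open>
  Ergodicity depends only on the measure class, so the Maharam extension may be considered on
  \<open>M \<Otimes>\<^sub>M lborel\<close> instead of the product with the equivalent measure with density \<open>exp (- t)\<close>, which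
  it leaves invariant.
\<close>

definition type_III1 ::
    "('g, 'b) monoid_scheme \<Rightarrow> 'x measure \<Rightarrow> ('g \<Rightarrow> 'x \<Rightarrow> 'x) \<Rightarrow> bool" where
  "type_III1 G M a \<longleftrightarrow>
     nonsingular_action G M a \<and> ergodic G M a \<and>
     ergodic G (M \<Otimes>\<^sub>M lborel) (maharam_extension G M a)"

definition stable_type_III1 ::
    "'y itself \<Rightarrow> ('g, 'b) monoid_scheme \<Rightarrow> 'x measure \<Rightarrow> ('g \<Rightarrow> 'x \<Rightarrow> 'x) \<Rightarrow> bool" where
  "stable_type_III1 (Y :: 'y itself) G M a \<longleftrightarrow>
     weakly_mixing Y G M a \<and>
     (\<forall>(N :: 'y measure) b. pmp_action G N b \<and> ergodic G N b \<longrightarrow>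
        type_III1 G (M \<Otimes>\<^sub>M N) (diagonal_action M a N b))"

definition nonatomic :: "'x measure \<Rightarrow> bool" where
  "nonatomic M \<longleftrightarrow>
     (\<forall>A\<in>sets M. 0 < emeasure M A \<longrightarrow>
        (\<exists>B\<in>sets M. B \<subseteq> A \<and> 0 < emeasure M B \<and> 0 < emeasure M (A - B)))"

definition type_II1 ::
    "('g, 'b) monoid_scheme \<Rightarrow> 'x measure \<Rightarrow> ('g \<Rightarrow> 'x \<Rightarrow> 'x) \<Rightarrow> bool" where
  "type_II1 G M a \<longleftrightarrow>
     nonsingular_action G M a \<and> ergodic G M a \<and> nonatomic M \<and>
     (\<exists>N. sets N = sets M \<and> absolutely_continuous M N \<and> absolutely_continuous N M \<and>
        pmp_action G N a)"

definition bernoulli_action ::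
    "('g, 'b) monoid_scheme \<Rightarrow> ('g \<Rightarrow> 'x measure) \<Rightarrow> 'g \<Rightarrow> ('g \<Rightarrow> 'x) \<Rightarrow> 'g \<Rightarrow> 'x" where
  "bernoulli_action G \<mu> g =
     (\<lambda>x\<in>space (PiM (carrier G) \<mu>). \<lambda>h\<in>carrier G. x (inv\<^bsub>G\<^esub> g \<otimes>\<^bsub>G\<^esub> h))"

definition shifted_measure :: "(real \<Rightarrow> real) \<Rightarrow> ('g \<Rightarrow> real) \<Rightarrow> 'g \<Rightarrow> real measure" where
  "shifted_measure \<phi> F g = density lborel (\<lambda>t. ennreal (\<phi> (t + F g)))"

definition square_summable_on :: "('g \<Rightarrow> real) \<Rightarrow> 'g set \<Rightarrow> bool" where
  "square_summable_on f A \<longleftrightarrow> (\<lambda>h. (f h)\<^sup>2) summable_on A"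

definition cocycle :: "('g, 'b) monoid_scheme \<Rightarrow> ('g \<Rightarrow> real) \<Rightarrow> 'g \<Rightarrow> 'g \<Rightarrow> real" where
  "cocycle G F g h = F (inv\<^bsub>G\<^esub> g \<otimes>\<^bsub>G\<^esub> h) - F h"

text \<open>The cocycle given by \<open>F\<close> is a coboundary.\<close>

definition coboundary :: "('g, 'b) monoid_scheme \<Rightarrow> ('g \<Rightarrow> real) \<Rightarrow> bool" where
  "coboundary G F \<longleftrightarrow>
     (\<exists>C f. square_summable_on f (carrier G) \<and> (\<forall>h\<in>carrier G. F h = C + f h))"

text \<open>
  The Poincare exponent takes values in the extended reals, and the logarithm of the cardinality of
  an infinite set is \<open>\<infinity>\<close> (whereas \<open>card\<close> would be \<open>0\<close>).
\<close>

definition log_card :: "'g set \<Rightarrow> ereal" where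
  "log_card S = (if finite S then ereal (ln (real (card S))) else \<infinity>)"

definition poincare_exponent :: "('g, 'b) monoid_scheme \<Rightarrow> ('g \<Rightarrow> 'g \<Rightarrow> real) \<Rightarrow> ereal" where
  "poincare_exponent G c =
     Limsup at_top (\<lambda>s::real.
       log_card {g \<in> carrier G. (\<Sum>\<^sub>\<infinity>h\<in>carrier G. (c g h)\<^sup>2) \<le> s} / ereal s)"

end

theory Submission
  imports Defs
begin

text \<open>
  In both cases \<open>\<integral> \<phi> (t + a)\<^sup>2 / \<phi> (t + b) dt \<le> exp (\<kappa> (a - b)\<^sup>2)\<close>, with \<open>\<kappa> = M\<^sup>2\<close>, resp. \<open>\<kappa> = M\<close>, and the result
  holds as soon as \<open>9 \<kappa> / 2 < \<delta>(c)\<close>.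

  Consider a \<open>[0, 1]\<close>-valued function \<open>Q\<close> on \<open>X \<times> Y \<times> \<real>\<close> that is invariant under the Maharam extension of the
  diagonal action. For a finite set \<open>S\<close> of at least \<open>exp (\<delta> s)\<close> elements \<open>g\<close> with \<open>\<parallel>c\<^sub>g\<parallel>\<^sup>2 \<le> s\<close>, weights
  proportional to the Radon-Nikodym cocycle select random pairs \<open>(k, l)\<close> in \<open>S \<times> S\<close> so that \<open>z \<mapsto> k l\<^sup>-\<^sup>1 z\<close>
  preserves the measure on average, and \<open>\<delta> > 9 \<kappa> / 2\<close> ensures that \<open>k l\<^sup>-\<^sup>1\<close> leaves every finite set. As \<open>Q\<close>
  nearly depends on finitely many coordinates, it does not notice when the coordinate \<open>k l\<^sup>-\<^sup>1 h\<close> is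
  resampled. Pulled back by invariance, this says that resampling the coordinate \<open>h\<close> changes \<open>Q\<close> only by a
  translation of the real variable, namely by the cocycle of the resampling relative to the shift \<open>F (k l\<^sup>-\<^sup>1 h)\<close>.

  If \<open>Q\<close> does not depend on the real variable, then it is invariant under all resamplings, hence a function
  on \<open>Y\<close>: diagonal products are ergodic. Otherwise \<open>F (k l\<^sup>-\<^sup>1 h)\<close> concentrates at a constant \<open>C\<close>, since two
  possible values would make \<open>Q\<close> periodic with a whole interval of periods. Resampling the coordinate \<open>h\<close> now
  translates \<open>Q\<close> by a quantity of variance comparable to \<open>(F h - C)\<^sup>2\<close>, and Bessel's inequality for functions of single
  coordinates bounds the sum of these variances. So \<open>F - C\<close> is square summable and \<open>c\<close> is a coboundary.
\<close>

section \<open>Infinite product measures\<close>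

text \<open>The obstacle is that no single group element is under control: the Radon-Nikodym
  derivative of \<open>T g\<close> is unbounded, so a small L1 error between \<open>Q\<close> and a
  cylinder function may become large after composition with \<open>T g\<close>. The kernel average
  transports L1 errors exactly. This is why every estimate is a sum over pairs from
  \<open>Ks n\<close>, and why the shifts \<open>F (k l^-1 h)\<close> are first controlled only on
  average. Origin of the threshold: if the squared cocycle norms of k and l are at most s, that of k
  l^-1 is at most 4 s, and the integral of \<open>1 / om (k l^-1)\<close> is at most exp (4 \<kappa>
  s). To make the Maharam space a probability space, the real line carries \<open>Lap\<close>; its
  rate 1/8 turns the first moment of \<open>1 / om\<close> into the moment of order 8/9 of
  \<open>1 / wt\<close>. The gain from the size of \<open>Ks n\<close> is then exp (8/9 \<delta> s),
  and it wins exactly if \<delta> exceeds 9/2 \<kappa>. The function \<open>Q\<close> is taken with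
  continuous sections in the real variable. Identities that hold for almost every translation then
  hold for all, and periods of a section can be discussed pointwise.\<close>

lemma (in product_prob_space) nn_integral_resample:
  assumes h: "h \<in> I" and f[measurable]: "f \<in> borel_measurable (PiM I M)"
  shows "(\<integral>\<^sup>+x. f x \<partial>PiM I M) = (\<integral>\<^sup>+x. \<integral>\<^sup>+u. f (x(h := u)) \<partial>M h \<partial>PiM I M)"
proof -
  let ?N = "PiM (I - {h}) M"
  have ins: "insert h (I - {h}) = I" using h by auto
  interpret N: prob_space ?N by (rule prob_space_PiM) (rule prob_space)
  interpret pair_sigma_finite "M h" ?N ..
  have m1[measurable]: "(\<lambda>(u, X). X(h := u)) \<in> measurable (M h \<Otimes>\<^sub>M ?N) (PiM I M)"
    unfolding split_beta' by (rule measurable_fun_upd[where J="I - {h}"]) (use h in auto)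
  have d: "distr (M h \<Otimes>\<^sub>M ?N) (PiM I M) (\<lambda>(u, X). X(h := u)) = PiM I M"
    using distr_pair_PiM_eq_PiM[of "I - {h}" M h] prob_space unfolding ins by auto
  have rep: "(\<integral>\<^sup>+x. g x \<partial>PiM I M) = (\<integral>\<^sup>+X. \<integral>\<^sup>+u. g (X(h := u)) \<partial>M h \<partial>?N)"
    if g[measurable]: "g \<in> borel_measurable (PiM I M)" for g
  proof -
    have gm: "(\<lambda>p. g (case p of (u, X) \<Rightarrow> X(h := u))) \<in> borel_measurable (M h \<Otimes>\<^sub>M ?N)"
      by measurable
    have "(\<integral>\<^sup>+x. g x \<partial>PiM I M) = (\<integral>\<^sup>+p. g (case p of (u, X) \<Rightarrow> X(h := u)) \<partial>(M h \<Otimes>\<^sub>M ?N))"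
      by (subst d[symmetric]) (simp add: nn_integral_distr)
    also have "\<dots> = (\<integral>\<^sup>+X. \<integral>\<^sup>+u. g (X(h := u)) \<partial>M h \<partial>?N)"
      using nn_integral_snd[OF gm] by simp
    finally show ?thesis .
  qed
  have m2[measurable]: "(\<lambda>p. (fst p)(h := snd p)) \<in> measurable (PiM I M \<Otimes>\<^sub>M M h) (PiM I M)"
    by (rule measurable_fun_upd[where J="I"]) (use h in auto)
  have m3: "(\<lambda>x. \<integral>\<^sup>+u. f (x(h := u)) \<partial>M h) \<in> borel_measurable (PiM I M)"
  proof -
    have "(\<lambda>p. f ((fst p)(h := snd p))) \<in> borel_measurable (PiM I M \<Otimes>\<^sub>M M h)" by measurable
    from M.borel_measurable_nn_integral_fst[OF this] show ?thesis by simp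
  qed
  have "(\<integral>\<^sup>+x. \<integral>\<^sup>+u. f (x(h := u)) \<partial>M h \<partial>PiM I M) = (\<integral>\<^sup>+X. \<integral>\<^sup>+v. \<integral>\<^sup>+u. f (X(h := u)) \<partial>M h \<partial>M h \<partial>?N)"
    by (subst rep[OF m3]) simp
  also have "\<dots> = (\<integral>\<^sup>+X. \<integral>\<^sup>+u. f (X(h := u)) \<partial>M h \<partial>?N)"
    by (simp add: M.emeasure_space_1)
  finally show ?thesis using rep[OF f] by simp
qed

lemma (in product_prob_space) measurable_resample[measurable]:
  assumes "h \<in> I"
  shows "(\<lambda>p. (fst p)(h := snd p)) \<in> measurable (PiM I M \<Otimes>\<^sub>M M h) (PiM I M)"
  by (rule measurable_fun_upd[where J="I"]) (use assms in auto)

lemma (in product_prob_space) distr_resample: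
  assumes h: "h \<in> I"
  shows "distr (PiM I M \<Otimes>\<^sub>M M h) (PiM I M) (\<lambda>p. (fst p)(h := snd p)) = PiM I M"
proof (rule measure_eqI)
  note [measurable] = measurable_resample[OF h]
  fix A assume "A \<in> sets (distr (PiM I M \<Otimes>\<^sub>M M h) (PiM I M) (\<lambda>p. (fst p)(h := snd p)))"
  then have [measurable]: "A \<in> sets (PiM I M)" by simp
  have gm: "(\<lambda>p. indicator A ((fst p)(h := snd p)) :: ennreal) \<in> borel_measurable (PiM I M \<Otimes>\<^sub>M M h)"
    by measurable
  have "emeasure (distr (PiM I M \<Otimes>\<^sub>M M h) (PiM I M) (\<lambda>p. (fst p)(h := snd p))) A
      = (\<integral>\<^sup>+p. indicator A ((fst p)(h := snd p)) \<partial>(PiM I M \<Otimes>\<^sub>M M h))"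
    by (subst nn_integral_indicator[symmetric], simp, subst nn_integral_distr) auto
  also have "\<dots> = (\<integral>\<^sup>+x. \<integral>\<^sup>+u. indicator A (x(h := u)) \<partial>M h \<partial>PiM I M)"
    using M.nn_integral_fst[OF gm] by simp
  also have "\<dots> = (\<integral>\<^sup>+x. indicator A x \<partial>PiM I M)"
    by (rule nn_integral_resample[OF h, symmetric]) simp
  finally show "emeasure (distr (PiM I M \<Otimes>\<^sub>M M h) (PiM I M) (\<lambda>p. (fst p)(h := snd p))) A = emeasure (PiM I M) A"
    by simp
qed simp

section \<open>Approximation by sets and functions of finitely many coordinates\<close>

definition depends_on :: "('i \<Rightarrow> 'a) set \<Rightarrow> 'i set \<Rightarrow> (('i \<Rightarrow> 'a) \<times> 'w \<Rightarrow> 'c) \<Rightarrow> bool" where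
  "depends_on X B f \<longleftrightarrow> (\<forall>x\<in>X. \<forall>y\<in>X. \<forall>w. (\<forall>i\<in>B. x i = y i) \<longrightarrow> f (x, w) = f (y, w))"

lemma depends_onD:
  "depends_on X B f \<Longrightarrow> x \<in> X \<Longrightarrow> y \<in> X \<Longrightarrow> (\<And>i. i \<in> B \<Longrightarrow> x i = y i) \<Longrightarrow> f (x, w) = f (y, w)"
  unfolding depends_on_def by blast

lemma depends_on_mono: "depends_on X B f \<Longrightarrow> B \<subseteq> C \<Longrightarrow> depends_on X C f"
  unfolding depends_on_def by (meson subsetD)

text \<open>Only the product factor is truncated; the auxiliary factor enters in full. Two measures
  are treated at once because the comparison of two product measures needs one cylinder function
  that is close to the given function for both.\<close>

definition cyl_approx ::
    "'i set \<Rightarrow> ('i \<Rightarrow> 'a measure) \<Rightarrow> (('i \<Rightarrow> 'a) \<times> 'w) measure \<Rightarrow> (('i \<Rightarrow> 'a) \<times> 'w) measure \<Rightarrow> (('i \<Rightarrow> 'a) \<times> 'w) set \<Rightarrow> bool" where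
  "cyl_approx I M m1 m2 S \<longleftrightarrow> (\<forall>e>0. \<exists>B S'. finite B \<and> B \<subseteq> I \<and> S' \<in> sets m1 \<and>
      depends_on (space (PiM I M)) B (\<lambda>p. p \<in> S') \<and>
      measure m1 ((S - S') \<union> (S' - S)) < e \<and> measure m2 ((S - S') \<union> (S' - S)) < e)"

lemma cyl_approxE:
  assumes "cyl_approx I M m1 m2 S" "e > 0"
  obtains B S' where "finite B" "B \<subseteq> I" "S' \<in> sets m1" "depends_on (space (PiM I M)) B (\<lambda>p. p \<in> S')"
    "measure m1 ((S - S') \<union> (S' - S)) < e" "measure m2 ((S - S') \<union> (S' - S)) < e"
  using assms(1)[unfolded cyl_approx_def, rule_format, OF assms(2)] by (elim exE conjE) (rule that)

lemma cyl_approx_local: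
  assumes "finite B" "B \<subseteq> I" "S \<in> sets m1" "depends_on (space (PiM I M)) B (\<lambda>p. p \<in> S)"
  shows "cyl_approx I M m1 m2 S"
  unfolding cyl_approx_def
proof (intro allI impI)
  fix e :: real assume e: "e > 0"
  have "measure m1 ((S - S) \<union> (S - S)) < e" "measure m2 ((S - S) \<union> (S - S)) < e" using e by simp_all
  then show "\<exists>B S'. finite B \<and> B \<subseteq> I \<and> S' \<in> sets m1 \<and> depends_on (space (PiM I M)) B (\<lambda>p. p \<in> S') \<and>
      measure m1 ((S - S') \<union> (S' - S)) < e \<and> measure m2 ((S - S') \<union> (S' - S)) < e"
    by (intro exI[of _ B] exI[of _ S] conjI assms)
qed

text \<open>Complements have the same symmetric difference. A countable union is first cut to a
  finite one by continuity from below for both measures, and then its finitely many members are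
  approximated separately.\<close>

lemma sigma_algebra_cyl_approx:
  assumes s1: "sets m1 = sets (PiM I M \<Otimes>\<^sub>M W)" and s2: "sets m2 = sets (PiM I M \<Otimes>\<^sub>M W)"
    and f1: "finite_measure m1" and f2: "finite_measure m2"
  shows "sigma_algebra (space m1) {S \<in> sets m1. cyl_approx I M m1 m2 S}"
  unfolding sigma_algebra_iff2
proof (intro conjI ballI allI impI)
  interpret m1: finite_measure m1 by fact
  interpret m2: finite_measure m2 by fact
  have s12: "sets m2 = sets m1" using s1 s2 by simp
  have sp: "space m1 = space (PiM I M) \<times> space W"
    using sets_eq_imp_space_eq[OF s1] by (simp add: space_pair_measure)
  let ?A = "{S \<in> sets m1. cyl_approx I M m1 m2 S}"
  show "?A \<subseteq> Pow (space m1)" using sets.sets_into_space by auto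
  have "cyl_approx I M m1 m2 {}"
    by (rule cyl_approx_local[of "{}"]) (auto simp: depends_on_def)
  then show "{} \<in> ?A" by simp
  fix S assume S: "S \<in> ?A"
  have "cyl_approx I M m1 m2 (space m1 - S)"
    unfolding cyl_approx_def
  proof (intro allI impI)
    fix e :: real assume "e > 0"
    from S have "cyl_approx I M m1 m2 S" by simp
    from this \<open>e > 0\<close> obtain B S' where 1: "finite B" "B \<subseteq> I" "S' \<in> sets m1" "depends_on (space (PiM I M)) B (\<lambda>p. p \<in> S')"
      "measure m1 ((S - S') \<union> (S' - S)) < e" "measure m2 ((S - S') \<union> (S' - S)) < e"
      by (rule cyl_approxE)
    have eq: "((space m1 - S) - (space m1 - S')) \<union> ((space m1 - S') - (space m1 - S)) = (S - S') \<union> (S' - S)"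
      using sets.sets_into_space[of S m1] sets.sets_into_space[of S' m1] S 1(3) by auto
    have "depends_on (space (PiM I M)) B (\<lambda>p. p \<in> space m1 - S')"
      using 1(4) unfolding depends_on_def sp by blast
    moreover have "space m1 - S' \<in> sets m1" using 1(3) by simp
    ultimately show "\<exists>B S'. finite B \<and> B \<subseteq> I \<and> S' \<in> sets m1 \<and>
      depends_on (space (PiM I M)) B (\<lambda>p. p \<in> S') \<and>
      measure m1 (((space m1 - S) - S') \<union> (S' - (space m1 - S))) < e \<and> measure m2 (((space m1 - S) - S') \<union> (S' - (space m1 - S))) < e"
      by (intro exI[of _ B] exI[of _ "space m1 - S'"] conjI; (simp only: eq 1)?)
  qed
  with S show "space m1 - S \<in> ?A" by auto
next
  interpret m1: finite_measure m1 by fact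
  interpret m2: finite_measure m2 by fact
  have s12: "sets m2 = sets m1" using s1 s2 by simp
  let ?A = "{S \<in> sets m1. cyl_approx I M m1 m2 S}"
  fix A :: "nat \<Rightarrow> _" assume A: "range A \<subseteq> ?A"
  then have As: "\<And>i. A i \<in> sets m1" and Ac: "\<And>i. cyl_approx I M m1 m2 (A i)" by auto
  define S where "S = (\<Union>i. A i)"
  have Ss: "S \<in> sets m1" using As by (auto simp: S_def)
  have "cyl_approx I M m1 m2 S"
    unfolding cyl_approx_def
  proof (intro allI impI)
    fix e :: real assume e: "e > 0"
    define U where "U = (\<lambda>n::nat. \<Union>i<n. A i)"
    have Us: "U n \<in> sets m1" for n using As by (auto simp: U_def)
    have inc: "incseq U" unfolding incseq_def U_def by (intro allI impI UN_mono) auto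
    have UU: "(\<Union>n. U n) = S" by (force simp: U_def S_def)
    have "(\<lambda>n. measure m1 (U n)) \<longlonglongrightarrow> measure m1 (\<Union>n. U n)"
      by (rule m1.finite_Lim_measure_incseq[OF _ inc]) (use Us in blast)
    then have l1: "\<forall>\<^sub>F n in sequentially. dist (measure m1 (U n)) (measure m1 S) < e / 2"
      unfolding UU by (rule tendstoD) (use e in simp)
    have "(\<lambda>n. measure m2 (U n)) \<longlonglongrightarrow> measure m2 (\<Union>n. U n)"
      by (rule m2.finite_Lim_measure_incseq[OF _ inc]) (use Us s12 in blast)
    then have l2: "\<forall>\<^sub>F n in sequentially. dist (measure m2 (U n)) (measure m2 S) < e / 2"
      unfolding UU by (rule tendstoD) (use e in simp)
    obtain n where n: "dist (measure m1 (U n)) (measure m1 S) < e / 2" "dist (measure m2 (U n)) (measure m2 S) < e / 2"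
      using eventually_happens'[OF _ eventually_conj[OF l1 l2]] by auto
    \<comment> \<open>The \<open>n\<close> errors of size \<open>d\<close> add up to at most
      \<open>e / 2\<close>; the \<open>+ 1\<close> covers \<open>n = 0\<close>.\<close>
    define d where "d = e / (2 * (real n + 1))"
    have d: "d > 0" using e by (simp add: d_def)
    have ex: "\<forall>i. \<exists>B S'. finite B \<and> B \<subseteq> I \<and> S' \<in> sets m1 \<and>
      depends_on (space (PiM I M)) B (\<lambda>p. p \<in> S') \<and>
      measure m1 ((A i - S') \<union> (S' - A i)) < d \<and> measure m2 ((A i - S') \<union> (S' - A i)) < d"
      using Ac d unfolding cyl_approx_def by blast
    obtain B where B: "\<forall>i. \<exists>S'. finite (B i) \<and> B i \<subseteq> I \<and> S' \<in> sets m1 \<and>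
      depends_on (space (PiM I M)) (B i) (\<lambda>p. p \<in> S') \<and>
      measure m1 ((A i - S') \<union> (S' - A i)) < d \<and> measure m2 ((A i - S') \<union> (S' - A i)) < d" using choice[OF ex] ..
    obtain S' where S': "\<forall>i. finite (B i) \<and> B i \<subseteq> I \<and> S' i \<in> sets m1 \<and>
      depends_on (space (PiM I M)) (B i) (\<lambda>p. p \<in> S' i) \<and>
      measure m1 ((A i - S' i) \<union> (S' i - A i)) < d \<and> measure m2 ((A i - S' i) \<union> (S' i - A i)) < d" using choice[OF B] ..
    have BS: "finite (B i)" "B i \<subseteq> I" "S' i \<in> sets m1"
      "depends_on (space (PiM I M)) (B i) (\<lambda>p. p \<in> S' i)"
      "measure m1 ((A i - S' i) \<union> (S' i - A i)) < d" "measure m2 ((A i - S' i) \<union> (S' i - A i)) < d" for i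
      using S' by blast+
    define T where "T = (\<Union>i<n. S' i)"
    have sub: "(S - T) \<union> (T - S) \<subseteq> (S - U n) \<union> (\<Union>i<n. (A i - S' i) \<union> (S' i - A i))"
      by (force simp: T_def U_def S_def)
    have bound: "measure m ((S - T) \<union> (T - S)) < e"
      if fm: "finite_measure m" and sm: "sets m = sets m1" and nn: "dist (measure m (U n)) (measure m S) < e / 2"
        and bb: "\<And>i. measure m ((A i - S' i) \<union> (S' i - A i)) < d" for m
    proof -
      interpret m: finite_measure m by fact
      have "measure m ((S - T) \<union> (T - S)) \<le> measure m ((S - U n) \<union> (\<Union>i<n. (A i - S' i) \<union> (S' i - A i)))"
        using sub Ss Us As BS(3) by (intro m.finite_measure_mono) (auto simp: sm)
      also have "\<dots> \<le> measure m (S - U n) + measure m (\<Union>i<n. (A i - S' i) \<union> (S' i - A i))"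
        using Ss Us As BS(3) by (intro measure_Un_le) (auto simp: sm)
      also have "measure m (S - U n) = measure m S - measure m (U n)"
        using Ss Us by (intro m.finite_measure_Diff) (auto simp: sm UU[symmetric])
      also have "measure m (\<Union>i<n. (A i - S' i) \<union> (S' i - A i)) \<le> (\<Sum>i<n. measure m ((A i - S' i) \<union> (S' i - A i)))"
        using As BS(3) by (intro measure_UNION_le) (auto simp: sm)
      also have "\<dots> \<le> (\<Sum>i<n. d)" using bb by (intro sum_mono) (auto intro: less_imp_le)
      also have "(\<Sum>i<n. d) \<le> e / 2" using e by (simp add: d_def field_simps)
      finally show ?thesis using nn unfolding dist_real_def by linarith
    qed
    show "\<exists>B S'. finite B \<and> B \<subseteq> I \<and> S' \<in> sets m1 \<and>
      depends_on (space (PiM I M)) B (\<lambda>p. p \<in> S') \<and>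
      measure m1 ((S - S') \<union> (S' - S)) < e \<and> measure m2 ((S - S') \<union> (S' - S)) < e"
    proof (intro exI conjI)
      show "finite (\<Union>i<n. B i)" "(\<Union>i<n. B i) \<subseteq> I" "T \<in> sets m1" using BS by (auto simp: T_def)
      have dd: "depends_on (space (PiM I M)) (\<Union>i<n. B i) (\<lambda>p. p \<in> S' i)" if "i < n" for i
        using that by (intro depends_on_mono[OF BS(4)]) auto
      show "depends_on (space (PiM I M)) (\<Union>i<n. B i) (\<lambda>p. p \<in> T)"
        unfolding depends_on_def
      proof (intro ballI allI impI)
        fix x y w assume xy: "x \<in> space (PiM I M)" "y \<in> space (PiM I M)" "\<forall>i\<in>\<Union>i<n. B i. x i = y i"
        have "(x, w) \<in> S' i \<longleftrightarrow> (y, w) \<in> S' i" if "i < n" for i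
          using depends_onD[OF dd[OF that] xy(1,2)] xy(3) by blast
        then show "((x, w) \<in> T) = ((y, w) \<in> T)" by (auto simp: T_def)
      qed
      show "measure m1 ((S - T) \<union> (T - S)) < e" using n BS f1 by (intro bound) auto
      show "measure m2 ((S - T) \<union> (T - S)) < e" using n BS f2 s12 by (intro bound) auto
    qed
  qed
  with Ss show "(\<Union>i. A i) \<in> ?A" by (simp add: S_def)
qed

text \<open>Let \<open>Z\<close> carry the sigma-algebra of approximable sets. The identity is
  measurable from \<open>Z\<close> into the product because all coordinates are: a preimage under
  one of them depends on at most one index and so approximates itself.\<close>

lemma cyl_approx_all:
  assumes s1: "sets m1 = sets (PiM I M \<Otimes>\<^sub>M W)" and s2: "sets m2 = sets (PiM I M \<Otimes>\<^sub>M W)"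
    and f1: "finite_measure m1" and f2: "finite_measure m2" and S: "S \<in> sets m1"
  shows "cyl_approx I M m1 m2 S"
proof -
  define Z where "Z = sigma (space m1) {S \<in> sets m1. cyl_approx I M m1 m2 S}"
  interpret sigma_algebra "space m1" "{S \<in> sets m1. cyl_approx I M m1 m2 S}"
    by (rule sigma_algebra_cyl_approx[OF assms(1-4)])
  have sZ: "sets Z = {S \<in> sets m1. cyl_approx I M m1 m2 S}" and spZ: "space Z = space m1"
    by (simp_all add: Z_def sigma_sets_eq)
  have sp: "space m1 = space (PiM I M) \<times> space W"
    using sets_eq_imp_space_eq[OF s1] by (simp add: space_pair_measure)
  note [measurable_cong] = s1
  have "(\<lambda>p. (fst p, snd p)) \<in> measurable Z (PiM I M \<Otimes>\<^sub>M W)"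
  proof (rule measurable_Pair)
    show "fst \<in> measurable Z (PiM I M)"
    proof (rule measurable_PiM_single')
      show "fst \<in> space Z \<rightarrow> (\<Pi>\<^sub>E i\<in>I. space (M i))" by (auto simp: spZ sp space_PiM)
      fix h assume h: "h \<in> I"
      show "(\<lambda>p. fst p h) \<in> measurable Z (M h)"
      proof (rule measurableI)
        show "fst p h \<in> space (M h)" if "p \<in> space Z" for p
          using that h by (auto simp: spZ sp space_PiM)
        fix A assume A: "A \<in> sets (M h)"
        have "(\<lambda>p. fst p h) \<in> measurable m1 (M h)" using h by measurable
        with A have 1: "(\<lambda>p. fst p h) -` A \<inter> space m1 \<in> sets m1" by measurable
        have "cyl_approx I M m1 m2 ((\<lambda>p. fst p h) -` A \<inter> space m1)"
          by (rule cyl_approx_local[where B="{h}"]) (use h 1 in \<open>auto simp: depends_on_def sp\<close>)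
        with 1 show "(\<lambda>p. fst p h) -` A \<inter> space Z \<in> sets Z" by (simp add: sZ spZ)
      qed
    qed
    show "snd \<in> measurable Z W"
    proof (rule measurableI)
      show "snd p \<in> space W" if "p \<in> space Z" for p using that by (auto simp: spZ sp)
      fix A assume A: "A \<in> sets W"
      have "snd \<in> measurable m1 W" by measurable
      with A have 1: "snd -` A \<inter> space m1 \<in> sets m1" by measurable
      have "cyl_approx I M m1 m2 (snd -` A \<inter> space m1)"
        by (rule cyl_approx_local[where B="{}"]) (use 1 in \<open>auto simp: depends_on_def sp\<close>)
      with 1 show "snd -` A \<inter> space Z \<in> sets Z" by (simp add: sZ spZ)
    qed
  qed
  from measurable_sets[OF this, of S] S s1
  have "(\<lambda>p. (fst p, snd p)) -` S \<inter> space Z \<in> sets Z" by simp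
  moreover have "(\<lambda>p. (fst p, snd p)) -` S \<inter> space Z = S"
    using sets.sets_into_space[OF S] by (auto simp: spZ)
  ultimately show ?thesis by (simp add: sZ)
qed

text \<open>The sum counts the levels \<open>k\<close> below \<open>n * y\<close>, so it is the
  floor of \<open>n * y\<close>.\<close>

lemma unit_interval_staircase:
  fixes y :: real assumes "0 \<le> y" "y \<le> 1" "n > 0"
  shows "\<bar>y - (\<Sum>k=1..n. of_bool (real k \<le> real n * y)) / real n\<bar> \<le> 1 / real n"
proof -
  have fl: "0 \<le> \<lfloor>real n * y\<rfloor>" using assms by simp
  have le: "real n * y \<le> real n" using assms by (simp add: mult_left_le)
  have iff: "k \<le> nat \<lfloor>real n * y\<rfloor> \<longleftrightarrow> real k \<le> real n * y" for k
    using fl by (simp add: le_nat_iff le_floor_iff)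
  have "k \<in> {k\<in>{1..n}. real k \<le> real n * y} \<longleftrightarrow> k \<in> {1..nat \<lfloor>real n * y\<rfloor>}" for k
    using le by (auto simp: iff)
  then have "{k\<in>{1..n}. real k \<le> real n * y} = {1..nat \<lfloor>real n * y\<rfloor>}" by blast
  then have "(\<Sum>k=1..n. of_bool (real k \<le> real n * y) :: real) = real_of_int \<lfloor>real n * y\<rfloor>"
    using fl by (subst sum_of_bool_eq) (simp_all add: Int_def)
  moreover have "y - real_of_int \<lfloor>real n * y\<rfloor> / real n = (real n * y - real_of_int \<lfloor>real n * y\<rfloor>) / real n"
    using assms(3) by (simp add: diff_divide_distrib)
  moreover have "\<bar>(real n * y - real_of_int \<lfloor>real n * y\<rfloor>) / real n\<bar> \<le> 1 / real n"
    using floor_correct[of "real n * y"] assms(3) unfolding abs_divide by (intro frac_le) linarith+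
  ultimately show ?thesis by simp
qed

text \<open>Each superlevel set at height \<open>k / n\<close> is approximated, and the resulting
  indicators are averaged. The average stays between 0 and 1, and the \<open>n\<close> set errors
  below \<open>e / 2\<close> are divided by \<open>n\<close>.\<close>

lemma cyl_approx_fun:
  fixes f :: "('i \<Rightarrow> 'a) \<times> 'w \<Rightarrow> real"
  assumes s1: "sets m1 = sets (PiM I M \<Otimes>\<^sub>M W)" and s2: "sets m2 = sets (PiM I M \<Otimes>\<^sub>M W)"
    and f1: "finite_measure m1" and f2: "finite_measure m2"
    and f[measurable]: "f \<in> borel_measurable m1" and f01: "\<And>p. 0 \<le> f p" "\<And>p. f p \<le> 1" and e: "e > 0"
  obtains B f' where "finite B" "B \<subseteq> I" "f' \<in> borel_measurable m1" "\<And>p. 0 \<le> f' p" "\<And>p. f' p \<le> 1"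
    "depends_on (space (PiM I M)) B f'"
    "(\<integral>\<^sup>+p. ennreal \<bar>f p - f' p\<bar> \<partial>m1) < ennreal e" "(\<integral>\<^sup>+p. ennreal \<bar>f p - f' p\<bar> \<partial>m2) < ennreal e"
proof -
  have s12: "sets m2 = sets m1" using s1 s2 by simp
  define c where "c = max (measure m1 (space m1)) (measure m2 (space m2))"
  \<comment> \<open>Large enough that the staircase error \<open>1 / n\<close>, integrated over a
    total mass of at most \<open>c\<close>, is below \<open>e / 2\<close>.\<close>
  obtain n :: nat where n: "real n > 2 * c / e + 1" using reals_Archimedean2 by blast
  have c0: "c \<ge> 0" by (simp add: c_def le_max_iff_disj)
  then have "2 * c / e \<ge> 0" using e by simp
  then have n0: "real n > 0" using n by linarith
  define S where "S = (\<lambda>k::nat. {p\<in>space m1. real k \<le> real n * f p})"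
  have Ss[measurable]: "S k \<in> sets m1" for k unfolding S_def by measurable
  have ex: "\<forall>k. \<exists>B S'. finite B \<and> B \<subseteq> I \<and> S' \<in> sets m1 \<and>
      depends_on (space (PiM I M)) B (\<lambda>p. p \<in> S') \<and>
      measure m1 ((S k - S') \<union> (S' - S k)) < e/2 \<and> measure m2 ((S k - S') \<union> (S' - S k)) < e/2"
    using cyl_approx_all[OF assms(1-4) Ss] half_gt_zero[OF e] unfolding cyl_approx_def by blast
    obtain B where B: "\<forall>k. \<exists>S'. finite (B k) \<and> B k \<subseteq> I \<and> S' \<in> sets m1 \<and>
      depends_on (space (PiM I M)) (B k) (\<lambda>p. p \<in> S') \<and>
      measure m1 ((S k - S') \<union> (S' - S k)) < e/2 \<and> measure m2 ((S k - S') \<union> (S' - S k)) < e/2" using choice[OF ex] ..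
    obtain S' where S': "\<forall>k. finite (B k) \<and> B k \<subseteq> I \<and> S' k \<in> sets m1 \<and>
      depends_on (space (PiM I M)) (B k) (\<lambda>p. p \<in> S' k) \<and>
      measure m1 ((S k - S' k) \<union> (S' k - S k)) < e/2 \<and> measure m2 ((S k - S' k) \<union> (S' k - S k)) < e/2" using choice[OF B] ..
    have BS: "finite (B k)" "B k \<subseteq> I" "S' k \<in> sets m1"
      "depends_on (space (PiM I M)) (B k) (\<lambda>p. p \<in> S' k)"
      "measure m1 ((S k - S' k) \<union> (S' k - S k)) < e/2" "measure m2 ((S k - S' k) \<union> (S' k - S k)) < e/2" for k
      using S' by blast+
  note [measurable] = BS(3)
  define f' where "f' = (\<lambda>p. (\<Sum>k=1..n. of_bool (p \<in> S' k)) / real n)"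
  have bound: "(\<integral>\<^sup>+p. ennreal \<bar>f p - f' p\<bar> \<partial>m) < ennreal e"
    if fm: "finite_measure m" and sm[measurable_cong]: "sets m = sets m1" and cc: "measure m (space m) \<le> c"
      and bb: "\<And>k. measure m ((S k - S' k) \<union> (S' k - S k)) < e/2" for m
  proof -
    interpret m: finite_measure m by fact
    have spm: "space m = space m1" using sm by (rule sets_eq_imp_space_eq)
    let ?D = "\<lambda>k. (S k - S' k) \<union> (S' k - S k)"
    have [measurable]: "?D k \<in> sets m" for k using Ss BS(3) sm by auto
    have pt: "\<bar>f p - f' p\<bar> \<le> 1 / real n + (\<Sum>k=1..n. indicator (?D k) p) / real n" if p: "p \<in> space m" for p
    proof -
      have "(\<Sum>k=1..n. of_bool (real k \<le> real n * f p) :: real) = (\<Sum>k=1..n. of_bool (p \<in> S k))"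
        using p by (intro sum.cong) (auto simp: S_def spm)
      then have "\<bar>f p - (\<Sum>k=1..n. of_bool (p \<in> S k)) / real n\<bar> \<le> 1 / real n"
        using unit_interval_staircase[of "f p" n] f01 n0 by simp
      moreover have "\<bar>(\<Sum>k=1..n. of_bool (p \<in> S k) :: real) - (\<Sum>k=1..n. of_bool (p \<in> S' k))\<bar> \<le> (\<Sum>k=1..n. indicator (?D k) p)"
        unfolding sum_subtractf[symmetric]
        by (rule order_trans[OF sum_abs]) (auto intro!: sum_mono simp: indicator_def)
      then have "\<bar>(\<Sum>k=1..n. of_bool (p \<in> S k)) / real n - f' p\<bar> \<le> (\<Sum>k=1..n. indicator (?D k) p) / real n"
        using n0 unfolding f'_def diff_divide_distrib[symmetric] abs_divide by (simp add: divide_right_mono)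
      ultimately show ?thesis by linarith
    qed
    have i1: "integrable m (\<lambda>p. (\<Sum>k=1..n. indicator (?D k) p :: real) / real n)"
      by (intro integrable_divide Bochner_Integration.integrable_sum integrable_real_indicator)
         (auto simp: less_top[symmetric] m.emeasure_finite)
    have i2: "integrable m (\<lambda>p. 1 / real n)" by (rule m.integrable_const)
    have "(\<integral>\<^sup>+p. ennreal \<bar>f p - f' p\<bar> \<partial>m) \<le> (\<integral>\<^sup>+p. ennreal (1 / real n + (\<Sum>k=1..n. indicator (?D k) p) / real n) \<partial>m)"
      by (intro nn_integral_mono ennreal_leI pt)
    also have "\<dots> = ennreal (\<integral>p. (1 / real n + (\<Sum>k=1..n. indicator (?D k) p) / real n) \<partial>m)"
      by (intro nn_integral_eq_integral Bochner_Integration.integrable_add i1 i2 AE_I2 add_nonneg_nonneg divide_nonneg_nonneg sum_nonneg) auto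
    also have "\<dots> = ennreal (measure m (space m) / real n + (\<Sum>k=1..n. measure m (?D k)) / real n)"
    proof (rule arg_cong[where f=ennreal])
      have "(\<integral>p. (\<Sum>k=1..n. indicator (?D k) p :: real) \<partial>m) = (\<Sum>k=1..n. (\<integral>p. indicator (?D k) p \<partial>m))"
        by (rule Bochner_Integration.integral_sum) (rule integrable_real_indicator, auto simp: less_top[symmetric] m.emeasure_finite)
      also have "\<dots> = (\<Sum>k=1..n. measure m (?D k))"
        by (rule sum.cong) simp_all
      finally show "(\<integral>p. (1 / real n + (\<Sum>k=1..n. indicator (?D k) p) / real n) \<partial>m)
          = measure m (space m) / real n + (\<Sum>k=1..n. measure m (?D k)) / real n"
        using Bochner_Integration.integral_add[OF i2 i1] by simp
    qed
    also have "\<dots> < ennreal e"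
    proof (intro ennreal_lessI e)
      have "measure m (space m) / real n < e / 2"
      proof -
        have "2 * c < e * real n" using n e by (simp add: field_simps)
        then show ?thesis using cc n0 by (simp add: field_simps)
      qed
      moreover have "(\<Sum>k=1..n. measure m (?D k)) \<le> real n * (e/2)"
        using sum_bounded_above[of "{1..n}" "\<lambda>k. measure m (?D k)" "e/2"] bb by (simp add: less_imp_le)
      then have "(\<Sum>k=1..n. measure m (?D k)) / real n \<le> e / 2" using n0 by (simp add: field_simps)
      ultimately show "measure m (space m) / real n + (\<Sum>k=1..n. measure m (?D k)) / real n < e" by linarith
    qed
    finally show ?thesis .
  qed
  show ?thesis
  proof (rule that[of "\<Union>k\<in>{1..n}. B k" f'])
    show "finite (\<Union>k\<in>{1..n}. B k)" "(\<Union>k\<in>{1..n}. B k) \<subseteq> I" using BS by auto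
    show "f' \<in> borel_measurable m1" unfolding f'_def by measurable
    show "0 \<le> f' p" for p by (auto simp: f'_def intro!: sum_nonneg divide_nonneg_nonneg)
    have "(\<Sum>k=1..n. of_bool (p \<in> S' k) :: real) \<le> real n" for p
      using sum_bounded_above[of "{1..n}" "\<lambda>k. of_bool (p \<in> S' k) :: real" 1] by simp
    then show "f' p \<le> 1" for p using n0 by (simp add: f'_def)
    have dd: "depends_on (space (PiM I M)) (\<Union>k\<in>{1..n}. B k) (\<lambda>p. p \<in> S' i)" if "i \<in> {1..n}" for i
        using that by (intro depends_on_mono[OF BS(4)]) auto
    show "depends_on (space (PiM I M)) (\<Union>k\<in>{1..n}. B k) f'"
      unfolding depends_on_def
    proof (intro ballI allI impI)
      fix x y w assume xy: "x \<in> space (PiM I M)" "y \<in> space (PiM I M)" "\<forall>i\<in>\<Union>k\<in>{1..n}. B k. x i = y i"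
      have "(x, w) \<in> S' i \<longleftrightarrow> (y, w) \<in> S' i" if "i \<in> {1..n}" for i
        using depends_onD[OF dd[OF that] xy(1,2)] xy(3) by blast
      then show "f' (x, w) = f' (y, w)" unfolding f'_def by (intro arg_cong2[where f="(/)"] sum.cong refl) simp
    qed
    show "(\<integral>\<^sup>+p. ennreal \<bar>f p - f' p\<bar> \<partial>m1) < ennreal e"
      by (intro bound f1 BS) (auto simp: c_def)
    show "(\<integral>\<^sup>+p. ennreal \<bar>f p - f' p\<bar> \<partial>m2) < ennreal e"
      by (intro bound f2 BS s12) (auto simp: c_def)
  qed
qed

text \<open>A one-point space serves as the auxiliary factor.\<close>

lemma cyl_approx_fun1:
  fixes f :: "('i \<Rightarrow> 'a) \<Rightarrow> real"
  assumes s1: "sets m1 = sets (PiM I M)" and s2: "sets m2 = sets (PiM I M)"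
    and f1: "finite_measure m1" and f2: "finite_measure m2"
    and f[measurable]: "f \<in> borel_measurable m1" and f01: "\<And>p. 0 \<le> f p" "\<And>p. f p \<le> 1" and e: "e > 0"
  obtains B f' where "finite B" "B \<subseteq> I" "f' \<in> borel_measurable m1" "\<And>p. 0 \<le> f' p" "\<And>p. f' p \<le> 1"
    "\<forall>x\<in>space (PiM I M). \<forall>y\<in>space (PiM I M). (\<forall>i\<in>B. x i = y i) \<longrightarrow> f' x = f' y"
    "(\<integral>\<^sup>+p. ennreal \<bar>f p - f' p\<bar> \<partial>m1) < ennreal e" "(\<integral>\<^sup>+p. ennreal \<bar>f p - f' p\<bar> \<partial>m2) < ennreal e"
proof -
  let ?W = "count_space {()}"
  let ?N = "PiM I M \<Otimes>\<^sub>M ?W"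
  have s12: "sets m2 = sets m1" using s1 s2 by simp
  note [measurable_cong] = s1
  have g1[measurable]: "(\<lambda>x. (x, ())) \<in> measurable m1 ?N" by measurable
  have g2[measurable]: "(\<lambda>x. (x, ())) \<in> measurable m2 ?N" using g1 s12 by (simp cong: measurable_cong_sets)
  have [measurable]: "f \<in> borel_measurable (PiM I M)" using f s1 by (simp cong: measurable_cong_sets)
  have d1: "finite_measure (distr m1 ?N (\<lambda>x. (x, ())))" by (rule finite_measure.finite_measure_distr[OF f1 g1])
  have d2: "finite_measure (distr m2 ?N (\<lambda>x. (x, ())))" by (rule finite_measure.finite_measure_distr[OF f2 g2])
  have fm: "(\<lambda>p. f (fst p)) \<in> borel_measurable (distr m1 ?N (\<lambda>x. (x, ())))" by simp
  obtain B f' where *: "finite B" "B \<subseteq> I" "f' \<in> borel_measurable (distr m1 ?N (\<lambda>x. (x, ())))" "\<And>p. 0 \<le> f' p" "\<And>p. f' p \<le> 1"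
    "depends_on (space (PiM I M)) B f'"
    "(\<integral>\<^sup>+p. ennreal \<bar>f (fst p) - f' p\<bar> \<partial>distr m1 ?N (\<lambda>x. (x, ()))) < ennreal e"
    "(\<integral>\<^sup>+p. ennreal \<bar>f (fst p) - f' p\<bar> \<partial>distr m2 ?N (\<lambda>x. (x, ()))) < ennreal e"
    by (rule cyl_approx_fun[OF sets_distr sets_distr d1 d2 fm f01 e]) (rule that)
  have [measurable]: "f' \<in> borel_measurable ?N" using *(3) by simp
  show ?thesis
  proof (rule that[of B "\<lambda>x. f' (x, ())"])
    show "(\<lambda>x. f' (x, ())) \<in> borel_measurable m1" by measurable
    show "\<forall>x\<in>space (PiM I M). \<forall>y\<in>space (PiM I M). (\<forall>i\<in>B. x i = y i) \<longrightarrow> f' (x, ()) = f' (y, ())"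
      using *(6) unfolding depends_on_def by blast
    show "(\<integral>\<^sup>+p. ennreal \<bar>f p - f' (p, ())\<bar> \<partial>m1) < ennreal e"
      using *(7) by (simp add: nn_integral_distr[OF g1])
    show "(\<integral>\<^sup>+p. ennreal \<bar>f p - f' (p, ())\<bar> \<partial>m2) < ennreal e"
      using *(8) by (simp add: nn_integral_distr[OF g2])
  qed (rule *)+
qed

text \<open>Replacing the indicator of the set where \<open>d\<close> is positive by a cylinder
  function changes its integral against \<open>d\<close> by at most \<open>e\<close>, since
  \<open>d\<close> is bounded by 1. So the positive part of \<open>d\<close> has integral 0.\<close>

lemma cylinder_test:
  fixes d :: "('i \<Rightarrow> 'a) \<times> 'w \<Rightarrow> real"
  assumes prob: "prob_space (PiM I M \<Otimes>\<^sub>M W)" and d[measurable]: "d \<in> borel_measurable (PiM I M \<Otimes>\<^sub>M W)" and d1: "\<And>p. \<bar>d p\<bar> \<le> 1"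
    and test: "\<And>B f. finite B \<Longrightarrow> B \<subseteq> I \<Longrightarrow> f \<in> borel_measurable (PiM I M \<Otimes>\<^sub>M W) \<Longrightarrow> (\<And>p. 0 \<le> f p) \<Longrightarrow> (\<And>p. f p \<le> 1) \<Longrightarrow>
      depends_on (space (PiM I M)) B f \<Longrightarrow> (\<integral>p. d p * f p \<partial>(PiM I M \<Otimes>\<^sub>M W)) = 0"
  shows "AE p in PiM I M \<Otimes>\<^sub>M W. d p \<le> 0"
proof -
  let ?Z = "PiM I M \<Otimes>\<^sub>M W"
  interpret prob_space ?Z by (rule prob)
  define f where "f = (\<lambda>p. of_bool (0 < d p) :: real)"
  have fm[measurable]: "f \<in> borel_measurable ?Z" unfolding f_def by measurable
  have f01: "0 \<le> f p" "f p \<le> 1" for p by (simp_all add: f_def)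
  have ss: "sets ?Z = sets (PiM I M \<Otimes>\<^sub>M W)" by (rule refl)
  have ibd: "integrable ?Z g" if "g \<in> borel_measurable ?Z" "\<And>p. \<bar>g p\<bar> \<le> 1" for g :: "('i \<Rightarrow> 'a) \<times> 'w \<Rightarrow> real"
    using that by (intro integrable_const_bound[where B=1]) auto
  have "(\<integral>p. d p * f p \<partial>?Z) \<le> e" if e: "e > 0" for e
  proof -
    obtain B w where B: "finite B" "B \<subseteq> I" and w[measurable]: "w \<in> borel_measurable ?Z" and w01: "\<And>p. 0 \<le> w p" "\<And>p. w p \<le> 1"
      and dep: "depends_on (space (PiM I M)) B w" and close: "(\<integral>\<^sup>+p. ennreal \<bar>f p - w p\<bar> \<partial>?Z) < ennreal e"
      by (rule cyl_approx_fun[OF ss ss finite_measure_axioms finite_measure_axioms fm f01 e]) (rule that)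
    have fw: "\<bar>f p - w p\<bar> \<le> 1" for p using w01[of p] by (auto simp: f_def)
    have dfw: "\<bar>d p * (f p - w p)\<bar> \<le> 1" for p using d1[of p] fw[of p] by (simp add: abs_mult mult_le_one)
    have dw: "\<bar>d p * w p\<bar> \<le> 1" for p using d1[of p] w01[of p] by (simp add: abs_mult mult_le_one)
    have "(\<integral>p. d p * f p \<partial>?Z) = (\<integral>p. d p * w p + d p * (f p - w p) \<partial>?Z)" by (simp add: algebra_simps)
    also have "\<dots> = (\<integral>p. d p * w p \<partial>?Z) + (\<integral>p. d p * (f p - w p) \<partial>?Z)"
      by (intro Bochner_Integration.integral_add ibd dfw dw) measurable
    also have "\<dots> = (\<integral>p. d p * (f p - w p) \<partial>?Z)" by (simp add: test[OF B w w01 dep])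
    also have "\<dots> \<le> (\<integral>p. \<bar>f p - w p\<bar> \<partial>?Z)"
    proof (rule integral_mono[OF ibd[OF _ dfw] ibd])
      show "d p * (f p - w p) \<le> \<bar>f p - w p\<bar>" for p
        using mult_right_mono[OF d1[of p], of "\<bar>f p - w p\<bar>"] by (simp add: abs_mult[symmetric])
    qed (use fw in auto)
    also have "\<dots> \<le> e"
    proof -
      have "ennreal (\<integral>p. \<bar>f p - w p\<bar> \<partial>?Z) < ennreal e"
        using close nn_integral_eq_integral[OF ibd, of "\<lambda>p. \<bar>f p - w p\<bar>"] fw by simp
      then show ?thesis using e by (simp add: ennreal_less_iff)
    qed
    finally show ?thesis .
  qed
  then have "(\<integral>p. d p * f p \<partial>?Z) \<le> 0" by (rule field_le_epsilon[of _ 0, simplified])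
  moreover have nn: "0 \<le> d p * f p" and df1: "\<bar>d p * f p\<bar> \<le> 1" for p using d1[of p] by (auto simp: f_def)
  ultimately have "(\<integral>p. d p * f p \<partial>?Z) = 0" by (simp add: antisym integral_nonneg_AE)
  then have "AE p in ?Z. d p * f p = 0"
    using nn df1 by (subst (asm) integral_nonneg_eq_0_iff_AE[OF ibd]) auto
  then show ?thesis by eventually_elim (auto simp: f_def split: if_splits)
qed

section \<open>A zero-one law for functions invariant under resampling of single coordinates\<close>

context product_prob_space
begin

text \<open>Resampling preserves the measure and does not change \<open>q\<close>, so in the
  integral of \<open>q * f\<close> the coordinate \<open>h\<close> of \<open>f\<close> alone may be
  resampled and then integrated out.\<close>

lemma nn_integral_average_coordinate:
  fixes q f :: "('i \<Rightarrow> 'a) \<times> 'w \<Rightarrow> ennreal"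
  assumes W: "prob_space W" and h: "h \<in> I"
    and q[measurable]: "q \<in> borel_measurable (PiM I M \<Otimes>\<^sub>M W)" and f[measurable]: "f \<in> borel_measurable (PiM I M \<Otimes>\<^sub>M W)"
    and inv: "AE p in (PiM I M \<Otimes>\<^sub>M M h) \<Otimes>\<^sub>M W. q ((fst (fst p))(h := snd (fst p)), snd p) = q (fst (fst p), snd p)"
  shows "(\<integral>\<^sup>+p. q p * f p \<partial>(PiM I M \<Otimes>\<^sub>M W)) = (\<integral>\<^sup>+p. q p * (\<integral>\<^sup>+u. f ((fst p)(h := u), snd p) \<partial>M h) \<partial>(PiM I M \<Otimes>\<^sub>M W))"
proof -
  interpret W: prob_space W by fact
  interpret MW: pair_sigma_finite "M h" W ..
  let ?r = "\<lambda>(p, w). ((fst p)(h := snd p), w)"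
  note [measurable] = measurable_resample[OF h]
  have rm: "?r \<in> measurable ((PiM I M \<Otimes>\<^sub>M M h) \<Otimes>\<^sub>M W) (PiM I M \<Otimes>\<^sub>M W)" by measurable
  have "distr (PiM I M \<Otimes>\<^sub>M M h) (PiM I M) (\<lambda>q. (fst q)(h := snd q)) \<Otimes>\<^sub>M distr W W (\<lambda>w. w) = distr ((PiM I M \<Otimes>\<^sub>M M h) \<Otimes>\<^sub>M W) (PiM I M \<Otimes>\<^sub>M W) ?r"
    by (rule pair_measure_distr) (simp_all add: distr_id W.sigma_finite_measure_axioms measurable_resample[OF h])
  then have dr: "distr ((PiM I M \<Otimes>\<^sub>M M h) \<Otimes>\<^sub>M W) (PiM I M \<Otimes>\<^sub>M W) ?r = PiM I M \<Otimes>\<^sub>M W"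
    by (simp add: distr_resample[OF h] distr_id)
  have m: "(\<lambda>p. q (fst (fst p), snd p) * f ((fst (fst p))(h := snd (fst p)), snd p)) \<in> borel_measurable ((PiM I M \<Otimes>\<^sub>M M h) \<Otimes>\<^sub>M W)"
    using measurable_compose[OF rm f] by (simp add: split_beta')
  have fm: "(\<lambda>z. f ((fst (fst z))(h := snd z), snd (fst z))) \<in> borel_measurable ((PiM I M \<Otimes>\<^sub>M W) \<Otimes>\<^sub>M M h)"
  proof -
    have "(\<lambda>z. ((fst (fst z), snd z), snd (fst z))) \<in> measurable ((PiM I M \<Otimes>\<^sub>M W) \<Otimes>\<^sub>M M h) ((PiM I M \<Otimes>\<^sub>M M h) \<Otimes>\<^sub>M W)" by measurable
    from measurable_compose[OF this measurable_compose[OF rm f]] show ?thesis by (simp add: split_beta')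
  qed
  have am: "(\<lambda>p. q p * (\<integral>\<^sup>+u. f ((fst p)(h := u), snd p) \<partial>M h)) \<in> borel_measurable (PiM I M \<Otimes>\<^sub>M W)"
    using M.borel_measurable_nn_integral_fst[OF fm] by simp
  have "(\<integral>\<^sup>+p. q p * f p \<partial>(PiM I M \<Otimes>\<^sub>M W)) = (\<integral>\<^sup>+p. q (?r p) * f (?r p) \<partial>((PiM I M \<Otimes>\<^sub>M M h) \<Otimes>\<^sub>M W))"
    using nn_integral_distr[OF rm, of "\<lambda>p. q p * f p"] by (simp add: dr)
  also have "\<dots> = (\<integral>\<^sup>+p. q (fst (fst p), snd p) * f ((fst (fst p))(h := snd (fst p)), snd p) \<partial>((PiM I M \<Otimes>\<^sub>M M h) \<Otimes>\<^sub>M W))"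
    by (rule nn_integral_cong_AE) (use inv in \<open>eventually_elim, simp add: split_beta\<close>)
  also have "\<dots> = (\<integral>\<^sup>+x. \<integral>\<^sup>+u. \<integral>\<^sup>+w. q (x, w) * f (x(h := u), w) \<partial>W \<partial>M h \<partial>PiM I M)"
    using W.nn_integral_fst[OF m] M.nn_integral_fst[OF W.borel_measurable_nn_integral_fst[OF m]] by simp
  also have "\<dots> = (\<integral>\<^sup>+x. \<integral>\<^sup>+w. q (x, w) * (\<integral>\<^sup>+u. f (x(h := u), w) \<partial>M h) \<partial>W \<partial>PiM I M)"
  proof (rule nn_integral_cong)
    fix x assume x: "x \<in> space (PiM I M)"
    have "(\<lambda>p. ((x, fst p), snd p)) \<in> measurable (M h \<Otimes>\<^sub>M W) ((PiM I M \<Otimes>\<^sub>M M h) \<Otimes>\<^sub>M W)" using x by measurable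
    from measurable_compose[OF this m] have "(\<lambda>(u, w). q (x, w) * f (x(h := u), w)) \<in> borel_measurable (M h \<Otimes>\<^sub>M W)"
      by (simp add: split_beta')
    from MW.Fubini'[OF this] have "(\<integral>\<^sup>+u. \<integral>\<^sup>+w. q (x, w) * f (x(h := u), w) \<partial>W \<partial>M h) = (\<integral>\<^sup>+w. \<integral>\<^sup>+u. q (x, w) * f (x(h := u), w) \<partial>M h \<partial>W)" ..
    also have "\<dots> = (\<integral>\<^sup>+w. q (x, w) * (\<integral>\<^sup>+u. f (x(h := u), w) \<partial>M h) \<partial>W)"
    proof (rule nn_integral_cong, rule nn_integral_cmult)
      fix w assume w: "w \<in> space W"
      have "(\<lambda>u. ((x, w), u)) \<in> measurable (M h) ((PiM I M \<Otimes>\<^sub>M W) \<Otimes>\<^sub>M M h)" using x w by measurable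
      from measurable_compose[OF this fm] show "(\<lambda>u. f (x(h := u), w)) \<in> borel_measurable (M h)" by simp
    qed
    finally show "(\<integral>\<^sup>+u. \<integral>\<^sup>+w. q (x, w) * f (x(h := u), w) \<partial>W \<partial>M h) = (\<integral>\<^sup>+w. q (x, w) * (\<integral>\<^sup>+u. f (x(h := u), w) \<partial>M h) \<partial>W)" .
  qed
  also have "\<dots> = (\<integral>\<^sup>+p. q p * (\<integral>\<^sup>+u. f ((fst p)(h := u), snd p) \<partial>M h) \<partial>(PiM I M \<Otimes>\<^sub>M W))"
    using W.nn_integral_fst[OF am] by simp
  finally show ?thesis .
qed

text \<open>Induction on \<open>B\<close>: averaging \<open>f\<close> over one coordinate removes it
  from \<open>B\<close>. Both sides admit this, the right one because the mean of \<open>q\<close>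
  over the product does not involve the coordinates at all. For empty \<open>B\<close> the function
  \<open>f\<close> depends on the auxiliary variable only and Fubini applies.\<close>

lemma nn_integral_times_cylinder:
  fixes q f :: "('i \<Rightarrow> 'a) \<times> 'w \<Rightarrow> ennreal"
  assumes W: "prob_space W" and q[measurable]: "q \<in> borel_measurable (PiM I M \<Otimes>\<^sub>M W)"
    and inv: "\<And>h. h \<in> I \<Longrightarrow> AE p in (PiM I M \<Otimes>\<^sub>M M h) \<Otimes>\<^sub>M W. q ((fst (fst p))(h := snd (fst p)), snd p) = q (fst (fst p), snd p)"
    and "finite B" "B \<subseteq> I" and "f \<in> borel_measurable (PiM I M \<Otimes>\<^sub>M W)" "depends_on (space (PiM I M)) B f"
  shows "(\<integral>\<^sup>+p. q p * f p \<partial>(PiM I M \<Otimes>\<^sub>M W)) = (\<integral>\<^sup>+p. (\<integral>\<^sup>+x. q (x, snd p) \<partial>PiM I M) * f p \<partial>(PiM I M \<Otimes>\<^sub>M W))"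
  using assms(4-7)
proof (induction B arbitrary: f rule: finite_induct)
  interpret W: prob_space W by fact
  interpret PW: pair_sigma_finite "PiM I M" W ..
  have "(\<lambda>z. q (snd z, fst z)) \<in> borel_measurable (W \<Otimes>\<^sub>M PiM I M)" by measurable
  from P.borel_measurable_nn_integral_fst[OF this]
  have qb: "(\<lambda>w. \<integral>\<^sup>+x. q (x, w) \<partial>PiM I M) \<in> borel_measurable W" by simp
  have qbm[measurable]: "(\<lambda>p. \<integral>\<^sup>+x. q (x, snd p) \<partial>PiM I M) \<in> borel_measurable (PiM I M \<Otimes>\<^sub>M W)" by (rule measurable_compose[OF measurable_snd qb])
  {
    case empty
    note [measurable] = empty(2)
    obtain x0 where x0: "x0 \<in> space (PiM I M)" using P.not_empty by blast
    have f0: "f (x, w) = f (x0, w)" if "x \<in> space (PiM I M)" for x w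
      by (rule depends_onD[OF empty(3) that x0]) simp
    have "(\<integral>\<^sup>+p. q p * f p \<partial>(PiM I M \<Otimes>\<^sub>M W)) = (\<integral>\<^sup>+w. \<integral>\<^sup>+x. q (x, w) * f (x, w) \<partial>PiM I M \<partial>W)"
      using PW.nn_integral_snd[of "\<lambda>p. q p * f p"] by simp
    also have "\<dots> = (\<integral>\<^sup>+w. \<integral>\<^sup>+x. (\<integral>\<^sup>+x'. q (x', w) \<partial>PiM I M) * f (x, w) \<partial>PiM I M \<partial>W)"
    proof (rule nn_integral_cong)
      fix w assume w: "w \<in> space W"
      have "(\<integral>\<^sup>+x. q (x, w) * f (x, w) \<partial>PiM I M) = (\<integral>\<^sup>+x. q (x, w) * f (x0, w) \<partial>PiM I M)" by (intro nn_integral_cong) (simp only: f0)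
      moreover have "(\<integral>\<^sup>+x. (\<integral>\<^sup>+x'. q (x', w) \<partial>PiM I M) * f (x, w) \<partial>PiM I M) = (\<integral>\<^sup>+x. (\<integral>\<^sup>+x'. q (x', w) \<partial>PiM I M) * f (x0, w) \<partial>PiM I M)"
        by (intro nn_integral_cong) (simp only: f0)
      moreover have "(\<lambda>x. q (x, w)) \<in> borel_measurable (PiM I M)" using w by measurable
      ultimately show "(\<integral>\<^sup>+x. q (x, w) * f (x, w) \<partial>PiM I M) = (\<integral>\<^sup>+x. (\<integral>\<^sup>+x'. q (x', w) \<partial>PiM I M) * f (x, w) \<partial>PiM I M)"
        by (simp add: nn_integral_multc P.emeasure_space_1)
    qed
    also have "\<dots> = (\<integral>\<^sup>+p. (\<integral>\<^sup>+x. q (x, snd p) \<partial>PiM I M) * f p \<partial>(PiM I M \<Otimes>\<^sub>M W))"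
      using PW.nn_integral_snd[of "\<lambda>p. (\<integral>\<^sup>+x. q (x, snd p) \<partial>PiM I M) * f p"] by simp
    finally show ?case .
  next
    case (insert h B)
    have h: "h \<in> I" and B: "B \<subseteq> I" using insert.prems(1) by auto
    note f = insert.prems(2)
    let ?f = "\<lambda>p. \<integral>\<^sup>+u. f ((fst p)(h := u), snd p) \<partial>M h"
    have "(\<lambda>z. (fst (fst z), snd z)) \<in> measurable ((PiM I M \<Otimes>\<^sub>M W) \<Otimes>\<^sub>M M h) (PiM I M \<Otimes>\<^sub>M M h)" by measurable
    from measurable_compose[OF this measurable_resample[OF h]]
    have [measurable]: "(\<lambda>z. (fst (fst z))(h := snd z)) \<in> measurable ((PiM I M \<Otimes>\<^sub>M W) \<Otimes>\<^sub>M M h) (PiM I M)" by simp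
    have "(\<lambda>z. ((fst (fst z))(h := snd z), snd (fst z))) \<in> measurable ((PiM I M \<Otimes>\<^sub>M W) \<Otimes>\<^sub>M M h) (PiM I M \<Otimes>\<^sub>M W)" by measurable
    from M.borel_measurable_nn_integral_fst[OF measurable_compose[OF this f]]
    have fm: "?f \<in> borel_measurable (PiM I M \<Otimes>\<^sub>M W)" by simp
    have "depends_on (space (PiM I M)) B ?f"
      unfolding depends_on_def fst_conv snd_conv
    proof (intro ballI allI impI nn_integral_cong)
      fix x y w u assume xy: "x \<in> space (PiM I M)" "y \<in> space (PiM I M)" "\<forall>i\<in>B. x i = y i" and u: "u \<in> space (M h)"
      have "x(h := u) \<in> space (PiM I M)" "y(h := u) \<in> space (PiM I M)"
        using xy(1,2) u h by (auto simp: space_PiM PiE_iff extensional_def)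
      then show "f (x(h := u), w) = f (y(h := u), w)" by (rule depends_onD[OF insert.prems(3)]) (use xy(3) in auto)
    qed
    from insert.IH[OF B fm this]
    show ?case
      unfolding nn_integral_average_coordinate[OF W h q f inv[OF h]]
      by (subst nn_integral_average_coordinate[OF W h qbm f]) simp_all
  }
qed

text \<open>Kolmogorov's zero-one law with a parameter: the difference between \<open>q\<close> and
  its mean over the product is orthogonal to all cylinder functions.\<close>

lemma resampling_zero_one_law:
  fixes q :: "('i \<Rightarrow> 'a) \<times> 'w \<Rightarrow> real"
  assumes W: "prob_space W" and q[measurable]: "q \<in> borel_measurable (PiM I M \<Otimes>\<^sub>M W)"
    and q01: "\<And>p. 0 \<le> q p" "\<And>p. q p \<le> 1"
    and inv: "\<And>h. h \<in> I \<Longrightarrow> AE p in (PiM I M \<Otimes>\<^sub>M M h) \<Otimes>\<^sub>M W. q ((fst (fst p))(h := snd (fst p)), snd p) = q (fst (fst p), snd p)"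
  shows "AE p in PiM I M \<Otimes>\<^sub>M W. q p = (\<integral>x. q (x, snd p) \<partial>PiM I M)"
proof -
  let ?Z = "PiM I M \<Otimes>\<^sub>M W"
  interpret W: prob_space W by fact
  interpret PW: pair_prob_space "PiM I M" W ..
  define qb where "qb = (\<lambda>w. \<integral>x. q (x, w) \<partial>PiM I M)"
  have m: "(\<lambda>(w, x). q (x, w)) \<in> borel_measurable (W \<Otimes>\<^sub>M PiM I M)" by measurable
  have qbm[measurable]: "qb \<in> borel_measurable W"
    unfolding qb_def by (rule P.borel_measurable_lebesgue_integral[OF m])
  have qb0: "0 \<le> qb w" for w unfolding qb_def using q01 by simp
  have qb1: "qb w \<le> 1" for w unfolding qb_def
    by (cases "integrable (PiM I M) (\<lambda>x. q (x, w))") (use q01 in \<open>auto intro!: P.integral_le_const simp: not_integrable_integral_eq\<close>)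
  define d where "d = (\<lambda>p. q p - qb (snd p))"
  have d1: "\<bar>d p\<bar> \<le> 1" for p using q01[of p] qb0[of "snd p"] qb1[of "snd p"] unfolding d_def by linarith
  have dm[measurable]: "d \<in> borel_measurable ?Z" unfolding d_def by measurable
  have ib: "integrable ?Z g" if "g \<in> borel_measurable ?Z" "\<And>p. 0 \<le> g p" "\<And>p. g p \<le> 1" for g :: "('i \<Rightarrow> 'a) \<times> 'w \<Rightarrow> real"
    using that by (intro PW.P.integrable_const_bound[where B=1]) auto
  have test: "(\<integral>p. d p * f p \<partial>?Z) = 0"
    if B: "finite B" "B \<subseteq> I" and f[measurable]: "f \<in> borel_measurable ?Z" and f01: "\<And>p. 0 \<le> f p" "\<And>p. f p \<le> 1"
      and dep: "depends_on (space (PiM I M)) B f" for B f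
  proof -
    have iq: "integrable ?Z (\<lambda>p. q p * f p)" and iqb: "integrable ?Z (\<lambda>p. qb (snd p) * f p)"
      using q01 qb0 qb1 f01 by (auto intro!: ib mult_le_one)
    have "(\<integral>\<^sup>+p. ennreal (q p) * ennreal (f p) \<partial>?Z) = (\<integral>\<^sup>+p. (\<integral>\<^sup>+x. ennreal (q (x, snd p)) \<partial>PiM I M) * ennreal (f p) \<partial>?Z)"
    proof (rule nn_integral_times_cylinder[OF W _ _ B])
      show "AE p in (PiM I M \<Otimes>\<^sub>M M h) \<Otimes>\<^sub>M W. ennreal (q ((fst (fst p))(h := snd (fst p)), snd p)) = ennreal (q (fst (fst p), snd p))" if "h \<in> I" for h
        using inv[OF that] by eventually_elim simp
      show "depends_on (space (PiM I M)) B (\<lambda>p. ennreal (f p))"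
        unfolding depends_on_def using depends_onD[OF dep] by metis
    qed measurable
    also have "\<dots> = (\<integral>\<^sup>+p. ennreal (qb (snd p)) * ennreal (f p) \<partial>?Z)"
    proof (rule nn_integral_cong)
      fix p assume "p \<in> space ?Z"
      then have "snd p \<in> space W" by (auto simp: space_pair_measure)
      then have "(\<lambda>x. q (x, snd p)) \<in> borel_measurable (PiM I M)" by measurable
      then have "integrable (PiM I M) (\<lambda>x. q (x, snd p))" using q01 by (intro P.integrable_const_bound[where B=1]) auto
      from nn_integral_eq_integral[OF this] q01 show "(\<integral>\<^sup>+x. ennreal (q (x, snd p)) \<partial>PiM I M) * ennreal (f p) = ennreal (qb (snd p)) * ennreal (f p)"
        by (simp add: qb_def)
    qed
    finally have "ennreal (\<integral>p. q p * f p \<partial>?Z) = ennreal (\<integral>p. qb (snd p) * f p \<partial>?Z)"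
      using nn_integral_eq_integral[OF iq] nn_integral_eq_integral[OF iqb] q01 qb0 f01 by (simp add: ennreal_mult)
    then have "(\<integral>p. q p * f p \<partial>?Z) = (\<integral>p. qb (snd p) * f p \<partial>?Z)"
      using q01 qb0 f01 by (subst (asm) ennreal_inj) (auto intro!: integral_nonneg_AE)
    then show ?thesis unfolding d_def left_diff_distrib using iq iqb by simp
  qed
  have le: "AE p in ?Z. d p \<le> 0"
    by (rule cylinder_test[OF PW.P.prob_space_axioms dm d1 test])
  \<comment> \<open>The constant 1 is a cylinder function as well. A nonpositive function with
    integral 0 vanishes almost everywhere.\<close>
  have "(\<integral>p. d p * 1 \<partial>?Z) = 0"
    by (rule test[of "{}"]) (simp_all add: depends_on_def)
  then have "(\<integral>p. - d p \<partial>?Z) = 0" by simp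
  moreover have "integrable ?Z (\<lambda>p. - d p)" by (rule PW.P.integrable_const_bound[where B=1]) (simp_all add: d1 del: split_paired_All)
  moreover have "AE p in ?Z. 0 \<le> - d p" using le by eventually_elim simp
  ultimately have "AE p in ?Z. - d p = 0" using integral_nonneg_eq_0_iff_AE by blast
  then show ?thesis by eventually_elim (simp add: d_def qb_def)
qed

end

section \<open>Comparison of two product measures\<close>

lemma PiM_density_finite:
  assumes M: "\<And>h. prob_space (M h)" and B: "finite B"
    and d[measurable]: "\<And>h. d h \<in> borel_measurable (M h)" and N: "\<And>h. prob_space (density (M h) (d h))"
  shows "PiM B (\<lambda>h. density (M h) (d h)) = density (PiM B M) (\<lambda>x. \<Prod>h\<in>B. d h (x h))"
proof -
  interpret M: product_sigma_finite M
    by unfold_locales (meson M prob_space_imp_sigma_finite sigma_finite_measure.sigma_finite_countable)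
  interpret N: product_sigma_finite "\<lambda>h. density (M h) (d h)"
    by unfold_locales (meson N prob_space_imp_sigma_finite sigma_finite_measure.sigma_finite_countable)
  show ?thesis
  proof (rule N.PiM_eqI[symmetric, OF B])
    show "sets (density (PiM B M) (\<lambda>x. \<Prod>h\<in>B. d h (x h))) = sets (PiM B (\<lambda>h. density (M h) (d h)))"
      by (simp cong: sets_PiM_cong)
    fix A assume "\<And>i. i \<in> B \<Longrightarrow> A i \<in> sets (density (M i) (d i))"
    then have A[measurable]: "\<And>i. i \<in> B \<Longrightarrow> A i \<in> sets (M i)" by simp
    have PA: "Pi\<^sub>E B A \<in> sets (PiM B M)" using B A by (rule sets_PiM_I_finite)
    have m: "(\<lambda>x. \<Prod>h\<in>B. d h (x h)) \<in> borel_measurable (PiM B M)"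
      using B by (intro borel_measurable_prod_ennreal) measurable
    have "emeasure (density (PiM B M) (\<lambda>x. \<Prod>h\<in>B. d h (x h))) (Pi\<^sub>E B A)
       = (\<integral>\<^sup>+x. (\<Prod>h\<in>B. d h (x h)) * indicator (Pi\<^sub>E B A) x \<partial>PiM B M)"
      by (rule emeasure_density[OF m PA])
    also have "\<dots> = (\<integral>\<^sup>+x. (\<Prod>h\<in>B. d h (x h) * indicator (A h) (x h)) \<partial>PiM B M)"
    proof (rule nn_integral_cong)
      fix x assume x: "x \<in> space (PiM B M)"
      then have "indicator (Pi\<^sub>E B A) x = (\<Prod>h\<in>B. indicator (A h) (x h) :: ennreal)"
        using B by (auto simp: indicator_def space_PiM PiE_iff prod_eq_1_iff intro!: prod_zero[symmetric])
      then show "(\<Prod>h\<in>B. d h (x h)) * indicator (Pi\<^sub>E B A) x = (\<Prod>h\<in>B. d h (x h) * indicator (A h) (x h))"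
        by (simp add: prod.distrib)
    qed
    also have "\<dots> = (\<Prod>h\<in>B. \<integral>\<^sup>+u. d h u * indicator (A h) u \<partial>M h)"
      by (rule M.product_nn_integral_prod[OF B]) (use A in measurable)
    also have "\<dots> = (\<Prod>h\<in>B. emeasure (density (M h) (d h)) (A h))"
      by (intro prod.cong refl emeasure_density[symmetric] d A)
    finally show "emeasure (density (PiM B M) (\<lambda>x. \<Prod>h\<in>B. d h (x h))) (Pi\<^sub>E B A)
       = (\<Prod>h\<in>B. emeasure (density (M h) (d h)) (A h))" .
  qed
qed

text \<open>One half of Kakutani's theorem on the equivalence of product measures: by Cauchy-Schwarz against
  the product of the densities.\<close>

lemma PiM_density_integral_square_le:
  fixes d :: "'i \<Rightarrow> 'a \<Rightarrow> real"
  assumes M: "\<And>h. prob_space (M h)" and d[measurable]: "\<And>h. d h \<in> borel_measurable (M h)"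
    and d0: "\<And>h u. 0 \<le> d h u"
    and Neq: "\<And>h. N h = density (M h) (\<lambda>u. ennreal (d h u))" and N: "\<And>h. prob_space (N h)"
    and sq: "\<And>h. h \<in> I \<Longrightarrow> (\<integral>\<^sup>+u. ennreal ((d h u)\<^sup>2) \<partial>M h) \<le> ennreal (exp (v h))"
    and v0: "\<And>h. 0 \<le> v h" and v: "v summable_on I"
    and f[measurable]: "f \<in> borel_measurable (PiM I M)" and f01: "\<And>p. 0 \<le> f p" "\<And>p. f p \<le> 1"
  shows "(\<integral>x. f x \<partial>PiM I N)\<^sup>2 \<le> exp (infsum v I) * (\<integral>x. (f x)\<^sup>2 \<partial>PiM I M)"
proof -
  interpret M: product_prob_space M I
    by (rule product_prob_spaceI[OF M])
  interpret N: product_prob_space N I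
    by (rule product_prob_spaceI[OF N])
  define C where "C = exp (infsum v I)"
  have C1: "C \<ge> 0" by (simp add: C_def)
  have sN: "sets (N h) = sets (M h)" for h by (simp add: Neq)
  have spN: "space (N h) = space (M h)" for h by (simp add: Neq)
  have sNM: "sets (PiM I N) = sets (PiM I M)" by (rule sets_PiM_cong) (simp_all add: sN)
  note [measurable_cong] = sNM
  obtain x0 where x0: "x0 \<in> space (PiM I M)" using M.P.not_empty by blast
  have cylinder: "(\<integral>x. g x \<partial>PiM I N)\<^sup>2 \<le> C * (\<integral>x. (g x)\<^sup>2 \<partial>PiM I M)"
    if B: "finite B" "B \<subseteq> I" and g[measurable]: "g \<in> borel_measurable (PiM I M)" and g01: "\<And>p. 0 \<le> g p" "\<And>p. g p \<le> 1"
      and dep: "\<And>x y. x \<in> space (PiM I M) \<Longrightarrow> y \<in> space (PiM I M) \<Longrightarrow> (\<And>i. i \<in> B \<Longrightarrow> x i = y i) \<Longrightarrow> g x = g y"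
    for B g
  proof -
    \<comment> \<open>Coordinates outside \<open>B\<close> are filled with the fixed point
      \<open>x0\<close>. Since \<open>g\<close> only sees \<open>B\<close>, its integrals become
      integrals over a finite product, where the densities multiply.\<close>
    define ext where "ext = (\<lambda>y::'i \<Rightarrow> 'a. \<lambda>h\<in>I. if h \<in> B then y h else x0 h)"
    have ext[measurable]: "ext \<in> measurable (PiM B M) (PiM I M)"
      unfolding ext_def
    proof (rule measurable_restrict)
      fix h assume h: "h \<in> I"
      have "x0 h \<in> space (M h)" using x0 h by (auto simp: space_PiM)
      then show "(\<lambda>y. if h \<in> B then y h else x0 h) \<in> measurable (PiM B M) (M h)"
        by (cases "h \<in> B") simp_all
    qed
    have sB: "sets (PiM B N) = sets (PiM B M)" by (rule sets_PiM_cong) (simp_all add: sN)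
    have extN[measurable]: "ext \<in> measurable (PiM B N) (PiM I M)" using ext sB by (simp cong: measurable_cong_sets)
    have gext: "g (ext (restrict x B)) = g x" if x: "x \<in> space (PiM I M)" for x
    proof (rule dep[OF _ x])
      show "ext (restrict x B) \<in> space (PiM I M)"
        using x x0 B by (auto simp: ext_def space_PiM PiE_iff)
      show "ext (restrict x B) i = x i" if "i \<in> B" for i using that B by (auto simp: ext_def)
    qed
    have transM: "(\<integral>\<^sup>+x. ennreal (k (g x)) \<partial>PiM I M) = (\<integral>\<^sup>+y. ennreal (k (g (ext y))) \<partial>PiM B M)"
      if [measurable]: "k \<in> borel_measurable borel" for k :: "real \<Rightarrow> real"
    proof -
      have "(\<integral>\<^sup>+x. ennreal (k (g x)) \<partial>PiM I M) = (\<integral>\<^sup>+x. ennreal (k (g (ext (restrict x B)))) \<partial>PiM I M)"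
        by (intro nn_integral_cong) (simp add: gext)
      also have "\<dots> = (\<integral>\<^sup>+y. ennreal (k (g (ext y))) \<partial>distr (PiM I M) (PiM B M) (\<lambda>x. restrict x B))"
        by (subst nn_integral_distr) (use B in \<open>auto intro!: measurable_restrict_subset\<close>)
      finally show ?thesis by (simp add: M.distr_PiM_restrict_finite[OF B])
    qed
    have transN: "(\<integral>\<^sup>+x. ennreal (g x) \<partial>PiM I N) = (\<integral>\<^sup>+y. ennreal (g (ext y)) \<partial>PiM B N)"
    proof -
      have "(\<integral>\<^sup>+x. ennreal (g x) \<partial>PiM I N) = (\<integral>\<^sup>+x. ennreal (g (ext (restrict x B))) \<partial>PiM I N)"
        by (intro nn_integral_cong) (simp add: gext sets_eq_imp_space_eq[OF sNM])
      also have "\<dots> = (\<integral>\<^sup>+y. ennreal (g (ext y)) \<partial>distr (PiM I N) (PiM B N) (\<lambda>x. restrict x B))"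
        by (subst nn_integral_distr) (use B in \<open>auto intro!: measurable_restrict_subset\<close>)
      finally show ?thesis by (simp add: N.distr_PiM_restrict_finite[OF B])
    qed
    define D where "D = (\<lambda>y. \<Prod>h\<in>B. ennreal (d h (y h)))"
    have Dm[measurable]: "D \<in> borel_measurable (PiM B M)"
      unfolding D_def by (intro borel_measurable_prod_ennreal measurable_compose[OF measurable_component_singleton]) simp_all
    have NB: "PiM B N = density (PiM B M) D"
      using PiM_density_finite[OF M B(1), of "\<lambda>h u. ennreal (d h u)"] N
      unfolding D_def Neq[abs_def] by simp
    have "(\<integral>\<^sup>+x. ennreal (g x) \<partial>PiM I N)\<^sup>2 = (\<integral>\<^sup>+y. D y * ennreal (g (ext y)) \<partial>PiM B M)\<^sup>2"
      unfolding transN unfolding NB by (subst nn_integral_density) auto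
    also have "\<dots> \<le> (\<integral>\<^sup>+y. (D y)\<^sup>2 \<partial>PiM B M) * (\<integral>\<^sup>+y. (ennreal (g (ext y)))\<^sup>2 \<partial>PiM B M)"
      by (rule Cauchy_Schwarz_nn_integral) measurable
    also have "(\<integral>\<^sup>+y. (D y)\<^sup>2 \<partial>PiM B M) \<le> ennreal C"
    proof -
      have "(\<integral>\<^sup>+y. (D y)\<^sup>2 \<partial>PiM B M) = (\<integral>\<^sup>+y. (\<Prod>h\<in>B. ennreal ((d h (y h))\<^sup>2)) \<partial>PiM B M)"
        by (simp add: D_def prod_power_distrib ennreal_power d0)
      also have "\<dots> = (\<Prod>h\<in>B. \<integral>\<^sup>+u. ennreal ((d h u)\<^sup>2) \<partial>M h)"
        by (rule M.product_nn_integral_prod[OF B(1)]) measurable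
      also have "\<dots> \<le> (\<Prod>h\<in>B. ennreal (exp (v h)))"
        using B by (intro prod_mono_ennreal sq) auto
      also have "\<dots> = ennreal (exp (sum v B))"
        by (simp add: prod_ennreal exp_sum B)
      also have "\<dots> \<le> ennreal C"
        unfolding C_def using finite_sum_le_infsum[OF v B] v0 by (simp add: ennreal_leI)
      finally show ?thesis .
    qed
    also have "(\<integral>\<^sup>+y. (ennreal (g (ext y)))\<^sup>2 \<partial>PiM B M) = (\<integral>\<^sup>+x. ennreal ((g x)\<^sup>2) \<partial>PiM I M)"
      using transM[of "\<lambda>t. t\<^sup>2"] by (simp add: ennreal_power g01)
    finally have le: "(\<integral>\<^sup>+x. ennreal (g x) \<partial>PiM I N)\<^sup>2 \<le> ennreal C * (\<integral>\<^sup>+x. ennreal ((g x)\<^sup>2) \<partial>PiM I M)"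
      by (simp add: mult_right_mono)
    have i1: "integrable (PiM I N) g" by (rule N.P.integrable_const_bound[where B=1]) (use g01 in auto)
    have i2: "integrable (PiM I M) (\<lambda>x. (g x)\<^sup>2)"
      by (rule M.P.integrable_const_bound[where B=1]) (use g01 in \<open>auto simp: power_le_one\<close>)
    from le show ?thesis
      by (simp add: nn_integral_eq_integral i1 i2 g01 ennreal_power ennreal_mult[symmetric] C1 ennreal_le_iff)
  qed
  have iN: "integrable (PiM I N) g" if "g \<in> borel_measurable (PiM I M)" "\<And>p. 0 \<le> g p" "\<And>p. g p \<le> 1" for g :: "_ \<Rightarrow> real"
    by (rule N.P.integrable_const_bound[where B=1]) (use that in auto)
  have iM: "integrable (PiM I M) g" if "g \<in> borel_measurable (PiM I M)" "\<And>p. 0 \<le> g p" "\<And>p. g p \<le> 1" for g :: "_ \<Rightarrow> real"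
    by (rule M.P.integrable_const_bound[where B=1]) (use that in auto)
  \<comment> \<open>Passing from \<open>f\<close> to the cylinder function costs
    \<open>2 * e\<close> in the square on the left and \<open>2 * C * e\<close> on the
    right.\<close>
  have approx: "(\<integral>x. f x \<partial>PiM I N)\<^sup>2 \<le> C * (\<integral>x. (f x)\<^sup>2 \<partial>PiM I M) + (2 * C + 2) * e" if e: "e > 0" for e
  proof -
    obtain B g where B: "finite B" "B \<subseteq> I" and g[measurable]: "g \<in> borel_measurable (PiM I M)" and g01: "\<And>p. 0 \<le> g p" "\<And>p. g p \<le> 1"
      and dep: "\<forall>x\<in>space (PiM I M). \<forall>y\<in>space (PiM I M). (\<forall>i\<in>B. x i = y i) \<longrightarrow> g x = g y"
      and aM: "(\<integral>\<^sup>+p. ennreal \<bar>f p - g p\<bar> \<partial>PiM I M) < ennreal e" and aN: "(\<integral>\<^sup>+p. ennreal \<bar>f p - g p\<bar> \<partial>PiM I N) < ennreal e"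
      by (rule cyl_approx_fun1[OF refl sNM M.P.finite_measure_axioms N.P.finite_measure_axioms f f01 e]) (rule that)
    have fg: "0 \<le> \<bar>f p - g p\<bar>" "\<bar>f p - g p\<bar> \<le> 1" for p using f01[of p] g01[of p] by auto
    have eM: "(\<integral>p. \<bar>f p - g p\<bar> \<partial>PiM I M) < e"
      using aM by (subst (asm) nn_integral_eq_integral) (auto intro!: iM fg simp: ennreal_less_iff)
    have eN: "(\<integral>p. \<bar>f p - g p\<bar> \<partial>PiM I N) < e"
      using aN by (subst (asm) nn_integral_eq_integral) (auto intro!: iN fg simp: ennreal_less_iff)
    have 1: "\<bar>(\<integral>x. f x \<partial>PiM I N) - (\<integral>x. g x \<partial>PiM I N)\<bar> \<le> e"
    proof -
      have "(\<integral>x. f x \<partial>PiM I N) - (\<integral>x. g x \<partial>PiM I N) = (\<integral>x. f x - g x \<partial>PiM I N)"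
        by (rule Bochner_Integration.integral_diff[symmetric]) (auto intro!: iN f01 g01)
      also have "\<bar>\<dots>\<bar> \<le> (\<integral>x. \<bar>f x - g x\<bar> \<partial>PiM I N)" by (rule integral_abs_bound)
      finally show ?thesis using eN by linarith
    qed
    have 2: "(\<integral>x. (g x)\<^sup>2 \<partial>PiM I M) \<le> (\<integral>x. (f x)\<^sup>2 \<partial>PiM I M) + 2 * e"
    proof -
      have "(\<integral>x. (g x)\<^sup>2 \<partial>PiM I M) \<le> (\<integral>x. (f x)\<^sup>2 + 2 * \<bar>f x - g x\<bar> \<partial>PiM I M)"
      proof (rule integral_mono)
        show "integrable (PiM I M) (\<lambda>x. (g x)\<^sup>2)" by (rule iM) (auto simp: power_le_one g01)
        show "integrable (PiM I M) (\<lambda>x. (f x)\<^sup>2 + 2 * \<bar>f x - g x\<bar>)"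
          by (intro Bochner_Integration.integrable_add integrable_mult_right iM fg) (auto simp: power_le_one f01)
        fix x
        have "(g x)\<^sup>2 - (f x)\<^sup>2 = (g x + f x) * (g x - f x)" by (simp add: power2_eq_square algebra_simps)
        also have "\<dots> \<le> \<bar>(g x + f x) * (g x - f x)\<bar>" by simp
        also have "\<dots> \<le> 2 * \<bar>f x - g x\<bar>"
          unfolding abs_mult using f01[of x] g01[of x] by (intro mult_mono) auto
        finally show "(g x)\<^sup>2 \<le> (f x)\<^sup>2 + 2 * \<bar>f x - g x\<bar>" by simp
      qed
      also have "\<dots> = (\<integral>x. (f x)\<^sup>2 \<partial>PiM I M) + 2 * (\<integral>x. \<bar>f x - g x\<bar> \<partial>PiM I M)"
        by (subst Bochner_Integration.integral_add) (auto intro!: integrable_mult_right iM fg simp: power_le_one f01)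
      finally show ?thesis using eM by linarith
    qed
    let ?a = "\<integral>x. f x \<partial>PiM I N" and ?b = "\<integral>x. g x \<partial>PiM I N"
    have b: "0 \<le> ?a" "?a \<le> 1" "0 \<le> ?b" "?b \<le> 1"
      by (auto intro!: integral_nonneg_AE f01 g01 N.P.integral_le_const iN)
    have "?a\<^sup>2 - ?b\<^sup>2 = (?a + ?b) * (?a - ?b)" by (simp add: power2_eq_square algebra_simps)
    also have "\<dots> \<le> \<bar>(?a + ?b) * (?a - ?b)\<bar>" by simp
    also have "\<dots> \<le> 2 * e" unfolding abs_mult using b 1 by (intro mult_mono) auto
    finally have "?a\<^sup>2 \<le> ?b\<^sup>2 + 2 * e" by simp
    also have "?b\<^sup>2 \<le> C * (\<integral>x. (g x)\<^sup>2 \<partial>PiM I M)" by (rule cylinder[OF B g g01]) (use dep in blast)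
    also have "\<dots> \<le> C * ((\<integral>x. (f x)\<^sup>2 \<partial>PiM I M) + 2 * e)" by (rule mult_left_mono[OF 2 C1])
    finally show ?thesis by (simp add: algebra_simps)
  qed
  have "(\<integral>x. f x \<partial>PiM I N)\<^sup>2 \<le> C * (\<integral>x. (f x)\<^sup>2 \<partial>PiM I M)"
  proof (rule field_le_epsilon)
    fix e :: real assume e: "e > 0"
    have "(2 * C + 2) * (e / (2 * C + 2)) = e" using C1 by simp
    with e C1 approx[of "e / (2 * C + 2)"] show "(\<integral>x. f x \<partial>PiM I N)\<^sup>2 \<le> C * (\<integral>x. (f x)\<^sup>2 \<partial>PiM I M) + e"
      by simp
  qed
  then show ?thesis by (simp add: C_def)
qed

section \<open>Translates of a density and the Bernoulli action\<close>

text \<open>Coordinate \<open>h\<close> and the fresh sample are two independent draws from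
  \<open>M h\<close>, hence exchangeable.\<close>

lemma (in product_prob_space) nn_integral_swap_out:
  assumes h: "h \<in> I" and f[measurable]: "f \<in> borel_measurable (PiM I M \<Otimes>\<^sub>M M h)"
  shows "(\<integral>\<^sup>+x. \<integral>\<^sup>+v. f (x(h := v), x h) \<partial>M h \<partial>PiM I M) = (\<integral>\<^sup>+x. \<integral>\<^sup>+v. f (x, v) \<partial>M h \<partial>PiM I M)"
proof -
  interpret Q: pair_sigma_finite "M h" "M h" ..
  have r[measurable]: "(\<lambda>p. (fst p)(h := snd p)) \<in> measurable (PiM I M \<Otimes>\<^sub>M M h) (PiM I M)"
    by (rule measurable_resample[OF h])
  have ch[measurable]: "(\<lambda>p. fst p h) \<in> measurable (PiM I M \<Otimes>\<^sub>M M h) (M h)"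
    using h by measurable
  have "(\<lambda>p. f ((fst p)(h := snd p), fst p h)) \<in> borel_measurable (PiM I M \<Otimes>\<^sub>M M h)" by measurable
  from M.borel_measurable_nn_integral_fst[OF this]
  have m1: "(\<lambda>x. \<integral>\<^sup>+v. f (x(h := v), x h) \<partial>M h) \<in> borel_measurable (PiM I M)" by simp
  have m2: "(\<lambda>x. \<integral>\<^sup>+v. f (x, v) \<partial>M h) \<in> borel_measurable (PiM I M)"
    using M.borel_measurable_nn_integral_fst[OF f] by simp
  have "(\<integral>\<^sup>+x. \<integral>\<^sup>+v. f (x(h := v), x h) \<partial>M h \<partial>PiM I M) = (\<integral>\<^sup>+x. \<integral>\<^sup>+u. \<integral>\<^sup>+v. f (x(h := v), u) \<partial>M h \<partial>M h \<partial>PiM I M)"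
    by (subst nn_integral_resample[OF h m1]) simp
  also have "\<dots> = (\<integral>\<^sup>+x. \<integral>\<^sup>+u. \<integral>\<^sup>+v. f (x(h := u), v) \<partial>M h \<partial>M h \<partial>PiM I M)"
  proof (rule nn_integral_cong)
    fix x assume x: "x \<in> space (PiM I M)"
    have "(\<lambda>q. (x(h := snd q), fst q)) \<in> measurable (M h \<Otimes>\<^sub>M M h) (PiM I M \<Otimes>\<^sub>M M h)"
      by (intro measurable_Pair measurable_fun_upd[where J="I"]) (use h x in auto)
    from measurable_compose[OF this f]
    have "(\<lambda>(u, v). f (x(h := v), u)) \<in> borel_measurable (M h \<Otimes>\<^sub>M M h)" by (simp add: split_beta')
    from Q.Fubini'[OF this]
    show "(\<integral>\<^sup>+u. \<integral>\<^sup>+v. f (x(h := v), u) \<partial>M h \<partial>M h) = (\<integral>\<^sup>+u. \<integral>\<^sup>+v. f (x(h := u), v) \<partial>M h \<partial>M h)" by simp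
  qed
  also have "\<dots> = (\<integral>\<^sup>+x. \<integral>\<^sup>+v. f (x, v) \<partial>M h \<partial>PiM I M)"
    by (rule nn_integral_resample[OF h m2, symmetric])
  finally show ?thesis .
qed

lemma (in group) group_actionI:
  assumes ext: "\<And>g. g \<in> carrier G \<Longrightarrow> a g \<in> extensional E"
    and maps: "\<And>g x. g \<in> carrier G \<Longrightarrow> x \<in> E \<Longrightarrow> a g x \<in> E"
    and mult: "\<And>g h x. g \<in> carrier G \<Longrightarrow> h \<in> carrier G \<Longrightarrow> x \<in> E \<Longrightarrow> a (g \<otimes> h) x = a g (a h x)"
    and one: "\<And>x. x \<in> E \<Longrightarrow> a \<one> x = x"
  shows "group_action G E a"
proof -
  have bij: "a g \<in> Bij E" if g: "g \<in> carrier G" for g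
  proof -
    have i: "inv g \<in> carrier G" using g by simp
    have "bij_betw (a g) E E"
      by (rule bij_betw_byWitness[where f'="a (inv g)"])
         (auto simp: mult[symmetric] g i one maps)
    then show ?thesis using ext[OF g] by (simp add: Bij_def)
  qed
  show ?thesis
    unfolding group_action_def group_hom_def group_hom_axioms_def
  proof (intro conjI)
    show "group G" by (rule is_group)
    show "group (BijGroup E)" by (rule group_BijGroup)
    show "a \<in> hom G (BijGroup E)"
    proof (rule homI)
      show "a g \<in> carrier (BijGroup E)" if "g \<in> carrier G" for g
        using bij[OF that] by (simp add: BijGroup_def)
      show "a (g \<otimes> h) = a g \<otimes>\<^bsub>BijGroup E\<^esub> a h" if "g \<in> carrier G" "h \<in> carrier G" for g h
        using that bij[of g] bij[of h] ext[of "g \<otimes> h"]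
        by (auto simp: BijGroup_def compose_def mult fun_eq_iff extensional_def)
    qed
  qed
qed

text \<open>\<open>L2\<close> distils the two regularity conditions into one second moment bound for
  density ratios of translates. It is exponential in a square so that it tensorises: over a product
  it becomes \<open>exp\<close> of \<kappa> times a squared l2 norm.\<close>

locale shift_density =
  fixes \<phi> :: "real \<Rightarrow> real" and \<kappa> :: real
  assumes cont: "continuous_on UNIV \<phi>" and pos: "0 < \<phi> t" and int: "has_bochner_integral lborel \<phi> 1"
    and kappa: "0 \<le> \<kappa>"
    and L2: "(\<integral>\<^sup>+t. ennreal ((\<phi> (t + a))\<^sup>2 / \<phi> (t + b)) \<partial>lborel) \<le> ennreal (exp (\<kappa> * (a - b)\<^sup>2))"
begin

lemma phi_measurable[measurable]: "\<phi> \<in> borel_measurable borel"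
  using cont by (rule borel_measurable_continuous_onI)

lemma sets_sh[simp, measurable_cong]: "sets (shifted_measure \<phi> b h) = sets borel"
  by (simp add: shifted_measure_def)

lemma space_sh[simp]: "space (shifted_measure \<phi> b h) = UNIV"
  by (simp add: shifted_measure_def)

lemma prob_sh: "prob_space (shifted_measure \<phi> b h)"
proof (rule prob_spaceI)
  have "integrable lborel \<phi>" "integral\<^sup>L lborel \<phi> = 1"
    using int by (auto simp: has_bochner_integral_iff)
  then have "(\<integral>\<^sup>+t. ennreal (\<phi> t) \<partial>lborel) = 1"
    using pos by (simp add: nn_integral_eq_integral less_imp_le)
  moreover have "(\<integral>\<^sup>+t. ennreal (\<phi> (t + b h)) \<partial>lborel) = (\<integral>\<^sup>+t. ennreal (\<phi> t) \<partial>lborel)"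
    by (subst (2) nn_integral_real_affine[where c=1 and t="b h"]) (auto simp: add.commute)
  ultimately show "emeasure (shifted_measure \<phi> b h) (space (shifted_measure \<phi> b h)) = 1"
    by (simp add: shifted_measure_def emeasure_density)
qed

lemma sh_density:
  "shifted_measure \<phi> b h = density (shifted_measure \<phi> a h) (\<lambda>u. ennreal (\<phi> (u + b h) / \<phi> (u + a h)))"
proof -
  have "\<phi> (u + a h) * (\<phi> (u + b h) / \<phi> (u + a h)) = \<phi> (u + b h)" for u
    using pos[of "u + a h"] by simp
  then show ?thesis
    unfolding shifted_measure_def
    by (subst density_density_eq) (auto simp: ennreal_mult[symmetric] pos less_imp_le)
qed

lemma AE_sh_iff:
  assumes [measurable]: "Measurable.pred borel Q"
  shows "(AE u in shifted_measure \<phi> b h. Q u) \<longleftrightarrow> (AE u in lborel. Q u)"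
  unfolding shifted_measure_def by (subst AE_density) (auto simp: pos)

lemma nn_integral_sh:
  assumes [measurable]: "f \<in> borel_measurable borel"
  shows "(\<integral>\<^sup>+u. f u \<partial>shifted_measure \<phi> b h) = (\<integral>\<^sup>+u. ennreal (\<phi> (u + b h)) * f u \<partial>lborel)"
  unfolding shifted_measure_def by (rule nn_integral_density) auto

lemma product_prob_sh: "product_prob_space (shifted_measure \<phi> b)"
  by (rule product_prob_spaceI[OF prob_sh])

lemma sets_PiM_sh: "sets (PiM I (shifted_measure \<phi> b)) = sets (PiM I (\<lambda>_. borel))"
  by (rule sets_PiM_cong) simp_all

lemma space_PiM_sh: "space (PiM I (shifted_measure \<phi> b)) = extensional I"
  by (simp add: space_PiM PiE_def)

text \<open>Applied to indicators this yields absolute continuity, and applied to truncations of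
  \<open>1 / om g\<close> it yields the moment bound \<open>nn_integral_inverse_om\<close>.\<close>

lemma PiM_sh_integral_square_le:
  assumes s: "(\<lambda>h. (b h - a h)\<^sup>2) summable_on I"
    and f[measurable]: "f \<in> borel_measurable (PiM I (\<lambda>_. borel))" and f01: "\<And>p. 0 \<le> f p" "\<And>p. f p \<le> (1::real)"
  shows "(\<integral>x. f x \<partial>PiM I (shifted_measure \<phi> b))\<^sup>2
    \<le> exp (\<kappa> * (\<Sum>\<^sub>\<infinity>h\<in>I. (b h - a h)\<^sup>2)) * (\<integral>x. (f x)\<^sup>2 \<partial>PiM I (shifted_measure \<phi> a))"
proof -
  have "(\<integral>x. f x \<partial>PiM I (shifted_measure \<phi> b))\<^sup>2
    \<le> exp (\<Sum>\<^sub>\<infinity>h\<in>I. \<kappa> * (b h - a h)\<^sup>2) * (\<integral>x. (f x)\<^sup>2 \<partial>PiM I (shifted_measure \<phi> a))"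
  proof (rule PiM_density_integral_square_le[where d="\<lambda>h u. \<phi> (u + b h) / \<phi> (u + a h)"])
    show "prob_space (shifted_measure \<phi> a h)" "prob_space (shifted_measure \<phi> b h)" for h by (rule prob_sh)+
    show "shifted_measure \<phi> b h = density (shifted_measure \<phi> a h) (\<lambda>u. ennreal (\<phi> (u + b h) / \<phi> (u + a h)))" for h
      by (rule sh_density)
    show "f \<in> borel_measurable (PiM I (shifted_measure \<phi> a))"
      using f by (simp cong: measurable_cong_sets add: sets_PiM_sh)
    show "(\<lambda>h. \<kappa> * (b h - a h)\<^sup>2) summable_on I" using s by (rule summable_on_cmult_right)
    show "0 \<le> \<kappa> * (b h - a h)\<^sup>2" for h using kappa by simp
    show "0 \<le> \<phi> (u + b h) / \<phi> (u + a h)" for h u by (simp add: pos less_imp_le)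
    fix h
    show "(\<lambda>u. \<phi> (u + b h) / \<phi> (u + a h)) \<in> borel_measurable (shifted_measure \<phi> a h)" by measurable
    have "\<phi> (u + a h) * (\<phi> (u + b h) / \<phi> (u + a h))\<^sup>2 = (\<phi> (u + b h))\<^sup>2 / \<phi> (u + a h)" for u
      using pos[of "u + a h"] by (simp add: power2_eq_square)
    then show "(\<integral>\<^sup>+u. ennreal ((\<phi> (u + b h) / \<phi> (u + a h))\<^sup>2) \<partial>shifted_measure \<phi> a h) \<le> ennreal (exp (\<kappa> * (b h - a h)\<^sup>2))"
      using L2[of "b h" "a h"] by (subst nn_integral_sh) (auto simp: ennreal_mult[symmetric] pos less_imp_le)
  qed (use f01 in auto)
  then show ?thesis by (simp only: infsum_cmult_right[OF s])
qed

lemma PiM_sh_absolutely_continuous: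
  assumes s: "(\<lambda>h. (b h - a h)\<^sup>2) summable_on I"
  shows "absolutely_continuous (PiM I (shifted_measure \<phi> a)) (PiM I (shifted_measure \<phi> b))"
  unfolding absolutely_continuous_def
proof
  interpret A: product_prob_space "shifted_measure \<phi> a" I by (rule product_prob_sh)
  interpret B: product_prob_space "shifted_measure \<phi> b" I by (rule product_prob_sh)
  fix S assume S: "S \<in> null_sets (PiM I (shifted_measure \<phi> a))"
  then have Sm[measurable]: "S \<in> sets (PiM I (\<lambda>_. borel))" by (auto simp: sets_PiM_sh)
  then have Sb: "S \<in> sets (PiM I (shifted_measure \<phi> b))" by (simp add: sets_PiM_sh)
  have Sa: "S \<in> sets (PiM I (shifted_measure \<phi> a))" using S by auto
  have ind2: "(indicator S x :: real)\<^sup>2 = indicator S x" for x by (simp add: indicator_def)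
  have "(measure (PiM I (shifted_measure \<phi> b)) S)\<^sup>2 \<le> exp (\<kappa> * (\<Sum>\<^sub>\<infinity>h\<in>I. (b h - a h)\<^sup>2)) * measure (PiM I (shifted_measure \<phi> a)) S"
    using PiM_sh_integral_square_le[OF s, of "indicator S"] Sa Sb sets.sets_into_space[OF Sa] sets.sets_into_space[OF Sb]
    by (simp add: ind2 Int_absorb2)
  also have "measure (PiM I (shifted_measure \<phi> a)) S = 0" using S by (simp add: measure_eq_0_null_sets)
  finally have "measure (PiM I (shifted_measure \<phi> b)) S = 0" by simp
  then show "S \<in> null_sets (PiM I (shifted_measure \<phi> b))"
    using Sb by (intro null_setsI) (simp add: B.P.emeasure_eq_measure)
qed

end

section \<open>The Bernoulli action and its Radon-Nikodym cocycle\<close>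

locale bernoulli_shift = shift_density \<phi> \<kappa> + group G
  for \<phi> :: "real \<Rightarrow> real" and \<kappa> :: real and G :: "('g, 'b) monoid_scheme" (structure) +
  fixes F :: "'g \<Rightarrow> real" and K :: real
  assumes countable_G: "countable (carrier G)"
    and F_bound: "g \<in> carrier G \<Longrightarrow> \<bar>F g\<bar> \<le> K"
    and sq_sum: "g \<in> carrier G \<Longrightarrow> (\<lambda>h. (F (g \<otimes> h) - F h)\<^sup>2) summable_on carrier G"
begin

abbreviation "I \<equiv> carrier G"
abbreviation "sh \<equiv> shifted_measure \<phi>"
abbreviation "P \<equiv> PiM I (sh F)"
abbreviation "act \<equiv> bernoulli_action G (sh F)"

definition tr :: "'g \<Rightarrow> 'g \<Rightarrow> real" where "tr g h = F (g \<otimes> h)"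

text \<open>As in \<open>sq_sum\<close>, the translation is by \<open>g\<close> and not by its
  inverse, so this is the squared norm of the cocycle at \<open>inv g\<close>. By
  \<open>nrm_inv\<close> it agrees with the one at \<open>g\<close>.\<close>

definition nrm :: "'g \<Rightarrow> real" where "nrm g = (\<Sum>\<^sub>\<infinity>h\<in>I. (F (g \<otimes> h) - F h)\<^sup>2)"

sublocale PP: product_prob_space "sh F" I
  by (rule product_prob_sh)

lemma space_P: "space P = extensional I"
  by (rule space_PiM_sh)

lemma act_apply: "x \<in> space P \<Longrightarrow> act g x = (\<lambda>h\<in>I. x (inv g \<otimes> h))"
  by (simp add: bernoulli_action_def)

lemma act_in_space: "g \<in> I \<Longrightarrow> x \<in> space P \<Longrightarrow> act g x \<in> space P"
  by (simp add: act_apply) (simp add: space_P)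

lemma act_mult: "g \<in> I \<Longrightarrow> h \<in> I \<Longrightarrow> x \<in> space P \<Longrightarrow> act (g \<otimes> h) x = act g (act h x)"
proof -
  assume *: "g \<in> I" "h \<in> I" "x \<in> space P"
  have "act g (act h x) = (\<lambda>k\<in>I. act h x (inv g \<otimes> k))"
    by (rule act_apply[OF act_in_space[OF *(2,3)]])
  also have "\<dots> = act (g \<otimes> h) x"
    using * by (auto simp: act_apply inv_mult_group m_assoc intro!: restrict_ext)
  finally show "act (g \<otimes> h) x = act g (act h x)" ..
qed

lemma act_one: "x \<in> space P \<Longrightarrow> act \<one> x = x"
  by (auto simp: act_apply space_P extensional_def fun_eq_iff)

lemma act_inv: "g \<in> I \<Longrightarrow> x \<in> space P \<Longrightarrow> act g (act (inv g) x) = x" "g \<in> I \<Longrightarrow> x \<in> space P \<Longrightarrow> act (inv g) (act g x) = x"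
  by (simp_all add: act_mult[symmetric] act_one)

lemma act_coord: "g \<in> I \<Longrightarrow> h \<in> I \<Longrightarrow> x \<in> space P \<Longrightarrow> act g x h = x (inv g \<otimes> h)"
  by (simp add: act_apply)

lemma act_upd:
  assumes "g \<in> I" "h \<in> I" "x \<in> space P"
  shows "act g (x(h := v)) = (act g x)(g \<otimes> h := v)"
proof -
  have "x(h := v) \<in> space P" using assms by (auto simp: space_P extensional_def)
  note y = this
  show ?thesis
  proof
    fix k
    have "(inv g \<otimes> k = h) = (k = g \<otimes> h)" if "k \<in> I"
      using inv_solve_left[of h g k] that assms by auto
    then show "act g (x(h := v)) k = ((act g x)(g \<otimes> h := v)) k"
      using assms by (cases "k \<in> I") (auto simp: act_apply[OF y] act_apply[OF assms(3)])
  qed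
qed

lemma act_measurable: "g \<in> I \<Longrightarrow> act g \<in> measurable P P"
proof -
  assume g: "g \<in> I"
  have "(\<lambda>x. \<lambda>h\<in>I. x (inv g \<otimes> h)) \<in> measurable P P"
  proof (rule measurable_restrict)
    fix h assume "h \<in> I"
    then have "(\<lambda>x. x (inv g \<otimes> h)) \<in> measurable P (sh F (inv g \<otimes> h))"
      using g by (intro measurable_component_singleton) simp
    then show "(\<lambda>x. x (inv g \<otimes> h)) \<in> measurable P (sh F h)" by (simp cong: measurable_cong_sets)
  qed
  then show "act g \<in> measurable P P"
    by (rule measurable_cong[THEN iffD2, rotated]) (rule act_apply)
qed

lemma group_action_act: "group_action G (space P) act"
  by (rule group_actionI) (auto simp: act_in_space act_mult act_one, simp add: bernoulli_action_def)

lemma distr_act: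
  assumes g: "g \<in> I"
  shows "distr P P (act (inv g)) = PiM I (sh (tr g))"
proof -
  have "distr P (\<Pi>\<^sub>M h\<in>I. sh F (g \<otimes> h)) (\<lambda>x. \<lambda>h\<in>I. x (g \<otimes> h)) = (\<Pi>\<^sub>M h\<in>I. sh F (g \<otimes> h))"
    using g by (intro distr_PiM_reindex prob_sh) (auto simp: inj_on_def)
  also have "(\<lambda>h. sh F (g \<otimes> h)) = sh (tr g)"
    by (simp add: shifted_measure_def tr_def fun_eq_iff)
  also have "distr P (PiM I (sh (tr g))) (\<lambda>x. \<lambda>h\<in>I. x (g \<otimes> h)) = distr P P (act (inv g))"
    by (rule distr_cong) (use g in \<open>simp_all add: sets_PiM_sh act_apply\<close>)
  finally show ?thesis .
qed

lemma sum_tr: "g \<in> I \<Longrightarrow> (\<lambda>h. (tr g h - F h)\<^sup>2) summable_on I" "g \<in> I \<Longrightarrow> (\<lambda>h. (F h - tr g h)\<^sup>2) summable_on I"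
  using sq_sum[of g] by (simp_all add: tr_def power2_commute)

lemma ac_tr: "g \<in> I \<Longrightarrow> absolutely_continuous P (PiM I (sh (tr g)))"
  "g \<in> I \<Longrightarrow> absolutely_continuous (PiM I (sh (tr g))) P"
  by (rule PiM_sh_absolutely_continuous, erule sum_tr)+

text \<open>A version of the derivative of the push forward under \<open>inv g\<close> that is
  finite and positive everywhere, so that \<open>ln (om g x)\<close> and \<open>1 / om g x\<close>
  are always meaningful. The default 1 also replaces the value infinity, which
  \<open>enn2real\<close> sends to 0.\<close>

definition om :: "'g \<Rightarrow> ('g \<Rightarrow> real) \<Rightarrow> real" where
  "om g x = (let r = enn2real (RN_deriv P (distr P P (act (inv g))) x) in if 0 < r then r else 1)"

lemma om_pos: "0 < om g x"
  by (simp add: om_def Let_def)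

lemma om_measurable[measurable]: "om g \<in> borel_measurable P"
  unfolding om_def[abs_def] Let_def by measurable

text \<open>Absolute continuity in both directions excludes the value 0 almost everywhere, and
  sigma-finiteness excludes infinity. So the default in \<open>om\<close> is taken on a null set
  only.\<close>

lemma AE_om:
  assumes g: "g \<in> I"
  shows "AE x in P. RN_deriv P (distr P P (act (inv g))) x = ennreal (om g x)"
proof -
  let ?N = "PiM I (sh (tr g))" and ?R = "RN_deriv P (PiM I (sh (tr g)))"
  interpret N: product_prob_space "sh (tr g)" I by (rule product_prob_sh)
  have sN: "sets ?N = sets P" by (simp add: sets_PiM_sh)
  have dR: "density P ?R = ?N" by (rule PP.P.density_RN_deriv[OF ac_tr(1)[OF g] sN])
  have fin: "AE x in P. ?R x \<noteq> \<infinity>"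
    by (rule PP.P.RN_deriv_finite[OF N.P.sigma_finite_measure_axioms ac_tr(1)[OF g] sN])
  define S where "S = {x\<in>space P. ?R x = 0}"
  have S: "S \<in> sets P" unfolding S_def by measurable
  have "AE x in density P ?R. ?R x \<noteq> 0" by (simp add: AE_density zero_less_iff_neq_zero)
  then have "AE x in density P ?R. x \<notin> S" by eventually_elim (simp add: S_def)
  then have "AE x in ?N. x \<notin> S" by (simp only: dR)
  then have "S \<in> null_sets ?N" using S sN by (subst AE_iff_null_sets) auto
  then have "S \<in> null_sets P"
    using ac_tr(2)[OF g] by (auto simp: absolutely_continuous_def)
  then have "AE x in P. x \<notin> S" using S by (subst (asm) AE_iff_null_sets) auto
  then have "AE x in P. ?R x \<noteq> 0"
    using AE_space by eventually_elim (simp add: S_def)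
  with fin show ?thesis
    unfolding distr_act[OF g]
  proof eventually_elim
    case (elim x)
    then have "?R x = ennreal (enn2real (?R x))" "0 < enn2real (?R x)"
      by (auto simp: enn2real_positive_iff less_top zero_less_iff_neq_zero)
    then show ?case by (simp add: om_def distr_act[OF g] Let_def)
  qed
qed

lemma density_om:
  assumes g: "g \<in> I"
  shows "density P (\<lambda>x. ennreal (om g x)) = PiM I (sh (tr g))"
proof -
  have sN: "sets (PiM I (sh (tr g))) = sets P" by (simp add: sets_PiM_sh)
  have "density P (\<lambda>x. ennreal (om g x)) = density P (RN_deriv P (PiM I (sh (tr g))))"
    by (rule density_cong) (use AE_om[OF g] in \<open>auto simp: distr_act[OF g]\<close>)
  then show ?thesis using PP.P.density_RN_deriv[OF ac_tr(1)[OF g] sN] by simp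
qed

lemma nn_integral_om:
  assumes g: "g \<in> I" and f[measurable]: "f \<in> borel_measurable P"
  shows "(\<integral>\<^sup>+x. ennreal (om g x) * f x \<partial>P) = (\<integral>\<^sup>+x. f (act (inv g) x) \<partial>P)"
proof -
  note [measurable] = act_measurable[OF inv_closed[OF g]]
  have "(\<integral>\<^sup>+x. ennreal (om g x) * f x \<partial>P) = (\<integral>\<^sup>+x. f x \<partial>density P (\<lambda>x. ennreal (om g x)))"
    by (rule nn_integral_density[symmetric]) auto
  also have "\<dots> = (\<integral>\<^sup>+x. f x \<partial>distr P P (act (inv g)))"
    by (simp add: density_om[OF g] distr_act[OF g])
  also have "\<dots> = (\<integral>\<^sup>+x. f (act (inv g) x) \<partial>P)" by (rule nn_integral_distr) auto
  finally show ?thesis .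
qed

lemma nn_integral_om_act:
  assumes g: "g \<in> I" and f[measurable]: "f \<in> borel_measurable P"
  shows "(\<integral>\<^sup>+x. ennreal (om g x) * f (act g x) \<partial>P) = (\<integral>\<^sup>+x. f x \<partial>P)"
proof -
  note [measurable] = act_measurable[OF g]
  have "(\<integral>\<^sup>+x. ennreal (om g x) * f (act g x) \<partial>P) = (\<integral>\<^sup>+x. f (act g (act (inv g) x)) \<partial>P)"
    by (rule nn_integral_om[OF g]) measurable
  also have "\<dots> = (\<integral>\<^sup>+x. f x \<partial>P)" by (rule nn_integral_cong) (simp add: act_inv g)
  finally show ?thesis .
qed

lemma om_unique:
  assumes [measurable]: "w \<in> borel_measurable P" "w' \<in> borel_measurable P"
    and pos: "\<And>x. 0 \<le> w x" "\<And>x. 0 \<le> w' x"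
    and eq: "\<And>S. S \<in> sets P \<Longrightarrow> (\<integral>\<^sup>+x. ennreal (w x) * indicator S x \<partial>P) = (\<integral>\<^sup>+x. ennreal (w' x) * indicator S x \<partial>P)"
  shows "AE x in P. w x = w' x"
proof -
  have "density P (\<lambda>x. ennreal (w x)) = density P (\<lambda>x. ennreal (w' x))"
    by (rule measure_eqI) (auto simp: emeasure_density eq)
  then have "AE x in P. ennreal (w x) = ennreal (w' x)"
    by (subst (asm) PP.P.density_unique_iff) auto
  then show ?thesis by eventually_elim (simp add: pos)
qed

lemma om_one: "AE x in P. om \<one> x = 1"
proof (rule om_unique)
  fix S assume "S \<in> sets P"
  then have "(\<integral>\<^sup>+x. ennreal (om \<one> x) * indicator S x \<partial>P) = (\<integral>\<^sup>+x. indicator S (act (inv \<one>) x) \<partial>P)"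
    by (intro nn_integral_om) auto
  also have "\<dots> = (\<integral>\<^sup>+x. ennreal 1 * indicator S x \<partial>P)" by (intro nn_integral_cong) (simp add: act_one)
  finally show "(\<integral>\<^sup>+x. ennreal (om \<one> x) * indicator S x \<partial>P) = (\<integral>\<^sup>+x. ennreal 1 * indicator S x \<partial>P)" .
qed (auto simp: less_imp_le om_pos)

text \<open>Chain rule: both sides are densities of the push forward of \<open>P\<close> under
  \<open>inv (g \<otimes> h)\<close>.\<close>

lemma om_cocycle:
  assumes g: "g \<in> I" and h: "h \<in> I"
  shows "AE x in P. om (g \<otimes> h) x = om g (act h x) * om h x"
proof (rule om_unique)
  note [measurable] = act_measurable[OF h] act_measurable[OF inv_closed[OF h]] act_measurable[OF inv_closed[OF g]]
  show "(\<lambda>x. om g (act h x) * om h x) \<in> borel_measurable P" by measurable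
  fix S assume [measurable]: "S \<in> sets P"
  have "(\<integral>\<^sup>+x. ennreal (om g (act h x) * om h x) * indicator S x \<partial>P)
     = (\<integral>\<^sup>+x. ennreal (om h x) * (ennreal (om g (act h x)) * indicator S (act (inv h) (act h x))) \<partial>P)"
    by (intro nn_integral_cong) (simp add: act_inv h ennreal_mult om_pos less_imp_le mult_ac)
  also have "\<dots> = (\<integral>\<^sup>+x. ennreal (om g x) * indicator S (act (inv h) x) \<partial>P)"
    by (rule nn_integral_om_act[OF h]) measurable
  also have "\<dots> = (\<integral>\<^sup>+x. indicator S (act (inv h) (act (inv g) x)) \<partial>P)"
    by (rule nn_integral_om[OF g]) measurable
  also have "\<dots> = (\<integral>\<^sup>+x. indicator S (act (inv (g \<otimes> h)) x) \<partial>P)"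
    by (intro nn_integral_cong) (simp add: act_mult[symmetric] g h inv_mult_group)
  also have "\<dots> = (\<integral>\<^sup>+x. ennreal (om (g \<otimes> h) x) * indicator S x \<partial>P)"
    by (rule nn_integral_om[symmetric]) (use g h in auto)
  finally show "(\<integral>\<^sup>+x. ennreal (om (g \<otimes> h) x) * indicator S x \<partial>P) = (\<integral>\<^sup>+x. ennreal (om g (act h x) * om h x) * indicator S x \<partial>P)" ..
qed (auto simp: less_imp_le om_pos)

text \<open>The function \<open>1 / om g\<close> is the density of \<open>P\<close> relative to the
  translated product \<open>?N\<close>, and its integral under \<open>P\<close> is its second moment
  under \<open>?N\<close>. For a truncation f the comparison of product measures bounds the square
  of the \<open>P\<close>-integral of f by \<open>C\<close> times the \<open>?N\<close>-integral of
  its square, which is at most \<open>C / Suc n\<close> times the \<open>P\<close>-integral of f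
  again. Dividing by that integral and letting \<open>n\<close> grow gives the bound.\<close>

lemma nn_integral_inverse_om:
  assumes g: "g \<in> I"
  shows "(\<integral>\<^sup>+x. ennreal (1 / om g x) \<partial>P) \<le> ennreal (exp (\<kappa> * nrm g))"
proof -
  let ?N = "PiM I (sh (tr g))"
  interpret N: product_prob_space "sh (tr g)" I by (rule product_prob_sh)
  define C where "C = exp (\<kappa> * nrm g)"
  have nrm: "(\<Sum>\<^sub>\<infinity>h\<in>I. (F h - tr g h)\<^sup>2) = nrm g" by (simp add: nrm_def tr_def power2_commute)
  have sN: "sets ?N = sets P" by (simp add: sets_PiM_sh)
  \<comment> \<open>Truncated and scaled to take values between 0 and 1; the multiples
    \<open>Suc n * f n\<close> increase to \<open>1 / om g\<close>.\<close>
  define f where "f = (\<lambda>(n::nat) x. min 1 (1 / (real (Suc n) * om g x)))"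
  have fm[measurable]: "f n \<in> borel_measurable P" for n unfolding f_def by measurable
  have f01: "0 \<le> f n x" "f n x \<le> 1" for n x using om_pos[of g x] by (auto simp: f_def)
  have fS: "real (Suc n) * f n x = min (real (Suc n)) (1 / om g x)" for n x
    unfolding f_def by (subst min_mult_distrib_left) (simp add: om_pos)
  have fb: "real (Suc n) * (\<integral>x. f n x \<partial>P) \<le> C" for n
  proof -
    have i: "integrable P (f n)" by (rule PP.P.integrable_const_bound[where B=1]) (use f01 in auto)
    have "(\<integral>\<^sup>+x. ennreal ((f n x)\<^sup>2) \<partial>?N) = (\<integral>\<^sup>+x. ennreal (om g x) * ennreal ((f n x)\<^sup>2) \<partial>P)"
      unfolding density_om[OF g, symmetric] by (rule nn_integral_density) auto
    also have "\<dots> \<le> (\<integral>\<^sup>+x. ennreal (f n x / real (Suc n)) \<partial>P)"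
    proof (rule nn_integral_mono)
      fix x
      have "om g x * f n x \<le> 1 / real (Suc n)"
      proof -
        have "f n x \<le> 1 / (real (Suc n) * om g x)" by (simp add: f_def)
        then have "f n x * (real (Suc n) * om g x) \<le> 1"
          by (subst (asm) pos_le_divide_eq) (simp_all add: om_pos)
        then show ?thesis by (subst pos_le_divide_eq) (simp_all add: mult_ac)
      qed
      then have "om g x * f n x * f n x \<le> 1 / real (Suc n) * f n x"
        by (rule mult_right_mono) (rule f01)
      then show "ennreal (om g x) * ennreal ((f n x)\<^sup>2) \<le> ennreal (f n x / real (Suc n))"
        using om_pos[of g x] f01[of n x] by (simp add: ennreal_mult[symmetric] less_imp_le power2_eq_square mult_ac)
    qed
    also have "\<dots> = ennreal ((\<integral>x. f n x \<partial>P) / real (Suc n))"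
      using i f01 by (subst nn_integral_eq_integral) auto
    finally have 1: "(\<integral>\<^sup>+x. ennreal ((f n x)\<^sup>2) \<partial>?N) \<le> ennreal ((\<integral>x. f n x \<partial>P) / real (Suc n))" .
    have fN: "f n \<in> borel_measurable ?N" using fm sN by (simp cong: measurable_cong_sets)
    have i2: "integrable ?N (\<lambda>x. (f n x)\<^sup>2)"
      by (rule N.P.integrable_const_bound[where B=1]) (use f01 fN in \<open>auto simp: power_le_one\<close>)
    have nn: "0 \<le> (\<integral>x. f n x \<partial>P)" by (simp add: integral_nonneg_AE f01)
    have 2: "(\<integral>x. (f n x)\<^sup>2 \<partial>?N) \<le> (\<integral>x. f n x \<partial>P) / real (Suc n)"
      using 1 nn by (subst (asm) nn_integral_eq_integral[OF i2]) (auto simp: ennreal_le_iff divide_nonneg_nonneg)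
    have "f n \<in> borel_measurable (PiM I (\<lambda>_. borel))" using fm by (simp cong: measurable_cong_sets add: sets_PiM_sh)
    from PiM_sh_integral_square_le[OF sum_tr(2)[OF g] this f01]
    have "(\<integral>x. f n x \<partial>P)\<^sup>2 \<le> C * (\<integral>x. (f n x)\<^sup>2 \<partial>?N)"
      by (simp add: C_def nrm)
    also have "\<dots> \<le> C * ((\<integral>x. f n x \<partial>P) / real (Suc n))"
      using 2 by (intro mult_left_mono) (simp_all add: C_def)
    finally have 3: "(\<integral>x. f n x \<partial>P) * (\<integral>x. f n x \<partial>P) \<le> (C / real (Suc n)) * (\<integral>x. f n x \<partial>P)"
      by (simp add: power2_eq_square)
    have "(\<integral>x. f n x \<partial>P) \<le> C / real (Suc n)"
    proof (cases "(\<integral>x. f n x \<partial>P) = 0")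
      case True then show ?thesis by (simp add: C_def)
    next
      case False
      with nn have "0 < (\<integral>x. f n x \<partial>P)" by simp
      with 3 show ?thesis by (rule mult_right_le_imp_le)
    qed
    then show ?thesis by (simp add: field_simps)
  qed
  have "(\<integral>\<^sup>+x. ennreal (1 / om g x) \<partial>P) = (\<integral>\<^sup>+x. (SUP n. ennreal (real (Suc n) * f n x)) \<partial>P)"
  proof (rule nn_integral_cong)
    fix x
    have "incseq (\<lambda>n. ennreal (real (Suc n) * f n x))"
    proof (rule incseq_SucI, rule ennreal_leI)
      fix n show "real (Suc n) * f n x \<le> real (Suc (Suc n)) * f (Suc n) x"
        unfolding fS by simp
    qed
    moreover have "(\<lambda>n. ennreal (real (Suc n) * f n x)) \<longlonglongrightarrow> ennreal (1 / om g x)"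
    proof (rule tendsto_ennrealI, rule tendsto_eventually)
      obtain m :: nat where m: "1 / om g x \<le> real m" using real_arch_simple by blast
      show "\<forall>\<^sub>F n in sequentially. real (Suc n) * f n x = 1 / om g x"
        unfolding eventually_sequentially
      proof (intro exI allI impI)
        fix n assume "m \<le> n"
        with m have "1 / om g x \<le> real (Suc n)" by (meson le_Suc_eq of_nat_mono order_trans)
        then show "real (Suc n) * f n x = 1 / om g x" unfolding fS by simp
      qed
    qed
    ultimately show "ennreal (1 / om g x) = (SUP n. ennreal (real (Suc n) * f n x))"
      using LIMSEQ_SUP LIMSEQ_unique by blast
  qed
  also have "\<dots> = (SUP n. \<integral>\<^sup>+x. ennreal (real (Suc n) * f n x) \<partial>P)"
  proof (rule nn_integral_monotone_convergence_SUP)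
    show "incseq (\<lambda>n x. ennreal (real (Suc n) * f n x))"
    proof (rule incseq_SucI, rule le_funI, rule ennreal_leI)
      fix n x show "real (Suc n) * f n x \<le> real (Suc (Suc n)) * f (Suc n) x"
        unfolding fS by simp
    qed
  qed measurable
  also have "\<dots> \<le> ennreal C"
  proof (rule SUP_least)
    fix n
    have i: "integrable P (\<lambda>x. real (Suc n) * f n x)"
      by (intro integrable_mult_right PP.P.integrable_const_bound[where B=1]) (use f01 in auto)
    have "(\<integral>\<^sup>+x. ennreal (real (Suc n) * f n x) \<partial>P) = ennreal (\<integral>x. real (Suc n) * f n x \<partial>P)"
      by (rule nn_integral_eq_integral[OF i]) (simp add: f01)
    also have "\<dots> \<le> ennreal C" using fb[of n] by (simp add: ennreal_leI)
    finally show "(\<integral>\<^sup>+x. ennreal (real (Suc n) * f n x) \<partial>P) \<le> ennreal C" .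
  qed
  finally show ?thesis by (simp add: C_def)
qed

text \<open>The factor that coordinate \<open>h\<close> contributes to \<open>om g\<close>, which is
  formally the infinite product of all \<open>rat g h (x h)\<close>.\<close>

definition rat :: "'g \<Rightarrow> 'g \<Rightarrow> real \<Rightarrow> real" where
  "rat g h u = \<phi> (u + F (g \<otimes> h)) / \<phi> (u + F h)"

lemma rat_pos: "0 < rat g h u"
  by (simp add: rat_def pos)

lemma rat_measurable[measurable]: "rat g h \<in> borel_measurable borel"
  unfolding rat_def[abs_def] by measurable

text \<open>Formally, changing coordinate \<open>h\<close> changes a single factor of an infinite
  product. Rigorously, \<open>D1\<close> is the density of the translated product times its own
  marginal at \<open>h\<close>, and \<open>D2\<close> is \<open>D1\<close> composed with the
  exchange of coordinate \<open>h\<close> and the fresh value. Both the original and the translated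
  measure are symmetric under this exchange, so \<open>D1\<close> and \<open>D2\<close> are
  densities of the same measure.\<close>

lemma om_local:
  assumes g: "g \<in> I" and h: "h \<in> I"
  shows "AE p in P \<Otimes>\<^sub>M sh F h. om g ((fst p)(h := snd p)) * rat g h (fst p h) = om g (fst p) * rat g h (snd p)"
proof -
  let ?N = "PiM I (sh (tr g))" and ?Q = "P \<Otimes>\<^sub>M sh F h"
  interpret N: product_prob_space "sh (tr g)" I by (rule product_prob_sh)
  interpret Q: pair_prob_space P "sh F h" ..
  have shd: "sh (tr g) h = density (sh F h) (\<lambda>u. ennreal (rat g h u))"
    using sh_density[of "tr g" h F] by (simp add: rat_def tr_def)
  have sN[measurable_cong]: "sets ?N = sets P" by (simp add: sets_PiM_sh)
  have [measurable]: "(\<lambda>p. (fst p)(h := snd p)) \<in> measurable ?Q P" by (rule PP.measurable_resample[OF h])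
  have ch0: "(\<lambda>p. fst p h) \<in> measurable ?Q (sh F h)" using h by measurable
  then have ch[measurable]: "(\<lambda>p. fst p h) \<in> borel_measurable ?Q" by (simp cong: measurable_cong_sets)
  define D1 where "D1 = (\<lambda>p. om g (fst p) * rat g h (snd p))"
  define D2 where "D2 = (\<lambda>p. om g ((fst p)(h := snd p)) * rat g h (fst p h))"
  have [measurable]: "D1 \<in> borel_measurable ?Q" "D2 \<in> borel_measurable ?Q" unfolding D1_def D2_def by measurable
  have D0: "0 \<le> D1 p" "0 \<le> D2 p" for p by (simp_all add: D1_def D2_def om_pos rat_pos less_imp_le)
  have iter: "(\<integral>\<^sup>+x. \<integral>\<^sup>+v. f (x, v) \<partial>sh (tr g) h \<partial>?N) = (\<integral>\<^sup>+x. \<integral>\<^sup>+v. ennreal (D1 (x, v)) * f (x, v) \<partial>sh F h \<partial>P)"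
    if f[measurable]: "f \<in> borel_measurable ?Q" for f
  proof -
    have fN: "f \<in> borel_measurable (P \<Otimes>\<^sub>M sh (tr g) h)" using f by (simp cong: measurable_cong_sets sets_pair_measure_cong)
    have m: "(\<lambda>x. \<integral>\<^sup>+v. f (x, v) \<partial>sh (tr g) h) \<in> borel_measurable P"
      using N.M.borel_measurable_nn_integral_fst[OF fN] by simp
    have "(\<integral>\<^sup>+x. \<integral>\<^sup>+v. f (x, v) \<partial>sh (tr g) h \<partial>?N) = (\<integral>\<^sup>+x. ennreal (om g x) * (\<integral>\<^sup>+v. f (x, v) \<partial>sh (tr g) h) \<partial>P)"
      unfolding density_om[OF g, symmetric] by (rule nn_integral_density) (use m in auto)
    also have "\<dots> = (\<integral>\<^sup>+x. \<integral>\<^sup>+v. ennreal (D1 (x, v)) * f (x, v) \<partial>sh F h \<partial>P)"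
    proof (rule nn_integral_cong)
      fix x assume x: "x \<in> space P"
      have fx: "(\<lambda>v. f (x, v)) \<in> borel_measurable borel"
        using measurable_compose[OF measurable_Pair1'[OF x] f] by (simp cong: measurable_cong_sets)
      have "ennreal (om g x) * (\<integral>\<^sup>+v. f (x, v) \<partial>sh (tr g) h) = ennreal (om g x) * (\<integral>\<^sup>+v. ennreal (rat g h v) * f (x, v) \<partial>sh F h)"
        unfolding shd by (subst nn_integral_density) (use fx in \<open>auto cong: measurable_cong_sets\<close>)
      also have "\<dots> = (\<integral>\<^sup>+v. ennreal (om g x) * (ennreal (rat g h v) * f (x, v)) \<partial>sh F h)"
        by (rule nn_integral_cmult[symmetric]) (use fx in \<open>auto cong: measurable_cong_sets\<close>)
      finally show "ennreal (om g x) * (\<integral>\<^sup>+v. f (x, v) \<partial>sh (tr g) h) = (\<integral>\<^sup>+v. ennreal (D1 (x, v)) * f (x, v) \<partial>sh F h)"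
        by (simp add: D1_def ennreal_mult om_pos rat_pos less_imp_le mult.assoc)
    qed
    finally show ?thesis .
  qed
  have main: "(\<integral>\<^sup>+x. \<integral>\<^sup>+v. ennreal (D1 (x, v)) * f (x, v) \<partial>sh F h \<partial>P) = (\<integral>\<^sup>+x. \<integral>\<^sup>+v. ennreal (D2 (x, v)) * f (x, v) \<partial>sh F h \<partial>P)"
    if f[measurable]: "f \<in> borel_measurable ?Q" for f
  proof -
    have fN: "f \<in> borel_measurable (?N \<Otimes>\<^sub>M sh (tr g) h)" using f sN by (simp cong: measurable_cong_sets sets_pair_measure_cong)
    have sw: "(\<lambda>p. ((fst p)(h := snd p), fst p h)) \<in> measurable ?Q ?Q" using ch0 by measurable
    have f2: "(\<lambda>p. f ((fst p)(h := snd p), fst p h)) \<in> borel_measurable ?Q" by (rule measurable_compose[OF sw f])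
    have f3: "(\<lambda>p. ennreal (D2 p) * f p) \<in> borel_measurable ?Q" by measurable
    have "(\<integral>\<^sup>+x. \<integral>\<^sup>+v. ennreal (D1 (x, v)) * f (x, v) \<partial>sh F h \<partial>P) = (\<integral>\<^sup>+x. \<integral>\<^sup>+v. f (x, v) \<partial>sh (tr g) h \<partial>?N)"
      by (rule iter[OF f, symmetric])
    also have "\<dots> = (\<integral>\<^sup>+x. \<integral>\<^sup>+v. f (x(h := v), x h) \<partial>sh (tr g) h \<partial>?N)"
      by (rule N.nn_integral_swap_out[OF h fN, symmetric])
    also have "\<dots> = (\<integral>\<^sup>+x. \<integral>\<^sup>+v. ennreal (D1 (x, v)) * f (x(h := v), x h) \<partial>sh F h \<partial>P)"
      using iter[OF f2] by simp
    also have "\<dots> = (\<integral>\<^sup>+x. \<integral>\<^sup>+v. ennreal (D2 (x(h := v), x h)) * f (x(h := v), x h) \<partial>sh F h \<partial>P)"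
      by (simp add: D1_def D2_def)
    also have "\<dots> = (\<integral>\<^sup>+x. \<integral>\<^sup>+v. ennreal (D2 (x, v)) * f (x, v) \<partial>sh F h \<partial>P)"
      by (rule PP.nn_integral_swap_out[OF h f3])
    finally show ?thesis .
  qed
  have "density ?Q (\<lambda>p. ennreal (D1 p)) = density ?Q (\<lambda>p. ennreal (D2 p))"
  proof (rule measure_eqI)
    fix S assume "S \<in> sets (density ?Q (\<lambda>p. ennreal (D1 p)))"
    then have [measurable]: "S \<in> sets ?Q" by simp
    show "emeasure (density ?Q (\<lambda>p. ennreal (D1 p))) S = emeasure (density ?Q (\<lambda>p. ennreal (D2 p))) S"
      apply (subst emeasure_density, measurable)
      apply (subst emeasure_density, measurable)
      using main[of "indicator S"]
        PP.M.nn_integral_fst[of "\<lambda>p. ennreal (D1 p) * indicator S p" P] PP.M.nn_integral_fst[of "\<lambda>p. ennreal (D2 p) * indicator S p" P]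
      by simp
  qed simp
  then have "AE p in ?Q. ennreal (D1 p) = ennreal (D2 p)"
    by (subst (asm) Q.density_unique_iff) auto
  then show ?thesis using D0 by (auto simp: D1_def D2_def elim!: eventually_mono)
qed

end

section \<open>Averaging kernels and escape to infinity\<close>

lemma AE_fst:
  assumes "prob_space N" "AE x in M. Q x"
  shows "AE z in M \<Otimes>\<^sub>M N. Q (fst z)"
proof -
  have "AE z in distr (M \<Otimes>\<^sub>M N) M fst. Q z"
    using assms(2) by (simp only: prob_space.distr_pair_fst[OF assms(1)])
  then show ?thesis by (rule AE_distrD[OF measurable_fst])
qed

lemma AE_snd:
  assumes N: "prob_space N" and M: "prob_space M" and Q: "AE x in N. Q x"
  shows "AE z in M \<Otimes>\<^sub>M N. Q (snd z)"
proof -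
  interpret M: prob_space M by fact
  interpret N: prob_space N by fact
  have "distr (M \<Otimes>\<^sub>M N) N snd = N"
  proof (rule measure_eqI)
    fix A assume "A \<in> sets (distr (M \<Otimes>\<^sub>M N) N snd)"
    then have A: "A \<in> sets N" by simp
    then have "snd -` A \<inter> space (M \<Otimes>\<^sub>M N) = space M \<times> A"
      using sets.sets_into_space[OF A] by (auto simp: space_pair_measure)
    then show "emeasure (distr (M \<Otimes>\<^sub>M N) N snd) A = emeasure N A"
      using A by (simp add: emeasure_distr N.emeasure_pair_measure_Times M.emeasure_space_1)
  qed simp
  with Q have "AE z in distr (M \<Otimes>\<^sub>M N) N snd. Q z" by (simp only:)
  then show ?thesis by (rule AE_distrD[OF measurable_snd])
qed

context group
begin

lemma mult_inv_cancel:
  assumes "x \<in> carrier G" "y \<in> carrier G" "z \<in> carrier G"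
  shows "(x \<otimes> inv y) \<otimes> (y \<otimes> z) = x \<otimes> z"
proof -
  have "inv y \<otimes> (y \<otimes> z) = z" using assms by (simp add: m_assoc[symmetric])
  then show ?thesis using assms by (simp add: m_assoc)
qed

definition ker :: "('a \<Rightarrow> 'z \<Rightarrow> real) \<Rightarrow> 'a set \<Rightarrow> 'a \<Rightarrow> 'a \<Rightarrow> 'z \<Rightarrow> real" where
  "ker w K k l z = w (k \<otimes> inv l) z / (real (card K) * (\<Sum>k'\<in>K. w (k' \<otimes> inv l) z))"

lemma ker_nonneg:
  assumes "\<And>g z. 0 < w g z"
  shows "0 \<le> ker w K k l z"
  unfolding ker_def using assms by (auto intro!: divide_nonneg_nonneg mult_nonneg_nonneg sum_nonneg simp: less_imp_le)

lemma ker_sum: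
  assumes "\<And>g z. 0 < w g z" "finite K" "K \<noteq> {}"
  shows "(\<Sum>k\<in>K. \<Sum>l\<in>K. ker w K k l z) = 1"
proof -
  have c: "real (card K) > 0" using assms by (simp add: card_gt_0_iff)
  have "(\<Sum>k\<in>K. ker w K k l z) = 1 / real (card K)" for l
  proof -
    have "(\<Sum>k'\<in>K. w (k' \<otimes> inv l) z) > 0" using assms by (intro sum_pos) auto
    then show ?thesis using c unfolding ker_def sum_divide_distrib[symmetric] by simp
  qed
  then have "(\<Sum>l\<in>K. \<Sum>k\<in>K. ker w K k l z) = 1" using c by simp
  then show ?thesis by (subst sum.swap)
qed

text \<open>A Harnack type comparison: one factor \<open>C\<close> comes from the numerator and one
  from the denominator.\<close>

lemma ker_le:
  assumes w: "\<And>g z. 0 < w g z" and K: "finite K" "K \<noteq> {}" "K \<subseteq> carrier G" "k \<in> K" "l \<in> K"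
    and C: "\<And>g. g \<in> carrier G \<Longrightarrow> w g z \<le> C * w g z'" "\<And>g. g \<in> carrier G \<Longrightarrow> w g z' \<le> C * w g z"
  shows "ker w K k l z \<le> C\<^sup>2 * ker w K k l z'"
proof -
  have kl: "k' \<otimes> inv l \<in> carrier G" if "k' \<in> K" for k' using that K by auto
  have c: "real (card K) > 0" using K by (simp add: card_gt_0_iff)
  let ?S = "\<lambda>z. \<Sum>k'\<in>K. w (k' \<otimes> inv l) z"
  have S: "?S z > 0" "?S z' > 0" using K w by (auto intro!: sum_pos)
  have C0: "C > 0" using C(1)[of \<one>] w[of \<one> z] w[of \<one> z'] by (metis one_closed less_le_trans zero_less_mult_pos2)
  have "?S z' \<le> (\<Sum>k'\<in>K. C * w (k' \<otimes> inv l) z)" by (intro sum_mono C kl)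
  then have "?S z' \<le> C * ?S z" by (simp add: sum_distrib_left)
  then have "1 / ?S z \<le> C / ?S z'" using S by (simp add: field_simps)
  then have "w (k \<otimes> inv l) z * (1 / ?S z) \<le> (C * w (k \<otimes> inv l) z') * (C / ?S z')"
    using C(1)[OF kl[OF K(4)]] S w C0 by (intro mult_mono) (auto simp: less_imp_le)
  then have "w (k \<otimes> inv l) z * (1 / ?S z) / real (card K) \<le> (C * w (k \<otimes> inv l) z') * (C / ?S z') / real (card K)"
    using c by (intro divide_right_mono) auto
  then show ?thesis by (simp add: ker_def power2_eq_square mult_ac)
qed

text \<open>If \<open>l\<close> is uniform on \<open>K\<close> and, given \<open>x = l\<^sup>-\<^sup>1 z\<close>, the element \<open>k\<close> is drawn from the posterior
  distribution of \<open>l\<close> given \<open>x\<close>, then \<open>k x\<close> has the same law as \<open>z\<close>. The kernel \<open>ker\<close> is the law of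
  \<open>(k, l)\<close> given \<open>z\<close>.\<close>

lemma ker_stationary:
  assumes w: "\<And>g z. 0 < w g z" and wm[measurable]: "\<And>g. g \<in> carrier G \<Longrightarrow> w g \<in> borel_measurable m"
    and Tm: "\<And>g. g \<in> carrier G \<Longrightarrow> T g \<in> measurable m m"
    and int: "\<And>g f. g \<in> carrier G \<Longrightarrow> f \<in> borel_measurable m \<Longrightarrow> (\<integral>\<^sup>+z. ennreal (w g z) * f (T g z) \<partial>m) = (\<integral>\<^sup>+z. f z \<partial>m)"
    and coc: "\<And>g h. g \<in> carrier G \<Longrightarrow> h \<in> carrier G \<Longrightarrow> AE z in m. w (g \<otimes> h) z = w g (T h z) * w h z"
    and one: "AE z in m. w \<one> z = 1"
    and K: "finite K" "K \<noteq> {}" "K \<subseteq> carrier G" and f[measurable]: "f \<in> borel_measurable m"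
  shows "(\<Sum>k\<in>K. \<Sum>l\<in>K. \<integral>\<^sup>+z. ennreal (ker w K k l z) * f (T (k \<otimes> inv l) z) \<partial>m) = (\<integral>\<^sup>+z. f z \<partial>m)"
proof -
  have c: "real (card K) > 0" using K by (simp add: card_gt_0_iff)
  have kl[measurable]: "k \<otimes> inv l \<in> carrier G" if "k \<in> K" "l \<in> K" for k l using that K by auto
  \<comment> \<open>The kernel with the roles of \<open>k\<close> and \<open>l\<close> exchanged,
    which is what \<open>ker\<close> becomes after the change of variables along
    \<open>T (k \<otimes> inv l)\<close>. Summed over \<open>l\<close> it gives
    \<open>1 / card K\<close>, whereas \<open>ker\<close> is normalised over
    \<open>k\<close>.\<close>
  define H where "H = (\<lambda>k l z. w (l \<otimes> inv k) z / (real (card K) * (\<Sum>k'\<in>K. w (k' \<otimes> inv k) z)))"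
  have Hm: "H k l \<in> borel_measurable m" if "k \<in> K" "l \<in> K" for k l
    unfolding H_def using that by (intro borel_measurable_divide borel_measurable_times borel_measurable_sum wm kl) auto
  have H0: "0 \<le> H k l z" for k l z
    unfolding H_def using w by (auto intro!: divide_nonneg_nonneg mult_nonneg_nonneg sum_nonneg simp: less_imp_le)
  have one_step: "(\<integral>\<^sup>+z. ennreal (ker w K k l z) * f (T (k \<otimes> inv l) z) \<partial>m) = (\<integral>\<^sup>+z. ennreal (H k l z) * f z \<partial>m)"
    if k: "k \<in> K" and l: "l \<in> K" for k l
  proof -
    let ?g = "k \<otimes> inv l"
    have kG: "k \<in> carrier G" "l \<in> carrier G" using k l K by auto
    have "AE z in m. \<forall>k'\<in>K. w ((k' \<otimes> inv k) \<otimes> ?g) z = w (k' \<otimes> inv k) (T ?g z) * w ?g z"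
      using K(1) by (intro AE_finite_allI coc kl k l)
    moreover have "(k' \<otimes> inv k) \<otimes> ?g = k' \<otimes> inv l" if "k' \<in> K" for k'
      using that K kG by (intro mult_inv_cancel) auto
    ultimately have 1: "AE z in m. \<forall>k'\<in>K. w (k' \<otimes> inv l) z = w (k' \<otimes> inv k) (T ?g z) * w ?g z"
      by simp
    have "(l \<otimes> inv k) \<otimes> ?g = \<one>"
      using kG mult_inv_cancel[of l k "inv l"] by simp
    then have 2: "AE z in m. w \<one> z = w (l \<otimes> inv k) (T ?g z) * w ?g z"
      using coc[OF kl[OF l k] kl[OF k l]] by simp
    have "AE z in m. ker w K k l z = w ?g z * H k l (T ?g z)"
      using 1 2 one
    proof eventually_elim
      case (elim z)
      have "(\<Sum>k'\<in>K. w (k' \<otimes> inv l) z) = w ?g z * (\<Sum>k'\<in>K. w (k' \<otimes> inv k) (T ?g z))"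
        using elim(1) by (simp add: sum_distrib_left mult.commute)
      moreover have "w (l \<otimes> inv k) (T ?g z) = 1 / w ?g z"
        using elim(2,3) w[of ?g z] by (simp add: field_simps)
      ultimately show ?case using w[of ?g z] unfolding ker_def H_def by simp
    qed
    then have "(\<integral>\<^sup>+z. ennreal (ker w K k l z) * f (T ?g z) \<partial>m) = (\<integral>\<^sup>+z. ennreal (w ?g z) * (ennreal (H k l (T ?g z)) * f (T ?g z)) \<partial>m)"
      by (intro nn_integral_cong_AE, eventually_elim) (simp add: ennreal_mult w H0 less_imp_le mult.assoc)
    also have "\<dots> = (\<integral>\<^sup>+z. ennreal (H k l z) * f z \<partial>m)"
      using int[OF kl[OF k l], of "\<lambda>z. ennreal (H k l z) * f z"] Hm[OF k l] by simp
    finally show ?thesis .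
  qed
  have "(\<Sum>k\<in>K. \<Sum>l\<in>K. \<integral>\<^sup>+z. ennreal (ker w K k l z) * f (T (k \<otimes> inv l) z) \<partial>m)
     = (\<Sum>k\<in>K. \<Sum>l\<in>K. \<integral>\<^sup>+z. ennreal (H k l z) * f z \<partial>m)"
    by (intro sum.cong refl one_step)
  also have "\<dots> = (\<Sum>k\<in>K. \<integral>\<^sup>+z. (\<Sum>l\<in>K. ennreal (H k l z) * f z) \<partial>m)"
  proof (intro sum.cong refl nn_integral_sum[symmetric])
    fix k l assume "k \<in> K" "l \<in> K"
    then have [measurable]: "H k l \<in> borel_measurable m" by (rule Hm)
    show "(\<lambda>z. ennreal (H k l z) * f z) \<in> borel_measurable m" by measurable
  qed
  also have "\<dots> = (\<Sum>k\<in>K. \<integral>\<^sup>+z. ennreal (1 / real (card K)) * f z \<partial>m)"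
  proof (intro sum.cong refl nn_integral_cong)
    fix k z
    assume k: "k \<in> K"
    have "(\<Sum>k'\<in>K. w (k' \<otimes> inv k) z) > 0" using K w by (intro sum_pos) auto
    then have "(\<Sum>l\<in>K. H k l z) = 1 / real (card K)"
      unfolding H_def sum_divide_distrib[symmetric] using c by simp
    then show "(\<Sum>l\<in>K. ennreal (H k l z) * f z) = ennreal (1 / real (card K)) * f z"
      by (simp add: sum_distrib_right[symmetric] sum_ennreal H0)
  qed
  also have "\<dots> = (\<Sum>k\<in>K. ennreal (1 / real (card K)) * (\<integral>\<^sup>+z. f z \<partial>m))"
    by (simp add: nn_integral_cmult)
  also have "\<dots> = ennreal (real (card K)) * ennreal (1 / real (card K)) * (\<integral>\<^sup>+z. f z \<partial>m)"
    by (simp add: ennreal_of_nat_eq_real_of_nat mult.assoc)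
  also have "\<dots> = (\<integral>\<^sup>+z. f z \<partial>m)" using c by (simp add: ennreal_mult[symmetric])
  finally show ?thesis .
qed

end

context bernoulli_shift
begin

lemma nrm_mult_inv:
  assumes k: "k \<in> I" and l: "l \<in> I"
  shows "nrm (k \<otimes> inv l) = (\<Sum>\<^sub>\<infinity>h\<in>I. (F (k \<otimes> h) - F (l \<otimes> h))\<^sup>2)"
    and "(\<lambda>h. (F (k \<otimes> h) - F (l \<otimes> h))\<^sup>2) summable_on I"
proof -
  have bij: "bij_betw (\<lambda>h. l \<otimes> h) I I"
    using l by (intro bij_betw_byWitness[where f'="\<lambda>h. inv l \<otimes> h"]) (auto simp: m_assoc[symmetric])
  have eq: "(k \<otimes> inv l) \<otimes> (l \<otimes> h) = k \<otimes> h" if "h \<in> I" for h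
    using that k l by (metis inv_closed inv_solve_right m_assoc m_closed)
  let ?f = "\<lambda>h. (F ((k \<otimes> inv l) \<otimes> h) - F h)\<^sup>2"
  have "nrm (k \<otimes> inv l) = (\<Sum>\<^sub>\<infinity>h\<in>I. ?f (l \<otimes> h))"
    unfolding nrm_def by (rule infsum_reindex_bij_betw[OF bij, symmetric])
  also have "\<dots> = (\<Sum>\<^sub>\<infinity>h\<in>I. (F (k \<otimes> h) - F (l \<otimes> h))\<^sup>2)" by (intro infsum_cong) (simp add: eq)
  finally show "nrm (k \<otimes> inv l) = (\<Sum>\<^sub>\<infinity>h\<in>I. (F (k \<otimes> h) - F (l \<otimes> h))\<^sup>2)" .
  have "(\<lambda>h. ?f (l \<otimes> h)) summable_on I"
    using sq_sum[of "k \<otimes> inv l"] k l by (subst summable_on_reindex_bij_betw[OF bij]) auto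
  then show "(\<lambda>h. (F (k \<otimes> h) - F (l \<otimes> h))\<^sup>2) summable_on I"
    by (rule summable_on_cong[THEN iffD1, rotated]) (simp add: eq)
qed

lemma nrm_inv: "g \<in> I \<Longrightarrow> nrm (inv g) = nrm g"
  using nrm_mult_inv(1)[of \<one> g] by (simp add: nrm_def power2_commute cong: infsum_cong)

text \<open>The square of a difference is at most twice the sum of the squares. This is where the 4
  in exp (4 \<kappa> s) comes from.\<close>

lemma nrm_mult_inv_le:
  assumes k: "k \<in> I" and l: "l \<in> I"
  shows "nrm (k \<otimes> inv l) \<le> 2 * nrm k + 2 * nrm l"
proof -
  have s: "(\<lambda>h. 2 * (F (g \<otimes> h) - F h)\<^sup>2) summable_on I" if "g \<in> I" for g
    by (rule summable_on_cmult_right[OF sq_sum[OF that]])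
  have "nrm (k \<otimes> inv l) \<le> (\<Sum>\<^sub>\<infinity>h\<in>I. 2 * (F (k \<otimes> h) - F h)\<^sup>2 + 2 * (F (l \<otimes> h) - F h)\<^sup>2)"
    unfolding nrm_mult_inv(1)[OF k l]
  proof (rule infsum_mono[OF nrm_mult_inv(2)[OF k l] summable_on_add[OF s[OF k] s[OF l]]])
    fix h
    have "0 \<le> ((F (k \<otimes> h) - F h) + (F (l \<otimes> h) - F h))\<^sup>2" by simp
    then show "(F (k \<otimes> h) - F (l \<otimes> h))\<^sup>2 \<le> 2 * (F (k \<otimes> h) - F h)\<^sup>2 + 2 * (F (l \<otimes> h) - F h)\<^sup>2"
      by (simp add: power2_eq_square algebra_simps)
  qed
  also have "\<dots> = 2 * nrm k + 2 * nrm l"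
    unfolding nrm_def by (subst infsum_add[OF s[OF k] s[OF l]]) (simp add: infsum_cmult_right' )
  finally show ?thesis .
qed

end

text \<open>A probability measure equivalent to Lebesgue measure. Translation by \<open>c\<close> distorts it by at most
  \<open>exp (\<bar>c\<bar> / 8)\<close>; it is this loss that raises the growth threshold from \<open>4 * \<kappa>\<close> to \<open>9 / 2 * \<kappa>\<close>.\<close>

definition Lap :: "real measure" where
  "Lap = density lborel (\<lambda>t. ennreal (exp (- \<bar>t\<bar> / 8) / 16))"

lemma sets_Lap[simp, measurable_cong]: "sets Lap = sets borel" and space_Lap[simp]: "space Lap = UNIV"
  by (simp_all add: Lap_def)

lemma prob_space_Lap: "prob_space Lap"
proof (rule prob_spaceI)
  let ?e = "\<lambda>t::real. exponential_density (1/8) t"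
  interpret E: prob_space "density lborel ?e" by (rule prob_space_exponential_density) simp
  have one: "(\<integral>\<^sup>+t. ennreal (?e t) \<partial>lborel) = 1"
    using E.emeasure_space_1 by (simp add: emeasure_density)
  have two: "(\<integral>\<^sup>+t. ennreal (?e (- t)) \<partial>lborel) = 1"
    using one by (subst (asm) nn_integral_real_affine[where c="-1" and t=0]) auto
  have half: "ennreal (1/2) * (ennreal u + ennreal v) = ennreal ((u + v) / 2)" if "0 \<le> u" "0 \<le> v" for u v
    using that by (subst ennreal_plus[symmetric], simp, simp, subst ennreal_mult[symmetric]) simp_all
  have "(\<integral>\<^sup>+t. ennreal (exp (- \<bar>t\<bar> / 8) / 16) \<partial>lborel) = (\<integral>\<^sup>+t. ennreal (1/2) * (ennreal (?e t) + ennreal (?e (- t))) \<partial>lborel)"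
  proof (rule nn_integral_cong_AE)
    \<comment> \<open>The density of \<open>Lap\<close> is the average of an exponential density and
      its reflection, except at 0, where both of them count.\<close>
    show "AE t in lborel. ennreal (exp (- \<bar>t\<bar> / 8) / 16) = ennreal (1/2) * (ennreal (?e t) + ennreal (?e (- t)))"
      using AE_lborel_singleton[of "0::real"]
    proof eventually_elim
      case (elim t)
      have "0 \<le> ?e t" "0 \<le> ?e (- t)" by (simp_all add: exponential_density_def)
      moreover have "(?e t + ?e (- t)) / 2 = exp (- \<bar>t\<bar> / 8) / 16"
        using elim by (auto simp: exponential_density_def)
      ultimately show ?case by (simp only: half)
    qed
  qed
  also have "\<dots> = ennreal (1/2) * (1 + 1)"
    by (subst nn_integral_cmult, simp, subst nn_integral_add) (simp_all add: one two)
  also have "\<dots> = ennreal (1/2) * ennreal 2" by simp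
  also have "\<dots> = 1" by (simp only: ennreal_mult[symmetric]) simp
  finally show "emeasure Lap (space Lap) = 1" by (simp add: Lap_def emeasure_density)
qed

lemma nn_integral_Lap:
  "f \<in> borel_measurable borel \<Longrightarrow> (\<integral>\<^sup>+t. f t \<partial>Lap) = (\<integral>\<^sup>+t. ennreal (exp (- \<bar>t\<bar> / 8) / 16) * f t \<partial>lborel)"
  unfolding Lap_def by (rule nn_integral_density) auto

text \<open>The exponential factor is the ratio of the densities of \<open>Lap\<close> at
  \<open>t + c\<close> and at \<open>t\<close>.\<close>

lemma nn_integral_Lap_shift:
  assumes [measurable]: "f \<in> borel_measurable borel"
  shows "(\<integral>\<^sup>+t. ennreal (exp ((\<bar>t\<bar> - \<bar>t + c\<bar>) / 8)) * f (t + c) \<partial>Lap) = (\<integral>\<^sup>+t. f t \<partial>Lap)"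
proof -
  have "(\<integral>\<^sup>+t. ennreal (exp ((\<bar>t\<bar> - \<bar>t + c\<bar>) / 8)) * f (t + c) \<partial>Lap)
      = (\<integral>\<^sup>+t. ennreal (exp (- \<bar>t\<bar> / 8) / 16) * (ennreal (exp ((\<bar>t\<bar> - \<bar>t + c\<bar>) / 8)) * f (t + c)) \<partial>lborel)"
    by (rule nn_integral_Lap) measurable
  also have "\<dots> = (\<integral>\<^sup>+t. ennreal (exp (- \<bar>c + 1 * t\<bar> / 8) / 16) * f (c + 1 * t) \<partial>lborel)"
  proof (rule nn_integral_cong)
    fix t
    have "exp (- \<bar>t\<bar> / 8) * exp ((\<bar>t\<bar> - \<bar>t + c\<bar>) / 8) = exp (- \<bar>c + 1 * t\<bar> / 8)"
      by (simp add: exp_add[symmetric] add.commute diff_divide_distrib)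
    then have "exp (- \<bar>t\<bar> / 8) / 16 * exp ((\<bar>t\<bar> - \<bar>t + c\<bar>) / 8) = exp (- \<bar>c + 1 * t\<bar> / 8) / 16" by simp
    then show "ennreal (exp (- \<bar>t\<bar> / 8) / 16) * (ennreal (exp ((\<bar>t\<bar> - \<bar>t + c\<bar>) / 8)) * f (t + c)) = ennreal (exp (- \<bar>c + 1 * t\<bar> / 8) / 16) * f (c + 1 * t)"
      by (simp add: mult.assoc[symmetric] ennreal_mult[symmetric] add.commute)
  qed
  also have "\<dots> = (\<integral>\<^sup>+t. ennreal (exp (- \<bar>t\<bar> / 8) / 16) * f t \<partial>lborel)"
    by (subst (2) nn_integral_real_affine[where c=1 and t=c]) auto
  also have "\<dots> = (\<integral>\<^sup>+t. f t \<partial>Lap)" by (rule nn_integral_Lap[symmetric]) simp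
  finally show ?thesis .
qed

lemma nn_integral_Lap_shift_le:
  assumes [measurable]: "f \<in> borel_measurable borel"
  shows "(\<integral>\<^sup>+t. f (t + c) \<partial>Lap) \<le> ennreal (exp (\<bar>c\<bar> / 8)) * (\<integral>\<^sup>+t. f t \<partial>Lap)"
proof -
  have "(\<integral>\<^sup>+t. f (t + c) \<partial>Lap) \<le> (\<integral>\<^sup>+t. ennreal (exp (\<bar>c\<bar> / 8)) * (ennreal (exp ((\<bar>t\<bar> - \<bar>t + c\<bar>) / 8)) * f (t + c)) \<partial>Lap)"
  proof (rule nn_integral_mono)
    fix t
    have "1 \<le> exp (\<bar>c\<bar> / 8) * exp ((\<bar>t\<bar> - \<bar>t + c\<bar>) / 8)"
      unfolding exp_add[symmetric] using abs_triangle_ineq[of t c] by (simp add: add_divide_distrib[symmetric])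
    then have "ennreal 1 \<le> ennreal (exp (\<bar>c\<bar> / 8)) * ennreal (exp ((\<bar>t\<bar> - \<bar>t + c\<bar>) / 8))"
      by (simp only: ennreal_mult[symmetric] exp_ge_zero ennreal_leI)
    from mult_right_mono[OF this, of "f (t + c)"]
    show "f (t + c) \<le> ennreal (exp (\<bar>c\<bar> / 8)) * (ennreal (exp ((\<bar>t\<bar> - \<bar>t + c\<bar>) / 8)) * f (t + c))"
      by (simp add: mult.assoc)
  qed
  also have "\<dots> = ennreal (exp (\<bar>c\<bar> / 8)) * (\<integral>\<^sup>+t. f t \<partial>Lap)"
    by (subst nn_integral_cmult) (simp_all add: nn_integral_Lap_shift)
  finally show ?thesis .
qed

section \<open>The Maharam extension of a diagonal product on a probability space\<close>

locale bernoulli_pmp = bernoulli_shift \<phi> \<kappa> G F K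
  for \<phi> :: "real \<Rightarrow> real" and \<kappa> :: real and G :: "('g, 'b) monoid_scheme" (structure) and F and K +
  fixes N :: "'y measure" and b :: "'g \<Rightarrow> 'y \<Rightarrow> 'y"
  assumes pmp: "pmp_action G N b"
begin

abbreviation "PN \<equiv> P \<Otimes>\<^sub>M N"

lemma prob_N: "prob_space N" using pmp by (simp add: pmp_action_def)

lemma prob_NL: "prob_space (N \<Otimes>\<^sub>M Lap)"
proof -
  interpret pair_prob_space N Lap
    unfolding pair_prob_space_def pair_sigma_finite_def
    by (simp add: prob_N prob_space_Lap prob_space_imp_sigma_finite)
  show ?thesis by (rule prob_space_axioms)
qed

lemma prob_Z: "prob_space (P \<Otimes>\<^sub>M (N \<Otimes>\<^sub>M Lap))"
proof -
  interpret pair_prob_space P "N \<Otimes>\<^sub>M Lap"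
    unfolding pair_prob_space_def pair_sigma_finite_def
    by (simp add: PP.P.prob_space_axioms prob_NL prob_space_imp_sigma_finite)
  show ?thesis by (rule prob_space_axioms)
qed

abbreviation "Z \<equiv> P \<Otimes>\<^sub>M (N \<Otimes>\<^sub>M Lap)"

lemma b_measurable: "g \<in> I \<Longrightarrow> b g \<in> measurable N N" and distr_b: "g \<in> I \<Longrightarrow> distr N N (b g) = N"
  using pmp by (simp_all add: pmp_action_def)

lemma nn_integral_b: "g \<in> I \<Longrightarrow> f \<in> borel_measurable N \<Longrightarrow> (\<integral>\<^sup>+y. f (b g y) \<partial>N) = (\<integral>\<^sup>+y. f y \<partial>N)"
  using nn_integral_distr[OF b_measurable, of g f] by (simp add: distr_b)

lemma nn_integral_Z:
  assumes f[measurable]: "f \<in> borel_measurable Z"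
  shows "(\<integral>\<^sup>+z. f z \<partial>Z) = (\<integral>\<^sup>+x. \<integral>\<^sup>+y. \<integral>\<^sup>+t. f (x, y, t) \<partial>Lap \<partial>N \<partial>P)"
proof -
  interpret L: prob_space Lap by (rule prob_space_Lap)
  interpret NL: prob_space "N \<Otimes>\<^sub>M Lap" by (rule prob_NL)
  have "(\<integral>\<^sup>+z. f z \<partial>Z) = (\<integral>\<^sup>+x. \<integral>\<^sup>+w. f (x, w) \<partial>(N \<Otimes>\<^sub>M Lap) \<partial>P)"
    by (rule NL.nn_integral_fst[symmetric, OF f])
  also have "\<dots> = (\<integral>\<^sup>+x. \<integral>\<^sup>+y. \<integral>\<^sup>+t. f (x, y, t) \<partial>Lap \<partial>N \<partial>P)"
  proof (rule nn_integral_cong)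
    fix x assume "x \<in> space P"
    then have "(\<lambda>w. f (x, w)) \<in> borel_measurable (N \<Otimes>\<^sub>M Lap)" by measurable
    from L.nn_integral_fst[OF this]
    show "(\<integral>\<^sup>+w. f (x, w) \<partial>(N \<Otimes>\<^sub>M Lap)) = (\<integral>\<^sup>+y. \<integral>\<^sup>+t. f (x, y, t) \<partial>Lap \<partial>N)" by simp
  qed
  finally show ?thesis .
qed

definition T :: "'g \<Rightarrow> ('g \<Rightarrow> real) \<times> 'y \<times> real \<Rightarrow> ('g \<Rightarrow> real) \<times> 'y \<times> real" where
  "T g z = (act g (fst z), b g (fst (snd z)), snd (snd z) + ln (om g (fst z)))"

text \<open>The Radon-Nikodym derivative of \<open>T g\<close> with respect to \<open>Z\<close>:
  \<open>om g\<close> from the Bernoulli factor, nothing from the pmp factor, and the distortion of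
  \<open>Lap\<close> under translation by \<open>ln (om g x)\<close>.\<close>

definition wt :: "'g \<Rightarrow> ('g \<Rightarrow> real) \<times> 'y \<times> real \<Rightarrow> real" where
  "wt g z = om g (fst z) * exp ((\<bar>snd (snd z)\<bar> - \<bar>snd (snd z) + ln (om g (fst z))\<bar>) / 8)"

lemma wt_pos: "0 < wt g z" by (simp add: wt_def om_pos)

lemma wt_measurable[measurable]: "wt g \<in> borel_measurable Z"
  unfolding wt_def[abs_def] by measurable

lemma T_measurable: "g \<in> I \<Longrightarrow> T g \<in> measurable Z Z"
  unfolding T_def[abs_def]
  using act_measurable[of g] b_measurable[of g] by measurable

lemma wt_integral:
  assumes g: "g \<in> I" and f[measurable]: "f \<in> borel_measurable Z"
  shows "(\<integral>\<^sup>+z. ennreal (wt g z) * f (T g z) \<partial>Z) = (\<integral>\<^sup>+z. f z \<partial>Z)"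
proof -
  interpret L: prob_space Lap by (rule prob_space_Lap)
  interpret NL: prob_space "N \<Otimes>\<^sub>M Lap" by (rule prob_NL)
  note [measurable] = T_measurable[OF g] act_measurable[OF g] b_measurable[OF g]
  define k where "k = (\<lambda>x. \<integral>\<^sup>+y. \<integral>\<^sup>+t. f (x, y, t) \<partial>Lap \<partial>N)"
  have km: "k \<in> borel_measurable P"
  proof -
    have "(\<lambda>x. \<integral>\<^sup>+w. f (x, w) \<partial>(N \<Otimes>\<^sub>M Lap)) \<in> borel_measurable P"
      by (rule NL.borel_measurable_nn_integral_fst) measurable
    also have "?this \<longleftrightarrow> k \<in> borel_measurable P"
    proof (rule measurable_cong)
      fix x assume "x \<in> space P"
      then have "(\<lambda>w. f (x, w)) \<in> borel_measurable (N \<Otimes>\<^sub>M Lap)" by measurable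
      from L.nn_integral_fst[OF this]
      show "(\<integral>\<^sup>+w. f (x, w) \<partial>(N \<Otimes>\<^sub>M Lap)) = k x" by (simp add: k_def)
    qed
    finally show ?thesis .
  qed
  have "(\<integral>\<^sup>+z. ennreal (wt g z) * f (T g z) \<partial>Z) = (\<integral>\<^sup>+x. \<integral>\<^sup>+y. \<integral>\<^sup>+t. ennreal (wt g (x, y, t)) * f (T g (x, y, t)) \<partial>Lap \<partial>N \<partial>P)"
    by (rule nn_integral_Z) measurable
  also have "\<dots> = (\<integral>\<^sup>+x. ennreal (om g x) * k (act g x) \<partial>P)"
  proof (rule nn_integral_cong)
    fix x assume x: "x \<in> space P"
    have ax: "act g x \<in> space P" by (rule act_in_space[OF g x])
    have fx[measurable]: "(\<lambda>w. f (act g x, w)) \<in> borel_measurable (N \<Otimes>\<^sub>M Lap)" using ax by measurable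
    have fx2: "(\<lambda>w. f (act g x, b g (fst w), snd w)) \<in> borel_measurable (N \<Otimes>\<^sub>M Lap)"
      using measurable_compose[OF _ fx, of "\<lambda>w. (b g (fst w), snd w)" "N \<Otimes>\<^sub>M Lap"] by measurable
    have jm: "(\<lambda>y. \<integral>\<^sup>+t. f (act g x, y, t) \<partial>Lap) \<in> borel_measurable N"
      using L.borel_measurable_nn_integral_fst[OF fx] by simp
    have "(\<integral>\<^sup>+y. \<integral>\<^sup>+t. ennreal (wt g (x, y, t)) * f (T g (x, y, t)) \<partial>Lap \<partial>N)
      = (\<integral>\<^sup>+y. ennreal (om g x) * (\<integral>\<^sup>+t. f (act g x, b g y, t) \<partial>Lap) \<partial>N)"
    proof (rule nn_integral_cong)
      fix y assume y: "y \<in> space N"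
      then have "b g y \<in> space N" using b_measurable[OF g] by (rule measurable_space[rotated])
      then have ft[measurable]: "(\<lambda>t. f (act g x, b g y, t)) \<in> borel_measurable borel"
        using measurable_compose[OF measurable_Pair1' fx] by (simp cong: measurable_cong_sets)
      have "(\<integral>\<^sup>+t. ennreal (wt g (x, y, t)) * f (T g (x, y, t)) \<partial>Lap)
        = (\<integral>\<^sup>+t. ennreal (om g x) * (ennreal (exp ((\<bar>t\<bar> - \<bar>t + ln (om g x)\<bar>) / 8)) * f (act g x, b g y, t + ln (om g x))) \<partial>Lap)"
        by (simp add: wt_def T_def ennreal_mult om_pos less_imp_le mult.assoc)
      also have "\<dots> = ennreal (om g x) * (\<integral>\<^sup>+t. ennreal (exp ((\<bar>t\<bar> - \<bar>t + ln (om g x)\<bar>) / 8)) * f (act g x, b g y, t + ln (om g x)) \<partial>Lap)"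
        by (rule nn_integral_cmult) measurable
      also have "\<dots> = ennreal (om g x) * (\<integral>\<^sup>+t. f (act g x, b g y, t) \<partial>Lap)"
        by (subst nn_integral_Lap_shift[OF ft]) simp
      finally show "(\<integral>\<^sup>+t. ennreal (wt g (x, y, t)) * f (T g (x, y, t)) \<partial>Lap) = ennreal (om g x) * (\<integral>\<^sup>+t. f (act g x, b g y, t) \<partial>Lap)" .
    qed
    also have "\<dots> = ennreal (om g x) * (\<integral>\<^sup>+y. (\<integral>\<^sup>+t. f (act g x, b g y, t) \<partial>Lap) \<partial>N)"
      using L.borel_measurable_nn_integral_fst[OF fx2] by (intro nn_integral_cmult) simp
    also have "\<dots> = ennreal (om g x) * k (act g x)"
      by (simp add: nn_integral_b[OF g jm] k_def)
    finally show "(\<integral>\<^sup>+y. \<integral>\<^sup>+t. ennreal (wt g (x, y, t)) * f (T g (x, y, t)) \<partial>Lap \<partial>N) = ennreal (om g x) * k (act g x)" .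
  qed
  also have "\<dots> = (\<integral>\<^sup>+x. k x \<partial>P)" by (rule nn_integral_om_act[OF g km])
  also have "\<dots> = (\<integral>\<^sup>+z. f z \<partial>Z)" by (simp add: nn_integral_Z k_def)
  finally show ?thesis .
qed

lemma wt_cocycle:
  assumes g: "g \<in> I" and h: "h \<in> I"
  shows "AE z in Z. wt (g \<otimes> h) z = wt g (T h z) * wt h z"
proof -
  have "AE z in Z. om (g \<otimes> h) (fst z) = om g (act h (fst z)) * om h (fst z)"
    by (rule AE_fst[OF prob_NL om_cocycle[OF g h]])
  then show ?thesis
  proof eventually_elim
    case (elim z)
    then show ?case
      by (simp add: wt_def T_def ln_mult om_pos exp_add[symmetric] mult_ac add_ac add_divide_distrib diff_divide_distrib)
  qed
qed

lemma wt_one: "AE z in Z. wt \<one> z = 1"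
  using AE_fst[OF prob_NL om_one] by eventually_elim (simp add: wt_def)

lemma stationary:
  assumes J: "finite J" "J \<noteq> {}" "J \<subseteq> I" and f: "f \<in> borel_measurable Z"
  shows "(\<Sum>k\<in>J. \<Sum>l\<in>J. \<integral>\<^sup>+z. ennreal (ker wt J k l z) * f (T (k \<otimes> inv l) z) \<partial>Z) = (\<integral>\<^sup>+z. f z \<partial>Z)"
  by (rule ker_stationary[OF wt_pos wt_measurable T_measurable wt_integral wt_cocycle wt_one J f])

lemma T_AE:
  assumes g: "g \<in> I" and Q: "AE z in Z. Q z"
  shows "AE z in Z. Q (T g z)"
proof -
  note [measurable] = T_measurable[OF g]
  obtain S where sub: "{z\<in>space Z. \<not> Q z} \<subseteq> S" and S[measurable]: "emeasure Z S = 0" "S \<in> sets Z"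
    by (rule AE_E[OF Q])
  have "(\<integral>\<^sup>+z. ennreal (wt g z) * indicator S (T g z) \<partial>Z) = 0"
    by (subst wt_integral[OF g]) (use S in auto)
  then have "AE z in Z. ennreal (wt g z) * indicator S (T g z) = 0"
    by (subst (asm) nn_integral_0_iff_AE) auto
  then show ?thesis
    using AE_space
  proof eventually_elim
    case (elim z)
    have "T g z \<in> space Z" by (rule measurable_space[OF T_measurable[OF g] elim(2)])
    moreover have "T g z \<notin> S" using elim(1) wt_pos[of g z] by (auto simp: indicator_def split: if_splits)
    ultimately show ?case using sub by auto
  qed
qed

text \<open>With generous constants: the change of \<open>ln (om g x)\<close> enters directly and,
  divided by 8, through the real variable. The bound depends on \<open>g\<close> through
  \<open>c\<close> only, so it feeds into \<open>ker_le\<close>.\<close>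

lemma wt_compare:
  assumes "\<bar>ln (om g x') - ln (om g x)\<bar> \<le> c" "\<bar>t' - t\<bar> \<le> d"
  shows "wt g (x', y', t') \<le> exp (2 * c + d) * wt g (x, y, t)"
proof -
  have e: "wt g (x, y, t) = exp (ln (om g x) + (\<bar>t\<bar> - \<bar>t + ln (om g x)\<bar>) / 8)" for x and y :: 'y and t
    by (simp add: wt_def exp_add om_pos)
  define A where "A = ln (om g x)"
  define A' where "A' = ln (om g x')"
  have "0 \<le> c" "0 \<le> d" "A' \<le> A + c" "\<bar>t'\<bar> \<le> \<bar>t\<bar> + d" "\<bar>t + A\<bar> \<le> \<bar>t' + A'\<bar> + d + c"
    using assms unfolding A_def[symmetric] A'_def[symmetric] by linarith+
  then have "A' + (\<bar>t'\<bar> - \<bar>t' + A'\<bar>) / 8 \<le> (2 * c + d) + (A + (\<bar>t\<bar> - \<bar>t + A\<bar>) / 8)"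
    by (simp add: field_simps)
  then show ?thesis unfolding e exp_add[symmetric] A_def A'_def by simp
qed

end

section \<open>Escape of the random element from finite sets\<close>

lemma nn_integral_double_sum:
  assumes "\<And>k l. f k l \<in> borel_measurable M"
  shows "(\<integral>\<^sup>+z. (\<Sum>k\<in>A. \<Sum>l\<in>B. f k l z) \<partial>M) = (\<Sum>k\<in>A. \<Sum>l\<in>B. \<integral>\<^sup>+z. f k l z \<partial>M)"
  using assms by (simp add: nn_integral_sum)

lemma sum_sum_ennreal:
  "(\<And>k l. 0 \<le> f k l) \<Longrightarrow> (\<Sum>k\<in>A. \<Sum>l\<in>B. ennreal (f k l)) = ennreal (\<Sum>k\<in>A. \<Sum>l\<in>B. f k l)"
  by (simp add: sum_nonneg)

text \<open>Jensen's inequality for a negative power, from the tangent at the mean: the power with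
  exponent \<open>- p\<close> of \<open>a k / \<theta>\<close> is at least 1 minus \<open>p\<close>
  times its logarithm, and the logarithm is at most \<open>a k / \<theta> - 1\<close>.\<close>

lemma powr_mean_le:
  fixes a :: "'k \<Rightarrow> real"
  assumes J: "finite J" "J \<noteq> {}" and a: "\<And>k. k \<in> J \<Longrightarrow> 0 < a k" and p: "0 \<le> p"
  shows "(sum a J / real (card J)) powr (- p) \<le> (\<Sum>k\<in>J. a k powr (- p)) / real (card J)"
proof -
  define \<theta> where "\<theta> = sum a J / real (card J)"
  have c: "real (card J) > 0" using J by (simp add: card_gt_0_iff)
  have s: "sum a J > 0" using J a by (intro sum_pos) auto
  have \<theta>: "\<theta> > 0" using c s by (simp add: \<theta>_def)
  have tangent: "\<theta> powr (- p) * (1 - p * (a k / \<theta> - 1)) \<le> a k powr (- p)" if "k \<in> J" for k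
  proof -
    have q: "a k / \<theta> > 0" using a[OF that] \<theta> by (rule divide_pos_pos)
    have "1 - p * (a k / \<theta> - 1) \<le> 1 - p * ln (a k / \<theta>)"
      using ln_le_minus_one[OF q] p by (simp add: mult_left_mono)
    also have "\<dots> \<le> exp (- p * ln (a k / \<theta>))" using exp_ge_add_one_self[of "- p * ln (a k / \<theta>)"] by simp
    also have "\<dots> = (a k / \<theta>) powr (- p)" using a[OF that] \<theta> by (simp add: powr_def)
    also have "\<dots> = a k powr (- p) / \<theta> powr (- p)" using a[OF that] \<theta> by (simp add: powr_divide)
    finally show ?thesis using \<theta> by (simp add: field_simps)
  qed
  have q: "sum a J / \<theta> = real (card J)" using s c by (simp add: \<theta>_def)
  have "(\<Sum>k\<in>J. 1 - p * (a k / \<theta> - 1)) = real (card J) * (1 + p) - p * (sum a J / \<theta>)"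
    by (simp add: sum_subtractf sum_distrib_left[symmetric] sum_divide_distrib[symmetric] algebra_simps)
  then have "(\<Sum>k\<in>J. 1 - p * (a k / \<theta> - 1)) = real (card J)" unfolding q by (simp add: algebra_simps)
  then have e: "\<theta> powr (- p) * real (card J) = (\<Sum>k\<in>J. \<theta> powr (- p) * (1 - p * (a k / \<theta> - 1)))"
    by (simp add: sum_distrib_left[symmetric])
  have "(\<Sum>k\<in>J. \<theta> powr (- p) * (1 - p * (a k / \<theta> - 1))) \<le> (\<Sum>k\<in>J. a k powr (- p))"
    by (intro sum_mono tangent)
  then have "\<theta> powr (- p) * real (card J) \<le> (\<Sum>k\<in>J. a k powr (- p))" unfolding e .
  then have "\<theta> powr (- p) \<le> (\<Sum>k\<in>J. a k powr (- p)) / real (card J)"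
    using c by (simp only: pos_le_divide_eq)
  then show ?thesis unfolding \<theta>_def .
qed

text \<open>The radii tend to infinity because \<open>real n \<le> rad n\<close>, so that a bound
  decaying exponentially in \<open>rad n\<close> becomes an arbitrarily small error. Ergodicity of
  the pmp factor is left to the individual results, because the escape estimates and the averaged
  resampling hold for every pmp factor.\<close>

locale bernoulli_growth = bernoulli_pmp \<phi> \<kappa> G F K N b
  for \<phi> :: "real \<Rightarrow> real" and \<kappa> :: real and G :: "('g, 'b) monoid_scheme" (structure) and F and K
    and N :: "'y measure" and b +
  fixes Ks :: "nat \<Rightarrow> 'g set" and rad :: "nat \<Rightarrow> real" and \<delta> :: real
  assumes Ks: "finite (Ks n)" "Ks n \<noteq> {}" "Ks n \<subseteq> carrier G"
    and nrm_Ks: "g \<in> Ks n \<Longrightarrow> nrm g \<le> rad n"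
    and rad: "real n \<le> rad n"
    and card_Ks: "exp (\<delta> * rad n) \<le> real (card (Ks n))"
    and growth: "9 / 2 * \<kappa> < \<delta>"
begin

text \<open>The probability that the random pair satisfies \<open>k \<otimes> inv l = g\<close>,
  with the base point distributed according to \<open>Z\<close>.\<close>

definition esc :: "nat \<Rightarrow> 'g \<Rightarrow> ennreal" where
  "esc n g = (\<Sum>k\<in>Ks n. \<Sum>l\<in>Ks n. if k \<otimes> inv l = g then \<integral>\<^sup>+z. ennreal (ker wt (Ks n) k l z) \<partial>Z else 0)"

text \<open>With \<open>L = ln (om g x)\<close>, the logarithm of \<open>wt\<close> is at least 9/8
  \<open>L\<close> for negative \<open>L\<close>, and it is nonnegative for
  \<open>L \<ge> 0\<close>. The exponent 8/9 is the one that brings the first case back to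
  \<open>1 / om\<close>.\<close>

lemma wt_powr_le: "wt g z powr (- (8 / 9)) \<le> 1 / om g (fst z) + 1"
proof -
  define L where "L = ln (om g (fst z))"
  define t where "t = snd (snd z)"
  have om: "om g (fst z) = exp L" by (simp add: L_def om_pos)
  have "wt g z = exp (L + (\<bar>t\<bar> - \<bar>t + L\<bar>) / 8)" by (simp add: wt_def om t_def exp_add)
  then have e: "wt g z powr (- (8 / 9)) = exp (- (8/9) * (L + (\<bar>t\<bar> - \<bar>t + L\<bar>) / 8))" by (simp add: powr_def)
  have "- (8/9) * (L + (\<bar>t\<bar> - \<bar>t + L\<bar>) / 8) \<le> max (- L) 0"
    using abs_triangle_ineq[of t L] by (cases "L \<ge> 0") (simp_all add: max_def field_simps)
  then have "wt g z powr (- (8 / 9)) \<le> exp (max (- L) 0)" unfolding e by simp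
  also have "\<dots> \<le> exp (- L) + 1" by (simp add: max_def)
  finally show ?thesis by (simp add: om exp_minus inverse_eq_divide)
qed

text \<open>For each \<open>l\<close> only \<open>k = g \<otimes> l\<close> contributes. Its share
  \<open>wt g z / S l\<close> is at most 1, which suffices on the event that \<open>wt g z\<close>
  exceeds \<open>A\<close>. Elsewhere it is traded for a mean of \<open>1 / om\<close> over the
  whole set, whose integral is under control.\<close>

lemma kernel_at_le:
  assumes g: "g \<in> I" and A: "0 < A"
  shows "(\<Sum>k\<in>Ks n. \<Sum>l\<in>Ks n. if k \<otimes> inv l = g then ker wt (Ks n) k l z else 0)
    \<le> of_bool (A < wt g z) + (A / real (card (Ks n))) powr (8 / 9) / (real (card (Ks n)))\<^sup>2 *
        (\<Sum>l\<in>Ks n. \<Sum>k\<in>Ks n. 1 / om (k \<otimes> inv l) (fst z) + 1)"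
proof -
  define N where "N = real (card (Ks n))"
  have N: "N > 0" using Ks[of n] by (simp add: N_def card_gt_0_iff)
  define S where "S = (\<lambda>l. \<Sum>k\<in>Ks n. wt (k \<otimes> inv l) z)"
  define R where "R = (\<lambda>l. \<Sum>k\<in>Ks n. 1 / om (k \<otimes> inv l) (fst z) + 1)"
  have Spos: "S l > 0" for l using Ks[of n] by (auto simp: S_def intro!: sum_pos wt_pos)
  have R0: "R l \<ge> 0" for l unfolding R_def by (intro sum_nonneg add_nonneg_nonneg) (auto simp: om_pos less_imp_le)
  have inner: "(\<Sum>k\<in>Ks n. if k \<otimes> inv l = g then ker wt (Ks n) k l z else 0) \<le> (of_bool (A < wt g z) + (A / N) powr (8 / 9) * (R l / N)) / N"
    if l: "l \<in> Ks n" for l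
  proof -
    have lI: "l \<in> I" using l Ks by auto
    have iff: "k \<otimes> inv l = g \<longleftrightarrow> k = g \<otimes> l" if "k \<in> Ks n" for k
    proof -
      have "k \<in> I" using that Ks(3)[of n] by blast
      then show ?thesis using inv_solve_right[OF g _ lI, of k] by auto
    qed
    have gl: "g \<otimes> l \<otimes> inv l = g" using g lI by (simp add: m_assoc)
    have "(\<Sum>k\<in>Ks n. if k \<otimes> inv l = g then ker wt (Ks n) k l z else 0) = (\<Sum>k\<in>Ks n. if k = g \<otimes> l then wt g z / (N * S l) else 0)"
      by (intro sum.cong refl) (auto simp: iff ker_def N_def S_def gl)
    also have "\<dots> = (if g \<otimes> l \<in> Ks n then (wt g z / S l) / N else 0)"
      using Ks(1)[of n] by (simp add: mult.commute)
    also have "\<dots> \<le> (of_bool (A < wt g z) + (A / N) powr (8 / 9) * (R l / N)) / N"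
    proof (cases "g \<otimes> l \<in> Ks n")
      case False
      then show ?thesis using N R0[of l] by (auto intro!: divide_nonneg_nonneg add_nonneg_nonneg mult_nonneg_nonneg)
    next
      case True
      have "wt g z \<le> S l"
        unfolding S_def using member_le_sum[of "g \<otimes> l" "Ks n" "\<lambda>k. wt (k \<otimes> inv l) z"] True Ks(1)[of n] gl by (auto simp: wt_pos less_imp_le)
      then have q1: "wt g z / S l \<le> 1" using Spos[of l] by simp
      have q0: "wt g z / S l > 0" using Spos[of l] wt_pos[of g z] by simp
      have "wt g z / S l \<le> of_bool (A < wt g z) + (A / N) powr (8 / 9) * (R l / N)"
      proof (cases "A < wt g z")
        case True
        have "0 \<le> (A / N) powr (8 / 9) * (R l / N)" using N R0[of l] by simp
        with True q1 show ?thesis by simp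
      next
        case False
        \<comment> \<open>A number between 0 and 1 is at most its power of exponent 8/9. This lowers
          the negative moment of \<open>S l\<close> to one that Jensen's inequality and
          \<open>wt_powr_le\<close> can handle.\<close>
        have "wt g z / S l = (wt g z / S l) powr 1" by (rule powr_one[symmetric]) (use q0 in simp)
        also have "\<dots> \<le> (wt g z / S l) powr (8 / 9)" using q0 q1 by (intro powr_mono') auto
        also have "\<dots> \<le> (A / S l) powr (8 / 9)"
          using q0 False Spos[of l] by (intro powr_mono2) (auto intro!: divide_right_mono)
        also have "\<dots> = (A / N) powr (8 / 9) * (S l / N) powr (- (8 / 9))"
          using A N Spos[of l] by (simp add: powr_divide powr_minus field_simps)
        also have "\<dots> \<le> (A / N) powr (8 / 9) * (R l / N)"
        proof (rule mult_left_mono)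
          have "(S l / N) powr (- (8 / 9)) \<le> (\<Sum>k\<in>Ks n. wt (k \<otimes> inv l) z powr (- (8 / 9))) / N"
            unfolding S_def N_def by (rule powr_mean_le[OF Ks(1,2) wt_pos]) simp
          also have "\<dots> \<le> R l / N"
            unfolding R_def using N by (intro divide_right_mono sum_mono wt_powr_le) auto
          finally show "(S l / N) powr (- (8 / 9)) \<le> R l / N" .
        qed simp
        finally show ?thesis using False by simp
      qed
      then show ?thesis unfolding if_P[OF True] by (rule divide_right_mono) (use N in simp)
    qed
    finally show ?thesis .
  qed
  have "(\<Sum>k\<in>Ks n. \<Sum>l\<in>Ks n. if k \<otimes> inv l = g then ker wt (Ks n) k l z else 0)
     = (\<Sum>l\<in>Ks n. \<Sum>k\<in>Ks n. if k \<otimes> inv l = g then ker wt (Ks n) k l z else 0)" by (rule sum.swap)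
  also have "\<dots> \<le> (\<Sum>l\<in>Ks n. (of_bool (A < wt g z) + (A / N) powr (8 / 9) * (R l / N)) / N)"
    by (intro sum_mono inner)
  also have "\<dots> = of_bool (A < wt g z) + (A / N) powr (8 / 9) / N\<^sup>2 * (\<Sum>l\<in>Ks n. R l)"
    using N by (simp add: sum.distrib add_divide_distrib sum_distrib_left sum_divide_distrib N_def[symmetric] power2_eq_square)
  finally show ?thesis by (simp add: N_def R_def)
qed

text \<open>In the integral of \<open>kernel_at_le\<close> each
  \<open>1 / om (k \<otimes> inv l)\<close> contributes at most
  \<open>exp (4 * \<kappa> * rad n)\<close>, while the cardinality contributes at most
  \<open>exp (- 8 / 9 * \<delta> * rad n)\<close>.\<close>

lemma esc_le:
  assumes g: "g \<in> I" and A: "0 < A"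
  shows "esc n g \<le> emeasure Z {z\<in>space Z. A < wt g z} + ennreal (2 * A powr (8 / 9) * exp (- (8 / 9 * \<delta> - 4 * \<kappa>) * real n))"
proof -
  interpret NL: prob_space "N \<Otimes>\<^sub>M Lap" by (rule prob_NL)
  interpret Z: prob_space Z by (rule prob_Z)
  define N where "N = real (card (Ks n))"
  have N: "N > 0" using Ks[of n] by (simp add: N_def card_gt_0_iff)
  define c where "c = (A / N) powr (8 / 9) / N\<^sup>2"
  have c: "c \<ge> 0" using N by (simp add: c_def)
  have ker0: "0 \<le> ker wt (Ks n) k l z" for k l and z :: "('g \<Rightarrow> real) \<times> 'y \<times> real" by (rule ker_nonneg[OF wt_pos])
  have km[measurable]: "ker wt (Ks n) k l \<in> borel_measurable Z" for k l
    unfolding ker_def[abs_def] by measurable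
  define u where "u = (\<lambda>k l z. if k \<otimes> inv l = g then ker wt (Ks n) k l z else 0)"
  have u0: "0 \<le> u k l z" for k l z by (simp add: u_def ker0)
  have um: "(\<lambda>z. ennreal (u k l z)) \<in> borel_measurable Z" for k l
    by (cases "k \<otimes> inv l = g") (simp_all add: u_def)
  define v where "v = (\<lambda>l k (z :: ('g \<Rightarrow> real) \<times> 'y \<times> real). ennreal (1 / om (k \<otimes> inv l) (fst z)) + 1)"
  have vm: "v l k \<in> borel_measurable Z" for k l unfolding v_def by measurable
  define J where "J = {z\<in>space Z. A < wt g z}"
  have J: "J \<in> sets Z" unfolding J_def by measurable
  have pt: "(\<Sum>k\<in>Ks n. \<Sum>l\<in>Ks n. ennreal (u k l z)) \<le> indicator J z + ennreal c * (\<Sum>l\<in>Ks n. \<Sum>k\<in>Ks n. v l k z)"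
    if z: "z \<in> space Z" for z
  proof -
    define r where "r = (\<lambda>l k. 1 / om (k \<otimes> inv l) (fst z) + 1)"
    have r0: "0 \<le> r l k" for l k unfolding r_def by (simp add: om_pos less_imp_le add_nonneg_nonneg)
    have v: "v l k z = ennreal (r l k)" for l k
      unfolding v_def r_def by (subst ennreal_plus) (simp_all add: om_pos less_imp_le)
    have 1: "(\<Sum>l\<in>Ks n. \<Sum>k\<in>Ks n. v l k z) = ennreal (\<Sum>l\<in>Ks n. \<Sum>k\<in>Ks n. r l k)"
      unfolding v by (rule sum_sum_ennreal[OF r0])
    have 2: "(indicator J z :: ennreal) = ennreal (of_bool (A < wt g z))"
      using z by (simp add: indicator_def J_def)
    have 3: "0 \<le> c * (\<Sum>l\<in>Ks n. \<Sum>k\<in>Ks n. r l k)" using c by (intro mult_nonneg_nonneg sum_nonneg r0)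
    have "(\<Sum>k\<in>Ks n. \<Sum>l\<in>Ks n. u k l z) \<le> of_bool (A < wt g z) + c * (\<Sum>l\<in>Ks n. \<Sum>k\<in>Ks n. r l k)"
      using kernel_at_le[OF g A, of n z] unfolding u_def c_def N_def r_def .
    then have "ennreal (\<Sum>k\<in>Ks n. \<Sum>l\<in>Ks n. u k l z) \<le> ennreal (of_bool (A < wt g z)) + ennreal (c * (\<Sum>l\<in>Ks n. \<Sum>k\<in>Ks n. r l k))"
      using 3 by (subst ennreal_plus[symmetric]) (auto intro: ennreal_leI simp del: ennreal_plus)
    then show ?thesis unfolding 1 2 sum_sum_ennreal[OF u0] using c by (subst (asm) ennreal_mult') auto
  qed
  have "esc n g = (\<Sum>k\<in>Ks n. \<Sum>l\<in>Ks n. \<integral>\<^sup>+z. ennreal (u k l z) \<partial>Z)"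
    unfolding esc_def u_def by (intro sum.cong refl) simp
  then have "esc n g = (\<integral>\<^sup>+z. (\<Sum>k\<in>Ks n. \<Sum>l\<in>Ks n. ennreal (u k l z)) \<partial>Z)"
    by (simp only: nn_integral_double_sum[OF um])
  then have e1: "esc n g \<le> (\<integral>\<^sup>+z. indicator J z + ennreal c * (\<Sum>l\<in>Ks n. \<Sum>k\<in>Ks n. v l k z) \<partial>Z)"
    by (simp only:) (rule nn_integral_mono[OF pt])
  have vs: "(\<lambda>z. \<Sum>l\<in>Ks n. \<Sum>k\<in>Ks n. v l k z) \<in> borel_measurable Z"
    using vm by (intro borel_measurable_sum) 
  have "(\<integral>\<^sup>+z. indicator J z + ennreal c * (\<Sum>l\<in>Ks n. \<Sum>k\<in>Ks n. v l k z) \<partial>Z)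
      = (\<integral>\<^sup>+z. indicator J z \<partial>Z) + (\<integral>\<^sup>+z. ennreal c * (\<Sum>l\<in>Ks n. \<Sum>k\<in>Ks n. v l k z) \<partial>Z)"
    using J vs by (intro nn_integral_add) simp_all
  then have e2: "(\<integral>\<^sup>+z. indicator J z + ennreal c * (\<Sum>l\<in>Ks n. \<Sum>k\<in>Ks n. v l k z) \<partial>Z)
      = emeasure Z J + ennreal c * (\<Sum>l\<in>Ks n. \<Sum>k\<in>Ks n. \<integral>\<^sup>+z. v l k z \<partial>Z)"
    using J vs by (simp only: nn_integral_indicator nn_integral_cmult nn_integral_double_sum[OF vm])
  have 1: "esc n g \<le> emeasure Z {z\<in>space Z. A < wt g z} + ennreal c * (\<Sum>l\<in>Ks n. \<Sum>k\<in>Ks n. \<integral>\<^sup>+z. ennreal (1 / om (k \<otimes> inv l) (fst z)) + 1 \<partial>Z)"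
    using e1 unfolding e2 unfolding J_def v_def .
  have 2: "(\<Sum>l\<in>Ks n. \<Sum>k\<in>Ks n. \<integral>\<^sup>+z. ennreal (1 / om (k \<otimes> inv l) (fst z)) + 1 \<partial>Z) \<le> (\<Sum>l\<in>Ks n. \<Sum>k\<in>Ks n. ennreal (2 * exp (4 * \<kappa> * rad n)))"
  proof (rule sum_mono, rule sum_mono)
    fix k l assume kl: "l \<in> Ks n" "k \<in> Ks n"
    then have kI: "k \<in> I" "l \<in> I" "k \<otimes> inv l \<in> I" using Ks[of n] by auto
    have nr: "nrm (k \<otimes> inv l) \<le> 4 * rad n"
      using nrm_mult_inv_le[OF kI(1,2)] nrm_Ks[OF kl(1)] nrm_Ks[OF kl(2)] by linarith
    have "rad n \<ge> 0" using rad[of n] by (meson of_nat_0_le_iff order_trans)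
    then have "1 \<le> exp (4 * \<kappa> * rad n)" using kappa by simp
    moreover have "exp (\<kappa> * nrm (k \<otimes> inv l)) \<le> exp (4 * \<kappa> * rad n)"
      using mult_left_mono[OF nr kappa] by (simp add: mult_ac)
    ultimately have 1: "exp (\<kappa> * nrm (k \<otimes> inv l)) + 1 \<le> 2 * exp (4 * \<kappa> * rad n)" by linarith
    have m: "(\<lambda>x. ennreal (1 / om (k \<otimes> inv l) x)) \<in> borel_measurable P" by measurable
    have "(\<integral>\<^sup>+z. ennreal (1 / om (k \<otimes> inv l) (fst z)) + 1 \<partial>Z) = (\<integral>\<^sup>+x. ennreal (1 / om (k \<otimes> inv l) x) \<partial>P) + 1"
      using NL.nn_integral_fst[of "\<lambda>z. ennreal (1 / om (k \<otimes> inv l) (fst z))" P]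
      by (subst nn_integral_add) (auto simp: NL.emeasure_space_1 Z.emeasure_space_1)
    also have "\<dots> \<le> ennreal (exp (\<kappa> * nrm (k \<otimes> inv l))) + 1"
      by (intro add_right_mono nn_integral_inverse_om kI)
    also have "\<dots> = ennreal (exp (\<kappa> * nrm (k \<otimes> inv l)) + 1)" by simp
    also have "\<dots> \<le> ennreal (2 * exp (4 * \<kappa> * rad n))" by (rule ennreal_leI[OF 1])
    finally show "(\<integral>\<^sup>+z. ennreal (1 / om (k \<otimes> inv l) (fst z)) + 1 \<partial>Z) \<le> ennreal (2 * exp (4 * \<kappa> * rad n))" .
  qed
  \<comment> \<open>The number of pairs cancels the \<open>N\<^sup>2\<close> in the definition of
    \<open>c\<close>.\<close>
  have 3: "ennreal c * (\<Sum>l\<in>Ks n. \<Sum>k\<in>Ks n. ennreal (2 * exp (4 * \<kappa> * rad n))) = ennreal ((A / N) powr (8 / 9) * (2 * exp (4 * \<kappa> * rad n)))"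
  proof -
    have "c * (N * (N * (2 * exp (4 * \<kappa> * rad n)))) = (A / N) powr (8 / 9) * (2 * exp (4 * \<kappa> * rad n))"
      using N by (simp add: c_def power2_eq_square)
    then show ?thesis using c
      by (simp add: ennreal_of_nat_eq_real_of_nat N_def[symmetric] ennreal_mult[symmetric] less_imp_le[OF N])
  qed
  have 4: "ennreal ((A / N) powr (8 / 9) * (2 * exp (4 * \<kappa> * rad n))) \<le> ennreal (2 * A powr (8 / 9) * exp (- (8 / 9 * \<delta> - 4 * \<kappa>) * real n))"
  proof (rule ennreal_leI)
    have "(A / N) powr (8 / 9) = A powr (8 / 9) * N powr (- (8 / 9))"
      using A N by (simp add: powr_divide powr_minus field_simps)
    moreover have "N powr (- (8 / 9)) \<le> exp (\<delta> * rad n) powr (- (8 / 9))"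
      using card_Ks[of n] by (intro powr_mono2') (auto simp: N_def)
    moreover have "exp (\<delta> * rad n) powr (- (8 / 9)) = exp (- (8 / 9 * \<delta>) * rad n)" by (simp add: powr_def)
    ultimately have "(A / N) powr (8 / 9) * (2 * exp (4 * \<kappa> * rad n)) \<le> A powr (8 / 9) * exp (- (8 / 9 * \<delta>) * rad n) * (2 * exp (4 * \<kappa> * rad n))"
      using A by (simp add: mult_left_mono mult_right_mono)
    also have "\<dots> = 2 * A powr (8 / 9) * exp (- (8 / 9 * \<delta> - 4 * \<kappa>) * rad n)"
      by (simp add: exp_add[symmetric] algebra_simps)
    also have "\<dots> \<le> 2 * A powr (8 / 9) * exp (- (8 / 9 * \<delta> - 4 * \<kappa>) * real n)"
    proof -
      have "0 \<le> 8 / 9 * \<delta> - 4 * \<kappa>" using growth by simp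
      from mult_left_mono[OF rad[of n] this]
      have "- (8 / 9 * \<delta> - 4 * \<kappa>) * rad n \<le> - (8 / 9 * \<delta> - 4 * \<kappa>) * real n"
        by (simp only: mult_minus_left neg_le_iff_le)
      then show ?thesis by (intro mult_left_mono) auto
    qed
    finally show "(A / N) powr (8 / 9) * (2 * exp (4 * \<kappa> * rad n)) \<le> 2 * A powr (8 / 9) * exp (- (8 / 9 * \<delta> - 4 * \<kappa>) * real n)" .
  qed
  have "ennreal c * (\<Sum>l\<in>Ks n. \<Sum>k\<in>Ks n. \<integral>\<^sup>+z. ennreal (1 / om (k \<otimes> inv l) (fst z)) + 1 \<partial>Z)
      \<le> ennreal (2 * A powr (8 / 9) * exp (- (8 / 9 * \<delta> - 4 * \<kappa>) * real n))"
    using order_trans[OF mult_left_mono[OF 2, of "ennreal c"] order_trans[OF eq_refl[OF 3] 4]] by simp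
  then show ?thesis using 1 by (meson add_left_mono order_trans)
qed

text \<open>As \<open>wt g\<close> is finite, some level \<open>A\<close>, chosen before
  \<open>n\<close>, is exceeded with probability below \<open>e / 2\<close>. For this
  \<open>A\<close> the second term of \<open>esc_le\<close> tends to 0.\<close>

lemma escape:
  assumes g: "g \<in> I" and e: "e > 0"
  shows "\<forall>\<^sub>F n in sequentially. esc n g \<le> ennreal e"
proof -
  interpret Z: prob_space Z by (rule prob_Z)
  define U where "U = (\<lambda>m::nat. {z\<in>space Z. real m < wt g z})"
  have Um[measurable]: "U m \<in> sets Z" for m unfolding U_def by measurable
  have dec: "decseq U" unfolding U_def decseq_def by (force intro: order_le_less_trans)
  have "(\<Inter>m. U m) = {}"
  proof -
    have "\<exists>m::nat. \<not> real m < wt g z" for z :: "('g \<Rightarrow> real) \<times> 'y \<times> real"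
      using real_arch_simple[of "wt g z"] by (auto simp: not_less)
    then show ?thesis unfolding U_def by blast
  qed
  then have "(\<lambda>m. measure Z (U m)) \<longlonglongrightarrow> 0"
    using Z.finite_Lim_measure_decseq[OF _ dec] Um by auto
  from order_tendstoD(2)[OF this, of "e/2"] e
  obtain m where "\<forall>n\<ge>m. measure Z (U n) < e/2" by (auto simp: eventually_sequentially)
  then have m: "measure Z (U (Suc m)) < e/2" by simp
  define A where "A = real (Suc m)"
  have A: "A > 0" by (simp add: A_def)
  define r where "r = 8 / 9 * \<delta> - 4 * \<kappa>"
  have r: "r > 0" using growth by (simp add: r_def)
  have "(\<lambda>n. exp (- r) ^ n) \<longlonglongrightarrow> 0" using r by (intro LIMSEQ_power_zero) simp
  then have "(\<lambda>n. 2 * A powr (8 / 9) * exp (- r * real n)) \<longlonglongrightarrow> 2 * A powr (8 / 9) * 0"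
    by (intro tendsto_mult tendsto_const) (simp add: exp_of_nat_mult[symmetric] mult.commute)
  then have "\<forall>\<^sub>F n in sequentially. 2 * A powr (8 / 9) * exp (- r * real n) < e / 2"
    using e by (intro order_tendstoD(2)) auto
  then show ?thesis
  proof eventually_elim
    case (elim n)
    have "esc n g \<le> emeasure Z (U (Suc m)) + ennreal (2 * A powr (8 / 9) * exp (- r * real n))"
      using esc_le[OF g A, of n] by (simp add: U_def A_def r_def)
    also have "\<dots> \<le> ennreal (e/2) + ennreal (e/2)"
      using m elim by (intro add_mono) (auto simp: Z.emeasure_eq_measure intro!: ennreal_leI)
    also have "\<dots> = ennreal e" using e by (subst ennreal_plus[symmetric]) auto
    finally show ?case .
  qed
qed

end

section \<open>Resampling one coordinate\<close>

context bernoulli_growth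
begin

text \<open>The point of \<open>Z\<close> is enlarged by an independent fresh value for coordinate
  \<open>h\<close>; \<open>zb\<close> forgets it.\<close>

abbreviation "ZZ h \<equiv> (P \<Otimes>\<^sub>M sh F h) \<Otimes>\<^sub>M (N \<Otimes>\<^sub>M Lap)"

definition zb :: "(('g \<Rightarrow> real) \<times> real) \<times> 'y \<times> real \<Rightarrow> ('g \<Rightarrow> real) \<times> 'y \<times> real" where
  "zb p = (fst (fst p), snd p)"

text \<open>The cocycle of the resampling \<open>u \<mapsto> v\<close> of coordinate \<open>h\<close>, computed with respect to a measure
  whose marginal at \<open>h\<close> has shift \<open>a\<close> instead of \<open>F h\<close>.\<close>

definition Dl :: "'g \<Rightarrow> real \<Rightarrow> real \<Rightarrow> real \<Rightarrow> real" where
  "Dl h a v u = (ln (\<phi> (v + F h)) - ln (\<phi> (v + a))) - (ln (\<phi> (u + F h)) - ln (\<phi> (u + a)))"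

text \<open>For \<open>a = F (g \<otimes> h)\<close> this is the resampling of coordinate
  \<open>g \<otimes> h\<close> pulled back along \<open>T g\<close>; see
  \<open>T_zeta\<close>.\<close>

definition zeta :: "'g \<Rightarrow> real \<Rightarrow> (('g \<Rightarrow> real) \<times> real) \<times> 'y \<times> real \<Rightarrow> ('g \<Rightarrow> real) \<times> 'y \<times> real" where
  "zeta h a p = ((fst (fst p))(h := snd (fst p)), fst (snd p), snd (snd p) + Dl h a (snd (fst p)) (fst (fst p) h))"

text \<open>While the old and the new value of the coordinate stay bounded, all changes of
  \<open>ln (om g x)\<close> are bounded uniformly in \<open>g\<close>. The rest is removed by
  exhaustion in \<open>averaged_resampling\<close>.\<close>

definition boxed :: "'g \<Rightarrow> real \<Rightarrow> (('g \<Rightarrow> real) \<times> real) \<times> 'y \<times> real \<Rightarrow> bool" where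
  "boxed h r p \<longleftrightarrow> \<bar>fst (fst p) h\<bar> \<le> r \<and> \<bar>snd (fst p)\<bar> \<le> r"

definition maharam_invariant :: "(('g \<Rightarrow> real) \<times> 'y \<times> real \<Rightarrow> real) \<Rightarrow> bool" where
  "maharam_invariant Q \<longleftrightarrow> Q \<in> borel_measurable Z \<and> (\<forall>p. 0 \<le> Q p \<and> Q p \<le> 1) \<and> (\<forall>g\<in>I. AE z in Z. Q (T g z) = Q z)"

lemma maharam_invariantD:
  assumes "maharam_invariant Q"
  shows "Q \<in> borel_measurable Z" "0 \<le> Q p" "Q p \<le> 1" "g \<in> I \<Longrightarrow> AE z in Z. Q (T g z) = Q z"
  using assms unfolding maharam_invariant_def by blast+

lemma coord_measurable[measurable (raw)]: "h \<in> I \<Longrightarrow> (\<lambda>x. x h) \<in> borel_measurable P"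
  using measurable_component_singleton[of h I "sh F"] by (simp cong: measurable_cong_sets)

lemma zb_measurable[measurable]: "zb \<in> measurable (ZZ h) Z"
  unfolding zb_def[abs_def] by measurable

lemma distr_zb: "distr (ZZ h) Z zb = Z"
proof -
  interpret NL: prob_space "N \<Otimes>\<^sub>M Lap" by (rule prob_NL)
  have "distr (P \<Otimes>\<^sub>M sh F h) P fst \<Otimes>\<^sub>M distr (N \<Otimes>\<^sub>M Lap) (N \<Otimes>\<^sub>M Lap) (\<lambda>w. w) = distr (ZZ h) Z (\<lambda>(q, w). (fst q, w))"
    by (rule pair_measure_distr) (simp_all add: distr_id NL.sigma_finite_measure_axioms)
  then show ?thesis
    by (simp add: prob_space.distr_pair_fst[OF prob_sh] distr_id zb_def[abs_def] split_beta')
qed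

lemma distr_resample_ZZ:
  assumes h: "h \<in> I"
  shows "distr (ZZ h) Z (\<lambda>p. ((fst (fst p))(h := snd (fst p)), snd p)) = Z"
    and "(\<lambda>p. ((fst (fst p))(h := snd (fst p)), snd p)) \<in> measurable (ZZ h) Z"
proof -
  interpret NL: prob_space "N \<Otimes>\<^sub>M Lap" by (rule prob_NL)
  have "distr (P \<Otimes>\<^sub>M sh F h) P (\<lambda>q. (fst q)(h := snd q)) \<Otimes>\<^sub>M distr (N \<Otimes>\<^sub>M Lap) (N \<Otimes>\<^sub>M Lap) (\<lambda>w. w)
      = distr (ZZ h) Z (\<lambda>(q, w). ((fst q)(h := snd q), w))"
    by (rule pair_measure_distr) (simp_all add: distr_id NL.sigma_finite_measure_axioms PP.measurable_resample[OF h])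
  then show "distr (ZZ h) Z (\<lambda>p. ((fst (fst p))(h := snd (fst p)), snd p)) = Z"
    by (simp add: PP.distr_resample[OF h] distr_id split_beta')
  show "(\<lambda>p. ((fst (fst p))(h := snd (fst p)), snd p)) \<in> measurable (ZZ h) Z"
    using measurable_compose[OF measurable_fst PP.measurable_resample[OF h]] by measurable
qed

lemma zb_integral: "f \<in> borel_measurable Z \<Longrightarrow> (\<integral>\<^sup>+p. f (zb p) \<partial>ZZ h) = (\<integral>\<^sup>+z. f z \<partial>Z)"
  using nn_integral_distr[OF zb_measurable, of f h] by (simp add: distr_zb)

lemma zb_AE: "AE z in Z. R z \<Longrightarrow> AE p in ZZ h. R (zb p)"
  using AE_distrD[OF zb_measurable[of h], of R] unfolding distr_zb .

lemma phi_measurable2[measurable]: "(\<lambda>u. ln (\<phi> (u + a))) \<in> borel_measurable borel"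
  by measurable

lemma zeta_measurable:
  assumes h: "h \<in> I"
  shows "zeta h a \<in> measurable (ZZ h) Z"
proof -
  have [measurable]: "(\<lambda>p. (fst (fst p))(h := snd (fst p))) \<in> measurable (ZZ h) P"
    using measurable_compose[OF measurable_fst PP.measurable_resample[OF h]] .
  have [measurable]: "(\<lambda>p. fst (fst p) h) \<in> borel_measurable (ZZ h)"
    by (rule measurable_compose[OF _ coord_measurable[OF h]]) measurable
  show ?thesis unfolding zeta_def[abs_def] Dl_def by measurable
qed

lemma boxed_measurable: "h \<in> I \<Longrightarrow> Measurable.pred (ZZ h) (boxed h r)"
proof -
  assume h: "h \<in> I"
  have [measurable]: "(\<lambda>p. fst (fst p) h) \<in> borel_measurable (ZZ h)"
    by (rule measurable_compose[OF _ coord_measurable[OF h]]) measurable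
  show ?thesis unfolding boxed_def[abs_def] by measurable
qed

lemma nn_integral_times_NL:
  assumes f[measurable]: "f \<in> borel_measurable (M \<Otimes>\<^sub>M (N \<Otimes>\<^sub>M Lap))"
  shows "(\<integral>\<^sup>+z. f z \<partial>(M \<Otimes>\<^sub>M (N \<Otimes>\<^sub>M Lap))) = (\<integral>\<^sup>+x. \<integral>\<^sup>+y. \<integral>\<^sup>+t. f (x, y, t) \<partial>Lap \<partial>N \<partial>M)"
proof -
  interpret L: prob_space Lap by (rule prob_space_Lap)
  interpret NL: prob_space "N \<Otimes>\<^sub>M Lap" by (rule prob_NL)
  have "(\<integral>\<^sup>+z. f z \<partial>(M \<Otimes>\<^sub>M (N \<Otimes>\<^sub>M Lap))) = (\<integral>\<^sup>+x. \<integral>\<^sup>+w. f (x, w) \<partial>(N \<Otimes>\<^sub>M Lap) \<partial>M)"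
    by (rule NL.nn_integral_fst[symmetric, OF f])
  also have "\<dots> = (\<integral>\<^sup>+x. \<integral>\<^sup>+y. \<integral>\<^sup>+t. f (x, y, t) \<partial>Lap \<partial>N \<partial>M)"
  proof (rule nn_integral_cong)
    fix x assume "x \<in> space M"
    then have "(\<lambda>w. f (x, w)) \<in> borel_measurable (N \<Otimes>\<^sub>M Lap)" by measurable
    from L.nn_integral_fst[OF this]
    show "(\<integral>\<^sup>+w. f (x, w) \<partial>(N \<Otimes>\<^sub>M Lap)) = (\<integral>\<^sup>+y. \<integral>\<^sup>+t. f (x, y, t) \<partial>Lap \<partial>N)" by simp
  qed
  finally show ?thesis .
qed

text \<open>Plain resampling preserves \<open>Z\<close>, so the only cost is that of translating
  \<open>Lap\<close> by at most \<open>d\<close>.\<close>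

lemma zeta_integral_le:
  assumes h: "h \<in> I" and d: "\<And>u v. \<bar>u\<bar> \<le> r \<Longrightarrow> \<bar>v\<bar> \<le> r \<Longrightarrow> \<bar>Dl h a v u\<bar> \<le> d" and f[measurable]: "f \<in> borel_measurable Z"
  shows "(\<integral>\<^sup>+p. of_bool (boxed h r p) * f (zeta h a p) \<partial>ZZ h) \<le> ennreal (exp (d / 8)) * (\<integral>\<^sup>+z. f z \<partial>Z)"
proof -
  note [measurable] = zeta_measurable[OF h] boxed_measurable[OF h] distr_resample_ZZ(2)[OF h]
  define f0 where "f0 = (\<lambda>p. ennreal (exp (d / 8)) * f ((fst (fst p))(h := snd (fst p)), snd p))"
  have f0m: "f0 \<in> borel_measurable (ZZ h)" unfolding f0_def by measurable
  have m1: "(\<lambda>p. of_bool (boxed h r p) * f (zeta h a p)) \<in> borel_measurable (ZZ h)" by measurable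
  have "(\<integral>\<^sup>+p. of_bool (boxed h r p) * f (zeta h a p) \<partial>ZZ h)
    = (\<integral>\<^sup>+q. \<integral>\<^sup>+y. \<integral>\<^sup>+t. of_bool (boxed h r (q, y, t)) * f (zeta h a (q, y, t)) \<partial>Lap \<partial>N \<partial>(P \<Otimes>\<^sub>M sh F h))"
    by (rule nn_integral_times_NL[OF m1])
  also have "\<dots> \<le> (\<integral>\<^sup>+q. \<integral>\<^sup>+y. \<integral>\<^sup>+t. f0 (q, y, t) \<partial>Lap \<partial>N \<partial>(P \<Otimes>\<^sub>M sh F h))"
  proof (rule nn_integral_mono, rule nn_integral_mono)
    fix q y assume q: "q \<in> space (P \<Otimes>\<^sub>M sh F h)" and y: "y \<in> space N"
    define x' where "x' = (fst q)(h := snd q)"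
    have "x' \<in> space P" using q h by (auto simp: x'_def space_P space_pair_measure extensional_def)
    then have ft[measurable]: "(\<lambda>t. f (x', y, t)) \<in> borel_measurable borel"
      using y by (intro measurable_compose[OF _ f]) (auto intro!: measurable_Pair)
    show "(\<integral>\<^sup>+t. of_bool (boxed h r (q, y, t)) * f (zeta h a (q, y, t)) \<partial>Lap) \<le> (\<integral>\<^sup>+t. f0 (q, y, t) \<partial>Lap)"
    proof (cases "\<bar>fst q h\<bar> \<le> r \<and> \<bar>snd q\<bar> \<le> r")
      case False
      then have "\<not> boxed h r (q, y, t)" for t by (auto simp: boxed_def)
      then show ?thesis by simp
    next
      case True
      define D where "D = Dl h a (snd q) (fst q h)"
      have D: "\<bar>D\<bar> \<le> d" unfolding D_def using True by (intro d) auto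
      have "(\<integral>\<^sup>+t. of_bool (boxed h r (q, y, t)) * f (zeta h a (q, y, t)) \<partial>Lap) = (\<integral>\<^sup>+t. f (x', y, t + D) \<partial>Lap)"
        using True by (simp add: boxed_def zeta_def x'_def D_def)
      also have "\<dots> \<le> ennreal (exp (\<bar>D\<bar> / 8)) * (\<integral>\<^sup>+t. f (x', y, t) \<partial>Lap)"
        by (rule nn_integral_Lap_shift_le[OF ft])
      also have "\<dots> \<le> ennreal (exp (d / 8)) * (\<integral>\<^sup>+t. f (x', y, t) \<partial>Lap)"
        using D by (intro mult_right_mono ennreal_leI) auto
      also have "\<dots> = (\<integral>\<^sup>+t. f0 (q, y, t) \<partial>Lap)"
        using ft by (simp add: f0_def x'_def[symmetric] nn_integral_cmult)
      finally show ?thesis .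
    qed
  qed
  also have "\<dots> = (\<integral>\<^sup>+p. f0 p \<partial>ZZ h)" by (rule nn_integral_times_NL[OF f0m, symmetric])
  also have "\<dots> = ennreal (exp (d / 8)) * (\<integral>\<^sup>+p. f ((fst (fst p))(h := snd (fst p)), snd p) \<partial>ZZ h)"
    unfolding f0_def by (rule nn_integral_cmult) measurable
  also have "\<dots> = ennreal (exp (d / 8)) * (\<integral>\<^sup>+z. f z \<partial>Z)"
    using nn_integral_distr[OF distr_resample_ZZ(2)[OF h], of f] f by (simp add: distr_resample_ZZ(1)[OF h])
  finally show ?thesis .
qed

lemma K_nonneg: "0 \<le> K"
  using F_bound[OF one_closed] by linarith

lemma ln_phi_bound: "\<exists>c\<ge>0. \<forall>u a. \<bar>u\<bar> \<le> r \<longrightarrow> \<bar>a\<bar> \<le> K \<longrightarrow> \<bar>ln (\<phi> (u + a))\<bar> \<le> c"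
proof -
  have "continuous_on {- (r + K)..r + K} (\<lambda>t. ln (\<phi> t))"
    using pos by (intro continuous_on_ln continuous_on_subset[OF cont]) (auto simp: less_imp_neq[THEN not_sym])
  then have "bounded ((\<lambda>t. ln (\<phi> t)) ` {- (r + K)..r + K})"
    by (intro compact_imp_bounded compact_continuous_image) auto
  then obtain c where c: "\<forall>t\<in>{- (r + K)..r + K}. \<bar>ln (\<phi> t)\<bar> \<le> c"
    by (auto simp: bounded_iff)
  show ?thesis
  proof (intro exI[of _ "max c 0"] conjI allI impI)
    fix u a assume "\<bar>u\<bar> \<le> r" "\<bar>a\<bar> \<le> K"
    then have "u + a \<in> {- (r + K)..r + K}" by auto
    from bspec[OF c this] show "\<bar>ln (\<phi> (u + a))\<bar> \<le> max c 0" by simp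
  qed simp
qed

lemma ln_om_local:
  assumes g: "g \<in> I" and h: "h \<in> I"
  shows "AE q in P \<Otimes>\<^sub>M sh F h. ln (om g ((fst q)(h := snd q))) - ln (om g (fst q)) = ln (rat g h (snd q)) - ln (rat g h (fst q h))"
  using om_local[OF g h]
proof eventually_elim
  case (elim q)
  have "ln (om g ((fst q)(h := snd q)) * rat g h (fst q h)) = ln (om g (fst q) * rat g h (snd q))" using elim by simp
  then show ?case by (simp add: ln_mult_pos om_pos rat_pos)
qed

lemma ln_rat: "ln (rat g h u) = ln (\<phi> (u + F (g \<otimes> h))) - ln (\<phi> (u + F h))"
  by (simp only: rat_def ln_divide_pos pos)

text \<open>By \<open>om_local\<close>, resampling changes \<open>ln (om g x)\<close> by a
  difference of values of \<open>ln (rat g h u)\<close>, and \<open>Dl\<close> with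
  \<open>a = F (g \<otimes> h)\<close> is minus this difference. The two translations cancel, so
  only coordinate \<open>g \<otimes> h\<close> of the image moves.\<close>

lemma T_zeta:
  assumes g: "g \<in> I" and h: "h \<in> I"
  shows "AE p in ZZ h. T g (zeta h (F (g \<otimes> h)) p) =
    ((act g (fst (fst p)))(g \<otimes> h := snd (fst p)), snd (T g (zb p)))"
  using AE_fst[OF prob_NL ln_om_local[OF g h]] AE_space
proof eventually_elim
  case (elim p)
  then have x: "fst (fst p) \<in> space P" by (auto simp: space_pair_measure)
  show ?case using elim(1)
    by (simp add: T_def zeta_def zb_def act_upd[OF g h x] ln_rat Dl_def)
qed

text \<open>On each box the preimage of a null set is null by \<open>zeta_integral_le\<close>, and
  countably many boxes exhaust the space.\<close>

lemma zeta_AE: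
  assumes h: "h \<in> I" and a: "\<bar>a\<bar> \<le> K" and R: "AE z in Z. R z"
  shows "AE p in ZZ h. R (zeta h a p)"
proof -
  obtain S where sub: "{z\<in>space Z. \<not> R z} \<subseteq> S" and S0: "emeasure Z S = 0" and S[measurable]: "S \<in> sets Z"
    by (rule AE_E[OF R])
  note [measurable] = zeta_measurable[OF h] boxed_measurable[OF h]
  have "AE p in ZZ h. of_bool (boxed h (real n) p) * indicator S (zeta h a p) = (0::ennreal)" for n :: nat
  proof -
    obtain c where c: "c \<ge> 0" "\<And>u a. \<bar>u\<bar> \<le> real n \<Longrightarrow> \<bar>a\<bar> \<le> K \<Longrightarrow> \<bar>ln (\<phi> (u + a))\<bar> \<le> c"
      using ln_phi_bound[of "real n"] by blast
    have d: "\<bar>Dl h a v u\<bar> \<le> 4 * c" if "\<bar>u\<bar> \<le> real n" "\<bar>v\<bar> \<le> real n" for u v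
      using c(2)[OF that(1) a] c(2)[OF that(2) a] c(2)[OF that(1) F_bound[OF h]] c(2)[OF that(2) F_bound[OF h]]
      unfolding Dl_def by linarith
    have "(\<integral>\<^sup>+p. of_bool (boxed h (real n) p) * indicator S (zeta h a p) \<partial>ZZ h) \<le> ennreal (exp (4 * c / 8)) * (\<integral>\<^sup>+z. indicator S z \<partial>Z)"
      by (rule zeta_integral_le[OF h d]) measurable
    then have "(\<integral>\<^sup>+p. of_bool (boxed h (real n) p) * indicator S (zeta h a p) \<partial>ZZ h) = 0" using S0 by (simp add: nn_integral_indicator[OF S])
    then show ?thesis by (subst (asm) nn_integral_0_iff_AE) auto
  qed
  then have "AE p in ZZ h. \<forall>n::nat. of_bool (boxed h (real n) p) * indicator S (zeta h a p) = (0::ennreal)"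
    by (subst AE_all_countable) blast
  then show ?thesis
    using AE_space
  proof eventually_elim
    case (elim p)
    obtain n :: nat where "max \<bar>fst (fst p) h\<bar> \<bar>snd (fst p)\<bar> \<le> real n" using real_arch_simple by blast
    then have "boxed h (real n) p" by (simp add: boxed_def)
    then have "zeta h a p \<notin> S" using elim(1)[rule_format, of n] by (simp add: indicator_def split: if_splits)
    moreover have "zeta h a p \<in> space Z" by (rule measurable_space[OF zeta_measurable[OF h] elim(2)])
    ultimately show ?case using sub by blast
  qed
qed

lemma ker_measurable[measurable]: "ker wt J k l \<in> borel_measurable Z"
  unfolding ker_def[abs_def] by measurable

lemma ker_wt_nonneg: "0 \<le> ker wt J k l z"
  by (rule ker_nonneg[OF wt_pos])

text \<open>Let \<open>Q'\<close> be a cylinder function on \<open>B\<close> close to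
  \<open>Q\<close>. If \<open>g \<otimes> h\<close> is not in \<open>B\<close>, then
  \<open>Q'\<close> takes the same value at \<open>T g (zb p)\<close> and at
  \<open>T g (zeta h a p)\<close>, where \<open>a = F (g \<otimes> h)\<close>. By invariance of
  \<open>Q\<close> the difference in question is then at most the sum of the errors
  \<open>|Q - Q'|\<close> at these two points. Averaged with the kernel, each error is controlled by
  \<open>stationary\<close>, the second one after the kernel at \<open>zb p\<close> has been
  compared with that at \<open>zeta h a p\<close>. Only finitely many \<open>g\<close> violate the
  condition, and they have small probability by \<open>escape\<close>.\<close>

lemma averaged_resampling_bounded:
  assumes Q: "maharam_invariant Q" and h: "h \<in> I" and e: "e > 0"
  shows "\<forall>\<^sub>F n in sequentially. (\<Sum>k\<in>Ks n. \<Sum>l\<in>Ks n. \<integral>\<^sup>+p. ennreal (of_bool (boxed h r p) * ker wt (Ks n) k l (zb p)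
      * \<bar>Q (zb p) - Q (zeta h (F (k \<otimes> inv l \<otimes> h)) p)\<bar>) \<partial>ZZ h) \<le> ennreal e"
proof -
  interpret Z: prob_space Z by (rule prob_Z)
  note [measurable] = maharam_invariantD(1)[OF Q] zeta_measurable[OF h] boxed_measurable[OF h]
  note Q01 = maharam_invariantD(2,3)[OF Q]
  obtain c where c: "c \<ge> 0" "\<And>u a. \<bar>u\<bar> \<le> r \<Longrightarrow> \<bar>a\<bar> \<le> K \<Longrightarrow> \<bar>ln (\<phi> (u + a))\<bar> \<le> c"
    using ln_phi_bound[of r] by blast
  have Dlb: "\<bar>Dl h a v u\<bar> \<le> 4 * c" if "\<bar>a\<bar> \<le> K" "\<bar>u\<bar> \<le> r" "\<bar>v\<bar> \<le> r" for a u v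
    using c(2)[OF that(2,1)] c(2)[OF that(3,1)] c(2)[OF that(2) F_bound[OF h]] c(2)[OF that(3) F_bound[OF h]]
    unfolding Dl_def by linarith
  \<comment> \<open>From \<open>wt_compare\<close>: the logarithm of \<open>om\<close> and the real
    variable change by at most \<open>4 * c\<close> each, being sums of four values of
    \<open>ln \<phi>\<close> bounded by \<open>c\<close> on the box.\<close>
  define C where "C = exp (2 * (4 * c) + 4 * c)"
  \<comment> \<open>The error at \<open>T g (zb p)\<close> counts once. The error at the resampled
    point costs \<open>C\<^sup>2\<close> for the kernel and \<open>exp (4 * c / 8)\<close> for the
    change of variables.\<close>
  define Cst where "Cst = 1 + C\<^sup>2 * exp (4 * c / 8)"
  have Cst: "Cst > 0" unfolding Cst_def by (intro add_pos_nonneg) auto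
  define \<epsilon> where "\<epsilon> = e / (2 * Cst)"
  have \<epsilon>: "\<epsilon> > 0" using e Cst by (simp add: \<epsilon>_def)
  obtain B Q' where B: "finite B" "B \<subseteq> I" and Q'[measurable]: "Q' \<in> borel_measurable Z"
    and dep: "depends_on (space P) B Q'" and app: "(\<integral>\<^sup>+z. ennreal \<bar>Q z - Q' z\<bar> \<partial>Z) < ennreal \<epsilon>"
    by (rule cyl_approx_fun[OF refl refl Z.finite_measure_axioms Z.finite_measure_axioms maharam_invariantD(1)[OF Q] Q01 \<epsilon>]) (rule that)
  define D where "D = (\<lambda>z. ennreal \<bar>Q z - Q' z\<bar>)"
  have Dm[measurable]: "D \<in> borel_measurable Z" unfolding D_def by measurable
  \<comment> \<open>The exceptional elements, for which \<open>Q'\<close> may see the resampled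
    coordinate. There are finitely many since right translation by \<open>h\<close> is
    injective.\<close>
  define G0 where "G0 = {g\<in>I. g \<otimes> h \<in> B}"
  have "G0 \<subseteq> (\<lambda>b. b \<otimes> inv h) ` B"
  proof
    fix g assume g: "g \<in> G0"
    then have "g = (g \<otimes> h) \<otimes> inv h" using h by (simp add: G0_def m_assoc)
    with g show "g \<in> (\<lambda>b. b \<otimes> inv h) ` B" by (auto simp: G0_def)
  qed
  then have G0: "finite G0" "G0 \<subseteq> I" using finite_subset[OF _ finite_imageI[OF B(1)]] by (blast, auto simp: G0_def)
  define Y where "Y = (\<lambda>n k l. \<integral>\<^sup>+z. ennreal (ker wt (Ks n) k l z) * D (T (k \<otimes> inv l) z) \<partial>Z)"
  define X where "X = (\<lambda>n k l. \<integral>\<^sup>+p. ennreal (of_bool (boxed h r p) * ker wt (Ks n) k l (zb p)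
      * \<bar>Q (zb p) - Q (zeta h (F (k \<otimes> inv l \<otimes> h)) p)\<bar>) \<partial>ZZ h)"
  define V where "V = (\<lambda>n k l. \<integral>\<^sup>+z. ennreal (ker wt (Ks n) k l z) \<partial>Z)"
  have pair: "X n k l \<le> (if k \<otimes> inv l \<in> G0 then V n k l else 0) + ennreal Cst * Y n k l"
    if kl: "k \<in> Ks n" "l \<in> Ks n" for n k l
  proof -
    define g where "g = k \<otimes> inv l"
    have g: "g \<in> I" unfolding g_def using kl Ks(3)[of n] by auto
    have gh: "g \<otimes> h \<in> I" using g h by simp
    note [measurable] = T_measurable[OF g]
    show ?thesis
    proof (cases "g \<in> G0")
      case True
      have "X n k l \<le> (\<integral>\<^sup>+p. ennreal (ker wt (Ks n) k l (zb p)) \<partial>ZZ h)"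
        unfolding X_def
      proof (rule nn_integral_mono, rule ennreal_leI)
        fix p
        have "\<bar>Q (zb p) - Q (zeta h (F (k \<otimes> inv l \<otimes> h)) p)\<bar> \<le> 1"
          using Q01[of "zb p"] Q01[of "zeta h (F (k \<otimes> inv l \<otimes> h)) p"] by linarith
        then show "of_bool (boxed h r p) * ker wt (Ks n) k l (zb p) * \<bar>Q (zb p) - Q (zeta h (F (k \<otimes> inv l \<otimes> h)) p)\<bar> \<le> ker wt (Ks n) k l (zb p)"
          using ker_wt_nonneg[of "Ks n" k l "zb p"] by (auto intro: mult_left_le)
      qed
      also have "\<dots> = V n k l" unfolding V_def by (rule zb_integral) measurable
      finally show ?thesis using True by (simp add: g_def add_increasing2)
    next
      case False
      then have ghB: "g \<otimes> h \<notin> B" using g by (simp add: G0_def)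
      define ze where "ze = zeta h (F (g \<otimes> h))"
      have zem[measurable]: "ze \<in> measurable (ZZ h) Z" unfolding ze_def by (rule zeta_measurable[OF h])
      have cmp: "AE p in ZZ h. \<forall>g'\<in>I. ln (om g' ((fst (fst p))(h := snd (fst p)))) - ln (om g' (fst (fst p)))
          = ln (rat g' h (snd (fst p))) - ln (rat g' h (fst (fst p) h))"
        using countable_G by (subst AE_ball_countable) (auto intro: AE_fst[OF prob_NL ln_om_local[OF _ h]])
      have "AE p in ZZ h. ennreal (of_bool (boxed h r p) * ker wt (Ks n) k l (zb p) * \<bar>Q (zb p) - Q (ze p)\<bar>)
        \<le> ennreal (ker wt (Ks n) k l (zb p)) * D (T g (zb p)) + of_bool (boxed h r p) * (ennreal (C\<^sup>2) * (ennreal (ker wt (Ks n) k l (ze p)) * D (T g (ze p))))"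
        using cmp zb_AE[OF maharam_invariantD(4)[OF Q g]] zeta_AE[OF h F_bound[OF gh] maharam_invariantD(4)[OF Q g]] T_zeta[OF g h] AE_space
      proof eventually_elim
        case (elim p)
        show ?case
        proof (cases "boxed h r p")
          case False then show ?thesis by simp
        next
          case True
          have x: "fst (fst p) \<in> space P" using elim(5) by (auto simp: space_pair_measure)
          \<comment> \<open>The errors at \<open>T g (ze p)\<close> must be weighted with the kernel
            at \<open>ze p\<close> before stationarity applies to them.\<close>
          have kk: "ker wt (Ks n) k l (zb p) \<le> C\<^sup>2 * ker wt (Ks n) k l (ze p)"
          proof (rule ker_le[OF wt_pos Ks kl])
            fix g' assume g': "g' \<in> I"
            have g'h: "g' \<otimes> h \<in> I" using g' h by simp
            have boxed: "\<bar>fst (fst p) h\<bar> \<le> r" "\<bar>snd (fst p)\<bar> \<le> r" using True by (auto simp: boxed_def)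
            have 1: "\<bar>ln (om g' (fst (ze p))) - ln (om g' (fst (zb p)))\<bar> \<le> 4 * c"
              using elim(1)[rule_format, OF g'] c(2)[OF boxed(1) F_bound[OF g'h]] c(2)[OF boxed(2) F_bound[OF g'h]]
                c(2)[OF boxed(1) F_bound[OF h]] c(2)[OF boxed(2) F_bound[OF h]]
              unfolding ln_rat by (simp add: ze_def zeta_def zb_def)
            have 2: "\<bar>snd (snd (ze p)) - snd (snd (zb p))\<bar> \<le> 4 * c"
              using Dlb[OF F_bound[OF gh] boxed] by (simp add: ze_def zeta_def zb_def)
            show "wt g' (zb p) \<le> C * wt g' (ze p)"
              using wt_compare[of g' "fst (zb p)" "fst (ze p)" "4 * c" "snd (snd (zb p))" "snd (snd (ze p))" "4 * c" "fst (snd (zb p))" "fst (snd (ze p))"] 1 2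
              by (simp add: C_def abs_minus_commute)
            show "wt g' (ze p) \<le> C * wt g' (zb p)"
              using wt_compare[of g' "fst (ze p)" "fst (zb p)" "4 * c" "snd (snd (ze p))" "snd (snd (zb p))" "4 * c" "fst (snd (ze p))" "fst (snd (zb p))"] 1 2
              by (simp add: C_def)
          qed
          have Teq: "T g (ze p) = ((act g (fst (fst p)))(g \<otimes> h := snd (fst p)), snd (T g (zb p)))"
            using elim(4) by (simp add: ze_def)
          have Tzb: "T g (zb p) = (act g (fst (fst p)), snd (T g (zb p)))" by (simp add: T_def zb_def)
          have ax: "act g (fst (fst p)) \<in> space P" by (rule act_in_space[OF g x])
          have ax': "(act g (fst (fst p)))(g \<otimes> h := snd (fst p)) \<in> space P" using ax gh by (auto simp: space_P extensional_def)
          have "Q' (act g (fst (fst p)), snd (T g (zb p))) = Q' ((act g (fst (fst p)))(g \<otimes> h := snd (fst p)), snd (T g (zb p)))"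
            by (rule depends_onD[OF dep ax ax']) (use ghB in auto)
          then have "Q' (T g (zb p)) = Q' (T g (ze p))" using Teq Tzb by simp
          then have "\<bar>Q (zb p) - Q (ze p)\<bar> \<le> \<bar>Q (T g (zb p)) - Q' (T g (zb p))\<bar> + \<bar>Q (T g (ze p)) - Q' (T g (ze p))\<bar>"
            using elim(2,3) unfolding ze_def by linarith
          then have "ker wt (Ks n) k l (zb p) * \<bar>Q (zb p) - Q (ze p)\<bar> \<le> ker wt (Ks n) k l (zb p) * (\<bar>Q (T g (zb p)) - Q' (T g (zb p))\<bar> + \<bar>Q (T g (ze p)) - Q' (T g (ze p))\<bar>)"
            by (rule mult_left_mono) (rule ker_wt_nonneg)
          also have "\<dots> \<le> ker wt (Ks n) k l (zb p) * \<bar>Q (T g (zb p)) - Q' (T g (zb p))\<bar> + C\<^sup>2 * (ker wt (Ks n) k l (ze p) * \<bar>Q (T g (ze p)) - Q' (T g (ze p))\<bar>)"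
            using mult_right_mono[OF kk, of "\<bar>Q (T g (ze p)) - Q' (T g (ze p))\<bar>"] by (simp add: algebra_simps)
          finally have "ennreal (ker wt (Ks n) k l (zb p) * \<bar>Q (zb p) - Q (ze p)\<bar>) \<le> ennreal (ker wt (Ks n) k l (zb p) * \<bar>Q (T g (zb p)) - Q' (T g (zb p))\<bar> + C\<^sup>2 * (ker wt (Ks n) k l (ze p) * \<bar>Q (T g (ze p)) - Q' (T g (ze p))\<bar>))"
            by (rule ennreal_leI)
          also have "\<dots> = ennreal (ker wt (Ks n) k l (zb p)) * D (T g (zb p)) + ennreal (C\<^sup>2) * (ennreal (ker wt (Ks n) k l (ze p)) * D (T g (ze p)))"
            unfolding D_def by (subst ennreal_plus) (auto simp: ennreal_mult ker_wt_nonneg intro!: mult_nonneg_nonneg)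
          finally show ?thesis using True by simp
        qed
      qed
      then have "X n k l \<le> (\<integral>\<^sup>+p. ennreal (ker wt (Ks n) k l (zb p)) * D (T g (zb p)) + of_bool (boxed h r p) * (ennreal (C\<^sup>2) * (ennreal (ker wt (Ks n) k l (ze p)) * D (T g (ze p)))) \<partial>ZZ h)"
        unfolding X_def ze_def g_def by (rule nn_integral_mono_AE)
      also have "\<dots> = (\<integral>\<^sup>+p. ennreal (ker wt (Ks n) k l (zb p)) * D (T g (zb p)) \<partial>ZZ h) + (\<integral>\<^sup>+p. of_bool (boxed h r p) * (ennreal (C\<^sup>2) * (ennreal (ker wt (Ks n) k l (ze p)) * D (T g (ze p)))) \<partial>ZZ h)"
        by (rule nn_integral_add) measurable
      also have "\<dots> \<le> Y n k l + ennreal (exp (4 * c / 8)) * (\<integral>\<^sup>+z. ennreal (C\<^sup>2) * (ennreal (ker wt (Ks n) k l z) * D (T g z)) \<partial>Z)"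
      proof (rule add_mono)
        have "(\<lambda>z. ennreal (ker wt (Ks n) k l z) * D (T g z)) \<in> borel_measurable Z" by measurable
        from zb_integral[OF this, of h] show "(\<integral>\<^sup>+p. ennreal (ker wt (Ks n) k l (zb p)) * D (T g (zb p)) \<partial>ZZ h) \<le> Y n k l"
          by (simp add: Y_def g_def)
        show "(\<integral>\<^sup>+p. of_bool (boxed h r p) * (ennreal (C\<^sup>2) * (ennreal (ker wt (Ks n) k l (ze p)) * D (T g (ze p)))) \<partial>ZZ h)
          \<le> ennreal (exp (4 * c / 8)) * (\<integral>\<^sup>+z. ennreal (C\<^sup>2) * (ennreal (ker wt (Ks n) k l z) * D (T g z)) \<partial>Z)"
          unfolding ze_def by (rule zeta_integral_le[OF h Dlb[OF F_bound[OF gh]]]) measurable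
      qed
      also have "(\<integral>\<^sup>+z. ennreal (C\<^sup>2) * (ennreal (ker wt (Ks n) k l z) * D (T g z)) \<partial>Z) = ennreal (C\<^sup>2) * Y n k l"
        unfolding Y_def g_def[symmetric] by (rule nn_integral_cmult) measurable
      also have "Y n k l + ennreal (exp (4 * c / 8)) * (ennreal (C\<^sup>2) * Y n k l) = ennreal Cst * Y n k l"
        unfolding Cst_def by (subst ennreal_plus) (auto simp: ennreal_mult algebra_simps)
      finally show ?thesis using False by (simp add: g_def)
    qed
  qed
  have Ysum: "(\<Sum>k\<in>Ks n. \<Sum>l\<in>Ks n. ennreal Cst * Y n k l) \<le> ennreal (e / 2)" for n
  proof -
    have "(\<Sum>k\<in>Ks n. \<Sum>l\<in>Ks n. ennreal Cst * Y n k l) = ennreal Cst * (\<integral>\<^sup>+z. D z \<partial>Z)"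
      using stationary[OF Ks Dm, of n] by (simp add: Y_def sum_distrib_left[symmetric])
    also have "\<dots> \<le> ennreal Cst * ennreal \<epsilon>"
      using app by (intro mult_left_mono) (auto simp: D_def)
    also have "\<dots> = ennreal (e / 2)" using Cst e by (simp add: ennreal_mult[symmetric] \<epsilon>_def)
    finally show ?thesis .
  qed
  have Vsum: "(\<Sum>k\<in>Ks n. \<Sum>l\<in>Ks n. if k \<otimes> inv l \<in> G0 then V n k l else 0) = (\<Sum>g\<in>G0. esc n g)" for n
  proof -
    have "(\<Sum>g\<in>G0. esc n g) = (\<Sum>k\<in>Ks n. \<Sum>l\<in>Ks n. \<Sum>g\<in>G0. if k \<otimes> inv l = g then V n k l else 0)"
      unfolding esc_def V_def by (subst sum.swap, rule sum.cong[OF refl], rule sum.swap)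
    also have "\<dots> = (\<Sum>k\<in>Ks n. \<Sum>l\<in>Ks n. if k \<otimes> inv l \<in> G0 then V n k l else 0)"
      using G0(1) by (intro sum.cong refl) simp
    finally show ?thesis ..
  qed
  define e' where "e' = e / (2 * (real (card G0) + 1))"
  have e': "e' > 0" using e by (simp add: e'_def)
  have "\<forall>\<^sub>F n in sequentially. \<forall>g\<in>G0. esc n g \<le> ennreal e'"
    using G0 by (intro eventually_ball_finite ballI escape e') auto
  then have "\<forall>\<^sub>F n in sequentially. (\<Sum>k\<in>Ks n. \<Sum>l\<in>Ks n. X n k l) \<le> ennreal e"
  proof eventually_elim
    case (elim n)
    have "(\<Sum>k\<in>Ks n. \<Sum>l\<in>Ks n. X n k l) \<le> (\<Sum>k\<in>Ks n. \<Sum>l\<in>Ks n. (if k \<otimes> inv l \<in> G0 then V n k l else 0) + ennreal Cst * Y n k l)"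
      by (intro sum_mono pair)
    also have "\<dots> = (\<Sum>g\<in>G0. esc n g) + (\<Sum>k\<in>Ks n. \<Sum>l\<in>Ks n. ennreal Cst * Y n k l)"
      unfolding Vsum[symmetric] by (simp add: sum.distrib)
    also have "\<dots> \<le> (\<Sum>g\<in>G0. ennreal e') + ennreal (e / 2)"
      using elim by (intro add_mono sum_mono Ysum) auto
    also have "(\<Sum>g\<in>G0. ennreal e') = ennreal (real (card G0) * e')"
      using e' by (simp add: ennreal_of_nat_eq_real_of_nat ennreal_mult)
    also have "\<dots> + ennreal (e / 2) = ennreal (real (card G0) * e' + e / 2)"
      using e e' by (subst ennreal_plus) auto
    also have "\<dots> \<le> ennreal e"
      using e by (intro ennreal_leI) (simp add: e'_def field_simps)
    finally show ?case .
  qed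
  then show ?thesis by (simp add: X_def)
qed

text \<open>The kernel has total mass 1, so the part outside a box contributes at most the measure
  of its complement, uniformly in \<open>n\<close>.\<close>

lemma averaged_resampling:
  assumes Q: "maharam_invariant Q" and h: "h \<in> I" and e: "e > 0"
  shows "\<forall>\<^sub>F n in sequentially. (\<Sum>k\<in>Ks n. \<Sum>l\<in>Ks n. \<integral>\<^sup>+p. ennreal (ker wt (Ks n) k l (zb p)
      * \<bar>Q (zb p) - Q (zeta h (F (k \<otimes> inv l \<otimes> h)) p)\<bar>) \<partial>ZZ h) \<le> ennreal e"
proof -
  interpret L: prob_space "N \<Otimes>\<^sub>M Lap" by (rule prob_NL)
  interpret S: prob_space "sh F h" by (rule prob_sh)
  interpret PS: pair_prob_space P "sh F h" ..
  interpret ZZ: pair_prob_space "P \<Otimes>\<^sub>M sh F h" "N \<Otimes>\<^sub>M Lap" ..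
  note [measurable] = maharam_invariantD(1)[OF Q] zeta_measurable[OF h] boxed_measurable[OF h]
  note Q01 = maharam_invariantD(2,3)[OF Q]
  define U where "U = (\<lambda>m::nat. {p\<in>space (ZZ h). \<not> boxed h (real m) p})"
  have Um[measurable]: "U m \<in> sets (ZZ h)" for m unfolding U_def by measurable
  have dec: "decseq U" unfolding U_def decseq_def boxed_def by (force intro: order_trans)
  have "(\<Inter>m. U m) = {}"
  proof -
    have "\<exists>m::nat. boxed h (real m) p" for p
      using real_arch_simple[of "max \<bar>fst (fst p) h\<bar> \<bar>snd (fst p)\<bar>"] by (auto simp: boxed_def)
    then show ?thesis unfolding U_def by blast
  qed
  then have "(\<lambda>m. measure (ZZ h) (U m)) \<longlonglongrightarrow> 0"
    using ZZ.finite_Lim_measure_decseq[OF _ dec] Um by auto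
  from order_tendstoD(2)[OF this, of "e/2"] e
  obtain m where m: "measure (ZZ h) (U m) < e/2" by (auto simp: eventually_sequentially)
  have "e / 2 > 0" using e by simp
  from averaged_resampling_bounded[OF Q h this, of "real m"]
  show ?thesis
  proof eventually_elim
    case (elim n)
    let ?d = "\<lambda>k l p. \<bar>Q (zb p) - Q (zeta h (F (k \<otimes> inv l \<otimes> h)) p)\<bar>"
    let ?X = "\<lambda>k l. \<integral>\<^sup>+p. ennreal (of_bool (boxed h (real m) p) * ker wt (Ks n) k l (zb p) * ?d k l p) \<partial>ZZ h"
    let ?W = "\<lambda>k l. \<integral>\<^sup>+p. ennreal (ker wt (Ks n) k l (zb p)) * indicator (U m) p \<partial>ZZ h"
    have 1: "(\<integral>\<^sup>+p. ennreal (ker wt (Ks n) k l (zb p) * ?d k l p) \<partial>ZZ h) \<le> ?X k l + ?W k l" for k l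
    proof -
      have "(\<integral>\<^sup>+p. ennreal (ker wt (Ks n) k l (zb p) * ?d k l p) \<partial>ZZ h)
        \<le> (\<integral>\<^sup>+p. ennreal (of_bool (boxed h (real m) p) * ker wt (Ks n) k l (zb p) * ?d k l p) + ennreal (ker wt (Ks n) k l (zb p)) * indicator (U m) p \<partial>ZZ h)"
      proof (rule nn_integral_mono)
        fix p assume p: "p \<in> space (ZZ h)"
        have "?d k l p \<le> 1"
          using Q01[of "zb p"] Q01[of "zeta h (F (k \<otimes> inv l \<otimes> h)) p"] by linarith
        then have "ennreal (ker wt (Ks n) k l (zb p) * ?d k l p) \<le> ennreal (ker wt (Ks n) k l (zb p))"
          using ker_wt_nonneg[of "Ks n" k l "zb p"] by (intro ennreal_leI mult_left_le) auto
        then show "ennreal (ker wt (Ks n) k l (zb p) * ?d k l p) \<le> ennreal (of_bool (boxed h (real m) p) * ker wt (Ks n) k l (zb p) * ?d k l p) + ennreal (ker wt (Ks n) k l (zb p)) * indicator (U m) p"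
          using p by (cases "boxed h (real m) p") (auto simp: U_def)
      qed
      also have "\<dots> = ?X k l + ?W k l" by (rule nn_integral_add) measurable
      finally show ?thesis .
    qed
    have "(\<Sum>k\<in>Ks n. \<Sum>l\<in>Ks n. ?W k l) = (\<integral>\<^sup>+p. (\<Sum>k\<in>Ks n. \<Sum>l\<in>Ks n. ennreal (ker wt (Ks n) k l (zb p)) * indicator (U m) p) \<partial>ZZ h)"
      by (rule nn_integral_double_sum[symmetric]) measurable
    also have "\<dots> = (\<integral>\<^sup>+p. indicator (U m) p \<partial>ZZ h)"
    proof (rule nn_integral_cong)
      fix p
      have "(\<Sum>k\<in>Ks n. \<Sum>l\<in>Ks n. ennreal (ker wt (Ks n) k l (zb p))) = 1"
        by (subst sum_sum_ennreal[OF ker_wt_nonneg]) (simp add: ker_sum[OF wt_pos Ks(1,2)])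
      then show "(\<Sum>k\<in>Ks n. \<Sum>l\<in>Ks n. ennreal (ker wt (Ks n) k l (zb p)) * indicator (U m) p) = indicator (U m) p"
        by (simp add: sum_distrib_right[symmetric])
    qed
    also have "\<dots> \<le> ennreal (e / 2)" using m by (simp add: nn_integral_indicator[OF Um] ZZ.emeasure_eq_measure ennreal_leI)
    finally have 2: "(\<Sum>k\<in>Ks n. \<Sum>l\<in>Ks n. ?W k l) \<le> ennreal (e / 2)" .
    have "(\<Sum>k\<in>Ks n. \<Sum>l\<in>Ks n. \<integral>\<^sup>+p. ennreal (ker wt (Ks n) k l (zb p) * ?d k l p) \<partial>ZZ h) \<le> (\<Sum>k\<in>Ks n. \<Sum>l\<in>Ks n. ?X k l + ?W k l)"
      by (intro sum_mono 1)
    also have "\<dots> = (\<Sum>k\<in>Ks n. \<Sum>l\<in>Ks n. ?X k l) + (\<Sum>k\<in>Ks n. \<Sum>l\<in>Ks n. ?W k l)" by (simp add: sum.distrib)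
    also have "\<dots> \<le> ennreal (e / 2) + ennreal (e / 2)" by (rule add_mono[OF elim 2])
    also have "\<dots> = ennreal e" using e by (subst ennreal_plus[symmetric]) auto
    finally show ?case .
  qed
qed

end

section \<open>Ergodicity of diagonal products\<close>

lemma ennreal_eq_0I:
  fixes x :: ennreal
  assumes "\<And>e. 0 < e \<Longrightarrow> x \<le> ennreal e"
  shows "x = 0"
proof -
  have "x \<le> 0" by (rule ennreal_le_epsilon) (simp add: assms)
  then show ?thesis by simp
qed

context bernoulli_growth
begin

lemma prob_PN: "prob_space PN"
proof -
  interpret N: prob_space N by (rule prob_N)
  interpret pair_prob_space P N ..
  show ?thesis by (rule prob_space_axioms)
qed

definition xy :: "('g \<Rightarrow> real) \<times> 'y \<times> real \<Rightarrow> ('g \<Rightarrow> real) \<times> 'y" where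
  "xy z = (fst z, fst (snd z))"

lemma xy_measurable[measurable]: "xy \<in> measurable Z PN"
  unfolding xy_def[abs_def] by measurable

lemma distr_xy: "distr Z PN xy = PN"
proof -
  interpret N: prob_space N by (rule prob_N)
  have d: "distr (N \<Otimes>\<^sub>M Lap) N fst = N" by (rule prob_space.distr_pair_fst[OF prob_space_Lap])
  have "distr P P (\<lambda>x. x) \<Otimes>\<^sub>M distr (N \<Otimes>\<^sub>M Lap) N fst = distr Z PN (\<lambda>(x, w). (x, fst w))"
    by (rule pair_measure_distr) (simp_all add: d N.sigma_finite_measure_axioms)
  then show ?thesis by (simp add: d distr_id xy_def[abs_def] split_beta')
qed

lemma xy_AE_iff:
  assumes [measurable]: "Measurable.pred PN R"
  shows "(AE p in PN. R p) \<longleftrightarrow> (AE z in Z. R (xy z))"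
  using AE_distr_iff[OF xy_measurable, of R] unfolding distr_xy by simp

definition diag :: "'g \<Rightarrow> ('g \<Rightarrow> real) \<times> 'y \<Rightarrow> ('g \<Rightarrow> real) \<times> 'y" where
  "diag g p = (act g (fst p), b g (snd p))"

lemma diag_measurable: "g \<in> I \<Longrightarrow> diag g \<in> measurable PN PN"
  unfolding diag_def[abs_def] using act_measurable[of g] b_measurable[of g] by measurable

lemma xy_T: "xy (T g z) = diag g (xy z)"
  by (simp add: xy_def T_def diag_def)

lemma diag_AE:
  assumes g: "g \<in> I" and [measurable]: "Measurable.pred PN R" and R: "AE p in PN. R p"
  shows "AE p in PN. R (diag g p)"
proof -
  note [measurable] = diag_measurable[OF g]
  have "AE z in Z. R (xy z)" using R by (simp add: xy_AE_iff)
  from T_AE[OF g this] have "AE z in Z. R (diag g (xy z))" by (simp add: xy_T)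
  then show ?thesis by (subst xy_AE_iff) measurable
qed

text \<open>For a function independent of the real variable the averaged statement loses its
  average: the integrand no longer involves \<open>k\<close> and \<open>l\<close>, and the kernel
  sums to 1. So \<open>S\<close> is invariant under every resampling, by the zero-one law it comes
  from a subset of \<open>N\<close>, and that subset is invariant under \<open>b\<close>.\<close>

theorem ergodic_diag:
  assumes erg: "ergodic G N b" and S[measurable]: "S \<in> sets PN"
    and inv: "\<And>g. g \<in> I \<Longrightarrow> AE p in PN. diag g p \<in> S \<longleftrightarrow> p \<in> S"
  shows "(AE p in PN. p \<in> S) \<or> (AE p in PN. p \<notin> S)"
proof -
  interpret N: prob_space N by (rule prob_N)
  interpret PN: pair_sigma_finite P N ..
  define Q where "Q = (\<lambda>z. indicator S (xy z) :: real)"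
  have Qm[measurable]: "Q \<in> borel_measurable Z" unfolding Q_def by measurable
  have Q: "maharam_invariant Q"
    unfolding maharam_invariant_def
  proof (intro conjI allI ballI)
    show "0 \<le> Q p" "Q p \<le> 1" for p by (simp_all add: Q_def)
    fix g assume g: "g \<in> I"
    note [measurable] = diag_measurable[OF g]
    have "AE z in Z. diag g (xy z) \<in> S \<longleftrightarrow> xy z \<in> S"
      using inv[OF g] by (subst (asm) xy_AE_iff) measurable
    then show "AE z in Z. Q (T g z) = Q z"
      by eventually_elim (simp add: Q_def xy_T indicator_def)
  qed (rule Qm)
  have inv1: "AE p in (P \<Otimes>\<^sub>M sh F h) \<Otimes>\<^sub>M N. indicator S ((fst (fst p))(h := snd (fst p)), snd p) = (indicator S (fst (fst p), snd p) :: real)"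
    if h: "h \<in> I" for h
  proof -
    note [measurable] = zeta_measurable[OF h]
    have rm[measurable]: "(\<lambda>p. (fst (fst p))(h := snd (fst p))) \<in> measurable ((P \<Otimes>\<^sub>M sh F h) \<Otimes>\<^sub>M N) P"
      using measurable_compose[OF measurable_fst PP.measurable_resample[OF h]] .
    define X where "X = (\<integral>\<^sup>+p. ennreal \<bar>Q (zb p) - Q (zeta h 0 p)\<bar> \<partial>ZZ h)"
    \<comment> \<open>The right-hand side does not involve \<open>a\<close>, so the value 0 can
      stand for every shift.\<close>
    have Qz: "Q (zeta h a p) = indicator S ((fst (fst p))(h := snd (fst p)), fst (snd p))" for a p
      by (simp add: Q_def zeta_def xy_def)
    have "X \<le> ennreal e" if e: "e > 0" for e
    proof -
      obtain n where "(\<Sum>k\<in>Ks n. \<Sum>l\<in>Ks n. \<integral>\<^sup>+p. ennreal (ker wt (Ks n) k l (zb p)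
        * \<bar>Q (zb p) - Q (zeta h (F (k \<otimes> inv l \<otimes> h)) p)\<bar>) \<partial>ZZ h) \<le> ennreal e"
        using eventually_happens'[OF sequentially_bot averaged_resampling[OF Q h e]] by (rule exE)
      then have le: "(\<Sum>k\<in>Ks n. \<Sum>l\<in>Ks n. \<integral>\<^sup>+p. ennreal (ker wt (Ks n) k l (zb p) * \<bar>Q (zb p) - Q (zeta h 0 p)\<bar>) \<partial>ZZ h) \<le> ennreal e"
        by (simp only: Qz)
      have "X = (\<integral>\<^sup>+p. (\<Sum>k\<in>Ks n. \<Sum>l\<in>Ks n. ennreal (ker wt (Ks n) k l (zb p) * \<bar>Q (zb p) - Q (zeta h 0 p)\<bar>)) \<partial>ZZ h)"
        unfolding X_def
      proof (rule nn_integral_cong)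
        fix p
        have "(\<Sum>k\<in>Ks n. \<Sum>l\<in>Ks n. ker wt (Ks n) k l (zb p) * \<bar>Q (zb p) - Q (zeta h 0 p)\<bar>) = \<bar>Q (zb p) - Q (zeta h 0 p)\<bar>"
          by (simp only: sum_distrib_right[symmetric] ker_sum[OF wt_pos Ks(1,2)] mult_1)
        then show "ennreal \<bar>Q (zb p) - Q (zeta h 0 p)\<bar> = (\<Sum>k\<in>Ks n. \<Sum>l\<in>Ks n. ennreal (ker wt (Ks n) k l (zb p) * \<bar>Q (zb p) - Q (zeta h 0 p)\<bar>))"
          by (subst sum_sum_ennreal) (auto simp: ker_wt_nonneg)
      qed
      also have "\<dots> = (\<Sum>k\<in>Ks n. \<Sum>l\<in>Ks n. \<integral>\<^sup>+p. ennreal (ker wt (Ks n) k l (zb p) * \<bar>Q (zb p) - Q (zeta h 0 p)\<bar>) \<partial>ZZ h)"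
        by (rule nn_integral_double_sum) measurable
      finally show ?thesis using le by simp
    qed
    then have "X = 0" by (rule ennreal_eq_0I)
    then have "AE p in ZZ h. Q (zb p) = Q (zeta h 0 p)"
      unfolding X_def by (subst (asm) nn_integral_0_iff_AE) auto
    then have A: "AE p in ZZ h. indicator S ((fst (fst p))(h := snd (fst p)), fst (snd p)) = (indicator S (fst (fst p), fst (snd p)) :: real)"
      by eventually_elim (simp add: Q_def xy_def zeta_def zb_def)
    have d: "distr (N \<Otimes>\<^sub>M Lap) N fst = N" by (rule prob_space.distr_pair_fst[OF prob_space_Lap])
    have mp: "(\<lambda>(q, w). (q, fst w)) \<in> measurable (ZZ h) ((P \<Otimes>\<^sub>M sh F h) \<Otimes>\<^sub>M N)" by measurable
    have "distr (P \<Otimes>\<^sub>M sh F h) (P \<Otimes>\<^sub>M sh F h) (\<lambda>x. x) \<Otimes>\<^sub>M distr (N \<Otimes>\<^sub>M Lap) N fst = distr (ZZ h) ((P \<Otimes>\<^sub>M sh F h) \<Otimes>\<^sub>M N) (\<lambda>(q, w). (q, fst w))"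
      by (rule pair_measure_distr) (simp_all add: d N.sigma_finite_measure_axioms)
    then have dd: "distr (ZZ h) ((P \<Otimes>\<^sub>M sh F h) \<Otimes>\<^sub>M N) (\<lambda>(q, w). (q, fst w)) = (P \<Otimes>\<^sub>M sh F h) \<Otimes>\<^sub>M N"
      by (simp add: d distr_id)
    have pm: "{p \<in> space ((P \<Otimes>\<^sub>M sh F h) \<Otimes>\<^sub>M N). indicator S ((fst (fst p))(h := snd (fst p)), snd p) = (indicator S (fst (fst p), snd p) :: real)} \<in> sets ((P \<Otimes>\<^sub>M sh F h) \<Otimes>\<^sub>M N)"
      by measurable
    show ?thesis
      using AE_distr_iff[OF mp pm] A unfolding dd by (simp add: split_beta)
  qed
  have ind: "indicator S \<in> borel_measurable PN" by measurable
  define qb where "qb = (\<lambda>y. \<integral>x. indicator S (x, y) \<partial>P :: real)"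
  have tc: "AE p in PN. indicator S p = qb (snd p)"
    unfolding qb_def by (rule PP.resampling_zero_one_law[OF prob_N _ _ _ inv1]) (use ind in auto)
  have "(\<lambda>(y, x). indicator S (x, y) :: real) \<in> borel_measurable (N \<Otimes>\<^sub>M P)" by measurable
  from PP.P.borel_measurable_lebesgue_integral[OF this]
  have qbm[measurable]: "qb \<in> borel_measurable N" unfolding qb_def .
  \<comment> \<open>Almost everywhere \<open>qb\<close> agrees with an indicator, so any threshold
    strictly between 0 and 1 would do.\<close>
  define Y where "Y = {y\<in>space N. 1/2 < qb y}"
  have Y[measurable]: "Y \<in> sets N" unfolding Y_def by measurable
  have SY: "AE p in PN. p \<in> S \<longleftrightarrow> snd p \<in> Y"
    using tc AE_space
  proof eventually_elim
    case (elim p)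
    then show ?case by (cases "p \<in> S") (auto simp: Y_def space_pair_measure)
  qed
  have sndAE: "(AE p in PN. R (snd p)) \<longleftrightarrow> (AE y in N. R y)" if [measurable]: "Measurable.pred N R" for R
  proof
    assume "AE y in N. R y"
    then show "AE p in PN. R (snd p)" by (rule AE_snd[OF prob_N PP.P.prob_space_axioms])
  next
    assume "AE p in PN. R (snd p)"
    then have "AE x in P. AE y in N. R y" using PN.AE_pair[of "\<lambda>p. R (snd p)"] by simp
    then show "AE y in N. R y" by simp
  qed
  have "AE y in N. (b g y \<in> Y) = (y \<in> Y)" if g: "g \<in> I" for g
  proof -
      note [measurable] = b_measurable[OF g]
      have "AE p in PN. diag g p \<in> S \<longleftrightarrow> snd (diag g p) \<in> Y"
        by (rule diag_AE[OF g _ SY]) measurable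
      with SY inv[OF g] have "AE p in PN. b g (snd p) \<in> Y \<longleftrightarrow> snd p \<in> Y"
        by eventually_elim (simp add: diag_def)
      moreover have "Measurable.pred N (\<lambda>y. (b g y \<in> Y) = (y \<in> Y))" by measurable
      ultimately show ?thesis using sndAE[of "\<lambda>y. (b g y \<in> Y) = (y \<in> Y)"] by simp
  qed
  with erg Y have "(AE y in N. y \<in> Y) \<or> (AE y in N. y \<notin> Y)"
    unfolding ergodic_def by blast
  then show ?thesis
  proof
    assume "AE y in N. y \<in> Y"
    then have "AE p in PN. snd p \<in> Y" by (rule AE_snd[OF prob_N PP.P.prob_space_axioms])
    with SY have "AE p in PN. p \<in> S" by eventually_elim simp
    then show ?thesis ..
  next
    assume "AE y in N. y \<notin> Y"
    then have "AE p in PN. snd p \<notin> Y" by (rule AE_snd[OF prob_N PP.P.prob_space_axioms])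
    with SY have "AE p in PN. p \<notin> S" by eventually_elim simp
    then show ?thesis ..
  qed
qed

end

section \<open>Resampling relative to a constant shift\<close>

text \<open>The set of disagreement inside \<open>S\<close> is open and null, hence empty.\<close>

lemma continuous_AE_eq_on:
  fixes f g :: "'a::euclidean_space \<Rightarrow> real"
  assumes f: "continuous_on UNIV f" and g: "continuous_on UNIV g" and S: "open S"
    and ae: "AE t in lborel. t \<in> S \<longrightarrow> f t = g t" and t: "t \<in> S"
  shows "f t = g t"
proof (rule ccontr)
  assume ne: "f t \<noteq> g t"
  let ?S = "{t. f t \<noteq> g t} \<inter> S"
  have "open {t. f t \<noteq> g t}" using f g by (intro open_Collect_neq) auto
  then have o: "open ?S" using S by blast
  have "AE s in lborel. s \<notin> ?S" using ae by eventually_elim auto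
  then have "?S \<in> null_sets lborel" using o by (subst AE_iff_null_sets) auto
  then have "negligible ?S" using negligible_iff_null_sets null_sets_completionI by blast
  with open_not_negligible[OF o] ne t show False by blast
qed

lemma continuous_AE_eq:
  fixes f g :: "real \<Rightarrow> real"
  assumes "continuous_on UNIV f" "continuous_on UNIV g" "AE t in lborel. f t = g t"
  shows "f t = g t"
  using continuous_AE_eq_on[OF assms(1,2) open_UNIV, of t] assms(3) by simp

text \<open>The range of \<open>\<eta>\<close> is connected and consists of periods. Differences of
  its elements fill an interval \<open>[0, d]\<close> with \<open>d > 0\<close>, and the group of
  periods generated by such an interval is the whole line.\<close>

lemma continuous_periods_constant:
  fixes q \<eta> :: "real \<Rightarrow> real"
  assumes \<eta>: "continuous_on UNIV \<eta>" and per: "\<And>v t. q (t + \<eta> v) = q t" and ne: "\<eta> v1 \<noteq> \<eta> v2"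
  shows "q t = q 0"
proof -
  define S where "S = {\<tau>. \<forall>t. q (t + \<tau>) = q t}"
  have diff: "a - b \<in> S" if "a \<in> S" "b \<in> S" for a b
  proof -
    have "q (t + (a - b)) = q t" for t
    proof -
      have "q ((t - b) + a) = q (t - b)" "q ((t - b) + b) = q (t - b)" using that unfolding S_def by blast+
      then show ?thesis by (simp add: algebra_simps)
    qed
    then show ?thesis by (simp add: S_def)
  qed
  have zero: "0 \<in> S" by (simp add: S_def)
  have add: "a + b \<in> S" if "a \<in> S" "b \<in> S" for a b
    using diff[OF that(1) diff[OF zero that(2)]] by simp
  have mult: "real n * a \<in> S" if "a \<in> S" for a n
    by (induction n) (auto simp: zero distrib_right intro: add that)
  define d where "d = \<bar>\<eta> v1 - \<eta> v2\<bar>"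
  have d: "d > 0" using ne by (simp add: d_def)
  have conn: "connected (range \<eta>)" using \<eta> by (intro connected_continuous_image) auto
  have small: "\<tau> \<in> S" if "0 \<le> \<tau>" "\<tau> \<le> d" for \<tau>
  proof -
    define a where "a = min (\<eta> v1) (\<eta> v2)"
    have a: "a \<in> range \<eta>" "a + d \<in> range \<eta>" unfolding a_def d_def by (auto simp: min_def abs_if)
    have "{a..a + d} \<subseteq> range \<eta>" by (rule connected_contains_Icc[OF conn a])
    then have "a + \<tau> \<in> range \<eta>" using that by auto
    then have "a + \<tau> \<in> S" "a \<in> S" using a per by (auto simp: S_def)
    then show ?thesis using diff by fastforce
  qed
  obtain m :: nat where m: "\<bar>t\<bar> / d \<le> real m" using real_arch_simple by blast
  define n where "n = Suc m"
  have n: "\<bar>t\<bar> / d \<le> real n" "n > 0" using m by (simp_all add: n_def)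
  have "\<bar>t\<bar> / real n \<in> S" using n d by (intro small) (auto simp: field_simps)
  from mult[OF this, of n] have "\<bar>t\<bar> \<in> S" using n by simp
  \<comment> \<open>The first identity serves nonnegative \<open>t\<close>, the second one negative
    \<open>t\<close>.\<close>
  then have "q (0 + \<bar>t\<bar>) = q 0" "q (t + \<bar>t\<bar>) = q t" unfolding S_def by blast+
  then show ?thesis by (cases "0 \<le> t") auto
qed

text \<open>The minimum of \<open>R\<close> on the compact interval is a lower bound for averages
  that tend to 0, so \<open>R\<close> has a zero, and by \<open>uniq\<close> only one. Away from
  this zero \<open>R\<close> is bounded below by some \<open>m > 0\<close>, so by Markov's
  inequality the weight that stays away from it tends to 0.\<close>

lemma weights_concentrate:
  fixes w :: "nat \<Rightarrow> 'i \<Rightarrow> real" and f :: "'i \<Rightarrow> real" and R :: "real \<Rightarrow> real"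
  assumes K: "0 \<le> K" and w0: "\<And>n i. 0 \<le> w n i" and w1: "\<And>n. sum (w n) (J n) = 1"
    and f: "\<And>n i. i \<in> J n \<Longrightarrow> f i \<in> {-K..K}"
    and R: "continuous_on {-K..K} R" and R0: "\<And>a. 0 \<le> R a"
    and uniq: "\<And>a b. a \<in> {-K..K} \<Longrightarrow> b \<in> {-K..K} \<Longrightarrow> R a = 0 \<Longrightarrow> R b = 0 \<Longrightarrow> a = b"
    and lim: "(\<lambda>n. \<Sum>i\<in>J n. w n i * R (f i)) \<longlonglongrightarrow> 0"
  shows "\<exists>a\<in>{-K..K}. R a = 0 \<and> (\<lambda>n. \<Sum>i\<in>J n. w n i * \<bar>f i - a\<bar>) \<longlonglongrightarrow> 0"
proof -
  have lower: "c \<le> (\<Sum>i\<in>J n. w n i * g i)" if "\<And>i. i \<in> J n \<Longrightarrow> c \<le> g i" for c g n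
  proof -
    have "c = (\<Sum>i\<in>J n. w n i * c)" by (simp add: sum_distrib_right[symmetric] w1)
    also have "\<dots> \<le> (\<Sum>i\<in>J n. w n i * g i)" using that w0 by (intro sum_mono mult_left_mono) auto
    finally show ?thesis .
  qed
  have "compact {-K..K}" "{-K..K} \<noteq> {}" using K by auto
  from continuous_attains_inf[OF this R] obtain a where a: "a \<in> {-K..K}" "\<And>b. b \<in> {-K..K} \<Longrightarrow> R a \<le> R b" by blast
  have "R a \<le> (\<Sum>i\<in>J n. w n i * R (f i))" for n by (intro lower a f)
  then have "R a \<le> 0" using LIMSEQ_le_const[OF lim] by blast
  then have Ra: "R a = 0" using R0[of a] by simp
  have "(\<lambda>n. \<Sum>i\<in>J n. w n i * \<bar>f i - a\<bar>) \<longlonglongrightarrow> 0"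
  proof (rule LIMSEQ_I)
    fix e :: real assume e: "0 < e"
    define A where "A = {-K..K} \<inter> {b. e / 2 \<le> \<bar>b - a\<bar>}"
    have cA: "compact A" unfolding A_def by (intro compact_Int_closed closed_Collect_le continuous_intros) auto
    obtain m where m: "m > 0" "\<And>b. b \<in> A \<Longrightarrow> m \<le> R b"
    proof (cases "A = {}")
      case True then show ?thesis using that[of 1] by simp
    next
      case False
      have "continuous_on A R" using R by (rule continuous_on_subset) (auto simp: A_def)
      from continuous_attains_inf[OF cA False this] obtain b where b: "b \<in> A" "\<And>c. c \<in> A \<Longrightarrow> R b \<le> R c" by blast
      have "R b \<noteq> 0" using uniq[of b a] b(1) a(1) Ra e by (auto simp: A_def)
      then have "R b > 0" using R0[of b] by simp
      with b that show ?thesis by blast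
    qed
    have pt: "\<bar>b - a\<bar> \<le> e / 2 + (2 * K / m) * R b" if b: "b \<in> {-K..K}" for b
    proof (cases "b \<in> A")
      case True
      have "\<bar>b - a\<bar> \<le> 2 * K" using a(1) b by auto
      also have "2 * K = (2 * K / m) * m" using m(1) by simp
      also have "\<dots> \<le> (2 * K / m) * R b" using m True K by (intro mult_left_mono) auto
      finally show ?thesis using e by simp
    next
      case False
      then have "\<bar>b - a\<bar> \<le> e / 2" using b by (simp add: A_def)
      moreover have "0 \<le> (2 * K / m) * R b" using K m(1) R0[of b] by simp
      ultimately show ?thesis by linarith
    qed
    have up: "(\<Sum>i\<in>J n. w n i * \<bar>f i - a\<bar>) \<le> e / 2 + (2 * K / m) * (\<Sum>i\<in>J n. w n i * R (f i))" for n
    proof -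
      have "(\<Sum>i\<in>J n. w n i * \<bar>f i - a\<bar>) \<le> (\<Sum>i\<in>J n. w n i * (e / 2 + (2 * K / m) * R (f i)))"
        by (intro sum_mono mult_left_mono pt f w0)
      moreover have "(\<Sum>i\<in>J n. w n i * (e / 2 + (2 * K / m) * R (f i))) = (\<Sum>i\<in>J n. w n i * (e / 2)) + (\<Sum>i\<in>J n. (2 * K / m) * (w n i * R (f i)))"
        by (simp add: distrib_left sum.distrib mult_ac)
      moreover have "(\<Sum>i\<in>J n. w n i * (e / 2)) = e / 2" by (simp only: sum_distrib_right[symmetric] w1 mult_1)
      moreover have "(\<Sum>i\<in>J n. (2 * K / m) * (w n i * R (f i))) = (2 * K / m) * (\<Sum>i\<in>J n. w n i * R (f i))"
        by (rule sum_distrib_left[symmetric])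
      ultimately show ?thesis by linarith
    qed
    have "(\<lambda>n. (2 * K / m) * (\<Sum>i\<in>J n. w n i * R (f i))) \<longlonglongrightarrow> (2 * K / m) * 0" by (intro tendsto_mult tendsto_const lim)
    moreover have "(2 * K / m) * 0 < e / 2" using e by simp
    ultimately have "\<forall>\<^sub>F n in sequentially. (2 * K / m) * (\<Sum>i\<in>J n. w n i * R (f i)) < e / 2" by (rule order_tendstoD(2))
    then obtain n0 where n0: "\<And>n. n \<ge> n0 \<Longrightarrow> (2 * K / m) * (\<Sum>i\<in>J n. w n i * R (f i)) < e / 2"
      unfolding eventually_sequentially by blast
    show "\<exists>no. \<forall>n\<ge>no. norm ((\<Sum>i\<in>J n. w n i * \<bar>f i - a\<bar>) - 0) < e"
    proof (rule exI[of _ n0], intro allI impI)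
      fix n assume n: "n0 \<le> n"
      have nn: "0 \<le> (\<Sum>i\<in>J n. w n i * \<bar>f i - a\<bar>)" by (intro sum_nonneg mult_nonneg_nonneg w0) simp
      show "norm ((\<Sum>i\<in>J n. w n i * \<bar>f i - a\<bar>) - 0) < e"
      proof -
        have "(\<Sum>i\<in>J n. w n i * \<bar>f i - a\<bar>) < e" using up[of n] n0[OF n] by linarith
        then show ?thesis using nn by simp
      qed
    qed
  qed
  with a(1) Ra show ?thesis by blast
qed

context shift_density
begin

lemma continuous_ln_phi: "continuous_on UNIV (\<lambda>t. ln (\<phi> t))"
  using cont pos by (intro continuous_on_ln) (auto simp: less_imp_neq[THEN not_sym])

lemma continuous_ln_phi_shift: "continuous_on UNIV (\<lambda>t. ln (\<phi> (t + a)))" "continuous_on UNIV (\<lambda>t. ln (\<phi> (a + t)))"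
  by (rule continuous_on_compose2[OF continuous_ln_phi]; auto intro!: continuous_intros)+

text \<open>Otherwise \<open>\<phi>\<close> would be periodic, hence not integrable.\<close>

lemma ln_phi_diff_nonconstant:
  assumes "a \<noteq> b"
  shows "\<exists>v. ln (\<phi> (v + a)) - ln (\<phi> (v + b)) \<noteq> ln (\<phi> (u + a)) - ln (\<phi> (u + b))"
proof (rule ccontr)
  assume "\<not> ?thesis"
  then have e: "ln (\<phi> (v + a)) - ln (\<phi> (v + b)) = ln (\<phi> (u + a)) - ln (\<phi> (u + b))" for v by blast
  define C where "C = exp (ln (\<phi> (u + a)) - ln (\<phi> (u + b)))"
  have Ceq: "\<phi> (v + a) = C * \<phi> (v + b)" for v
  proof -
    have "ln (\<phi> (v + a)) = (ln (\<phi> (u + a)) - ln (\<phi> (u + b))) + ln (\<phi> (v + b))" using e[of v] by simp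
    then have "exp (ln (\<phi> (v + a))) = C * exp (ln (\<phi> (v + b)))" unfolding C_def exp_add[symmetric] by simp
    then show ?thesis by (simp add: pos)
  qed
  have i: "integrable lborel \<phi>" "integral\<^sup>L lborel \<phi> = 1" using int by (auto simp: has_bochner_integral_iff)
  have tr: "(\<integral>v. \<phi> (v + c) \<partial>lborel) = 1" for c
    using lborel_integral_real_affine[of 1 \<phi> c] i(2) by (simp add: add.commute)
  have "(\<integral>v. \<phi> (v + a) \<partial>lborel) = C * (\<integral>v. \<phi> (v + b) \<partial>lborel)" unfolding Ceq by simp
  \<comment> \<open>All translates have the same integral, so the factor between the two translates
    is 1 and the distance of \<open>a\<close> and \<open>b\<close> is a period.\<close>
  then have C: "C = 1" by (simp add: tr)
  define d where "d = \<bar>a - b\<bar>"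
  have d: "d > 0" using assms by (simp add: d_def)
  have per: "\<phi> (v + d) = \<phi> v" for v
  proof (cases "a \<ge> b")
    case True then show ?thesis using Ceq[of "v - b"] C by (simp add: d_def algebra_simps)
  next
    case False then show ?thesis using Ceq[of "v - a"] C by (simp add: d_def algebra_simps)
  qed
  have pern: "\<phi> (v + real n * d) = \<phi> v" for v n
    by (induction n) (simp_all add: distrib_right add.assoc[symmetric] add.commute[of d] per)
  have "\<exists>m>0. \<forall>v\<in>{0..d}. m \<le> \<phi> v"
  proof -
    have "compact {0..d}" "{0..d} \<noteq> {}" "continuous_on {0..d} \<phi>" using d cont by (auto intro: continuous_on_subset)
    from continuous_attains_inf[OF this] show ?thesis using pos by blast
  qed
  then obtain m where m: "m > 0" "\<And>v. v \<in> {0..d} \<Longrightarrow> m \<le> \<phi> v" by blast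
  have low: "m \<le> \<phi> v" if "0 \<le> v" for v
  proof -
    define n where "n = nat \<lfloor>v / d\<rfloor>"
    have fl: "0 \<le> \<lfloor>v / d\<rfloor>" using that d by simp
    have "real n = of_int \<lfloor>v / d\<rfloor>" using fl by (simp add: n_def)
    then have "real n \<le> v / d" "v / d < real n + 1" by linarith+
    then have "0 \<le> v - real n * d" "v - real n * d \<le> d" using d by (simp_all add: field_simps)
    then show ?thesis using m(2)[of "v - real n * d"] pern[of "v - real n * d" n] by simp
  qed
  have "m * real n \<le> 1" for n :: nat
  proof -
    have "m * real n = (\<integral>v. m * indicator {0..real n} v \<partial>lborel)" by simp
    also have "\<dots> \<le> (\<integral>v. \<phi> v \<partial>lborel)"
    proof (rule integral_mono[OF _ i(1)])
      show "integrable lborel (\<lambda>v. m * indicator {0..real n} v)" by simp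
      show "m * indicator {0..real n} v \<le> \<phi> v" for v
        using low[of v] pos[of v] by (simp add: indicator_def less_imp_le)
    qed
    finally show ?thesis using i(2) by simp
  qed
  moreover obtain n :: nat where "1 / m < real n" using reals_Archimedean2 by blast
  ultimately show False using m(1) by (metis less_divide_eq linorder_not_less mult.commute pos_divide_less_eq)
qed

end

context bernoulli_growth
begin

lemma Dl_continuous: "continuous_on UNIV (\<lambda>a. Dl h a v u)" "continuous_on UNIV (\<lambda>v. Dl h a v u)"
  unfolding Dl_def by (intro continuous_intros continuous_ln_phi_shift)+

text \<open>Collects the fresh value and the real variable in one factor, so that they can be
  integrated out for a fixed point of \<open>PN\<close>.\<close>

definition regroup :: "(('g \<Rightarrow> real) \<times> real) \<times> 'y \<times> real \<Rightarrow> (('g \<Rightarrow> real) \<times> 'y) \<times> real \<times> real" where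
  "regroup p = ((fst (fst p), fst (snd p)), (snd (fst p), snd (snd p)))"

definition ungroup :: "(('g \<Rightarrow> real) \<times> 'y) \<times> real \<times> real \<Rightarrow> (('g \<Rightarrow> real) \<times> real) \<times> 'y \<times> real" where
  "ungroup c = ((fst (fst c), fst (snd c)), (snd (fst c), snd (snd c)))"

lemma ungroup_regroup[simp]: "ungroup (regroup p) = p" by (simp add: ungroup_def regroup_def)

lemma ungroup_measurable: "ungroup \<in> measurable (PN \<Otimes>\<^sub>M (sh F h \<Otimes>\<^sub>M Lap)) (ZZ h)"
  unfolding ungroup_def[abs_def] by measurable

lemma regroup_measurable: "regroup \<in> measurable (ZZ h) (PN \<Otimes>\<^sub>M (sh F h \<Otimes>\<^sub>M Lap))"
  unfolding regroup_def[abs_def] by measurable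

lemma prob_SL: "prob_space (sh F h \<Otimes>\<^sub>M Lap)"
proof -
  interpret S: prob_space "sh F h" by (rule prob_sh)
  interpret L: prob_space Lap by (rule prob_space_Lap)
  interpret pair_prob_space "sh F h" Lap ..
  show ?thesis by (rule prob_space_axioms)
qed

lemma regroup_integral:
  assumes f[measurable]: "f \<in> borel_measurable (PN \<Otimes>\<^sub>M (sh F h \<Otimes>\<^sub>M Lap))"
  shows "(\<integral>\<^sup>+p. f (regroup p) \<partial>ZZ h) = (\<integral>\<^sup>+a. \<integral>\<^sup>+c. f (a, c) \<partial>(sh F h \<Otimes>\<^sub>M Lap) \<partial>PN)"
proof -
  interpret S: prob_space "sh F h" by (rule prob_sh)
  interpret L: prob_space Lap by (rule prob_space_Lap)
  interpret N: prob_space N by (rule prob_N)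
  interpret SN: pair_sigma_finite "sh F h" N ..
  interpret SL: prob_space "sh F h \<Otimes>\<^sub>M Lap" by (rule prob_SL)
  note [measurable] = regroup_measurable
  have m: "(\<lambda>p. f (regroup p)) \<in> borel_measurable (ZZ h)" by measurable
  have mq: "(\<lambda>q. \<integral>\<^sup>+y. \<integral>\<^sup>+t. f (regroup (q, y, t)) \<partial>Lap \<partial>N) \<in> borel_measurable (P \<Otimes>\<^sub>M sh F h)"
  proof -
    have "(\<lambda>c. f (regroup (fst (fst c), snd (fst c), snd c))) \<in> borel_measurable (((P \<Otimes>\<^sub>M sh F h) \<Otimes>\<^sub>M N) \<Otimes>\<^sub>M Lap)"
      using measurable_compose[OF _ m, of "\<lambda>c. (fst (fst c), snd (fst c), snd c)"] by measurable
    from N.borel_measurable_nn_integral_fst[OF L.borel_measurable_nn_integral_fst[OF this]] show ?thesis by simp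
  qed
  have "(\<integral>\<^sup>+p. f (regroup p) \<partial>ZZ h) = (\<integral>\<^sup>+q. \<integral>\<^sup>+y. \<integral>\<^sup>+t. f (regroup (q, y, t)) \<partial>Lap \<partial>N \<partial>(P \<Otimes>\<^sub>M sh F h))"
    by (rule nn_integral_times_NL[OF m])
  also have "\<dots> = (\<integral>\<^sup>+x. \<integral>\<^sup>+v. \<integral>\<^sup>+y. \<integral>\<^sup>+t. f ((x, y), (v, t)) \<partial>Lap \<partial>N \<partial>sh F h \<partial>P)"
    using PP.M.nn_integral_fst[OF mq] by (simp add: regroup_def)
  also have "\<dots> = (\<integral>\<^sup>+x. \<integral>\<^sup>+y. \<integral>\<^sup>+c. f ((x, y), c) \<partial>(sh F h \<Otimes>\<^sub>M Lap) \<partial>N \<partial>P)"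
  proof (rule nn_integral_cong)
    fix x assume x: "x \<in> space P"
    have "(\<lambda>c. f ((x, snd (fst c)), (fst (fst c), snd c))) \<in> borel_measurable ((sh F h \<Otimes>\<^sub>M N) \<Otimes>\<^sub>M Lap)"
      using x by (intro measurable_compose[OF _ f]) measurable
    from L.borel_measurable_nn_integral_fst[OF this]
    have "(\<lambda>(v, y). \<integral>\<^sup>+t. f ((x, y), (v, t)) \<partial>Lap) \<in> borel_measurable (sh F h \<Otimes>\<^sub>M N)" by (simp add: split_beta')
    from SN.Fubini'[OF this]
    have "(\<integral>\<^sup>+v. \<integral>\<^sup>+y. \<integral>\<^sup>+t. f ((x, y), (v, t)) \<partial>Lap \<partial>N \<partial>sh F h) = (\<integral>\<^sup>+y. \<integral>\<^sup>+v. \<integral>\<^sup>+t. f ((x, y), (v, t)) \<partial>Lap \<partial>sh F h \<partial>N)" ..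
    also have "\<dots> = (\<integral>\<^sup>+y. \<integral>\<^sup>+c. f ((x, y), c) \<partial>(sh F h \<Otimes>\<^sub>M Lap) \<partial>N)"
    proof (rule nn_integral_cong)
      fix y assume y: "y \<in> space N"
      have "(\<lambda>c. f ((x, y), c)) \<in> borel_measurable (sh F h \<Otimes>\<^sub>M Lap)"
        using x y by (intro measurable_compose[OF _ f]) (auto simp: space_pair_measure)
      from L.nn_integral_fst[OF this]
      show "(\<integral>\<^sup>+v. \<integral>\<^sup>+t. f ((x, y), (v, t)) \<partial>Lap \<partial>sh F h) = (\<integral>\<^sup>+c. f ((x, y), c) \<partial>(sh F h \<Otimes>\<^sub>M Lap))" by simp
    qed
    finally show "(\<integral>\<^sup>+v. \<integral>\<^sup>+y. \<integral>\<^sup>+t. f ((x, y), (v, t)) \<partial>Lap \<partial>N \<partial>sh F h) = (\<integral>\<^sup>+y. \<integral>\<^sup>+c. f ((x, y), c) \<partial>(sh F h \<Otimes>\<^sub>M Lap) \<partial>N)" .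
  qed
  also have "\<dots> = (\<integral>\<^sup>+a. \<integral>\<^sup>+c. f (a, c) \<partial>(sh F h \<Otimes>\<^sub>M Lap) \<partial>PN)"
    using N.nn_integral_fst[OF SL.borel_measurable_nn_integral_fst[OF f]] by simp
  finally show ?thesis .
qed

lemma T_AE_param:
  assumes V: "prob_space V" and g: "g \<in> I" and R: "AE q in Z \<Otimes>\<^sub>M V. R q"
  shows "AE q in Z \<Otimes>\<^sub>M V. R (T g (fst q), snd q)"
proof -
  interpret V: prob_space V by fact
  interpret Z: prob_space Z by (rule prob_Z)
  interpret ZV: pair_sigma_finite Z V ..
  note [measurable] = T_measurable[OF g]
  obtain S where sub: "{q\<in>space (Z \<Otimes>\<^sub>M V). \<not> R q} \<subseteq> S" and S0: "emeasure (Z \<Otimes>\<^sub>M V) S = 0" and S[measurable]: "S \<in> sets (Z \<Otimes>\<^sub>M V)"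
    by (rule AE_E[OF R])
  have Tm: "(\<lambda>q. (T g (fst q), snd q)) \<in> measurable (Z \<Otimes>\<^sub>M V) (Z \<Otimes>\<^sub>M V)" by measurable
  have m: "(\<lambda>q. ennreal (wt g (fst q)) * indicator S (T g (fst q), snd q)) \<in> borel_measurable (Z \<Otimes>\<^sub>M V)" by measurable
  have "(\<integral>\<^sup>+q. ennreal (wt g (fst q)) * indicator S (T g (fst q), snd q) \<partial>(Z \<Otimes>\<^sub>M V))
      = (\<integral>\<^sup>+v. \<integral>\<^sup>+z. ennreal (wt g z) * indicator S (T g z, v) \<partial>Z \<partial>V)"
    using ZV.nn_integral_snd[OF m] by simp
  also have "\<dots> = (\<integral>\<^sup>+v. \<integral>\<^sup>+z. indicator S (z, v) \<partial>Z \<partial>V)"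
    by (intro nn_integral_cong wt_integral[OF g]) measurable
  also have "\<dots> = 0"
    using ZV.nn_integral_snd[of "indicator S"] S0 by (simp add: nn_integral_indicator[OF S])
  finally have "AE q in Z \<Otimes>\<^sub>M V. ennreal (wt g (fst q)) * indicator S (T g (fst q), snd q) = 0"
    by (subst (asm) nn_integral_0_iff_AE[OF m]) auto
  then show ?thesis using AE_space
  proof eventually_elim
    case (elim q)
    have "(T g (fst q), snd q) \<in> space (Z \<Otimes>\<^sub>M V)" by (rule measurable_space[OF Tm elim(2)])
    moreover have "(T g (fst q), snd q) \<notin> S" using elim(1) wt_pos[of g "fst q"] by (auto simp: indicator_def split: if_splits)
    ultimately show ?case using sub by blast
  qed
qed

lemma distr_zb_times:
  "distr (ZZ h) (Z \<Otimes>\<^sub>M sh F h) (\<lambda>p. (zb p, snd (fst p))) = Z \<Otimes>\<^sub>M sh F h"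
proof (rule measure_eqI)
  interpret S: prob_space "sh F h" by (rule prob_sh)
  interpret NL: prob_space "N \<Otimes>\<^sub>M Lap" by (rule prob_NL)
  interpret SNL: pair_sigma_finite "sh F h" "N \<Otimes>\<^sub>M Lap" ..
  have mp[measurable]: "(\<lambda>p. (zb p, snd (fst p))) \<in> measurable (ZZ h) (Z \<Otimes>\<^sub>M sh F h)" by measurable
  fix A assume AD: "A \<in> sets (distr (ZZ h) (Z \<Otimes>\<^sub>M sh F h) (\<lambda>p. (zb p, snd (fst p))))"
  then have A[measurable]: "A \<in> sets (Z \<Otimes>\<^sub>M sh F h)" by simp
  let ?f = "indicator A :: _ \<Rightarrow> ennreal"
  have f: "?f \<in> borel_measurable (Z \<Otimes>\<^sub>M sh F h)" by simp
  have fm: "(\<lambda>p. ?f (zb p, snd (fst p))) \<in> borel_measurable (ZZ h)" by (rule measurable_compose[OF mp f])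
  have "emeasure (distr (ZZ h) (Z \<Otimes>\<^sub>M sh F h) (\<lambda>p. (zb p, snd (fst p)))) A = (\<integral>\<^sup>+p. ?f (zb p, snd (fst p)) \<partial>ZZ h)"
    using nn_integral_indicator[OF AD] nn_integral_distr[OF mp, of ?f] by simp
  also have "\<dots> = (\<integral>\<^sup>+x. \<integral>\<^sup>+v. \<integral>\<^sup>+w. ?f ((x, w), v) \<partial>(N \<Otimes>\<^sub>M Lap) \<partial>sh F h \<partial>P)"
    using NL.nn_integral_fst[OF fm] PP.M.nn_integral_fst[OF NL.borel_measurable_nn_integral_fst[OF fm]] by (simp add: zb_def)
  also have "\<dots> = (\<integral>\<^sup>+x. \<integral>\<^sup>+w. \<integral>\<^sup>+v. ?f ((x, w), v) \<partial>sh F h \<partial>(N \<Otimes>\<^sub>M Lap) \<partial>P)"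
  proof (rule nn_integral_cong)
    fix x assume x: "x \<in> space P"
    have "(\<lambda>(v, w). ?f ((x, w), v)) \<in> borel_measurable (sh F h \<Otimes>\<^sub>M (N \<Otimes>\<^sub>M Lap))" using x by measurable
    from SNL.Fubini'[OF this] show "(\<integral>\<^sup>+v. \<integral>\<^sup>+w. ?f ((x, w), v) \<partial>(N \<Otimes>\<^sub>M Lap) \<partial>sh F h) = (\<integral>\<^sup>+w. \<integral>\<^sup>+v. ?f ((x, w), v) \<partial>sh F h \<partial>(N \<Otimes>\<^sub>M Lap))" ..
  qed
  also have "\<dots> = emeasure (Z \<Otimes>\<^sub>M sh F h) A"
    using NL.nn_integral_fst[OF PP.M.borel_measurable_nn_integral_fst[OF f]] PP.M.nn_integral_fst[OF f] by (simp add: nn_integral_indicator[OF A])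
  finally show "emeasure (distr (ZZ h) (Z \<Otimes>\<^sub>M sh F h) (\<lambda>p. (zb p, snd (fst p)))) A = emeasure (Z \<Otimes>\<^sub>M sh F h) A" .
qed simp

text \<open>All marginals are equivalent to Lebesgue measure, so the null sets do not depend on the
  coordinate from which the fresh value is drawn.\<close>

lemma AE_sh_change:
  assumes R: "AE q in Z \<Otimes>\<^sub>M sh F h. R q"
  shows "AE q in Z \<Otimes>\<^sub>M sh F h'. R q"
proof -
  interpret S: prob_space "sh F h" by (rule prob_sh)
  interpret S': prob_space "sh F h'" by (rule prob_sh)
  obtain A where sub: "{q\<in>space (Z \<Otimes>\<^sub>M sh F h). \<not> R q} \<subseteq> A" and A0: "emeasure (Z \<Otimes>\<^sub>M sh F h) A = 0" and A[measurable]: "A \<in> sets (Z \<Otimes>\<^sub>M sh F h)"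
    by (rule AE_E[OF R])
  have seq: "sets (Z \<Otimes>\<^sub>M sh F h') = sets (Z \<Otimes>\<^sub>M sh F h)" by (rule sets_pair_measure_cong) simp_all
  have A'[measurable]: "A \<in> sets (Z \<Otimes>\<^sub>M sh F h')" using A seq by simp
  have "emeasure (Z \<Otimes>\<^sub>M sh F h) A = (\<integral>\<^sup>+z. \<integral>\<^sup>+v. indicator A (z, v) \<partial>sh F h \<partial>Z)"
    using PP.M.nn_integral_fst[of "indicator A" Z] by (simp add: nn_integral_indicator[OF A])
  then have "(\<integral>\<^sup>+z. \<integral>\<^sup>+v. indicator A (z, v) \<partial>sh F h \<partial>Z) = 0" using A0 by simp
  then have 1: "AE z in Z. (\<integral>\<^sup>+v. indicator A (z, v) \<partial>sh F h) = 0"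
    using PP.M.borel_measurable_nn_integral_fst[of "indicator A" Z] by (subst (asm) nn_integral_0_iff_AE) auto
  have "AE z in Z. (\<integral>\<^sup>+v. indicator A (z, v) \<partial>sh F h') = 0"
    using 1 AE_space
  proof eventually_elim
    case (elim z)
    have "(\<lambda>v. indicator A (z, v) :: ennreal) \<in> borel_measurable (sh F h)" using elim(2) by measurable
    then have m[measurable]: "(\<lambda>v. indicator A (z, v) :: ennreal) \<in> borel_measurable borel" by (simp cong: measurable_cong_sets)
    have "AE v in sh F h. indicator A (z, v) = (0::ennreal)"
      using elim(1) by (subst (asm) nn_integral_0_iff_AE) (auto cong: measurable_cong_sets)
    moreover have "Measurable.pred borel (\<lambda>v. indicator A (z, v) = (0::ennreal))" by measurable
    ultimately have "AE v in sh F h'. indicator A (z, v) = (0::ennreal)" by (simp only: AE_sh_iff)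
    then show ?case by (subst nn_integral_0_iff_AE) (auto cong: measurable_cong_sets)
  qed
  then have "(\<integral>\<^sup>+z. \<integral>\<^sup>+v. indicator A (z, v) \<partial>sh F h' \<partial>Z) = 0"
    using PP.M.borel_measurable_nn_integral_fst[of "indicator A" Z] by (subst nn_integral_0_iff_AE) auto
  then have "emeasure (Z \<Otimes>\<^sub>M sh F h') A = 0"
    using PP.M.nn_integral_fst[of "indicator A" Z] by (simp add: nn_integral_indicator[OF A'])
  then have "A \<in> null_sets (Z \<Otimes>\<^sub>M sh F h')" by (rule null_setsI[OF _ A'])
  then have "AE q in Z \<Otimes>\<^sub>M sh F h'. q \<notin> A" by (rule AE_not_in)
  then show ?thesis
    using AE_space by eventually_elim (use sub in \<open>auto simp: space_pair_measure\<close>)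
qed

text \<open>By equivariance: \<open>T (inv h)\<close> moves coordinate \<open>h\<close> to coordinate \<open>\<one>\<close>.\<close>

lemma resample_invariance_all:
  assumes Q: "maharam_invariant Q" and C: "\<bar>C\<bar> \<le> K" and one: "AE p in ZZ \<one>. Q (zeta \<one> C p) = Q (zb p)" and h: "h \<in> I"
  shows "AE p in ZZ h. Q (zeta h C p) = Q (zb p)"
proof -
  define g where "g = inv h"
  have g: "g \<in> I" and gh: "g \<otimes> h = \<one>" using h by (auto simp: g_def)
  \<comment> \<open>Inverse of the map that separates the fresh value from the point of
    \<open>Z\<close>. In the separated form \<open>T g\<close> acts on the point alone and leaves
    the fresh value fixed.\<close>
  define bk where "bk = (\<lambda>q :: (('g \<Rightarrow> real) \<times> 'y \<times> real) \<times> real. ((fst (fst q), snd q), snd (fst q)))"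
  have "AE q in Z \<Otimes>\<^sub>M sh F \<one>. Q (zeta \<one> C (bk q)) = Q (fst q)"
  proof -
    note [measurable] = zeta_measurable[OF one_closed] maharam_invariantD(1)[OF Q]
    have [measurable]: "bk \<in> measurable (Z \<Otimes>\<^sub>M sh F \<one>) (ZZ \<one>)" unfolding bk_def by measurable
    have mp: "(\<lambda>p. (zb p, snd (fst p))) \<in> measurable (ZZ \<one>) (Z \<Otimes>\<^sub>M sh F \<one>)" by measurable
    have pm: "{q \<in> space (Z \<Otimes>\<^sub>M sh F \<one>). Q (zeta \<one> C (bk q)) = Q (fst q)} \<in> sets (Z \<Otimes>\<^sub>M sh F \<one>)" by measurable
    have "bk (zb p, snd (fst p)) = p" for p by (simp add: bk_def zb_def)
    then show ?thesis using AE_distr_iff[OF mp pm] one unfolding distr_zb_times by simp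
  qed
  then have "AE q in Z \<Otimes>\<^sub>M sh F h. Q (zeta \<one> C (bk q)) = Q (fst q)" by (rule AE_sh_change)
  from T_AE_param[OF prob_sh g this]
  have "AE q in distr (ZZ h) (Z \<Otimes>\<^sub>M sh F h) (\<lambda>p. (zb p, snd (fst p))). Q (zeta \<one> C (bk (T g (fst q), snd q))) = Q (T g (fst q))"
    unfolding distr_zb_times by simp
  from AE_distrD[OF _ this]
  have A: "AE p in ZZ h. Q (zeta \<one> C (bk (T g (zb p), snd (fst p)))) = Q (T g (zb p))" by simp
  show ?thesis
    using A zb_AE[OF maharam_invariantD(4)[OF Q g]] zeta_AE[OF h C maharam_invariantD(4)[OF Q g]] AE_fst[OF prob_NL ln_om_local[OF g h]] AE_space
  proof eventually_elim
    case (elim p)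
    have x: "fst (fst p) \<in> space P" using elim(5) by (auto simp: space_pair_measure)
    have c1: "act g (fst (fst p)) \<one> = fst (fst p) h" using x g h by (simp add: act_coord g_def)
    \<comment> \<open>The change of \<open>ln (om g x)\<close> replaces the shift \<open>F h\<close>
      in \<open>Dl\<close> by \<open>F \<one>\<close> and leaves the reference shift
      \<open>C\<close> as it is.\<close>
    have "T g (zeta h C p) = zeta \<one> C (bk (T g (zb p), snd (fst p)))"
      using elim(4) by (simp add: T_def zeta_def bk_def zb_def act_upd[OF g h x] gh c1 ln_rat Dl_def)
    then show ?case using elim(1-3) by simp
  qed
qed

end

section \<open>Square summability\<close>

text \<open>The additivity \<open>\<Delta> b (u + a) = \<Delta> (b + a) u - \<Delta> a u\<close> turns a chain of \<open>n \<approx> 1 / \<bar>a\<bar>\<close> small steps into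
  one step of macroscopic size \<open>n * a\<close>; Cauchy-Schwarz loses a factor \<open>n\<^sup>2\<close>.\<close>

lemma quadratic_lower_bound:
  fixes \<psi> :: "real \<Rightarrow> real" and \<Delta> :: "real \<Rightarrow> real \<Rightarrow> real"
  assumes \<psi>: "continuous_on UNIV \<psi>" and nonconst: "\<psi> t1 \<noteq> \<psi> t2"
    and \<Delta>: "continuous_on UNIV (\<lambda>p. \<Delta> (fst p) (snd p))"
    and add: "\<And>a b u. \<Delta> b (u + a) = \<Delta> (b + a) u - \<Delta> a u"
    and nc: "\<And>b. b \<noteq> 0 \<Longrightarrow> \<exists>u v. \<Delta> b u \<noteq> \<Delta> b v" and H: "0 < (H::real)"
  shows "\<exists>c>0. \<exists>L. \<forall>a. \<bar>a\<bar> \<le> H \<longrightarrow> ennreal (c * a\<^sup>2) \<le>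
    (\<integral>\<^sup>+u. \<integral>\<^sup>+v. \<integral>\<^sup>+t. indicator {-L..L} u * indicator {-L..L} v * indicator {-L..L} t
       * ennreal ((\<psi> (t + \<Delta> a u) - \<psi> (t + \<Delta> a v))\<^sup>2) \<partial>lborel \<partial>lborel \<partial>lborel)"
proof -
  \<comment> \<open>The squared change of \<open>\<psi>\<close> under translation by
    \<open>\<Delta> b u - \<Delta> b v\<close>, where \<open>z = (u, v, t)\<close>.
    \<open>W m b\<close> below is its integral over a box.\<close>
  define e where "e = (\<lambda>b (z :: real \<times> real \<times> real). (\<psi> (snd (snd z) + \<Delta> b (fst z) - \<Delta> b (fst (snd z))) - \<psi> (snd (snd z)))\<^sup>2)"
  define bx where "bx = (\<lambda>(m::real). {-m..m} \<times> {-m..m} \<times> {-m..m} :: (real \<times> real \<times> real) set)"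
  define W where "W = (\<lambda>m b. \<integral>\<^sup>+z. indicator (bx m) z * ennreal (e b z) \<partial>lborel)"
  have \<Delta>1: "continuous_on A (\<lambda>x. \<Delta> (f x) (g x))" if "continuous_on A f" "continuous_on A g" for A :: "'z::topological_space set" and f g
    using continuous_on_compose2[OF \<Delta> continuous_on_Pair[OF that]] by simp
  have \<psi>1: "continuous_on A (\<lambda>x. \<psi> (f x))" if "continuous_on A f" for A :: "'z::topological_space set" and f
    using continuous_on_compose2[OF \<psi> that] by simp
  have ecz: "continuous_on UNIV (e b)" for b
    unfolding e_def by (intro continuous_intros \<psi>1 \<Delta>1)
  have em[measurable]: "e b \<in> borel_measurable borel" for b by (rule borel_measurable_continuous_onI[OF ecz])
  have bxm[measurable]: "bx m \<in> sets borel" for m unfolding bx_def by (intro borel_closed closed_Times) auto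
  \<comment> \<open>Compactness in \<open>b\<close>, for macroscopic \<open>b\<close>. Otherwise, by
    Fatou's lemma, a limit \<open>b\<close> of absolute value at least 1 has
    \<open>W m b = 0\<close> on every box. Then all \<open>\<Delta> b u - \<Delta> b v\<close> are
    periods of \<open>\<psi>\<close>, and as \<open>\<Delta> b\<close> is not constant,
    \<open>\<psi>\<close> is.\<close>
  have "\<exists>m\<ge>0. \<exists>w>0. \<forall>b. 1 \<le> \<bar>b\<bar> \<and> \<bar>b\<bar> \<le> 1 + H \<longrightarrow> ennreal w \<le> W m b"
  proof (rule ccontr)
    assume "\<not> ?thesis"
    then have "\<exists>b. (1 \<le> \<bar>b\<bar> \<and> \<bar>b\<bar> \<le> 1 + H) \<and> W (real k) b < ennreal (1 / real (Suc k))" for k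
      by (metis not_less of_nat_0_le_iff of_nat_0_less_iff zero_less_Suc zero_less_divide_1_iff)
    then obtain bs where bs: "\<And>k. 1 \<le> \<bar>bs k\<bar> \<and> \<bar>bs k\<bar> \<le> 1 + H" "\<And>k. W (real k) (bs k) < ennreal (1 / real (Suc k))" by metis
    have "bounded (range bs)" using bs(1) by (auto simp: bounded_iff intro!: exI[of _ "1 + H"])
    then obtain b r where r: "strict_mono r" and lim: "(bs \<circ> r) \<longlonglongrightarrow> b"
      using bounded_imp_convergent_subsequence by blast
    have "1 \<le> \<bar>b\<bar>" using LIMSEQ_le_const[OF tendsto_rabs[OF lim], of 1] bs(1) by auto
    then have b0: "b \<noteq> 0" by auto
    have W0: "W (real m) b = 0" for m
    proof -
      have "W (real m) b = (\<integral>\<^sup>+z. liminf (\<lambda>k. indicator (bx (real m)) z * ennreal (e (bs (r k)) z)) \<partial>lborel)"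
        unfolding W_def
      proof (rule nn_integral_cong, rule lim_imp_Liminf[symmetric])
        fix z
        have "continuous_on UNIV (\<lambda>b. e b z)"
          unfolding e_def by (intro continuous_intros \<psi>1 \<Delta>1)
        from continuous_on_tendsto_compose[OF this lim] have "(\<lambda>k. e (bs (r k)) z) \<longlonglongrightarrow> e b z" by (simp add: comp_def)
        then show "(\<lambda>k. indicator (bx (real m)) z * ennreal (e (bs (r k)) z)) \<longlonglongrightarrow> indicator (bx (real m)) z * ennreal (e b z)"
          by (cases "z \<in> bx (real m)") auto
      qed simp
      also have "\<dots> \<le> liminf (\<lambda>k. W (real m) (bs (r k)))"
        unfolding W_def by (rule nn_integral_liminf) measurable
      also have "\<dots> \<le> liminf (\<lambda>k. ennreal (1 / real (Suc (r k))))"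
      proof (rule Liminf_mono, unfold eventually_sequentially, intro exI allI impI)
        fix k assume "m \<le> k"
        then have "real m \<le> real (r k)" using seq_suble[OF r, of k] by simp
        then have "bx (real m) \<subseteq> bx (real (r k))" by (auto simp: bx_def)
        then have "W (real m) (bs (r k)) \<le> W (real (r k)) (bs (r k))"
          unfolding W_def by (intro nn_integral_mono mult_right_mono) (auto simp: indicator_def)
        with bs(2)[of "r k"] show "W (real m) (bs (r k)) \<le> ennreal (1 / real (Suc (r k)))" by (meson le_less_trans less_imp_le)
      qed
      also have "\<dots> = 0"
      proof (rule lim_imp_Liminf)
        have "(\<lambda>k. 1 / real (Suc k)) \<longlonglongrightarrow> 0" by (rule LIMSEQ_Suc[OF lim_1_over_n])
        then have "((\<lambda>k. 1 / real (Suc k)) \<circ> r) \<longlonglongrightarrow> 0" by (rule LIMSEQ_subseq_LIMSEQ[OF _ r])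
        then show "(\<lambda>k. ennreal (1 / real (Suc (r k)))) \<longlonglongrightarrow> 0" unfolding comp_def using tendsto_ennrealI by fastforce
      qed simp
      finally show ?thesis by simp
    qed
    have ez: "e b z = 0" for z :: "real \<times> real \<times> real"
    proof -
      obtain m :: nat where m: "max \<bar>fst z\<bar> (max \<bar>fst (snd z)\<bar> \<bar>snd (snd z)\<bar>) < real m" using reals_Archimedean2 by blast
      define S where "S = {-real m<..<real m} \<times> {-real m<..<real m} \<times> {-real m<..<real m}"
      have "AE z in lborel. indicator (bx (real m)) z * ennreal (e b z) = 0"
        using W0[of m] unfolding W_def by (subst (asm) nn_integral_0_iff_AE) auto
      then have "AE z in lborel. z \<in> S \<longrightarrow> e b z = 0"
        by eventually_elim (auto simp: S_def bx_def e_def)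
      moreover have "open S" unfolding S_def by (intro open_Times) auto
      moreover have "z \<in> S" using m by (cases z) (auto simp: S_def abs_less_iff)
      ultimately show ?thesis using continuous_AE_eq_on[OF ecz continuous_on_const] by blast
    qed
    obtain u v where uv: "\<Delta> b u \<noteq> \<Delta> b v" using nc[OF b0] by blast
    have per: "\<psi> (t + (\<Delta> b w - \<Delta> b v)) = \<psi> t" for t w
      using ez[of "(w, v, t)"] by (simp add: e_def algebra_simps)
    have "\<psi> t = \<psi> 0" for t
    proof (rule continuous_periods_constant[of "\<lambda>w. \<Delta> b w - \<Delta> b v"])
      show "continuous_on UNIV (\<lambda>w. \<Delta> b w - \<Delta> b v)" by (intro continuous_intros \<Delta>1)
      show "\<Delta> b u - \<Delta> b v \<noteq> \<Delta> b v - \<Delta> b v" using uv by simp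
    qed (rule per)
    then show False using nonconst by metis
  qed
  then obtain m w where m: "m \<ge> 0" and w: "w > 0" "\<And>b. 1 \<le> \<bar>b\<bar> \<Longrightarrow> \<bar>b\<bar> \<le> 1 + H \<Longrightarrow> ennreal w \<le> W m b" by blast
  have "compact ({-(1 + H)..1 + H} \<times> {-(m + 1 + H)..m + 1 + H})" by (intro compact_Times) auto
  then have "bounded ((\<lambda>p. \<Delta> (fst p) (snd p)) ` ({-(1 + H)..1 + H} \<times> {-(m + 1 + H)..m + 1 + H}))"
    by (intro compact_imp_bounded compact_continuous_image continuous_on_subset[OF \<Delta>]) auto
  then obtain B where B0: "\<forall>p\<in>{-(1 + H)..1 + H} \<times> {-(m + 1 + H)..m + 1 + H}. \<bar>\<Delta> (fst p) (snd p)\<bar> \<le> B"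
    unfolding bounded_iff by auto
  have B: "\<bar>\<Delta> a u\<bar> \<le> B" if "\<bar>a\<bar> \<le> 1 + H" "\<bar>u\<bar> \<le> m + 1 + H" for a u
    using bspec[OF B0, of "(a, u)"] that by (simp add: abs_le_iff)
  \<comment> \<open>Room for the translations below: \<open>u\<close> and \<open>v\<close> move by
    at most \<open>1 + H\<close> along the chain, and \<open>t\<close> moves by at most
    \<open>3 * B\<close>.\<close>
  define L where "L = m + 1 + H + 3 * \<bar>B\<bar>"
  have L: "m + 1 + H \<le> L" "m + 3 * B \<le> L" "m \<le> L" using H m by (auto simp: L_def)
  define \<Phi> where "\<Phi> = (\<lambda>a. \<integral>\<^sup>+u. \<integral>\<^sup>+v. \<integral>\<^sup>+t. indicator {-L..L} u * indicator {-L..L} v * indicator {-L..L} t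
       * ennreal ((\<psi> (t + \<Delta> a u) - \<psi> (t + \<Delta> a v))\<^sup>2) \<partial>lborel \<partial>lborel \<partial>lborel)"
  have main: "ennreal (w / (1 + H)\<^sup>2 * a\<^sup>2) \<le> \<Phi> a" if a: "\<bar>a\<bar> \<le> H" "a \<noteq> 0" for a
  proof -
    \<comment> \<open>So many steps of size \<open>a\<close> that the total displacement lies
      between 1 and \<open>1 + H\<close>.\<close>
    define n where "n = nat \<lceil>1 / \<bar>a\<bar>\<rceil>"
    have n1: "1 / \<bar>a\<bar> \<le> real n" unfolding n_def by linarith
    have "0 \<le> 1 / \<bar>a\<bar>" by simp
    then have n2: "real n \<le> 1 / \<bar>a\<bar> + 1" unfolding n_def by linarith
    have n3: "1 \<le> real n * \<bar>a\<bar>" using n1 a(2) by (simp add: field_simps)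
    have "real n * \<bar>a\<bar> \<le> (1 / \<bar>a\<bar> + 1) * \<bar>a\<bar>" using n2 by (rule mult_right_mono) simp
    also have "\<dots> = 1 + \<bar>a\<bar>" using a(2) by (simp add: field_simps)
    finally have n4: "real n * \<bar>a\<bar> \<le> 1 + H" using a(1) by linarith
    have npos: "0 < real n" using n3 by (metis abs_ge_zero mult_less_0_iff mult_zero_left not_one_le_zero of_nat_0_le_iff order_le_less)
    define \<sigma> where "\<sigma> = (\<lambda>j u v. \<Delta> (real j * a) u - \<Delta> (real j * a) v)"
    have mC: "(\<lambda>x. f (g x)) \<in> borel_measurable M" if "continuous_on UNIV (f :: 'z::euclidean_space \<Rightarrow> real)" "g \<in> borel_measurable M" for f g and M :: "'q measure"
      using measurable_compose[OF that(2) borel_measurable_continuous_onI[OF that(1)]] .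
    define X where "X = (\<lambda>u v t. ennreal ((\<psi> (t + \<Delta> a u) - \<psi> (t + \<Delta> a v))\<^sup>2))"
    define X1 where "X1 = (\<lambda>u v. \<integral>\<^sup>+t. indicator {-L..L} t * X u v t \<partial>lborel)"
    have "continuous_on UNIV (\<lambda>z::real\<times>real\<times>real. (\<psi> (snd (snd z) + \<Delta> a (fst z)) - \<psi> (snd (snd z) + \<Delta> a (fst (snd z))))\<^sup>2)"
      by (intro continuous_intros \<psi>1 \<Delta>1)
    from borel_measurable_continuous_onI[OF this]
    have Xm0: "(\<lambda>z::real\<times>real\<times>real. X (fst z) (fst (snd z)) (snd (snd z))) \<in> borel_measurable borel" unfolding X_def by measurable
    have Xm[measurable (raw)]: "(\<lambda>z. X (f z) (g z) (h z)) \<in> borel_measurable M" if "f \<in> borel_measurable M" "g \<in> borel_measurable M" "h \<in> borel_measurable M" for f g h and M :: "'z measure"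
      using measurable_compose[OF _ Xm0, of "\<lambda>z. (f z, g z, h z)" M] that by (simp add: borel_prod[symmetric])
    have X1m0: "(\<lambda>(p::real\<times>real). X1 (fst p) (snd p)) \<in> borel_measurable (borel \<Otimes>\<^sub>M borel)"
      unfolding X1_def by (rule lborel.borel_measurable_nn_integral) measurable
    have X1m[measurable (raw)]: "(\<lambda>z. X1 (f z) (g z)) \<in> borel_measurable M" if "f \<in> borel_measurable M" "g \<in> borel_measurable M" for f g and M :: "'z measure"
      using measurable_compose[OF _ X1m0, of "\<lambda>z. (f z, g z)" M] that by simp
    have step: "(\<integral>\<^sup>+t. indicator {-m..m} t * ennreal ((\<psi> (t + \<sigma> (Suc j) u v) - \<psi> (t + \<sigma> j u v))\<^sup>2) \<partial>lborel) \<le> X1 (u + real j * a) (v + real j * a)"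
      if j: "j < n" and uv: "\<bar>u\<bar> \<le> m" "\<bar>v\<bar> \<le> m" for j u v
    proof -
      have ja: "\<bar>real j * a\<bar> \<le> 1 + H"
      proof -
        have "real j * \<bar>a\<bar> \<le> real n * \<bar>a\<bar>" using j by (intro mult_right_mono) auto
        then show ?thesis using n4 by (simp add: abs_mult)
      qed
      \<comment> \<open>By additivity, the step from \<open>\<sigma> j\<close> to
        \<open>\<sigma> (Suc j)\<close> is a comparison for the single increment \<open>a\<close> at
        the points \<open>u + j a\<close> and \<open>v + j a\<close>, up to a common translation
        \<open>d\<close> of \<open>t\<close>, which Lebesgue measure absorbs.\<close>
      define d where "d = \<sigma> j u v - \<Delta> a (v + real j * a)"
      have "\<bar>\<Delta> (real j * a) u\<bar> \<le> B" "\<bar>\<Delta> (real j * a) v\<bar> \<le> B" using B[OF ja] uv H by auto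
      moreover have "\<bar>\<Delta> a (v + real j * a)\<bar> \<le> B" using a(1) uv ja by (intro B) auto
      ultimately have d: "\<bar>d\<bar> \<le> 3 * B" unfolding d_def \<sigma>_def by linarith
      have e1: "\<sigma> (Suc j) u v = d + \<Delta> a (u + real j * a)" and e2: "\<sigma> j u v = d + \<Delta> a (v + real j * a)"
        by (simp_all add: d_def \<sigma>_def add distrib_right algebra_simps)
      have "(\<integral>\<^sup>+t. indicator {-m..m} t * ennreal ((\<psi> (t + \<sigma> (Suc j) u v) - \<psi> (t + \<sigma> j u v))\<^sup>2) \<partial>lborel)
          \<le> (\<integral>\<^sup>+t. indicator {-L..L} (d + 1 * t) * X (u + real j * a) (v + real j * a) (d + 1 * t) \<partial>lborel)"
      proof (rule nn_integral_mono)
        fix t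
        have "X (u + real j * a) (v + real j * a) (d + 1 * t) = ennreal ((\<psi> (t + \<sigma> (Suc j) u v) - \<psi> (t + \<sigma> j u v))\<^sup>2)"
          unfolding X_def e1 e2 by (simp add: ac_simps)
        moreover have "(indicator {-m..m} t :: ennreal) \<le> indicator {-L..L} (d + 1 * t)"
          using d L(2) by (auto simp: indicator_def)
        ultimately show "indicator {-m..m} t * ennreal ((\<psi> (t + \<sigma> (Suc j) u v) - \<psi> (t + \<sigma> j u v))\<^sup>2)
          \<le> indicator {-L..L} (d + 1 * t) * X (u + real j * a) (v + real j * a) (d + 1 * t)" by (simp add: mult_right_mono)
      qed
      also have "\<dots> = X1 (u + real j * a) (v + real j * a)"
        unfolding X1_def by (subst (2) nn_integral_real_affine[where c=1 and t=d]) auto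
      finally show ?thesis .
    qed
    have shift: "(\<integral>\<^sup>+u. \<integral>\<^sup>+v. indicator {-m..m} u * indicator {-m..m} v * X1 (u + s) (v + s) \<partial>lborel \<partial>lborel) \<le> \<Phi> a" if s: "\<bar>s\<bar> \<le> 1 + H" for s
    proof -
      have "(\<integral>\<^sup>+u. \<integral>\<^sup>+v. indicator {-m..m} u * indicator {-m..m} v * X1 (u + s) (v + s) \<partial>lborel \<partial>lborel)
        \<le> (\<integral>\<^sup>+u. \<integral>\<^sup>+v. indicator {-L..L} (s + 1 * u) * indicator {-L..L} (s + 1 * v) * X1 (s + 1 * u) (s + 1 * v) \<partial>lborel \<partial>lborel)"
        using s L(1) by (intro nn_integral_mono) (auto simp: indicator_def add.commute)
      also have "\<dots> = (\<integral>\<^sup>+u. \<integral>\<^sup>+v. indicator {-L..L} (s + 1 * u) * indicator {-L..L} v * X1 (s + 1 * u) v \<partial>lborel \<partial>lborel)"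
        by (subst (2) nn_integral_real_affine[where c=1 and t=s]) auto
      also have "\<dots> = (\<integral>\<^sup>+u. \<integral>\<^sup>+v. indicator {-L..L} u * indicator {-L..L} v * X1 u v \<partial>lborel \<partial>lborel)"
        by (subst (3) nn_integral_real_affine[where c=1 and t=s]) auto
      also have "\<dots> = \<Phi> a"
        unfolding \<Phi>_def X1_def X_def[symmetric] by (simp add: nn_integral_cmult[symmetric] mult.assoc) (simp add: X_def)
      finally show ?thesis .
    qed
    define Y where "Y = (\<lambda>u v. \<Sum>j<n. indicator {-m..m} u * indicator {-m..m} v * X1 (u + real j * a) (v + real j * a))"
    have "ennreal w \<le> W m (real n * a)" using n3 n4 by (intro w(2)) (simp_all add: abs_mult)
    also have "W m (real n * a) = (\<integral>\<^sup>+u. \<integral>\<^sup>+v. \<integral>\<^sup>+t. indicator (bx m) (u, v, t) * ennreal (e (real n * a) (u, v, t)) \<partial>lborel \<partial>lborel \<partial>lborel)"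
    proof -
      have m1: "(\<lambda>z. indicator (bx m) z * ennreal (e (real n * a) z)) \<in> borel_measurable (lborel \<Otimes>\<^sub>M lborel)"
        unfolding lborel_prod by measurable
      have m2: "(\<lambda>z. indicator (bx m) (u, z) * ennreal (e (real n * a) (u, z))) \<in> borel_measurable (lborel \<Otimes>\<^sub>M lborel)" for u
        using measurable_compose[OF _ m1, of "\<lambda>z. (u, z)" "lborel \<Otimes>\<^sub>M lborel"] by (simp add: lborel_prod)
      have "W m (real n * a) = (\<integral>\<^sup>+z. indicator (bx m) z * ennreal (e (real n * a) z) \<partial>(lborel \<Otimes>\<^sub>M lborel))"
        unfolding W_def lborel_prod ..
      also have "\<dots> = (\<integral>\<^sup>+u. \<integral>\<^sup>+z. indicator (bx m) (u, z) * ennreal (e (real n * a) (u, z)) \<partial>(lborel \<Otimes>\<^sub>M lborel) \<partial>lborel)"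
        using lborel.nn_integral_fst[OF m1, symmetric] by (simp only: lborel_prod)
      also have "\<dots> = (\<integral>\<^sup>+u. \<integral>\<^sup>+v. \<integral>\<^sup>+t. indicator (bx m) (u, v, t) * ennreal (e (real n * a) (u, v, t)) \<partial>lborel \<partial>lborel \<partial>lborel)"
        by (simp only: lborel.nn_integral_fst[OF m2, symmetric])
      finally show ?thesis .
    qed
    also have "\<dots> \<le> (\<integral>\<^sup>+u. \<integral>\<^sup>+v. ennreal (real n) * Y u v \<partial>lborel \<partial>lborel)"
    proof (intro nn_integral_mono)
      fix u v :: real
      show "(\<integral>\<^sup>+t. indicator (bx m) (u, v, t) * ennreal (e (real n * a) (u, v, t)) \<partial>lborel) \<le> ennreal (real n) * Y u v"
      proof (cases "\<bar>u\<bar> \<le> m \<and> \<bar>v\<bar> \<le> m")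
        case False
        then have "indicator (bx m) (u, v, t) = (0::ennreal)" for t by (auto simp: bx_def indicator_def)
        then show ?thesis by simp
      next
        case True
        have s0: "\<sigma> 0 u v = 0" using add[of 0 u 0] add[of 0 v 0] by (simp add: \<sigma>_def)
        have cs: "e (real n * a) (u, v, t) \<le> real n * (\<Sum>j<n. (\<psi> (t + \<sigma> (Suc j) u v) - \<psi> (t + \<sigma> j u v))\<^sup>2)" for t
        proof -
          have "(\<Sum>j<n. \<psi> (t + \<sigma> (Suc j) u v) - \<psi> (t + \<sigma> j u v)) = \<psi> (t + \<sigma> n u v) - \<psi> t"
            using sum_lessThan_telescope[of "\<lambda>j. \<psi> (t + \<sigma> j u v)" n] s0 by simp
          moreover have "e (real n * a) (u, v, t) = (\<psi> (t + \<sigma> n u v) - \<psi> t)\<^sup>2"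
            by (simp add: e_def \<sigma>_def add_diff_eq)
          ultimately have "e (real n * a) (u, v, t) = (\<Sum>j<n. \<psi> (t + \<sigma> (Suc j) u v) - \<psi> (t + \<sigma> j u v))\<^sup>2"
            by simp
          also have "\<dots> \<le> real n * (\<Sum>j<n. (\<psi> (t + \<sigma> (Suc j) u v) - \<psi> (t + \<sigma> j u v))\<^sup>2)"
            using sum_squared_le_sum_of_squares[of "\<lambda>j. \<psi> (t + \<sigma> (Suc j) u v) - \<psi> (t + \<sigma> j u v)" "{..<n}"] by (simp add: mult.commute)
          finally show ?thesis .
        qed
        have tm: "(\<lambda>t. \<psi> (t + c)) \<in> borel_measurable borel" for c
          by (rule borel_measurable_continuous_onI[OF \<psi>1]) (intro continuous_intros)
        note [measurable] = tm
        have "(\<integral>\<^sup>+t. indicator (bx m) (u, v, t) * ennreal (e (real n * a) (u, v, t)) \<partial>lborel)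
          \<le> (\<integral>\<^sup>+t. ennreal (real n) * (\<Sum>j<n. indicator {-m..m} t * ennreal ((\<psi> (t + \<sigma> (Suc j) u v) - \<psi> (t + \<sigma> j u v))\<^sup>2)) \<partial>lborel)"
        proof (rule nn_integral_mono)
          fix t :: real
          have "ennreal (e (real n * a) (u, v, t)) \<le> ennreal (real n) * (\<Sum>j<n. ennreal ((\<psi> (t + \<sigma> (Suc j) u v) - \<psi> (t + \<sigma> j u v))\<^sup>2))"
            using ennreal_leI[OF cs[of t]] by (simp add: ennreal_mult sum_nonneg)
          then show "indicator (bx m) (u, v, t) * ennreal (e (real n * a) (u, v, t))
            \<le> ennreal (real n) * (\<Sum>j<n. indicator {-m..m} t * ennreal ((\<psi> (t + \<sigma> (Suc j) u v) - \<psi> (t + \<sigma> j u v))\<^sup>2))"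
            by (cases "(u, v, t) \<in> bx m") (auto simp: bx_def)
        qed
        also have "\<dots> = ennreal (real n) * (\<Sum>j<n. \<integral>\<^sup>+t. indicator {-m..m} t * ennreal ((\<psi> (t + \<sigma> (Suc j) u v) - \<psi> (t + \<sigma> j u v))\<^sup>2) \<partial>lborel)"
          by (subst nn_integral_cmult, measurable, subst nn_integral_sum) measurable
        also have "\<dots> \<le> ennreal (real n) * Y u v"
          unfolding Y_def using True by (intro mult_left_mono sum_mono order_trans[OF step]) (auto simp: indicator_def abs_le_iff)
        finally show ?thesis .
      qed
    qed
    also have "\<dots> = ennreal (real n) * (\<Sum>j<n. \<integral>\<^sup>+u. \<integral>\<^sup>+v. indicator {-m..m} u * indicator {-m..m} v * X1 (u + real j * a) (v + real j * a) \<partial>lborel \<partial>lborel)"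
    proof -
      have "(\<integral>\<^sup>+v. ennreal (real n) * Y u v \<partial>lborel) = ennreal (real n) * (\<Sum>j<n. \<integral>\<^sup>+v. indicator {-m..m} u * indicator {-m..m} v * X1 (u + real j * a) (v + real j * a) \<partial>lborel)" for u
        unfolding Y_def by (subst nn_integral_cmult, measurable, subst nn_integral_sum) measurable
      note Yeq = this
      show ?thesis
        unfolding Yeq by (subst nn_integral_cmult, measurable, subst nn_integral_sum) measurable
    qed
    also have "\<dots> \<le> ennreal (real n) * (\<Sum>j<n. \<Phi> a)"
    proof (intro mult_left_mono sum_mono shift)
      fix j assume "j \<in> {..<n}"
      then have "real j * \<bar>a\<bar> \<le> real n * \<bar>a\<bar>" by (intro mult_right_mono) auto
      then show "\<bar>real j * a\<bar> \<le> 1 + H" using n4 by (simp add: abs_mult)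
    qed simp
    also have "\<dots> = ennreal ((real n)\<^sup>2) * \<Phi> a"
      by (simp add: power2_eq_square ennreal_mult ennreal_of_nat_eq_real_of_nat mult.assoc)
    finally have wn: "ennreal w \<le> ennreal ((real n)\<^sup>2) * \<Phi> a" .
    \<comment> \<open>The loss of \<open>n\<^sup>2\<close> is affordable because \<open>n\<close> is
      at most \<open>(1 + H)\<close> divided by the absolute value of \<open>a\<close>: this
      produces the quadratic bound.\<close>
    have "(real n * \<bar>a\<bar>)\<^sup>2 \<le> (1 + H)\<^sup>2" using n4 by (intro power_mono) auto
    then have "w * a\<^sup>2 * (real n)\<^sup>2 \<le> w * (1 + H)\<^sup>2" using w(1) by (simp add: power_mult_distrib mult_ac)
    then have "w / (1 + H)\<^sup>2 * a\<^sup>2 \<le> 1 / (real n)\<^sup>2 * w"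
      using npos H by (simp add: field_simps)
    then have "ennreal (w / (1 + H)\<^sup>2 * a\<^sup>2) \<le> ennreal (1 / (real n)\<^sup>2) * ennreal w"
      using w(1) by (simp only: ennreal_mult[symmetric] zero_le_divide_1_iff zero_le_power2 less_imp_le ennreal_leI)
    also have "\<dots> \<le> ennreal (1 / (real n)\<^sup>2) * (ennreal ((real n)\<^sup>2) * \<Phi> a)" by (rule mult_left_mono[OF wn]) simp
    also have "\<dots> = \<Phi> a" using npos by (simp add: mult.assoc[symmetric] ennreal_mult[symmetric])
    finally show ?thesis .
  qed
  have "\<exists>L. \<forall>a. \<bar>a\<bar> \<le> H \<longrightarrow> ennreal (w / (1 + H)\<^sup>2 * a\<^sup>2) \<le>
    (\<integral>\<^sup>+u. \<integral>\<^sup>+v. \<integral>\<^sup>+t. indicator {-L..L} u * indicator {-L..L} v * indicator {-L..L} t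
       * ennreal ((\<psi> (t + \<Delta> a u) - \<psi> (t + \<Delta> a v))\<^sup>2) \<partial>lborel \<partial>lborel \<partial>lborel)"
  proof (intro exI[of _ L] allI impI)
    fix a assume "\<bar>a\<bar> \<le> H"
    then show "ennreal (w / (1 + H)\<^sup>2 * a\<^sup>2) \<le> (\<integral>\<^sup>+u. \<integral>\<^sup>+v. \<integral>\<^sup>+t. indicator {-L..L} u * indicator {-L..L} v * indicator {-L..L} t
       * ennreal ((\<psi> (t + \<Delta> a u) - \<psi> (t + \<Delta> a v))\<^sup>2) \<partial>lborel \<partial>lborel \<partial>lborel)"
      using main unfolding \<Phi>_def by (cases "a = 0") auto
  qed
  moreover have "0 < w / (1 + H)\<^sup>2" using w(1) H by simp
  ultimately show ?thesis by blast
qed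

lemma continuous_rat_eq:
  fixes f g :: "real \<Rightarrow> real"
  assumes f: "continuous_on UNIV f" and g: "continuous_on UNIV g" and eq: "\<And>r :: rat. f (of_rat r) = g (of_rat r)"
  shows "f t = g t"
proof (rule ccontr)
  assume ne: "f t \<noteq> g t"
  have "open {t. f t \<noteq> g t}" using f g by (intro open_Collect_neq) auto
  then obtain e where e: "e > 0" "ball t e \<subseteq> {t. f t \<noteq> g t}" using ne by (auto elim: openE)
  obtain r where r: "t < real_of_rat r" "real_of_rat r < t + e" using of_rat_dense[of t "t + e"] e(1) by auto
  then have "of_rat r \<in> ball t e" by (simp add: dist_real_def)
  with e(2) eq show False by blast
qed

lemma AE_Lap: "AE t in Lap. Q t \<Longrightarrow> AE t in lborel. Q t"
  unfolding Lap_def by (subst (asm) AE_density) auto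

section \<open>Sections in the real variable and their invariance defect\<close>

context bernoulli_growth
begin

lemma distr_assoc: "distr (PN \<Otimes>\<^sub>M Lap) Z (\<lambda>q. (fst (fst q), snd (fst q), snd q)) = Z"
proof (rule measure_eqI)
  interpret L: prob_space Lap by (rule prob_space_Lap)
  interpret N: prob_space N by (rule prob_N)
  have m[measurable]: "(\<lambda>q. (fst (fst q), snd (fst q), snd q)) \<in> measurable (PN \<Otimes>\<^sub>M Lap) Z" by measurable
  fix A assume AD: "A \<in> sets (distr (PN \<Otimes>\<^sub>M Lap) Z (\<lambda>q. (fst (fst q), snd (fst q), snd q)))"
  then have A[measurable]: "A \<in> sets Z" by simp
  let ?f = "indicator A :: _ \<Rightarrow> ennreal"
  have f: "?f \<in> borel_measurable Z" by simp
  have fm: "(\<lambda>q. ?f (fst (fst q), snd (fst q), snd q)) \<in> borel_measurable (PN \<Otimes>\<^sub>M Lap)" by (rule measurable_compose[OF m f])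
  have "emeasure (distr (PN \<Otimes>\<^sub>M Lap) Z (\<lambda>q. (fst (fst q), snd (fst q), snd q))) A
      = (\<integral>\<^sup>+q. ?f (fst (fst q), snd (fst q), snd q) \<partial>(PN \<Otimes>\<^sub>M Lap))"
    using nn_integral_indicator[OF AD] nn_integral_distr[OF m, of ?f] by simp
  also have "\<dots> = (\<integral>\<^sup>+x. \<integral>\<^sup>+y. \<integral>\<^sup>+t. ?f (x, y, t) \<partial>Lap \<partial>N \<partial>P)"
    using L.nn_integral_fst[OF fm] N.nn_integral_fst[OF L.borel_measurable_nn_integral_fst[OF fm]] by simp
  also have "\<dots> = emeasure Z A"
    using nn_integral_Z[OF f] by (simp add: nn_integral_indicator[OF A])
  finally show "emeasure (distr (PN \<Otimes>\<^sub>M Lap) Z (\<lambda>q. (fst (fst q), snd (fst q), snd q))) A = emeasure Z A" .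
qed simp

lemma AE_sections:
  assumes "AE z in Z. R z"
  shows "AE p in PN. AE t in lborel. R (fst p, snd p, t)"
proof -
  interpret L: prob_space Lap by (rule prob_space_Lap)
  interpret PN: prob_space "PN" by (rule prob_PN)
  interpret PNL: pair_sigma_finite "PN" Lap ..
  have m: "(\<lambda>q. (fst (fst q), snd (fst q), snd q)) \<in> measurable (PN \<Otimes>\<^sub>M Lap) Z" by measurable
  have "AE q in PN \<Otimes>\<^sub>M Lap. R (fst (fst q), snd (fst q), snd q)"
    using AE_distrD[OF m, of R] assms unfolding distr_assoc by simp
  from PNL.AE_pair[OF this] have "AE p in PN. AE t in Lap. R (fst p, snd p, t)" by simp
  then show ?thesis by eventually_elim (rule AE_Lap)
qed

definition sections_continuous :: "(('g \<Rightarrow> real) \<times> 'y \<times> real \<Rightarrow> real) \<Rightarrow> bool" where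
  "sections_continuous Q \<longleftrightarrow> (\<forall>x y. continuous_on UNIV (\<lambda>t. Q (x, y, t)))"

lemma sections_continuousD: "sections_continuous Q \<Longrightarrow> continuous_on A (\<lambda>t. Q (x, y, t))"
  unfolding sections_continuous_def by (meson continuous_on_subset subset_UNIV)

lemma sections_continuous_shift: "sections_continuous Q \<Longrightarrow> continuous_on UNIV (\<lambda>t. Q (x, y, t + c))"
  by (rule continuous_on_compose2[OF sections_continuousD[of Q UNIV]]) (auto intro!: continuous_intros)

lemma constant_sections_measurable:
  assumes Q: "maharam_invariant Q" and c: "sections_continuous Q"
  shows "{p \<in> space PN. \<forall>t. Q (fst p, snd p, t) = Q (fst p, snd p, 0)} \<in> sets PN"
proof -
  note [measurable] = maharam_invariantD(1)[OF Q]
  have "(\<forall>t. Q (fst p, snd p, t) = Q (fst p, snd p, 0)) \<longleftrightarrow> (\<forall>r::rat. Q (fst p, snd p, of_rat r) = Q (fst p, snd p, 0))" for p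
    using continuous_rat_eq[OF sections_continuousD[OF c] continuous_on_const] by blast
  then show ?thesis by simp measurable
qed

text \<open>\<open>T g\<close> maps the section over a point of \<open>PN\<close> to a translate of
  itself, and a translate of a constant is constant.\<close>

lemma constant_sections_invariant:
  assumes Q: "maharam_invariant Q" and c: "sections_continuous Q" and g: "g \<in> I"
  shows "AE p in PN. (\<forall>t. Q (fst (diag g p), snd (diag g p), t) = Q (fst (diag g p), snd (diag g p), 0))
    \<longleftrightarrow> (\<forall>t. Q (fst p, snd p, t) = Q (fst p, snd p, 0))"
  using AE_sections[OF maharam_invariantD(4)[OF Q g]]
proof eventually_elim
  case (elim p)
  define q where "q = (\<lambda>t. Q (fst p, snd p, t))"
  define q' where "q' = (\<lambda>t. Q (fst (diag g p), snd (diag g p), t))"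
  define s where "s = ln (om g (fst p))"
  have "q' (t + s) = q t" for t
    unfolding q_def q'_def s_def
    by (rule continuous_AE_eq[OF sections_continuous_shift[OF c] sections_continuousD[OF c]]) (use elim in \<open>simp add: T_def diag_def\<close>)
  then have e: "q' t = q (t - s)" for t by (metis diff_add_cancel)
  have "(\<forall>t. q' t = q' 0) \<longleftrightarrow> (\<forall>t. q t = q 0)"
  proof
    assume A: "\<forall>t. q' t = q' 0"
    show "\<forall>t. q t = q 0"
    proof
      fix t show "q t = q 0" using A[rule_format, of "t + s"] A[rule_format, of s] by (simp add: e)
    qed
  next
    assume "\<forall>t. q t = q 0" then show "\<forall>t. q' t = q' 0" unfolding e by metis
  qed
  then show ?case by (simp add: q_def q'_def)
qed

text \<open>The factor \<open>exp (- 2 * \<bar>t\<bar>)\<close> pays for the comparison of the kernel at \<open>t\<close> with the kernel at \<open>0\<close>.\<close>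

definition gap :: "(('g \<Rightarrow> real) \<times> 'y \<times> real \<Rightarrow> real) \<Rightarrow> real \<Rightarrow> (('g \<Rightarrow> real) \<times> 'y) \<times> real \<times> real \<Rightarrow> real" where
  "gap Q a c = exp (- 2 * \<bar>snd (snd c)\<bar>) * \<bar>Q (zb (ungroup c)) - Q (zeta \<one> a (ungroup c))\<bar>"

text \<open>For a fixed point of \<open>PN\<close>, the defect of invariance of \<open>Q\<close>
  under resampling of coordinate \<open>\<one>\<close> relative to the shift \<open>a\<close>. Its
  zeros in \<open>a\<close> are the candidates for the constant shift.\<close>

definition Gap :: "(('g \<Rightarrow> real) \<times> 'y \<times> real \<Rightarrow> real) \<Rightarrow> real \<Rightarrow> ('g \<Rightarrow> real) \<times> 'y \<Rightarrow> real" where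
  "Gap Q a p = (\<integral>c. gap Q a (p, c) \<partial>(sh F \<one> \<Otimes>\<^sub>M Lap))"

context
  fixes Q assumes Q: "maharam_invariant Q"
begin

lemma gap_bounds: "0 \<le> gap Q a c" "gap Q a c \<le> 1"
proof -
  show "0 \<le> gap Q a c" by (simp add: gap_def)
  have "\<bar>Q (zb (ungroup c)) - Q (zeta \<one> a (ungroup c))\<bar> \<le> 1"
    using maharam_invariantD(2,3)[OF Q, of "zb (ungroup c)"] maharam_invariantD(2,3)[OF Q, of "zeta \<one> a (ungroup c)"] by linarith
  then show "gap Q a c \<le> 1" unfolding gap_def by (intro mult_le_one) auto
qed

lemma gap_measurable: "gap Q a \<in> borel_measurable (PN \<Otimes>\<^sub>M (sh F \<one> \<Otimes>\<^sub>M Lap))"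
proof -
  note [measurable] = maharam_invariantD(1)[OF Q]
  have "(\<lambda>c. Q (zb (ungroup c))) \<in> borel_measurable (PN \<Otimes>\<^sub>M (sh F \<one> \<Otimes>\<^sub>M Lap))"
    by (rule measurable_compose[OF ungroup_measurable]) measurable
  moreover have "(\<lambda>c. Q (zeta \<one> a (ungroup c))) \<in> borel_measurable (PN \<Otimes>\<^sub>M (sh F \<one> \<Otimes>\<^sub>M Lap))"
    by (rule measurable_compose[OF ungroup_measurable], rule measurable_compose[OF zeta_measurable[OF one_closed]]) measurable
  ultimately show ?thesis unfolding gap_def[abs_def] by measurable
qed

lemma gap_section: "p \<in> space PN \<Longrightarrow> (\<lambda>c. gap Q a (p, c)) \<in> borel_measurable (sh F \<one> \<Otimes>\<^sub>M Lap)"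
  by (rule measurable_compose[OF measurable_Pair1' gap_measurable])

lemma gap_integrable: "p \<in> space PN \<Longrightarrow> integrable (sh F \<one> \<Otimes>\<^sub>M Lap) (\<lambda>c. gap Q a (p, c))"
proof -
  interpret SL: prob_space "sh F \<one> \<Otimes>\<^sub>M Lap" by (rule prob_SL)
  assume "p \<in> space PN"
  then show ?thesis using gap_bounds by (intro SL.integrable_const_bound[where B=1] gap_section) auto
qed

lemma Gap_nonneg: "0 \<le> Gap Q a p"
  unfolding Gap_def by (intro integral_nonneg_AE) (simp add: gap_bounds)

lemma Gap_ennreal: "p \<in> space PN \<Longrightarrow> (\<integral>\<^sup>+c. ennreal (gap Q a (p, c)) \<partial>(sh F \<one> \<Otimes>\<^sub>M Lap)) = ennreal (Gap Q a p)"
  unfolding Gap_def by (rule nn_integral_eq_integral[OF gap_integrable]) (simp_all add: gap_bounds)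

lemma Gap_measurable[measurable]: "Gap Q a \<in> borel_measurable PN"
proof -
  interpret SL: prob_space "sh F \<one> \<Otimes>\<^sub>M Lap" by (rule prob_SL)
  have "(\<lambda>(p, c). gap Q a (p, c)) \<in> borel_measurable (PN \<Otimes>\<^sub>M (sh F \<one> \<Otimes>\<^sub>M Lap))" using gap_measurable by simp
  from SL.borel_measurable_lebesgue_integral[OF this] show ?thesis unfolding Gap_def[abs_def] .
qed

lemma Gap_le_1: "p \<in> space PN \<Longrightarrow> Gap Q a p \<le> 1"
proof -
  interpret SL: prob_space "sh F \<one> \<Otimes>\<^sub>M Lap" by (rule prob_SL)
  assume p: "p \<in> space PN"
  show ?thesis unfolding Gap_def by (rule SL.integral_le_const[OF gap_integrable[OF p]]) (simp add: gap_bounds)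
qed

lemma Gap_continuous:
  assumes c: "sections_continuous Q" and p: "p \<in> space PN"
  shows "continuous_on UNIV (\<lambda>a. Gap Q a p)"
proof (rule continuous_on_sequentiallyI)
  interpret SL: prob_space "sh F \<one> \<Otimes>\<^sub>M Lap" by (rule prob_SL)
  fix u :: "nat \<Rightarrow> real" and a assume u: "u \<longlonglongrightarrow> a"
  show "(\<lambda>n. Gap Q (u n) p) \<longlonglongrightarrow> Gap Q a p"
    unfolding Gap_def
  proof (rule integral_dominated_convergence[where w="\<lambda>_. 1"])
    show "AE c in sh F \<one> \<Otimes>\<^sub>M Lap. (\<lambda>n. gap Q (u n) (p, c)) \<longlonglongrightarrow> gap Q a (p, c)"
    proof (rule AE_I2)
      fix c :: "real \<times> real"
      obtain x y v t where e: "p = (x, y)" "c = (v, t)" by (cases p, cases c) auto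
      have "continuous_on UNIV (\<lambda>a. Q (x(\<one> := v), y, t + Dl \<one> a v (x \<one>)))"
        by (rule continuous_on_compose2[OF sections_continuousD[OF \<open>sections_continuous Q\<close>, of UNIV]]) (auto intro!: continuous_intros Dl_continuous)
      then have "continuous_on UNIV (\<lambda>a. gap Q a (p, c))"
        by (auto simp: gap_def e ungroup_def zb_def zeta_def intro!: continuous_intros)
      from continuous_on_tendsto_compose[OF this u] show "(\<lambda>n. gap Q (u n) (p, c)) \<longlonglongrightarrow> gap Q a (p, c)" by simp
    qed
    show "AE c in sh F \<one> \<Otimes>\<^sub>M Lap. norm (gap Q (u n) (p, c)) \<le> 1" for n using gap_bounds by simp
  qed (use gap_section[OF p] in auto)
qed

text \<open>Fubini gives the identity for almost every \<open>v\<close> and almost every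
  \<open>t\<close>; continuity of the sections upgrades the latter to every
  \<open>t\<close>.\<close>

lemma Gap_zero:
  assumes c: "sections_continuous Q" and p: "(x, y) \<in> space PN" and 0: "Gap Q a (x, y) = 0"
  shows "AE v in lborel. \<forall>t. Q (x(\<one> := v), y, t + Dl \<one> a v (x \<one>)) = Q (x, y, t)"
proof -
  interpret L: prob_space Lap by (rule prob_space_Lap)
  interpret S: prob_space "sh F \<one>" by (rule prob_sh)
  interpret SL: pair_sigma_finite "sh F \<one>" Lap ..
  have "(\<integral>\<^sup>+c. ennreal (gap Q a ((x, y), c)) \<partial>(sh F \<one> \<Otimes>\<^sub>M Lap)) = 0" using Gap_ennreal[OF p, of a] 0 by simp
  then have "AE c in sh F \<one> \<Otimes>\<^sub>M Lap. ennreal (gap Q a ((x, y), c)) = 0"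
    using gap_section[OF p] by (subst (asm) nn_integral_0_iff_AE) auto
  then have "AE c in sh F \<one> \<Otimes>\<^sub>M Lap. Q (x(\<one> := fst c), y, snd c + Dl \<one> a (fst c) (x \<one>)) = Q (x, y, snd c)"
  proof eventually_elim
    case (elim c)
    then have "gap Q a ((x, y), c) = 0" using gap_bounds by (simp add: antisym)
    then show ?case by (simp add: gap_def ungroup_def zb_def zeta_def)
  qed
  from SL.AE_pair[OF this] have "AE v in sh F \<one>. \<forall>t. Q (x(\<one> := v), y, t + Dl \<one> a v (x \<one>)) = Q (x, y, t)"
  proof eventually_elim
    case (elim v)
    then have "AE t in lborel. Q (x(\<one> := v), y, t + Dl \<one> a v (x \<one>)) = Q (x, y, t)" using AE_Lap by simp
    then show ?case using continuous_AE_eq[OF sections_continuous_shift[OF c] sections_continuousD[OF c]] by blast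
  qed
  then show ?thesis unfolding shifted_measure_def by (subst (asm) AE_density) (auto simp: pos)
qed

text \<open>Resampling relative to \<open>a\<close> and undoing it relative to \<open>a'\<close>
  restores the coordinate and leaves a translation by \<open>\<eta> v\<close>, which is therefore a
  period of the section. By \<open>ln_phi_diff_nonconstant\<close> the continuous function
  \<open>\<eta>\<close> is not constant, so the periods contain an interval.\<close>

lemma Gap_two_zeros:
  assumes c: "sections_continuous Q" and p: "(x, y) \<in> space PN" and a: "Gap Q a (x, y) = 0" and b': "Gap Q a' (x, y) = 0" and ne: "a \<noteq> a'"
  shows "Q (x, y, t) = Q (x, y, 0)"
proof -
  define \<eta> where "\<eta> = (\<lambda>v. Dl \<one> a v (x \<one>) - Dl \<one> a' v (x \<one>))"
  have \<eta>: "continuous_on UNIV \<eta>" unfolding \<eta>_def by (intro continuous_intros Dl_continuous)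
  have ae: "AE v in lborel. \<forall>t. Q (x, y, t + \<eta> v) = Q (x, y, t)"
    using Gap_zero[OF c p a] Gap_zero[OF c p b']
  proof eventually_elim
    case (elim v)
    show ?case
    proof
      fix t
      show "Q (x, y, t + \<eta> v) = Q (x, y, t)"
        using elim(1)[rule_format, of t] elim(2)[rule_format, of "t + \<eta> v"] by (simp add: \<eta>_def algebra_simps)
    qed
  qed
  have per: "Q (x, y, t + \<eta> v) = Q (x, y, t)" for t v
  proof (rule continuous_AE_eq[of "\<lambda>v. Q (x, y, t + \<eta> v)" "\<lambda>v. Q (x, y, t)"])
    show "continuous_on UNIV (\<lambda>v. Q (x, y, t + \<eta> v))"
      by (rule continuous_on_compose2[OF sections_continuousD[OF c, of UNIV]]) (auto intro!: continuous_intros \<eta>)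
    show "AE v in lborel. Q (x, y, t + \<eta> v) = Q (x, y, t)" using ae by eventually_elim simp
  qed simp
  obtain v where v: "ln (\<phi> (v + a)) - ln (\<phi> (v + a')) \<noteq> ln (\<phi> (x \<one> + a)) - ln (\<phi> (x \<one> + a'))"
    using ln_phi_diff_nonconstant[OF ne] by blast
  then have "\<eta> v \<noteq> \<eta> (x \<one>)" by (auto simp: \<eta>_def Dl_def)
  from continuous_periods_constant[OF \<eta>, of "\<lambda>t. Q (x, y, t)", OF per this] show ?thesis .
qed

end

text \<open>\<open>wt\<close> does not depend on the point of \<open>N\<close>, so that \<open>undefined\<close> is harmless.\<close>

definition k0 :: "nat \<Rightarrow> 'g \<Rightarrow> 'g \<Rightarrow> ('g \<Rightarrow> real) \<Rightarrow> real" where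
  "k0 n k l x = ker wt (Ks n) k l (x, undefined, 0)"

lemma k0_nonneg: "0 \<le> k0 n k l x" unfolding k0_def by (rule ker_wt_nonneg)

lemma k0_sum: "(\<Sum>k\<in>Ks n. \<Sum>l\<in>Ks n. k0 n k l x) = 1"
  unfolding k0_def by (rule ker_sum[OF wt_pos Ks(1,2)])

lemma k0_measurable[measurable]: "k0 n k l \<in> borel_measurable P"
  unfolding k0_def[abs_def] ker_def wt_def fst_conv snd_conv by measurable

lemma k0_le:
  assumes "k \<in> Ks n" "l \<in> Ks n"
  shows "k0 n k l x \<le> exp (2 * \<bar>t\<bar>) * ker wt (Ks n) k l (x, y, t)"
proof -
  have "k0 n k l x \<le> (exp \<bar>t\<bar>)\<^sup>2 * ker wt (Ks n) k l (x, y, t)"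
    unfolding k0_def
  proof (rule ker_le[OF wt_pos Ks assms])
    fix g
    show "wt g (x, undefined, 0) \<le> exp \<bar>t\<bar> * wt g (x, y, t)" using wt_compare[of g x x 0 0 t "\<bar>t\<bar>" undefined y] by simp
    show "wt g (x, y, t) \<le> exp \<bar>t\<bar> * wt g (x, undefined, 0)" using wt_compare[of g x x 0 t 0 "\<bar>t\<bar>" y undefined] by simp
  qed
  then show ?thesis by (simp add: exp_double)
qed

lemma k0_resample:
  assumes "\<And>g. g \<in> I \<Longrightarrow> \<bar>ln (om g x') - ln (om g x)\<bar> \<le> c" and kl: "k \<in> Ks n" "l \<in> Ks n"
  shows "k0 n k l x' \<le> (exp (2 * c))\<^sup>2 * k0 n k l x"
  unfolding k0_def
proof (rule ker_le[OF wt_pos Ks kl])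
  fix g assume g: "g \<in> I"
  show "wt g (x', undefined, 0) \<le> exp (2 * c) * wt g (x, undefined, 0)"
    using wt_compare[of g x' x c 0 0 0 undefined undefined] assms(1)[OF g] by simp
  show "wt g (x, undefined, 0) \<le> exp (2 * c) * wt g (x', undefined, 0)"
    using wt_compare[of g x x' c 0 0 0 undefined undefined] assms(1)[OF g] by simp
qed

definition mean_gap :: "(('g \<Rightarrow> real) \<times> 'y \<times> real \<Rightarrow> real) \<Rightarrow> nat \<Rightarrow> ('g \<Rightarrow> real) \<times> 'y \<Rightarrow> real" where
  "mean_gap Q n p = (\<Sum>k\<in>Ks n. \<Sum>l\<in>Ks n. k0 n k l (fst p) * Gap Q (F (k \<otimes> inv l)) p)"

text \<open>The weight \<open>k0\<close> depends on the Bernoulli point only and can be pulled out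
  of the integral over the fresh value and the real variable. That integral is then a
  \<open>Gap\<close>, and \<open>averaged_resampling\<close> at the coordinate \<open>\<one>\<close>
  bounds the sum.\<close>

lemma mean_gap_small:
  assumes Q: "maharam_invariant Q" and e: "e > 0"
  shows "\<forall>\<^sub>F n in sequentially. (\<integral>\<^sup>+p. ennreal (mean_gap Q n p) \<partial>PN) \<le> ennreal e"
  using averaged_resampling[OF Q one_closed e]
proof eventually_elim
  case (elim n)
  interpret SL: prob_space "sh F \<one> \<Otimes>\<^sub>M Lap" by (rule prob_SL)
  note [measurable] = Gap_measurable[OF Q] gap_measurable[OF Q]
  have "(\<integral>\<^sup>+p. ennreal (mean_gap Q n p) \<partial>PN)
      = (\<integral>\<^sup>+p. (\<Sum>k\<in>Ks n. \<Sum>l\<in>Ks n. ennreal (k0 n k l (fst p) * Gap Q (F (k \<otimes> inv l)) p)) \<partial>PN)"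
    unfolding mean_gap_def by (intro nn_integral_cong sum_sum_ennreal[symmetric] mult_nonneg_nonneg k0_nonneg Gap_nonneg[OF Q])
  also have "\<dots> = (\<Sum>k\<in>Ks n. \<Sum>l\<in>Ks n. \<integral>\<^sup>+p. ennreal (k0 n k l (fst p) * Gap Q (F (k \<otimes> inv l)) p) \<partial>PN)"
    by (rule nn_integral_double_sum) measurable
  also have "\<dots> \<le> (\<Sum>k\<in>Ks n. \<Sum>l\<in>Ks n. \<integral>\<^sup>+p. ennreal (ker wt (Ks n) k l (zb p)
      * \<bar>Q (zb p) - Q (zeta \<one> (F (k \<otimes> inv l \<otimes> \<one>)) p)\<bar>) \<partial>ZZ \<one>)"
  proof (intro sum_mono)
    fix k l assume kl: "k \<in> Ks n" "l \<in> Ks n"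
    then have kl1: "k \<otimes> inv l \<otimes> \<one> = k \<otimes> inv l" using Ks(3)[of n] by (intro r_one m_closed inv_closed) auto
    define a where "a = F (k \<otimes> inv l)"
    have fm: "(\<lambda>c. ennreal (k0 n k l (fst (fst c)) * gap Q a c)) \<in> borel_measurable (PN \<Otimes>\<^sub>M (sh F \<one> \<Otimes>\<^sub>M Lap))" by measurable
    have "(\<integral>\<^sup>+p. ennreal (k0 n k l (fst p) * Gap Q a p) \<partial>PN)
        = (\<integral>\<^sup>+p. \<integral>\<^sup>+c. ennreal (k0 n k l (fst p) * gap Q a (p, c)) \<partial>(sh F \<one> \<Otimes>\<^sub>M Lap) \<partial>PN)"
    proof (rule nn_integral_cong)
      fix p assume p: "p \<in> space PN"
      show "ennreal (k0 n k l (fst p) * Gap Q a p) = (\<integral>\<^sup>+c. ennreal (k0 n k l (fst p) * gap Q a (p, c)) \<partial>(sh F \<one> \<Otimes>\<^sub>M Lap))"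
        using gap_section[OF Q p] Gap_ennreal[OF Q p]
        by (simp add: ennreal_mult k0_nonneg gap_bounds[OF Q] Gap_nonneg[OF Q] nn_integral_cmult)
    qed
    also have "\<dots> = (\<integral>\<^sup>+p. ennreal (k0 n k l (fst (fst (regroup p))) * gap Q a (regroup p)) \<partial>ZZ \<one>)"
      using regroup_integral[OF fm] by simp
    also have "\<dots> \<le> (\<integral>\<^sup>+p. ennreal (ker wt (Ks n) k l (zb p) * \<bar>Q (zb p) - Q (zeta \<one> a p)\<bar>) \<partial>ZZ \<one>)"
    proof (intro nn_integral_mono ennreal_leI)
      fix p :: "(('g \<Rightarrow> real) \<times> real) \<times> 'y \<times> real"
      obtain x v y t where p: "p = ((x, v), y, t)" by (metis prod.collapse)
      have "k0 n k l x * exp (- 2 * \<bar>t\<bar>) \<le> exp (2 * \<bar>t\<bar>) * ker wt (Ks n) k l (x, y, t) * exp (- 2 * \<bar>t\<bar>)"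
        by (intro mult_right_mono k0_le kl) simp
      also have "\<dots> = ker wt (Ks n) k l (x, y, t) * (exp (2 * \<bar>t\<bar>) * exp (- 2 * \<bar>t\<bar>))" by (simp only: mult_ac)
      also have "exp (2 * \<bar>t\<bar>) * exp (- 2 * \<bar>t\<bar>) = 1" by (simp add: exp_add[symmetric])
      finally have "k0 n k l x * exp (- 2 * \<bar>t\<bar>) \<le> ker wt (Ks n) k l (x, y, t)" by simp
      then have "k0 n k l x * exp (- 2 * \<bar>t\<bar>) * \<bar>Q (zb p) - Q (zeta \<one> a p)\<bar> \<le> ker wt (Ks n) k l (x, y, t) * \<bar>Q (zb p) - Q (zeta \<one> a p)\<bar>"
        by (rule mult_right_mono) simp
      moreover have "fst (fst (regroup p)) = x" "snd (snd (regroup p)) = t" "zb p = (x, y, t)" by (simp_all add: p regroup_def zb_def)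
      ultimately show "k0 n k l (fst (fst (regroup p))) * gap Q a (regroup p) \<le> ker wt (Ks n) k l (zb p) * \<bar>Q (zb p) - Q (zeta \<one> a p)\<bar>"
        unfolding gap_def ungroup_regroup by (simp only: mult.assoc)
    qed
    finally show "(\<integral>\<^sup>+p. ennreal (k0 n k l (fst p) * Gap Q (F (k \<otimes> inv l)) p) \<partial>PN)
        \<le> (\<integral>\<^sup>+p. ennreal (ker wt (Ks n) k l (zb p) * \<bar>Q (zb p) - Q (zeta \<one> (F (k \<otimes> inv l \<otimes> \<one>)) p)\<bar>) \<partial>ZZ \<one>)"
      by (simp only: a_def kl1)
  qed
  also note elim
  finally show ?case .
qed

text \<open>Concentration of the shifts is a statement about a single point, so convergence in L1 is
  turned into almost sure convergence along a subsequence.\<close>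

lemma mean_gap_AE_subseq:
  assumes Q: "maharam_invariant Q"
  shows "\<exists>r :: nat \<Rightarrow> nat. strict_mono r \<and> (AE p in PN. (\<lambda>n. mean_gap Q (r n) p) \<longlonglongrightarrow> 0)"
proof (rule tendsto_L1_AE_subseq)
  interpret PN: prob_space "PN" by (rule prob_PN)
  note [measurable] = Gap_measurable[OF Q]
  have m: "mean_gap Q n \<in> borel_measurable PN" for n unfolding mean_gap_def[abs_def] by measurable
  have nn: "0 \<le> mean_gap Q n p" for n p unfolding mean_gap_def by (intro sum_nonneg mult_nonneg_nonneg k0_nonneg Gap_nonneg[OF Q])
  have le: "mean_gap Q n p \<le> 1" if "p \<in> space PN" for n p
  proof -
    have "mean_gap Q n p \<le> (\<Sum>k\<in>Ks n. \<Sum>l\<in>Ks n. k0 n k l (fst p) * 1)"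
      unfolding mean_gap_def by (intro sum_mono mult_left_mono k0_nonneg Gap_le_1[OF Q] that)
    then show ?thesis by (simp add: k0_sum)
  qed
  show i: "integrable PN (mean_gap Q n)" for n
    using nn le by (intro PN.integrable_const_bound[where B=1] m) auto
  show "(\<lambda>n. \<integral>p. norm (mean_gap Q n p) \<partial>PN) \<longlonglongrightarrow> 0"
  proof (rule LIMSEQ_I)
    fix e :: real assume e: "0 < e"
    from mean_gap_small[OF Q, of "e / 2"] e obtain n0 where n0: "\<And>n. n \<ge> n0 \<Longrightarrow> (\<integral>\<^sup>+p. ennreal (mean_gap Q n p) \<partial>PN) \<le> ennreal (e / 2)"
      unfolding eventually_sequentially by auto
    show "\<exists>no. \<forall>n\<ge>no. norm ((\<integral>p. norm (mean_gap Q n p) \<partial>PN) - 0) < e"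
    proof (intro exI[of _ n0] allI impI)
      fix n assume n: "n0 \<le> n"
      have "ennreal (\<integral>p. mean_gap Q n p \<partial>PN) \<le> ennreal (e / 2)"
        using n0[OF n] nn_integral_eq_integral[OF i] nn by simp
      then have "(\<integral>p. mean_gap Q n p \<partial>PN) \<le> e / 2" using e by (subst (asm) ennreal_le_iff) auto
      then show "norm ((\<integral>p. norm (mean_gap Q n p) \<partial>PN) - 0) < e"
        using e nn by (simp add: integral_nonneg_AE)
    qed
  qed
qed

end

section \<open>Concentration of the shifts at a constant\<close>

context bernoulli_growth
begin

definition concentrates :: "(nat \<Rightarrow> nat) \<Rightarrow> ('g \<Rightarrow> real) \<Rightarrow> real \<Rightarrow> bool" where
  "concentrates r x a \<longleftrightarrow> (\<lambda>n. \<Sum>k\<in>Ks (r n). \<Sum>l\<in>Ks (r n). k0 (r n) k l x * \<bar>F (k \<otimes> inv l) - a\<bar>) \<longlonglongrightarrow> 0"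

text \<open>A measurable choice of the point of concentration, depending on the Bernoulli point
  only.\<close>

definition barycentre :: "(nat \<Rightarrow> nat) \<Rightarrow> ('g \<Rightarrow> real) \<Rightarrow> real" where
  "barycentre r x = lim (\<lambda>n. \<Sum>k\<in>Ks (r n). \<Sum>l\<in>Ks (r n). k0 (r n) k l x * F (k \<otimes> inv l))"

lemma barycentre_measurable[measurable]: "barycentre r \<in> borel_measurable P"
  unfolding barycentre_def[abs_def] by measurable

lemma concentrates_barycentre:
  assumes "concentrates r x a"
  shows "barycentre r x = a"
  unfolding barycentre_def
proof (rule limI, rule LIM_zero_cancel, rule Lim_null_comparison[OF always_eventually, rule_format])
  let ?S = "\<lambda>n f. \<Sum>k\<in>Ks (r n). \<Sum>l\<in>Ks (r n). k0 (r n) k l x * f k l"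
  show "norm (?S n (\<lambda>k l. F (k \<otimes> inv l)) - a) \<le> ?S n (\<lambda>k l. \<bar>F (k \<otimes> inv l) - a\<bar>)" for n
  proof -
    have "?S n (\<lambda>k l. F (k \<otimes> inv l)) - a = ?S n (\<lambda>k l. F (k \<otimes> inv l)) - ?S n (\<lambda>k l. a)"
      by (simp only: sum_distrib_right[symmetric] k0_sum mult_1)
    also have "\<dots> = ?S n (\<lambda>k l. F (k \<otimes> inv l) - a)"
      by (simp only: sum_subtractf[symmetric] right_diff_distrib)
    finally have e: "?S n (\<lambda>k l. F (k \<otimes> inv l)) - a = ?S n (\<lambda>k l. F (k \<otimes> inv l) - a)" .
    have "\<bar>?S n (\<lambda>k l. F (k \<otimes> inv l) - a)\<bar> \<le> (\<Sum>k\<in>Ks (r n). \<Sum>l\<in>Ks (r n). \<bar>k0 (r n) k l x * (F (k \<otimes> inv l) - a)\<bar>)"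
      by (intro order_trans[OF sum_abs] sum_mono sum_abs)
    then show ?thesis unfolding e by (simp add: abs_mult k0_nonneg)
  qed
  show "(\<lambda>n. ?S n (\<lambda>k l. \<bar>F (k \<otimes> inv l) - a\<bar>)) \<longlonglongrightarrow> 0" using assms by (simp add: concentrates_def)
qed

text \<open>The weights at the two points are comparable with a factor that does not depend on
  \<open>n\<close>.\<close>

lemma concentrates_resample:
  assumes c: "concentrates r x a" and le: "\<And>g. g \<in> I \<Longrightarrow> \<bar>ln (om g x') - ln (om g x)\<bar> \<le> d"
  shows "concentrates r x' a"
  unfolding concentrates_def
proof (rule Lim_null_comparison[OF always_eventually, rule_format])
  let ?S = "\<lambda>n x. \<Sum>k\<in>Ks (r n). \<Sum>l\<in>Ks (r n). k0 (r n) k l x * \<bar>F (k \<otimes> inv l) - a\<bar>"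
  define D where "D = (exp (2 * d))\<^sup>2"
  show "norm (?S n x') \<le> D * ?S n x" for n
  proof -
    have "?S n x' \<le> (\<Sum>k\<in>Ks (r n). \<Sum>l\<in>Ks (r n). D * k0 (r n) k l x * \<bar>F (k \<otimes> inv l) - a\<bar>)"
      unfolding D_def by (intro sum_mono mult_right_mono k0_resample le) auto
    also have "\<dots> = D * ?S n x" by (simp only: sum_distrib_left mult.assoc)
    moreover have "0 \<le> ?S n x'" by (intro sum_nonneg mult_nonneg_nonneg k0_nonneg) simp
    ultimately show ?thesis by simp
  qed
  show "(\<lambda>n. D * ?S n x) \<longlonglongrightarrow> 0" using tendsto_mult[OF tendsto_const c[unfolded concentrates_def], of D] by simp
qed

text \<open>Resampling one coordinate does not move the point of concentration, so by the zero-one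
  law the barycentre depends on the point of \<open>N\<close> alone. By construction it does not
  depend on that point either.\<close>

lemma barycentre_constant:
  assumes c: "AE x in P. \<exists>a. concentrates r x a \<and> \<bar>a\<bar> \<le> K"
  shows "\<exists>C. \<bar>C\<bar> \<le> K \<and> (AE x in P. barycentre r x = C)"
proof -
  interpret N: prob_space N by (rule prob_N)
  interpret PN: pair_sigma_finite P N ..
  interpret PNp: prob_space "PN" by (rule prob_PN)
  have K0: "0 \<le> K" by (rule K_nonneg)
  \<comment> \<open>Clamps to \<open>[-K, K]\<close> and rescales into \<open>[0, 1]\<close>, as the
    zero-one law requires. The denominator \<open>2 * K + 1\<close> stays positive for
    \<open>K = 0\<close>.\<close>
  define cl where "cl = (\<lambda>s. (max (- K) (min K s) + K) / (2 * K + 1))"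
  have cl01: "0 \<le> cl s" "cl s \<le> 1" for s using K0 by (auto simp: cl_def field_simps)
  have cl_inv: "s = cl s * (2 * K + 1) - K" if "\<bar>s\<bar> \<le> K" for s using that K0 by (auto simp: cl_def)
  define q where "q = (\<lambda>p :: ('g \<Rightarrow> real) \<times> 'y. cl (barycentre r (fst p)))"
  have qm: "q \<in> borel_measurable PN" unfolding q_def cl_def by measurable
  have inv: "AE p in (P \<Otimes>\<^sub>M sh F h) \<Otimes>\<^sub>M N. q ((fst (fst p))(h := snd (fst p)), snd p) = q (fst (fst p), snd p)" if h: "h \<in> I" for h
  proof -
    have "AE w in P \<Otimes>\<^sub>M sh F h. \<forall>g\<in>I. ln (om g ((fst w)(h := snd w))) - ln (om g (fst w)) = ln (rat g h (snd w)) - ln (rat g h (fst w h))"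
      using ln_om_local[OF _ h] by (subst AE_ball_countable[OF countable_G]) blast
    with AE_fst[OF prob_sh c, of F h] have "AE w in P \<Otimes>\<^sub>M sh F h. barycentre r ((fst w)(h := snd w)) = barycentre r (fst w)"
    proof eventually_elim
      case (elim w)
      obtain a where a: "concentrates r (fst w) a" using elim(1) by blast
      obtain d where d: "\<And>u a. \<bar>u\<bar> \<le> max \<bar>snd w\<bar> \<bar>fst w h\<bar> \<Longrightarrow> \<bar>a\<bar> \<le> K \<Longrightarrow> \<bar>ln (\<phi> (u + a))\<bar> \<le> d"
        using ln_phi_bound by blast
      have "concentrates r ((fst w)(h := snd w)) a"
      proof (rule concentrates_resample[OF a])
        fix g assume g: "g \<in> I"
        have gh: "g \<otimes> h \<in> I" using g h by simp
        show "\<bar>ln (om g ((fst w)(h := snd w))) - ln (om g (fst w))\<bar> \<le> 4 * d"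
          unfolding bspec[OF elim(2) g] ln_rat
          using d[of "snd w" "F (g \<otimes> h)"] d[of "snd w" "F h"] d[of "fst w h" "F (g \<otimes> h)"] d[of "fst w h" "F h"] F_bound[OF gh] F_bound[OF h] by simp
      qed
      then show ?case using concentrates_barycentre a by simp
    qed
    from AE_fst[OF prob_N this] show ?thesis by eventually_elim (simp add: q_def)
  qed
  have "AE p in PN. q p = (\<integral>x. q (x, snd p) \<partial>P)"
    by (rule PP.resampling_zero_one_law[OF prob_N qm _ _ inv]) (simp_all add: q_def cl01)
  then have "AE p in PN. cl (barycentre r (fst p)) = (\<integral>x. cl (barycentre r x) \<partial>P)" by (simp add: q_def)
  from PN.AE_pair[OF this] have ae: "AE x in P. cl (barycentre r x) = (\<integral>x. cl (barycentre r x) \<partial>P)" by simp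
  define C where "C = (\<integral>x. cl (barycentre r x) \<partial>P) * (2 * K + 1) - K"
  have aeC: "AE x in P. barycentre r x = C \<and> \<bar>barycentre r x\<bar> \<le> K"
    using ae c
  proof eventually_elim
    case (elim x)
    then have "\<bar>barycentre r x\<bar> \<le> K" using concentrates_barycentre by blast
    from cl_inv[OF this] this show ?case unfolding elim(1) C_def by simp
  qed
  then have "AE x in P. \<bar>C\<bar> \<le> K" by eventually_elim auto
  then have "\<bar>C\<bar> \<le> K" by simp
  with aeC show ?thesis by (auto elim: eventually_mono)
qed

text \<open>The set of points of \<open>PN\<close> with constant section is invariant, hence null or
  conull. If it is null, almost every point has at most one zero of \<open>Gap\<close>; the shifts
  concentrate at this zero, and it is the same constant \<open>C\<close> almost everywhere. This
  settles the coordinate \<open>\<one>\<close>, and equivariance yields the other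
  coordinates.\<close>

theorem resample_dichotomy:
  assumes Q: "maharam_invariant Q" and c: "sections_continuous Q" and erg: "ergodic G N b"
  shows "(AE p in PN. \<forall>t. Q (fst p, snd p, t) = Q (fst p, snd p, 0)) \<or>
    (\<exists>C. \<bar>C\<bar> \<le> K \<and> (\<forall>h\<in>I. AE p in ZZ h. Q (zeta h C p) = Q (zb p)))"
proof -
  interpret N: prob_space N by (rule prob_N)
  interpret PN: pair_sigma_finite P N ..
  define V where "V = {p \<in> space PN. \<forall>t. Q (fst p, snd p, t) = Q (fst p, snd p, 0)}"
  have V: "V \<in> sets PN" unfolding V_def by (rule constant_sections_measurable[OF Q c])
  have "AE p in PN. diag g p \<in> V \<longleftrightarrow> p \<in> V" if g: "g \<in> I" for g
    using constant_sections_invariant[OF Q c g] AE_space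
  proof eventually_elim
    case (elim p)
    then show ?case using measurable_space[OF diag_measurable[OF g] elim(2)] by (simp add: V_def)
  qed
  from ergodic_diag[OF erg V this] show ?thesis
  proof
    assume "AE p in PN. p \<in> V"
    then show ?thesis by (auto simp: V_def elim!: eventually_mono)
  next
    assume nV: "AE p in PN. p \<notin> V"
    obtain r where r: "strict_mono r" and lim: "AE p in PN. (\<lambda>n. mean_gap Q (r n) p) \<longlonglongrightarrow> 0"
      using mean_gap_AE_subseq[OF Q] by blast
    have main: "AE p in PN. \<exists>a. \<bar>a\<bar> \<le> K \<and> Gap Q a p = 0 \<and> concentrates r (fst p) a"
      using nV lim AE_space
    proof eventually_elim
      case (elim p)
      obtain x y where p: "p = (x, y)" by (cases p)
      have "\<exists>a\<in>{-K..K}. Gap Q a p = 0 \<and>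
        (\<lambda>n. \<Sum>i\<in>Ks (r n) \<times> Ks (r n). k0 (r n) (fst i) (snd i) x * \<bar>F (fst i \<otimes> inv (snd i)) - a\<bar>) \<longlonglongrightarrow> 0"
      proof (rule weights_concentrate[OF K_nonneg])
        show "0 \<le> k0 (r n) (fst i) (snd i) x" for n i by (rule k0_nonneg)
        show "(\<Sum>i\<in>Ks (r n) \<times> Ks (r n). k0 (r n) (fst i) (snd i) x) = 1" for n
          using k0_sum[of "r n" x] by (simp add: sum.cartesian_product split_beta)
        show "F (fst i \<otimes> inv (snd i)) \<in> {-K..K}" if "i \<in> Ks (r n) \<times> Ks (r n)" for n i
        proof -
          have "fst i \<otimes> inv (snd i) \<in> I" using that Ks(3)[of "r n"] by (intro m_closed inv_closed) auto
          from F_bound[OF this] show ?thesis by auto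
        qed
        show "continuous_on {-K..K} (\<lambda>a. Gap Q a p)" by (rule continuous_on_subset[OF Gap_continuous[OF Q c elim(3)]]) simp
        show "0 \<le> Gap Q a p" for a by (rule Gap_nonneg[OF Q])
        show "a = a'" if "Gap Q a p = 0" "Gap Q a' p = 0" for a a'
        proof (rule ccontr)
          assume "a \<noteq> a'"
          then have "Q (x, y, t) = Q (x, y, 0)" for t
            using Gap_two_zeros[OF Q c, of x y a a' t] that elim(3) by (simp add: p)
          then have "\<forall>t. Q (fst p, snd p, t) = Q (fst p, snd p, 0)" by (simp only: p fst_conv snd_conv) blast
          with elim(1,3) show False by (simp add: V_def)
        qed
        show "(\<lambda>n. \<Sum>i\<in>Ks (r n) \<times> Ks (r n). k0 (r n) (fst i) (snd i) x * Gap Q (F (fst i \<otimes> inv (snd i))) p) \<longlonglongrightarrow> 0"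
          using elim(2) by (simp add: mean_gap_def sum.cartesian_product split_beta p)
      qed
      then obtain a where "a \<in> {-K..K}" "Gap Q a p = 0" "concentrates r x a"
        by (auto simp: concentrates_def sum.cartesian_product split_beta)
      then show ?case unfolding p by (intro exI[of _ a]) auto
    qed
    have "AE x in P. AE y in N. \<exists>a. concentrates r x a \<and> \<bar>a\<bar> \<le> K"
      using PN.AE_pair[OF main]
    proof eventually_elim
      case (elim x)
      then show ?case by eventually_elim auto
    qed
    then have cx: "AE x in P. \<exists>a. concentrates r x a \<and> \<bar>a\<bar> \<le> K" by simp
    obtain C where C: "\<bar>C\<bar> \<le> K" and aeC: "AE x in P. barycentre r x = C" using barycentre_constant[OF cx] by blast
    have G0: "AE p in PN. Gap Q C p = 0"
      using main AE_fst[OF prob_N aeC]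
    proof eventually_elim
      case (elim p)
      then show ?case using concentrates_barycentre by blast
    qed
    have fm: "(\<lambda>z. ennreal (gap Q C z)) \<in> borel_measurable (PN \<Otimes>\<^sub>M (sh F \<one> \<Otimes>\<^sub>M Lap))"
      using gap_measurable[OF Q] by measurable
    have "(\<integral>\<^sup>+p. ennreal (gap Q C (regroup p)) \<partial>ZZ \<one>) = (\<integral>\<^sup>+p. ennreal (Gap Q C p) \<partial>PN)"
      unfolding regroup_integral[OF fm] by (intro nn_integral_cong Gap_ennreal[OF Q])
    also have "\<dots> = 0" using G0 Gap_measurable[OF Q] by (subst nn_integral_0_iff_AE) (auto elim!: eventually_mono)
    finally have "AE p in ZZ \<one>. ennreal (gap Q C (regroup p)) = 0"
      using measurable_compose[OF regroup_measurable fm] by (subst (asm) nn_integral_0_iff_AE) auto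
    then have "AE p in ZZ \<one>. Q (zeta \<one> C p) = Q (zb p)"
    proof eventually_elim
      case (elim p)
      then have "gap Q C (regroup p) = 0" using gap_bounds[OF Q] by (simp add: antisym)
      then show ?case by (simp add: gap_def)
    qed
    then show ?thesis using resample_invariance_all[OF Q C] C by blast
  qed
qed

end

section \<open>Bessel's inequality for functions of single coordinates\<close>

context product_prob_space
begin

lemma integral_resample:
  fixes f :: "('i \<Rightarrow> 'a) \<Rightarrow> real"
  assumes h: "h \<in> I" and f[measurable]: "f \<in> borel_measurable (PiM I M)" and B: "\<And>x. \<bar>f x\<bar> \<le> B"
  shows "(\<integral>x. f x \<partial>PiM I M) = (\<integral>u. \<integral>x. f (x(h := u)) \<partial>PiM I M \<partial>M h)"
proof -
  interpret PM: pair_prob_space "PiM I M" "M h" ..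
  note [measurable] = measurable_resample[OF h]
  have "(\<integral>x. f x \<partial>PiM I M) = (\<integral>p. f ((fst p)(h := snd p)) \<partial>(PiM I M \<Otimes>\<^sub>M M h))"
    using integral_distr[OF measurable_resample[OF h] f] by (simp add: distr_resample[OF h])
  also have "\<dots> = (\<integral>u. \<integral>x. f (x(h := u)) \<partial>PiM I M \<partial>M h)"
    using PM.integral_snd[of "\<lambda>x u. f (x(h := u))"] B
    by (simp add: split_beta' PM.P.integrable_const_bound[where B=B])
  finally show ?thesis .
qed

text \<open>The conditional means of \<open>q\<close> given single coordinates, once centred, are
  pairwise orthogonal, and the inner product of \<open>q\<close> with each of them is its squared
  norm \<open>V h\<close>. Expanding the nonnegative integral of the square of \<open>q\<close>
  minus their sum gives the bound.\<close>

lemma bessel_single_coordinates: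
  fixes q :: "('i \<Rightarrow> 'a) \<Rightarrow> real"
  assumes q[measurable]: "q \<in> borel_measurable (PiM I M)" and q01: "\<And>x. 0 \<le> q x" "\<And>x. q x \<le> 1" and A: "finite A" "A \<subseteq> I"
  shows "(\<Sum>h\<in>A. \<integral>u. ((\<integral>x. q (x(h := u)) \<partial>PiM I M) - (\<integral>x. q x \<partial>PiM I M))\<^sup>2 \<partial>M h) \<le> 1"
proof -
  define \<psi> where "\<psi> = (\<lambda>h u. \<integral>x. q (x(h := u)) \<partial>PiM I M)"
  define \<mu> where "\<mu> = (\<integral>x. q x \<partial>PiM I M)"
  define \<zeta> where "\<zeta> = (\<lambda>h x. \<psi> h (x h) - \<mu>)"
  define V where "V = (\<lambda>h. \<integral>u. (\<psi> h u - \<mu>)\<^sup>2 \<partial>M h)"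
  have le1: "0 \<le> (\<integral>x. f x \<partial>PiM I M)" "(\<integral>x. f x \<partial>PiM I M) \<le> 1" if "\<And>x. 0 \<le> f x" "\<And>x. f x \<le> (1::real)" for f
  proof -
    show "0 \<le> (\<integral>x. f x \<partial>PiM I M)" using that by simp
    show "(\<integral>x. f x \<partial>PiM I M) \<le> 1"
      by (cases "integrable (PiM I M) f") (use that in \<open>auto intro!: P.integral_le_const simp: not_integrable_integral_eq\<close>)
  qed
  have \<psi>01: "0 \<le> \<psi> h u" "\<psi> h u \<le> 1" and \<mu>01: "0 \<le> \<mu>" "\<mu> \<le> 1" for h u unfolding \<psi>_def \<mu>_def by (intro le1 q01)+
  have \<psi>m[measurable]: "\<psi> h \<in> borel_measurable (M h)" if h: "h \<in> I" for h
  proof -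
    have "(\<lambda>p. q ((snd p)(h := fst p))) \<in> borel_measurable (M h \<Otimes>\<^sub>M PiM I M)"
      using measurable_compose[OF measurable_compose[OF _ measurable_resample[OF h]] q, of "\<lambda>p. (snd p, fst p)"] by simp
    then show ?thesis unfolding \<psi>_def by (intro P.borel_measurable_lebesgue_integral) (simp add: split_beta')
  qed
  have \<zeta>m[measurable]: "\<zeta> h \<in> borel_measurable (PiM I M)" if "h \<in> I" for h
    unfolding \<zeta>_def using that by measurable
  have \<zeta>1: "\<bar>\<zeta> h x\<bar> \<le> 1" for h x unfolding \<zeta>_def using \<psi>01[of h "x h"] \<mu>01 by (simp add: abs_le_iff)
  have \<psi>i: "integrable (M h) (\<lambda>u. \<psi> h u)" if "h \<in> I" for h
    using that \<psi>01 by (intro M.integrable_const_bound[where B=1]) auto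
  have \<psi>\<mu>: "(\<integral>u. \<psi> h u - \<mu> \<partial>M h) = 0" if h: "h \<in> I" for h
    using integral_resample[OF h q, of 1] q01 \<psi>i[OF h] by (simp add: \<psi>_def \<mu>_def[symmetric] M.prob_space)
  have ib: "integrable (PiM I M) f" if "f \<in> borel_measurable (PiM I M)" "\<And>x. \<bar>f x\<bar> \<le> 1" for f :: "('i \<Rightarrow> 'a) \<Rightarrow> real"
    using that by (intro P.integrable_const_bound[where B=1]) auto
  have prod1: "\<bar>a * b\<bar> \<le> 1" if "\<bar>a\<bar> \<le> 1" "\<bar>b\<bar> \<le> 1" for a b :: real
    using mult_le_one[OF that(1) _ that(2)] by (simp add: abs_mult)
  have q1: "\<bar>q x\<bar> \<le> 1" for x using q01 by simp
  have zz: "(\<integral>x. \<zeta> h x * \<zeta> k x \<partial>PiM I M) = (if h = k then V h else 0)" if hk: "h \<in> I" "k \<in> I" for h k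
  proof -
    have "(\<integral>x. \<zeta> h x * \<zeta> k x \<partial>PiM I M) = (\<integral>u. \<integral>x. \<zeta> h (x(h := u)) * \<zeta> k (x(h := u)) \<partial>PiM I M \<partial>M h)"
      using hk by (intro integral_resample[where B=1] prod1 \<zeta>1) measurable
    also have "\<dots> = (if h = k then V h else 0)"
    proof (cases "h = k")
      case True then show ?thesis by (simp add: \<zeta>_def V_def power2_eq_square P.prob_space)
    next
      case False
      then have "\<zeta> h (x(h := u)) * \<zeta> k (x(h := u)) = (\<psi> h u - \<mu>) * \<zeta> k x" for x u by (simp add: \<zeta>_def)
      then show ?thesis using False \<psi>\<mu>[OF hk(1)] by simp
    qed
    finally show ?thesis .
  qed
  have qz: "(\<integral>x. q x * \<zeta> h x \<partial>PiM I M) = V h" if h: "h \<in> I" for h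
  proof -
    have "(\<integral>x. q x * \<zeta> h x \<partial>PiM I M) = (\<integral>u. \<integral>x. q (x(h := u)) * \<zeta> h (x(h := u)) \<partial>PiM I M \<partial>M h)"
      using h by (intro integral_resample[where B=1] prod1 \<zeta>1 q1) measurable
    also have "\<dots> = (\<integral>u. (\<psi> h u - \<mu>)\<^sup>2 + \<mu> * (\<psi> h u - \<mu>) \<partial>M h)"
    proof (rule Bochner_Integration.integral_cong[OF refl])
      fix u
      have "(\<integral>x. q (x(h := u)) * \<zeta> h (x(h := u)) \<partial>PiM I M) = (\<integral>x. q (x(h := u)) \<partial>PiM I M) * (\<psi> h u - \<mu>)" by (simp add: \<zeta>_def)
      then have e: "(\<integral>x. q (x(h := u)) * \<zeta> h (x(h := u)) \<partial>PiM I M) = \<psi> h u * (\<psi> h u - \<mu>)" by (simp only: \<psi>_def)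
      show "(\<integral>x. q (x(h := u)) * \<zeta> h (x(h := u)) \<partial>PiM I M) = (\<psi> h u - \<mu>)\<^sup>2 + \<mu> * (\<psi> h u - \<mu>)"
        unfolding e by (simp add: power2_eq_square algebra_simps)
    qed
    also have "\<dots> = V h + \<mu> * (\<integral>u. \<psi> h u - \<mu> \<partial>M h)"
      unfolding V_def
    proof (subst Bochner_Integration.integral_add)
      have "(\<psi> h u - \<mu>)\<^sup>2 \<le> 1" for u using \<psi>01[of h u] \<mu>01 by (simp add: abs_square_le_1 abs_le_iff)
      then show "integrable (M h) (\<lambda>u. (\<psi> h u - \<mu>)\<^sup>2)" using h by (intro M.integrable_const_bound[where B=1]) auto
    qed (use \<psi>i[OF h] in auto)
    finally show ?thesis using \<psi>\<mu>[OF h] by simp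
  qed
  define S where "S = (\<lambda>x. \<Sum>h\<in>A. \<zeta> h x)"
  have AI: "h \<in> I" if "h \<in> A" for h using A(2) that by blast
  have iqz: "integrable (PiM I M) (\<lambda>x. q x * \<zeta> h x)" if "h \<in> A" for h
    using AI[OF that] by (intro ib prod1 \<zeta>1 q1) measurable
  have izz: "integrable (PiM I M) (\<lambda>x. \<zeta> h x * \<zeta> k x)" if "h \<in> A" "k \<in> A" for h k
    using AI[OF that(1)] AI[OF that(2)] by (intro ib prod1 \<zeta>1) measurable
  have iqq: "integrable (PiM I M) (\<lambda>x. q x * q x)" by (intro ib prod1 q1) measurable
  have "(\<integral>x. (\<Sum>h\<in>A. q x * \<zeta> h x) \<partial>PiM I M) = (\<Sum>h\<in>A. V h)"
    using iqz by (subst Bochner_Integration.integral_sum) (auto simp: qz AI)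
  moreover have "(\<integral>x. (\<Sum>h\<in>A. \<Sum>k\<in>A. \<zeta> h x * \<zeta> k x) \<partial>PiM I M) = (\<Sum>h\<in>A. V h)"
  proof -
    have "(\<integral>x. (\<Sum>h\<in>A. \<Sum>k\<in>A. \<zeta> h x * \<zeta> k x) \<partial>PiM I M) = (\<Sum>h\<in>A. \<Sum>k\<in>A. \<integral>x. \<zeta> h x * \<zeta> k x \<partial>PiM I M)"
      using izz by (simp add: Bochner_Integration.integral_sum)
    also have "\<dots> = (\<Sum>h\<in>A. \<Sum>k\<in>A. if h = k then V h else 0)" using AI by (intro sum.cong refl zz) auto
    finally show ?thesis using A(1) by (simp add: sum.delta)
  qed
  moreover have "(\<integral>x. q x * q x - 2 * (\<Sum>h\<in>A. q x * \<zeta> h x) + (\<Sum>h\<in>A. \<Sum>k\<in>A. \<zeta> h x * \<zeta> k x) \<partial>PiM I M)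
    = (\<integral>x. q x * q x \<partial>PiM I M) - 2 * (\<integral>x. (\<Sum>h\<in>A. q x * \<zeta> h x) \<partial>PiM I M) + (\<integral>x. (\<Sum>h\<in>A. \<Sum>k\<in>A. \<zeta> h x * \<zeta> k x) \<partial>PiM I M)"
    using iqq iqz izz by (subst Bochner_Integration.integral_add, simp, simp, subst Bochner_Integration.integral_diff) auto
  moreover have "0 \<le> (\<integral>x. q x * q x - 2 * (\<Sum>h\<in>A. q x * \<zeta> h x) + (\<Sum>h\<in>A. \<Sum>k\<in>A. \<zeta> h x * \<zeta> k x) \<partial>PiM I M)"
  proof (rule integral_nonneg_AE, rule AE_I2)
    fix x
    have "(\<Sum>h\<in>A. q x * \<zeta> h x) = q x * S x" "(\<Sum>h\<in>A. \<Sum>k\<in>A. \<zeta> h x * \<zeta> k x) = S x * S x"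
      by (simp add: S_def sum_distrib_left) (simp only: S_def sum_product)
    then have "q x * q x - 2 * (\<Sum>h\<in>A. q x * \<zeta> h x) + (\<Sum>h\<in>A. \<Sum>k\<in>A. \<zeta> h x * \<zeta> k x) = (q x - S x)\<^sup>2"
      by (simp add: power2_eq_square algebra_simps)
    then show "0 \<le> q x * q x - 2 * (\<Sum>h\<in>A. q x * \<zeta> h x) + (\<Sum>h\<in>A. \<Sum>k\<in>A. \<zeta> h x * \<zeta> k x)" by simp
  qed
  moreover have "(\<integral>x. q x * q x \<partial>PiM I M) \<le> 1" using q01 by (intro le1) (auto intro: mult_le_one)
  ultimately show ?thesis by (simp add: V_def \<psi>_def \<mu>_def)
qed

end

context bernoulli_growth
begin

lemma integral_PN_continuous:
  assumes m: "\<And>t. (\<lambda>p. f p t) \<in> borel_measurable PN" and b1: "\<And>p t. \<bar>f p t\<bar> \<le> (1::real)"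
    and c: "\<And>p. continuous_on UNIV (f p)"
  shows "continuous_on UNIV (\<lambda>t::real. \<integral>p. f p t \<partial>PN)"
proof (rule continuous_on_sequentiallyI)
  interpret PN: prob_space "PN" by (rule prob_PN)
  fix u :: "nat \<Rightarrow> real" and a assume u: "u \<longlonglongrightarrow> a"
  show "(\<lambda>n. \<integral>p. f p (u n) \<partial>PN) \<longlonglongrightarrow> (\<integral>p. f p a \<partial>PN)"
  proof (rule integral_dominated_convergence[where w="\<lambda>_. 1"])
    show "AE p in PN. (\<lambda>n. f p (u n)) \<longlonglongrightarrow> f p a"
      using continuous_on_tendsto_compose[OF c u] by simp
  qed (use m b1 in auto)
qed

end

text \<open>Integration against a test function \<open>w\<close> turns \<open>Q\<close> into a
  function of the real variable alone. As \<open>w\<close> only involves the finite set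
  \<open>B\<close>, Bessel's inequality is available at all coordinates outside \<open>B\<close>,
  and finitely many coordinates do not affect summability.\<close>

locale resample_invariant = bernoulli_growth \<phi> \<kappa> G F K N b Ks rad \<delta>
  for \<phi> :: "real \<Rightarrow> real" and \<kappa> :: real and G :: "('g, 'b) monoid_scheme" (structure) and F and K
    and N :: "'y measure" and b and Ks and rad and \<delta> +
  fixes Q :: "('g \<Rightarrow> real) \<times> 'y \<times> real \<Rightarrow> real" and C :: real
    and w :: "('g \<Rightarrow> real) \<times> 'y \<Rightarrow> real" and B :: "'g set"
  assumes Q: "maharam_invariant Q" and cQ: "sections_continuous Q" and C: "\<bar>C\<bar> \<le> K"
    and resample_Q: "h \<in> carrier G \<Longrightarrow> AE p in ZZ h. Q (zeta h C p) = Q (zb p)"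
    and w[measurable]: "w \<in> borel_measurable PN" and w01: "0 \<le> w p" "w p \<le> 1"
    and B: "finite B" "B \<subseteq> carrier G" and w_local: "depends_on (space P) B w"
begin

text \<open>The log-likelihood ratio between the shifts \<open>C + a\<close> and \<open>C\<close>.
  The resampling \<open>zeta h C\<close> from \<open>u\<close> to \<open>v\<close> translates the
  real variable by \<open>D h v - D h u\<close>.\<close>

definition lr :: "real \<Rightarrow> real \<Rightarrow> real" where
  "lr a u = ln (\<phi> (u + (C + a))) - ln (\<phi> (u + C))"

abbreviation "D h \<equiv> lr (F h - C)"

definition psi :: "real \<Rightarrow> real" where "psi t = (\<integral>p. Q (fst p, snd p, t) * w p \<partial>PN)"

definition psih :: "'g \<Rightarrow> real \<Rightarrow> real \<Rightarrow> real" where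
  "psih h u t = (\<integral>p. Q ((fst p)(h := u), snd p, t) * w p \<partial>PN)"

text \<open>The common translate: by \<open>psih_shift\<close>, every \<open>psih h u\<close> is
  \<open>kap h\<close> translated by \<open>D h u\<close>.\<close>

definition kap :: "'g \<Rightarrow> real \<Rightarrow> real" where
  "kap h t = (\<integral>p. Q (fst p, snd p, t + D h (fst p h)) * w p \<partial>PN)"

lemma Qw01: "0 \<le> Q z * w p" "Q z * w p \<le> 1" "\<bar>Q z * w p\<bar> \<le> 1"
  using maharam_invariantD(2,3)[OF Q, of z] w01[of p] mult_le_one[of "Q z" "w p"] by auto

lemma Q_measurable[measurable]: "Q \<in> borel_measurable Z" by (rule maharam_invariantD(1)[OF Q])

lemma lr_continuous: "continuous_on UNIV (\<lambda>p. lr (fst p) (snd p))"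
  unfolding lr_def by (intro continuous_intros continuous_on_compose2[OF continuous_ln_phi]) auto

lemma lr_measurable[measurable]: "lr a \<in> borel_measurable borel"
  unfolding lr_def[abs_def] using phi_measurable2 by measurable

lemma upd_measurable: "h \<in> I \<Longrightarrow> f \<in> measurable M' P \<Longrightarrow> g \<in> borel_measurable M' \<Longrightarrow> (\<lambda>z. (f z)(h := g z)) \<in> measurable M' P"
  using measurable_compose[OF _ PP.measurable_resample[of h], of "\<lambda>z. (f z, g z)" M'] by (simp cong: measurable_cong_sets)

lemma psi_continuous: "continuous_on UNIV psi"
  unfolding psi_def[abs_def]
  by (rule integral_PN_continuous) (auto intro!: Qw01 continuous_intros sections_continuousD[OF cQ])

lemma psih_continuous: "h \<in> I \<Longrightarrow> continuous_on UNIV (psih h u)"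
  unfolding psih_def[abs_def]
proof (rule integral_PN_continuous)
  fix t assume h: "h \<in> I"
  note [measurable] = upd_measurable[OF h]
  show "(\<lambda>p. Q ((fst p)(h := u), snd p, t) * w p) \<in> borel_measurable PN" by measurable
qed (auto intro!: Qw01 continuous_intros sections_continuousD[OF cQ])

lemma kap_continuous: "h \<in> I \<Longrightarrow> continuous_on UNIV (kap h)"
  unfolding kap_def[abs_def]
proof (rule integral_PN_continuous)
  fix t assume h: "h \<in> I"
  note [measurable] = coord_measurable[OF h]
  show "(\<lambda>p. Q (fst p, snd p, t + D h (fst p h)) * w p) \<in> borel_measurable PN" by measurable
qed (auto intro!: Qw01 continuous_intros sections_continuous_shift[OF cQ])

text \<open>Invariance under resampling equates the value of \<open>Q\<close> at the fresh value
  \<open>u\<close> and the real variable \<open>t + D h u\<close> with an expression that does not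
  involve \<open>u\<close>.\<close>

lemma psih_shift:
  assumes h: "h \<in> I"
  shows "AE u in lborel. \<forall>t. psih h u (t + D h u) = kap h t"
proof -
  interpret L: prob_space Lap by (rule prob_space_Lap)
  interpret N: prob_space N by (rule prob_N)
  interpret S: prob_space "sh F h" by (rule prob_sh)
  interpret PS: pair_sigma_finite P "sh F h" ..
  interpret PS2: pair_sigma_finite "P \<Otimes>\<^sub>M sh F h" "N \<Otimes>\<^sub>M Lap"
    unfolding pair_sigma_finite_def using PS.sigma_finite_measure_axioms prob_space_imp_sigma_finite[OF prob_NL] by simp
  interpret NL: pair_sigma_finite N Lap ..
  have DD: "Dl h C v u = D h v - D h u" for u v by (simp add: Dl_def lr_def)
  have 1: "AE q in P \<Otimes>\<^sub>M sh F h. AE y in N. \<forall>t. Q ((fst q)(h := snd q), y, t + D h (snd q)) = Q (fst q, y, t + D h (fst q h))"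
    using PS2.AE_pair[OF resample_Q[OF h]]
  proof eventually_elim
    case (elim q)
    show ?case using NL.AE_pair[OF elim]
    proof eventually_elim
      case (elim y)
      have a: "AE t in lborel. Q ((fst q)(h := snd q), y, t + Dl h C (snd q) (fst q h)) = Q (fst q, y, t)"
        using AE_Lap[OF elim] by (simp add: zeta_def zb_def)
      have s: "Q ((fst q)(h := snd q), y, s + Dl h C (snd q) (fst q h)) = Q (fst q, y, s)" for s
        by (rule continuous_AE_eq[OF sections_continuous_shift[OF cQ] sections_continuousD[OF cQ] a])
      show ?case
      proof
        fix t show "Q ((fst q)(h := snd q), y, t + D h (snd q)) = Q (fst q, y, t + D h (fst q h))"
          using s[of "t + D h (fst q h)"] by (simp add: DD)
      qed
    qed
  qed
  note [measurable] = upd_measurable[OF h] coord_measurable[OF h]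
  have 2: "AE u in sh F h. psih h u (t + D h u) = kap h t" for t
  proof -
    define k where "k = (\<lambda>x u y. ennreal \<bar>Q (x(h := u), y, t + D h u) - Q (x, y, t + D h (x h))\<bar>)"
    have km: "(\<lambda>p. k (fst (fst p)) (snd (fst p)) (snd p)) \<in> borel_measurable ((P \<Otimes>\<^sub>M sh F h) \<Otimes>\<^sub>M N)"
      unfolding k_def by measurable
    have k1m: "(\<lambda>q. \<integral>\<^sup>+y. k (fst q) (snd q) y \<partial>N) \<in> borel_measurable (P \<Otimes>\<^sub>M sh F h)"
      using N.borel_measurable_nn_integral_fst[OF km] by simp
    have "AE q in P \<Otimes>\<^sub>M sh F h. (\<integral>\<^sup>+y. k (fst q) (snd q) y \<partial>N) = 0"
      using 1 by eventually_elim (auto simp: k_def elim!: eventually_mono intro!: nn_integral_0_iff_AE[THEN iffD2] nn_integral_zero' )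
    then have "(\<integral>\<^sup>+q. \<integral>\<^sup>+y. k (fst q) (snd q) y \<partial>N \<partial>(P \<Otimes>\<^sub>M sh F h)) = 0" by (rule nn_integral_zero')
    then have "(\<integral>\<^sup>+u. \<integral>\<^sup>+x. \<integral>\<^sup>+y. k x u y \<partial>N \<partial>P \<partial>sh F h) = 0" using PS.nn_integral_snd[OF k1m] by simp
    moreover have "(\<lambda>u. \<integral>\<^sup>+x. \<integral>\<^sup>+y. k x u y \<partial>N \<partial>P) \<in> borel_measurable (sh F h)"
      using PP.P.borel_measurable_nn_integral_fst[OF measurable_compose[OF _ k1m], of "\<lambda>p. (snd p, fst p)"] by simp
    ultimately have "AE u in sh F h. (\<integral>\<^sup>+x. \<integral>\<^sup>+y. k x u y \<partial>N \<partial>P) = 0"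
      by (subst (asm) nn_integral_0_iff_AE) auto
    then show ?thesis
    proof eventually_elim
      case (elim u)
      have m: "(\<lambda>p. k (fst p) u (snd p)) \<in> borel_measurable PN" unfolding k_def by measurable
      have "(\<integral>\<^sup>+p. k (fst p) u (snd p) \<partial>PN) = 0" using N.nn_integral_fst[OF m] elim by simp
      then have ae: "AE p in PN. k (fst p) u (snd p) = 0" by (subst (asm) nn_integral_0_iff_AE[OF m])
      show ?case unfolding psih_def kap_def
      proof (rule integral_cong_AE)
        show "AE p in PN. Q ((fst p)(h := u), snd p, t + D h u) * w p = Q (fst p, snd p, t + D h (fst p h)) * w p"
          using ae by eventually_elim (simp add: k_def)
      qed measurable
    qed
  qed
  \<comment> \<open>Countably many \<open>t\<close> share one null set; continuity supplies the
    other \<open>t\<close>.\<close>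
  have "AE u in sh F h. \<forall>r::rat. psih h u (of_rat r + D h u) = kap h (of_rat r)"
    by (subst AE_all_countable) (use 2 in blast)
  then have "AE u in sh F h. \<forall>t. psih h u (t + D h u) = kap h t"
  proof eventually_elim
    case (elim u)
    have "continuous_on UNIV (\<lambda>t. psih h u (t + D h u))"
      by (rule continuous_on_compose2[OF psih_continuous[OF h]]) (auto intro!: continuous_intros)
    then show ?case using continuous_rat_eq[OF _ kap_continuous[OF h]] elim by blast
  qed
  then show ?thesis unfolding shifted_measure_def by (subst (asm) AE_density) (auto simp: pos)
qed

lemma psih_measurable: "h \<in> I \<Longrightarrow> (\<lambda>z. psih h (fst z) (snd z)) \<in> borel_measurable (borel \<Otimes>\<^sub>M borel)"
proof -
  interpret PN: prob_space "PN" by (rule prob_PN)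
  assume h: "h \<in> I"
  note [measurable] = upd_measurable[OF h]
  show ?thesis unfolding psih_def by (rule PN.borel_measurable_lebesgue_integral) measurable
qed

text \<open>For \<open>h\<close> outside \<open>B\<close> the weight \<open>w\<close> ignores the
  resampled coordinate, so \<open>psih h u t\<close> is the conditional mean, given that coordinate
  \<open>h\<close> equals \<open>u\<close>, of a single function \<open>q\<close>.\<close>

lemma psih_bessel:
  assumes A: "finite A" "A \<subseteq> I - B"
  shows "(\<Sum>h\<in>A. \<integral>u. (psih h u t - psi t)\<^sup>2 \<partial>sh F h) \<le> 1"
proof -
  interpret N: prob_space N by (rule prob_N)
  interpret PN: pair_prob_space P N ..
  define q where "q = (\<lambda>x. \<integral>y. Q (x, y, t) * w (x, y) \<partial>N)"
  have fub: "(\<integral>x. \<integral>y. f (x, y) \<partial>N \<partial>P) = (\<integral>p. f p \<partial>PN)"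
    if "f \<in> borel_measurable PN" "\<And>p. \<bar>f p\<bar> \<le> 1" for f :: "('g \<Rightarrow> real) \<times> 'y \<Rightarrow> real"
    using PN.integral_fst'[OF PN.P.integrable_const_bound[where B=1, OF _ that(1)]] that(2) by simp
  have qm: "q \<in> borel_measurable P"
    unfolding q_def by (rule N.borel_measurable_lebesgue_integral) measurable
  have q01: "0 \<le> q x" "q x \<le> 1" for x
  proof -
    show "0 \<le> q x" unfolding q_def by (simp add: Qw01)
    show "q x \<le> 1" unfolding q_def
      by (cases "integrable N (\<lambda>y. Q (x, y, t) * w (x, y))") (auto intro!: N.integral_le_const simp: Qw01 not_integrable_integral_eq)
  qed
  have 0: "(\<integral>x. q x \<partial>P) = psi t"
    unfolding q_def psi_def by (subst fub[symmetric]) (auto simp: Qw01)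
  have h: "(\<integral>x. q (x(h := u)) \<partial>P) = psih h u t" if h: "h \<in> A" for h u
  proof -
    have hI: "h \<in> I" "h \<notin> B" using h A(2) by auto
    note [measurable] = upd_measurable[OF hI(1)]
    have "(\<integral>x. q (x(h := u)) \<partial>P) = (\<integral>x. \<integral>y. Q (x(h := u), y, t) * w (x, y) \<partial>N \<partial>P)"
    proof (rule Bochner_Integration.integral_cong)
      fix x assume x: "x \<in> space P"
      have "x(h := u) \<in> space P" using x hI by (auto simp: space_P extensional_def)
      then have "w (x(h := u), y) = w (x, y)" for y
        using depends_onD[OF w_local _ x, of "x(h := u)" y] hI(2) by fastforce
      then show "q (x(h := u)) = (\<integral>y. Q (x(h := u), y, t) * w (x, y) \<partial>N)" by (simp add: q_def)
    qed simp
    also have "\<dots> = psih h u t" unfolding psih_def by (subst fub[symmetric]) (auto simp: Qw01)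
    finally show ?thesis .
  qed
  have "A \<subseteq> I" using A(2) by auto
  from PP.bessel_single_coordinates[OF qm q01 A(1) this] show ?thesis by (simp add: 0 h)
qed

end

lemma nn_integral_linear:
  "f \<in> borel_measurable M \<Longrightarrow> g \<in> borel_measurable M \<Longrightarrow> (\<integral>\<^sup>+x. c * f x + d * g x \<partial>M) = c * (\<integral>\<^sup>+x. f x \<partial>M) + d * (\<integral>\<^sup>+x. g x \<partial>M)"
  by (simp add: nn_integral_add nn_integral_cmult)

context resample_invariant
begin

lemma psi_measurable[measurable]: "psi \<in> borel_measurable borel"
  by (rule borel_measurable_continuous_onI[OF psi_continuous])

lemma kap_measurable: "h \<in> I \<Longrightarrow> kap h \<in> borel_measurable borel"
  by (rule borel_measurable_continuous_onI[OF kap_continuous])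

lemma psih01: "0 \<le> psih h u t" "psih h u t \<le> 1" and psi01: "0 \<le> psi t" "psi t \<le> 1"
proof -
  interpret PN: prob_space "PN" by (rule prob_PN)
  have le1: "(\<integral>p. f p \<partial>PN) \<le> 1" if "\<And>p. f p \<le> (1::real)" for f
    by (cases "integrable PN f") (use that in \<open>auto intro!: PN.integral_le_const simp: not_integrable_integral_eq\<close>)
  show "0 \<le> psih h u t" "psih h u t \<le> 1" "0 \<le> psi t" "psi t \<le> 1"
    unfolding psih_def psi_def by (auto intro!: le1 simp: Qw01)
qed

text \<open>By \<open>psih_shift\<close> the difference of \<open>psi (t + D h u)\<close> and
  \<open>kap h t\<close> is the deviation of \<open>psih h u\<close> from \<open>psi\<close> at the
  point \<open>t + D h u\<close>. Both terms of the displacement are compared with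
  \<open>kap h t\<close>, in which \<open>u\<close> does not occur.\<close>

lemma displacement_le_variance:
  assumes h: "h \<in> I" and L: "0 \<le> L" and m: "0 < m" "\<And>u. \<bar>u\<bar> \<le> L \<Longrightarrow> m \<le> \<phi> (u + F h)" and M': "\<And>u. \<bar>u\<bar> \<le> L \<Longrightarrow> \<bar>D h u\<bar> \<le> M'"
  shows "(\<integral>\<^sup>+u. \<integral>\<^sup>+v. \<integral>\<^sup>+t. indicator {-L..L} u * indicator {-L..L} v * indicator {-L..L} t
       * ennreal ((psi (t + D h u) - psi (t + D h v))\<^sup>2) \<partial>lborel \<partial>lborel \<partial>lborel)
    \<le> ennreal (8 * L / m) * (\<integral>\<^sup>+s. indicator {-(L + M')..L + M'} s * ennreal (\<integral>u. (psih h u s - psi s)\<^sup>2 \<partial>sh F h) \<partial>lborel)"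
proof -
  interpret S: prob_space "sh F h" by (rule prob_sh)
  interpret SL: pair_sigma_finite "sh F h" "lborel :: real measure" ..
  note [measurable] = kap_measurable[OF h]
  have [measurable (raw)]: "(\<lambda>z. psih h (f z) (g z)) \<in> borel_measurable M''" if "f \<in> borel_measurable M''" "g \<in> borel_measurable M''" for f g and M'' :: "'z measure"
    using measurable_compose[OF _ psih_measurable[OF h], of "\<lambda>z. (f z, g z)" M''] that by simp
  let ?i = "\<lambda>u. indicator {-L..L} u :: ennreal" and ?j = "\<lambda>s. indicator {-(L + M')..L + M'} s :: ennreal"
  define W where "W = (\<lambda>u. \<integral>\<^sup>+t. ?i t * ennreal ((psi (t + D h u) - kap h t)\<^sup>2) \<partial>lborel)"
  have Wm[measurable]: "W \<in> borel_measurable borel" unfolding W_def by measurable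
  define E where "E = (\<lambda>u. \<integral>\<^sup>+s. ?j s * ennreal ((psih h u s - psi s)\<^sup>2) \<partial>lborel)"
  have Em[measurable]: "E \<in> borel_measurable borel" unfolding E_def by measurable
  have ii: "(\<integral>\<^sup>+v. ?i v \<partial>lborel) = ennreal (2 * L)" using L by simp
  have "(\<integral>\<^sup>+u. \<integral>\<^sup>+v. \<integral>\<^sup>+t. ?i u * ?i v * ?i t * ennreal ((psi (t + D h u) - psi (t + D h v))\<^sup>2) \<partial>lborel \<partial>lborel \<partial>lborel)
      \<le> (\<integral>\<^sup>+u. \<integral>\<^sup>+v. 2 * (?i v * (?i u * W u)) + 2 * (?i u * (?i v * W v)) \<partial>lborel \<partial>lborel)"
  proof (intro nn_integral_mono)
    fix u v :: real
    have "(\<integral>\<^sup>+t. ?i u * ?i v * ?i t * ennreal ((psi (t + D h u) - psi (t + D h v))\<^sup>2) \<partial>lborel)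
      \<le> (\<integral>\<^sup>+t. 2 * ?i u * ?i v * (?i t * ennreal ((psi (t + D h u) - kap h t)\<^sup>2)) + 2 * ?i u * ?i v * (?i t * ennreal ((psi (t + D h v) - kap h t)\<^sup>2)) \<partial>lborel)"
    proof (rule nn_integral_mono)
      fix t :: real
      have gen: "?i u * ?i v * ?i t * ennreal ((a - b)\<^sup>2) \<le> 2 * ?i u * ?i v * (?i t * ennreal (a\<^sup>2)) + 2 * ?i u * ?i v * (?i t * ennreal (b\<^sup>2))" for a b
      proof -
        have "(a - b)\<^sup>2 \<le> 2 * a\<^sup>2 + 2 * b\<^sup>2" using zero_le_power2[of "a + b"] by (simp add: power2_eq_square algebra_simps)
        then have "ennreal ((a - b)\<^sup>2) \<le> ennreal (2 * a\<^sup>2 + 2 * b\<^sup>2)" by (rule ennreal_leI)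
        then have "ennreal ((a - b)\<^sup>2) \<le> 2 * ennreal (a\<^sup>2) + 2 * ennreal (b\<^sup>2)" by (simp add: ennreal_mult)
        then have "?i u * ?i v * ?i t * ennreal ((a - b)\<^sup>2) \<le> ?i u * ?i v * ?i t * (2 * ennreal (a\<^sup>2) + 2 * ennreal (b\<^sup>2))"
          by (rule mult_left_mono) simp
        then show ?thesis by (simp only: distrib_left mult_ac)
      qed
      show "?i u * ?i v * ?i t * ennreal ((psi (t + D h u) - psi (t + D h v))\<^sup>2)
        \<le> 2 * ?i u * ?i v * (?i t * ennreal ((psi (t + D h u) - kap h t)\<^sup>2)) + 2 * ?i u * ?i v * (?i t * ennreal ((psi (t + D h v) - kap h t)\<^sup>2))"
        using gen[of "psi (t + D h u) - kap h t" "psi (t + D h v) - kap h t"] by simp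
    qed
    also have "\<dots> = 2 * ?i u * ?i v * W u + 2 * ?i u * ?i v * W v"
      unfolding W_def by (rule nn_integral_linear) measurable
    finally show "(\<integral>\<^sup>+t. ?i u * ?i v * ?i t * ennreal ((psi (t + D h u) - psi (t + D h v))\<^sup>2) \<partial>lborel)
      \<le> 2 * (?i v * (?i u * W u)) + 2 * (?i u * (?i v * W v))" by (simp add: mult_ac)
  qed
  also have "\<dots> = (\<integral>\<^sup>+u. 2 * ennreal (2 * L) * (?i u * W u) + 2 * (\<integral>\<^sup>+v. ?i v * W v \<partial>lborel) * ?i u \<partial>lborel)"
  proof (rule nn_integral_cong)
    fix u
    have "(\<integral>\<^sup>+v. 2 * (?i v * (?i u * W u)) + 2 * (?i u * (?i v * W v)) \<partial>lborel) = (\<integral>\<^sup>+v. (2 * (?i u * W u)) * ?i v + (2 * ?i u) * (?i v * W v) \<partial>lborel)"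
      by (simp add: mult_ac)
    also have "\<dots> = (2 * (?i u * W u)) * ennreal (2 * L) + (2 * ?i u) * (\<integral>\<^sup>+v. ?i v * W v \<partial>lborel)"
      unfolding ii[symmetric] by (rule nn_integral_linear) measurable
    finally show "(\<integral>\<^sup>+v. 2 * (?i v * (?i u * W u)) + 2 * (?i u * (?i v * W v)) \<partial>lborel) = 2 * ennreal (2 * L) * (?i u * W u) + 2 * (\<integral>\<^sup>+v. ?i v * W v \<partial>lborel) * ?i u"
      by (simp add: mult_ac)
  qed
  also have "\<dots> = 2 * ennreal (2 * L) * (\<integral>\<^sup>+u. ?i u * W u \<partial>lborel) + 2 * (\<integral>\<^sup>+v. ?i v * W v \<partial>lborel) * ennreal (2 * L)"
    unfolding ii[symmetric] by (rule nn_integral_linear) measurable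
  also have "\<dots> = (2 * ennreal (2 * L) + 2 * ennreal (2 * L)) * (\<integral>\<^sup>+u. ?i u * W u \<partial>lborel)"
    by (simp add: distrib_left distrib_right mult_ac)
  \<comment> \<open>A factor 2 from splitting the square and the length \<open>2 * L\<close> of the
    free variable, for each of two symmetric terms.\<close>
  also have "2 * ennreal (2 * L) + 2 * ennreal (2 * L) = ennreal (8 * L)"
    using L by (simp add: ennreal_plus[symmetric] ennreal_mult[symmetric] ennreal_numeral[symmetric] del: ennreal_plus ennreal_numeral)
  finally have 1: "(\<integral>\<^sup>+u. \<integral>\<^sup>+v. \<integral>\<^sup>+t. ?i u * ?i v * ?i t * ennreal ((psi (t + D h u) - psi (t + D h v))\<^sup>2) \<partial>lborel \<partial>lborel \<partial>lborel)
    \<le> ennreal (8 * L) * (\<integral>\<^sup>+u. ?i u * W u \<partial>lborel)" .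
  \<comment> \<open>The factor \<open>1 / m\<close> passes from Lebesgue measure to the marginal at
    \<open>h\<close>, whose density is at least \<open>m\<close> on \<open>[-L, L]\<close>. The
    window for \<open>t\<close> grows by the size \<open>M'\<close> of the translation.\<close>
  have 2: "(\<integral>\<^sup>+u. ?i u * W u \<partial>lborel) \<le> (\<integral>\<^sup>+u. ennreal (1 / m) * (ennreal (\<phi> (u + F h)) * E u) \<partial>lborel)"
  proof (rule nn_integral_mono_AE, use psih_shift[OF h] in eventually_elim)
    fix u assume eq: "\<forall>t. psih h u (t + D h u) = kap h t"
    show "?i u * W u \<le> ennreal (1 / m) * (ennreal (\<phi> (u + F h)) * E u)"
    proof (cases "\<bar>u\<bar> \<le> L")
      case False then show ?thesis by (auto simp: indicator_def abs_le_iff)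
    next
      case True
      have "W u \<le> (\<integral>\<^sup>+t. ?j (D h u + 1 * t) * ennreal ((psih h u (D h u + 1 * t) - psi (D h u + 1 * t))\<^sup>2) \<partial>lborel)"
        unfolding W_def
      proof (rule nn_integral_mono)
        fix t
        have "(psi (t + D h u) - kap h t)\<^sup>2 = (psih h u (D h u + 1 * t) - psi (D h u + 1 * t))\<^sup>2"
          using eq[rule_format, of t] by (simp add: add.commute power2_commute)
        moreover have "?i t \<le> ?j (D h u + 1 * t)" using M'[OF True] by (auto simp: indicator_def abs_le_iff)
        ultimately show "?i t * ennreal ((psi (t + D h u) - kap h t)\<^sup>2) \<le> ?j (D h u + 1 * t) * ennreal ((psih h u (D h u + 1 * t) - psi (D h u + 1 * t))\<^sup>2)"
          by (simp add: mult_right_mono)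
      qed
      also have "\<dots> = E u" unfolding E_def by (subst (2) nn_integral_real_affine[where c=1 and t="D h u"]) auto
      finally have WE: "W u \<le> E u" .
      have "ennreal 1 \<le> ennreal (1 / m * \<phi> (u + F h))" using m(1) m(2)[OF True] by (intro ennreal_leI) (simp add: field_simps)
      then have "1 \<le> ennreal (1 / m) * ennreal (\<phi> (u + F h))" using m(1) pos[of "u + F h"] by (simp add: ennreal_mult[symmetric])
      from mult_mono[OF this WE] have "W u \<le> ennreal (1 / m) * ennreal (\<phi> (u + F h)) * E u" by simp
      moreover have "?i u * W u \<le> 1 * W u" by (rule mult_right_mono) (auto simp: indicator_def)
      ultimately show ?thesis by (simp add: mult.assoc)
    qed
  qed
  have 3: "(\<integral>\<^sup>+u. ennreal (1 / m) * (ennreal (\<phi> (u + F h)) * E u) \<partial>lborel) = ennreal (1 / m) * (\<integral>\<^sup>+u. E u \<partial>sh F h)"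
    by (simp add: nn_integral_cmult nn_integral_sh)
  have 4: "(\<integral>\<^sup>+u. E u \<partial>sh F h) = (\<integral>\<^sup>+s. ?j s * ennreal (\<integral>u. (psih h u s - psi s)\<^sup>2 \<partial>sh F h) \<partial>lborel)"
  proof -
    have "(\<lambda>(u, s). ?j s * ennreal ((psih h u s - psi s)\<^sup>2)) \<in> borel_measurable (sh F h \<Otimes>\<^sub>M lborel)" by measurable
    from SL.Fubini'[OF this] have "(\<integral>\<^sup>+u. E u \<partial>sh F h) = (\<integral>\<^sup>+s. \<integral>\<^sup>+u. ?j s * ennreal ((psih h u s - psi s)\<^sup>2) \<partial>sh F h \<partial>lborel)"
      unfolding E_def ..
    also have "\<dots> = (\<integral>\<^sup>+s. ?j s * ennreal (\<integral>u. (psih h u s - psi s)\<^sup>2 \<partial>sh F h) \<partial>lborel)"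
    proof (rule nn_integral_cong)
      fix s
      have m: "(\<lambda>u. (psih h u s - psi s)\<^sup>2) \<in> borel_measurable (sh F h)" by measurable
      have "\<bar>psih h u s - psi s\<bar> \<le> 1" for u using psih01[of h u s] psi01[of s] by (simp add: abs_le_iff)
      then have "(psih h u s - psi s)\<^sup>2 \<le> 1" for u by (simp add: abs_square_le_1)
      then have "integrable (sh F h) (\<lambda>u. (psih h u s - psi s)\<^sup>2)" using m by (intro PP.M.integrable_const_bound[where B=1]) auto
      from nn_integral_eq_integral[OF this] show "(\<integral>\<^sup>+u. ?j s * ennreal ((psih h u s - psi s)\<^sup>2) \<partial>sh F h) = ?j s * ennreal (\<integral>u. (psih h u s - psi s)\<^sup>2 \<partial>sh F h)"
        using m by (subst nn_integral_cmult) auto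
    qed
    finally show ?thesis .
  qed
  have "(\<integral>\<^sup>+u. ?i u * W u \<partial>lborel) \<le> ennreal (1 / m) * (\<integral>\<^sup>+s. ?j s * ennreal (\<integral>u. (psih h u s - psi s)\<^sup>2 \<partial>sh F h) \<partial>lborel)"
    using 2 unfolding 3 4 .
  from order_trans[OF 1 mult_left_mono[OF this]]
  show ?thesis using L m(1) by (simp add: mult.assoc[symmetric] ennreal_mult[symmetric])
qed

text \<open>If \<open>psi\<close> is not constant, \<open>quadratic_lower_bound\<close> with
  \<Delta> = \<open>lr\<close> bounds \<open>(F h - C)\<^sup>2\<close> by a constant times the
  integrated variance at \<open>h\<close>, and Bessel's inequality bounds the sum of these variances
  at every point of a fixed interval.\<close>

theorem psi_constant:
  assumes ns: "\<not> (\<lambda>h. (F h - C)\<^sup>2) summable_on I"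
  shows "psi t = psi 0"
proof (rule ccontr)
  assume ne: "psi t \<noteq> psi 0"
  \<comment> \<open>The distance of \<open>F h\<close> and \<open>C\<close> is at most
    \<open>2 * K\<close>; the \<open>+ 1\<close> keeps the range positive for
    \<open>K = 0\<close>.\<close>
  have H: "0 < 2 * K + 1" using K_nonneg by simp
  have add: "lr b (u + a) = lr (b + a) u - lr a u" for a b u by (simp add: lr_def ac_simps)
  have nc: "\<exists>u v. lr b u \<noteq> lr b v" if "b \<noteq> 0" for b
  proof -
    have "C + b \<noteq> C" using that by simp
    from ln_phi_diff_nonconstant[OF this, of 0] show ?thesis unfolding lr_def by blast
  qed
  from quadratic_lower_bound[OF psi_continuous ne lr_continuous add nc H]
  obtain c L where c: "c > 0" and low: "\<And>a. \<bar>a\<bar> \<le> 2 * K + 1 \<Longrightarrow> ennreal (c * a\<^sup>2) \<le>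
    (\<integral>\<^sup>+u. \<integral>\<^sup>+v. \<integral>\<^sup>+t. indicator {-L..L} u * indicator {-L..L} v * indicator {-L..L} t
       * ennreal ((psi (t + lr a u) - psi (t + lr a v))\<^sup>2) \<partial>lborel \<partial>lborel \<partial>lborel)" by blast
  have Fh: "\<bar>F h - C\<bar> \<le> 2 * K + 1" if "h \<in> I" for h using F_bound[OF that] C by simp
  \<comment> \<open>A negative \<open>L\<close> would make the box empty and the right-hand side of
    \<open>low\<close> zero.\<close>
  have L: "0 \<le> L"
  proof (rule ccontr)
    assume "\<not> 0 \<le> L"
    then have "ennreal (c * (2 * K + 1)\<^sup>2) \<le> 0" using low[of "2 * K + 1"] H by simp
    then show False using c H by simp
  qed
  obtain d where d: "0 \<le> d" "\<And>u a. \<bar>u\<bar> \<le> L \<Longrightarrow> \<bar>a\<bar> \<le> K \<Longrightarrow> \<bar>ln (\<phi> (u + a))\<bar> \<le> d" using ln_phi_bound[of L] by blast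
  have m: "exp (- d) \<le> \<phi> (u + F h)" if "h \<in> I" "\<bar>u\<bar> \<le> L" for h u
  proof -
    have "exp (- d) \<le> exp (ln (\<phi> (u + F h)))" using d(2)[OF that(2) F_bound[OF that(1)]] by simp
    then show ?thesis using pos by simp
  qed
  have D: "\<bar>D h u\<bar> \<le> 2 * d" if "h \<in> I" "\<bar>u\<bar> \<le> L" for h u
    using d(2)[OF that(2) F_bound[OF that(1)]] d(2)[OF that(2) C] by (simp add: lr_def)
  define L' where "L' = L + 2 * d"
  have L': "0 \<le> L'" using L d(1) by (simp add: L'_def)
  define V where "V = (\<lambda>h s. \<integral>u. (psih h u s - psi s)\<^sup>2 \<partial>sh F h)"
  have V0: "0 \<le> V h s" for h s by (simp add: V_def)
  have Vm: "(\<lambda>s. V h s) \<in> borel_measurable borel" if h: "h \<in> I" for h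
  proof -
    have "(\<lambda>z. psih h (snd z) (fst z)) \<in> borel_measurable (borel \<Otimes>\<^sub>M sh F h)"
      using measurable_compose[OF _ psih_measurable[OF h], of "\<lambda>z. (snd z, fst z)" "borel \<Otimes>\<^sub>M sh F h"] by simp
    then have "(\<lambda>(s, u). (psih h u s - psi s)\<^sup>2) \<in> borel_measurable (borel \<Otimes>\<^sub>M sh F h)" by (simp add: split_beta')
    then show ?thesis unfolding V_def by (rule PP.M.borel_measurable_lebesgue_integral)
  qed
  define c1 where "c1 = 8 * L / exp (- d)"
  have c1: "0 \<le> c1" using L by (simp add: c1_def)
  have up: "ennreal (c * (F h - C)\<^sup>2) \<le> ennreal c1 * (\<integral>\<^sup>+s. indicator {-L'..L'} s * ennreal (V h s) \<partial>lborel)" if h: "h \<in> I" for h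
    using order_trans[OF low[OF Fh[OF h]] displacement_le_variance[OF h L exp_gt_zero m[OF h] D[OF h]]]
    by (simp add: V_def L'_def c1_def)
  have bound: "(\<Sum>h\<in>A. (F h - C)\<^sup>2) \<le> c1 * (2 * L') / c" if A: "finite A" "A \<subseteq> I - B" for A
  proof -
    have AI: "h \<in> I" if "h \<in> A" for h using A(2) that by auto
    have "ennreal (c * (\<Sum>h\<in>A. (F h - C)\<^sup>2)) = (\<Sum>h\<in>A. ennreal (c * (F h - C)\<^sup>2))"
      using c by (simp add: sum_distrib_left sum_ennreal)
    also have "\<dots> \<le> (\<Sum>h\<in>A. ennreal c1 * (\<integral>\<^sup>+s. indicator {-L'..L'} s * ennreal (V h s) \<partial>lborel))"
      by (intro sum_mono up AI)
    also have "\<dots> = ennreal c1 * (\<integral>\<^sup>+s. (\<Sum>h\<in>A. indicator {-L'..L'} s * ennreal (V h s)) \<partial>lborel)"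
      using Vm[OF AI] by (subst nn_integral_sum) (auto simp: sum_distrib_left)
    also have "\<dots> \<le> ennreal c1 * (\<integral>\<^sup>+s. indicator {-L'..L'} s \<partial>lborel)"
    proof (intro mult_left_mono nn_integral_mono)
      fix s
      have "(\<Sum>h\<in>A. V h s) \<le> 1" unfolding V_def by (rule psih_bessel[OF A])
      then have "ennreal (\<Sum>h\<in>A. V h s) \<le> 1" by (metis ennreal_1 ennreal_leI)
      then have "indicator {-L'..L'} s * ennreal (\<Sum>h\<in>A. V h s) \<le> indicator {-L'..L'} s * (1::ennreal)" by (rule mult_left_mono) simp
      then show "(\<Sum>h\<in>A. indicator {-L'..L'} s * ennreal (V h s)) \<le> indicator {-L'..L'} s"
        by (simp add: sum_distrib_left[symmetric] V0)
    qed simp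
    also have "\<dots> = ennreal (c1 * (2 * L'))" using L' c1 by (simp add: ennreal_mult)
    finally have "c * (\<Sum>h\<in>A. (F h - C)\<^sup>2) \<le> c1 * (2 * L')" using c1 L' by (subst (asm) ennreal_le_iff) auto
    then show ?thesis using c by (simp add: field_simps)
  qed
  have "(\<lambda>h. (F h - C)\<^sup>2) summable_on (I - B)"
  proof (rule nonneg_bdd_above_summable_on)
    show "bdd_above (sum (\<lambda>h. (F h - C)\<^sup>2) ` {A. A \<subseteq> I - B \<and> finite A})"
      using bound by (intro bdd_aboveI2[of _ _ "c1 * (2 * L') / c"]) auto
  qed simp
  moreover have "(\<lambda>h. (F h - C)\<^sup>2) summable_on B" using B(1) by simp
  ultimately have "(\<lambda>h. (F h - C)\<^sup>2) summable_on ((I - B) \<union> B)" by (intro summable_on_Un_disjoint) auto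
  moreover have "(I - B) \<union> B = I" using B(2) by blast
  ultimately show False using ns by simp
qed

lemma weighted_integral_constant:
  "\<not> (\<lambda>h. (F h - C)\<^sup>2) summable_on I \<Longrightarrow>
    (\<integral>p. Q (fst p, snd p, s) * w p \<partial>PN) = (\<integral>p. Q (fst p, snd p, t) * w p \<partial>PN)"
  using psi_constant[of s] psi_constant[of t] by (simp add: psi_def)

end

context bernoulli_growth
begin

text \<open>In the second alternative of the dichotomy the pairing of \<open>Q\<close> with every
  cylinder function is constant in the real variable. So the difference of two slices of
  \<open>Q\<close> passes \<open>cylinder_test\<close>, whose one-sided conclusion is applied in
  both orders.\<close>

theorem sections_constant:
  assumes Q: "maharam_invariant Q" and c: "sections_continuous Q" and erg: "ergodic G N b"
    and ns: "\<And>C. \<not> (\<lambda>h. (F h - C)\<^sup>2) summable_on I"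
  shows "AE p in PN. \<forall>t. Q (fst p, snd p, t) = Q (fst p, snd p, 0)"
  using resample_dichotomy[OF Q c erg]
proof (elim disjE exE conjE)
  fix C assume C: "\<bar>C\<bar> \<le> K" and inv: "\<forall>h\<in>I. AE p in ZZ h. Q (zeta h C p) = Q (zb p)"
  interpret PN: prob_space "PN" by (rule prob_PN)
  note [measurable] = maharam_invariantD(1)[OF Q]
  have le: "AE p in PN. Q (fst p, snd p, s) \<le> Q (fst p, snd p, t)" for s t
  proof -
    define d where "d = (\<lambda>p. Q (fst p, snd p, s) - Q (fst p, snd p, t))"
    have dm[measurable]: "d \<in> borel_measurable PN" unfolding d_def by measurable
    have d1: "\<bar>d p\<bar> \<le> 1" for p
      using maharam_invariantD(2,3)[OF Q, of "(fst p, snd p, s)"] maharam_invariantD(2,3)[OF Q, of "(fst p, snd p, t)"] unfolding d_def by linarith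
    have "AE p in PN. d p \<le> 0"
    proof (rule cylinder_test[OF prob_PN dm d1])
      fix B and w :: "('g \<Rightarrow> real) \<times> 'y \<Rightarrow> real" assume B: "finite B" "B \<subseteq> I" and w[measurable]: "w \<in> borel_measurable PN" and w01: "\<And>p. 0 \<le> w p" "\<And>p. w p \<le> 1"
        and dep: "depends_on (space P) B w"
      have R: "resample_invariant \<phi> \<kappa> G F K N b Ks rad \<delta> Q C w B"
        by (intro resample_invariant.intro bernoulli_growth_axioms resample_invariant_axioms.intro Q c C bspec[OF inv] w w01 B dep)
      have i1: "\<bar>Q z * w p\<bar> \<le> 1" for z p
        using maharam_invariantD(2,3)[OF Q, of z] w01[of p] mult_le_one[of "Q z" "w p"] by auto
      have "integrable PN (\<lambda>p. Q (fst p, snd p, r) * w p)" for r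
        using i1 by (intro PN.integrable_const_bound[where B=1]) auto
      then show "(\<integral>p. d p * w p \<partial>PN) = 0"
        unfolding d_def left_diff_distrib
        using resample_invariant.weighted_integral_constant[OF R ns, of s t] by simp
    qed
    then show ?thesis by eventually_elim (simp add: d_def)
  qed
  have "AE p in PN. \<forall>r::rat. Q (fst p, snd p, of_rat r) \<le> Q (fst p, snd p, 0) \<and> Q (fst p, snd p, 0) \<le> Q (fst p, snd p, of_rat r)"
    by (subst AE_all_countable) (auto intro: le)
  then show ?thesis
  proof eventually_elim
    case (elim p)
    have "Q (fst p, snd p, t) = Q (fst p, snd p, 0)" for t
      by (rule continuous_rat_eq[OF sections_continuousD[OF c] continuous_on_const]) (use elim in \<open>simp add: antisym\<close>)
    then show ?case by blast
  qed
qed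

end

section \<open>The Maharam extension\<close>

text \<open>The converse implication is the hypothesis for the inverse element.\<close>

lemma nonsingular_actionI:
  fixes G (structure)
  assumes grp: "group_action G (space M) a" and m: "\<And>g. g \<in> carrier G \<Longrightarrow> a g \<in> measurable M M"
    and null: "\<And>g A. g \<in> carrier G \<Longrightarrow> A \<in> null_sets M \<Longrightarrow> a g -` A \<inter> space M \<in> null_sets M"
  shows "nonsingular_action G M a"
  unfolding nonsingular_action_def
proof (intro conjI ballI grp m)
  interpret group_action G "space M" a by (rule grp)
  interpret group G using group_hom by (simp add: group_hom_def)
  fix g A assume g: "g \<in> carrier G" and A: "A \<in> sets M"
  show "a g -` A \<inter> space M \<in> null_sets M \<longleftrightarrow> A \<in> null_sets M"
  proof
    assume "a g -` A \<inter> space M \<in> null_sets M"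
    from null[OF inv_closed[OF g] this] have "a (inv g) -` (a g -` A \<inter> space M) \<inter> space M \<in> null_sets M" .
    moreover have "a (inv g) -` (a g -` A \<inter> space M) \<inter> space M = A"
    proof -
      have "a g (a (inv g) x) = x" if "x \<in> space M" for x
        using orbit_sym_aux[OF inv_closed[OF g] that refl] g by simp
      moreover have "a (inv g) x \<in> space M" if "x \<in> space M" for x
        using element_image[OF inv_closed[OF g] that refl] .
      ultimately show ?thesis using sets.sets_into_space[OF A] by auto
    qed
    ultimately show "A \<in> null_sets M" by simp
  qed (rule null[OF g])
qed

context bernoulli_shift
begin

lemma act_AE:
  assumes g: "g \<in> I" and R: "AE x in P. R x"
  shows "AE x in P. R (act g x)"
proof -
  note [measurable] = act_measurable[OF g]
  obtain S where sub: "{x\<in>space P. \<not> R x} \<subseteq> S" and S0: "emeasure P S = 0" and S[measurable]: "S \<in> sets P"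
    by (rule AE_E[OF R])
  have "(\<integral>\<^sup>+x. ennreal (om g x) * indicator S (act g x) \<partial>P) = 0"
    using S0 by (subst nn_integral_om_act[OF g]) (simp_all add: nn_integral_indicator[OF S])
  then have "AE x in P. ennreal (om g x) * indicator S (act g x) = 0"
    by (subst (asm) nn_integral_0_iff_AE) auto
  then show ?thesis using AE_space
  proof eventually_elim
    case (elim x)
    have "act g x \<notin> S" using elim(1) om_pos[of g x] by (auto simp: indicator_def split: if_splits)
    then show ?case using sub act_in_space[OF g elim(2)] by blast
  qed
qed

lemma nonsingular_act: "nonsingular_action G P act"
proof (rule nonsingular_actionI[OF group_action_act act_measurable])
  fix g A assume g: "g \<in> I" and A: "A \<in> null_sets P"
  have "AE x in P. act g x \<notin> A" by (rule act_AE[OF g AE_not_in[OF A]])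
  then have "AE x in P. x \<notin> act g -` A \<inter> space P" by eventually_elim simp
  then show "act g -` A \<inter> space P \<in> null_sets P"
    using measurable_sets[OF act_measurable[OF g], of A] A by (subst AE_iff_null_sets) auto
qed

end

context bernoulli_pmp
begin

abbreviation "dg \<equiv> diagonal_action P act N b"

lemma dg_apply: "p \<in> space PN \<Longrightarrow> dg g p = (act g (fst p), b g (snd p))"
  by (simp add: diagonal_action_def)

lemma b_action: "group_action G (space N) b" using pmp by (simp add: pmp_action_def)

lemma dg_measurable: "g \<in> I \<Longrightarrow> dg g \<in> measurable PN PN"
proof -
  assume g: "g \<in> I"
  note [measurable] = act_measurable[OF g] b_measurable[OF g]
  have "(\<lambda>p. (act g (fst p), b g (snd p))) \<in> measurable PN PN" by measurable
  then show ?thesis by (rule measurable_cong[THEN iffD1, rotated]) (simp add: dg_apply)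
qed

lemma group_action_dg: "group_action G (space PN) dg"
proof (rule group_actionI)
  interpret b: group_action G "space N" b by (rule b_action)
  show "dg g \<in> extensional (space PN)" for g by (simp add: diagonal_action_def)
  show im: "dg g p \<in> space PN" if "g \<in> I" "p \<in> space PN" for g p
    using measurable_space[OF dg_measurable[OF that(1)] that(2)] .
  show "dg (g \<otimes> h) p = dg g (dg h p)" if gh: "g \<in> I" "h \<in> I" and p: "p \<in> space PN" for g h p
  proof -
    have p': "fst p \<in> space P" "snd p \<in> space N" using p by (auto simp: space_pair_measure)
    show ?thesis
      using b.composition_rule[OF p'(2) gh] act_mult[OF gh p'(1)] p im[OF gh(2) p] by (simp add: dg_apply)
  qed
  show "dg \<one> p = p" if p: "p \<in> space PN" for p
  proof -
    have p': "fst p \<in> space P" "snd p \<in> space N" using p by (auto simp: space_pair_measure)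
    have "b \<one> (snd p) = snd p" using b.id_eq_one p'(2) by (metis restrict_apply')
    then show ?thesis using act_one[OF p'(1)] p by (simp add: dg_apply)
  qed
qed

lemma density_dg:
  assumes g: "g \<in> I"
  shows "density PN (\<lambda>p. ennreal (om g (fst p))) = distr PN PN (dg (inv g))"
proof (rule measure_eqI)
  interpret N: prob_space N by (rule prob_N)
  have ig: "inv g \<in> I" using g by simp
  note [measurable] = act_measurable[OF ig] b_measurable[OF ig] dg_measurable[OF ig]
  fix A assume "A \<in> sets (density PN (\<lambda>p. ennreal (om g (fst p))))"
  then have A[measurable]: "A \<in> sets PN" by simp
  let ?f = "indicator A :: _ \<Rightarrow> ennreal"
  have m1: "(\<lambda>p. ennreal (om g (fst p)) * ?f p) \<in> borel_measurable PN"
    and m2: "(\<lambda>p. ?f (act (inv g) (fst p), b (inv g) (snd p))) \<in> borel_measurable PN" by measurable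
  have "emeasure (density PN (\<lambda>p. ennreal (om g (fst p)))) A = (\<integral>\<^sup>+p. ennreal (om g (fst p)) * ?f p \<partial>PN)"
    by (rule emeasure_density) measurable
  also have "\<dots> = (\<integral>\<^sup>+x. \<integral>\<^sup>+y. ennreal (om g x) * ?f (x, y) \<partial>N \<partial>P)"
    using N.nn_integral_fst[OF m1] by simp
  also have "\<dots> = (\<integral>\<^sup>+x. ennreal (om g x) * (\<integral>\<^sup>+y. ?f (x, y) \<partial>N) \<partial>P)"
    by (intro nn_integral_cong nn_integral_cmult) measurable
  also have "\<dots> = (\<integral>\<^sup>+x. \<integral>\<^sup>+y. ?f (act (inv g) x, y) \<partial>N \<partial>P)"
    by (rule nn_integral_om[OF g]) measurable
  also have "\<dots> = (\<integral>\<^sup>+x. \<integral>\<^sup>+y. ?f (act (inv g) x, b (inv g) y) \<partial>N \<partial>P)"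
  proof (rule nn_integral_cong)
    fix x assume "x \<in> space P"
    then have "(\<lambda>y. ?f (act (inv g) x, y)) \<in> borel_measurable N" using act_in_space[OF ig] by measurable
    from nn_integral_b[OF ig this] show "(\<integral>\<^sup>+y. ?f (act (inv g) x, y) \<partial>N) = (\<integral>\<^sup>+y. ?f (act (inv g) x, b (inv g) y) \<partial>N)" by simp
  qed
  also have "\<dots> = (\<integral>\<^sup>+p. ?f (act (inv g) (fst p), b (inv g) (snd p)) \<partial>PN)"
    using N.nn_integral_fst[OF m2] by simp
  also have "\<dots> = (\<integral>\<^sup>+p. ?f (dg (inv g) p) \<partial>PN)"
    by (rule nn_integral_cong) (simp add: dg_apply)
  also have "\<dots> = (\<integral>\<^sup>+p. ?f p \<partial>distr PN PN (dg (inv g)))"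
    by (rule nn_integral_distr[symmetric]) measurable
  also have "\<dots> = emeasure (distr PN PN (dg (inv g))) A"
    by (rule nn_integral_indicator) simp
  finally show "emeasure (density PN (\<lambda>p. ennreal (om g (fst p)))) A = emeasure (distr PN PN (dg (inv g))) A" .
qed simp

text \<open>The pmp factor contributes nothing, so the maps of \<open>maharam_extension\<close>
  agree with \<open>T\<close> almost everywhere.\<close>

lemma RN_deriv_dg:
  assumes g: "g \<in> I"
  shows "AE p in PN. RN_deriv PN (distr PN PN (dg (inv g))) p = ennreal (om g (fst p))"
proof -
  interpret N: prob_space N by (rule prob_N)
  interpret PN: pair_prob_space P N ..
  have m: "(\<lambda>p. ennreal (om g (fst p))) \<in> borel_measurable PN" by measurable
  show ?thesis using PN.P.RN_deriv_unique[OF m density_dg[OF g]] by eventually_elim simp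
qed

end

text \<open>The kernel is supported on \<open>r \<ge> t\<close>, so smoothing at \<open>t\<close>
  measures the tail beyond \<open>t\<close> of the measure with density
  \<open>exp (- r) * u r\<close>. The last claim is this identity, from which \<open>u\<close> can
  be recovered.\<close>

lemma integral_exponential_kernel:
  fixes u :: "real \<Rightarrow> real"
  assumes u[measurable]: "u \<in> borel_measurable borel" and u01: "\<And>r. 0 \<le> u r" "\<And>r. u r \<le> 1"
  shows "integrable lborel (\<lambda>r. u r * exponential_density 1 (r - t))"
    and "0 \<le> (\<integral>r. u r * exponential_density 1 (r - t) \<partial>lborel)" "(\<integral>r. u r * exponential_density 1 (r - t) \<partial>lborel) \<le> 1"
    and "emeasure (density lborel (\<lambda>r. ennreal (exp (- r) * u r))) {t<..} = ennreal (exp (- t) * (\<integral>r. u r * exponential_density 1 (r - t) \<partial>lborel))"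
proof -
  have nn: "0 \<le> exponential_density 1 s" for s :: real by (rule exponential_density_nonneg) simp
  have one: "(\<integral>\<^sup>+s. ennreal (exponential_density 1 s) \<partial>lborel) = 1"
    using prob_space.emeasure_space_1[OF prob_space_exponential_density[of 1]] by (simp add: emeasure_density)
  have "(\<integral>\<^sup>+r. ennreal (exponential_density 1 (- t + 1 * r)) \<partial>lborel) = (\<integral>\<^sup>+s. ennreal (exponential_density 1 s) \<partial>lborel)"
    by (subst (2) nn_integral_real_affine[where c=1 and t="- t"]) auto
  then have k1: "(\<integral>\<^sup>+r. ennreal (exponential_density 1 (r - t)) \<partial>lborel) = 1" by (simp add: one)
  have ki: "integrable lborel (\<lambda>r. exponential_density 1 (r - t))"
    by (rule integrableI_nonneg) (auto simp: nn k1)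
  show i: "integrable lborel (\<lambda>r. u r * exponential_density 1 (r - t))"
    by (rule Bochner_Integration.integrable_bound[OF ki]) (auto simp: abs_mult nn u01 intro!: mult_left_le_one_le)
  show "0 \<le> (\<integral>r. u r * exponential_density 1 (r - t) \<partial>lborel)" by (simp add: nn u01)
  have "(\<integral>r. exponential_density 1 (r - t) \<partial>lborel) = 1" using k1 by (simp add: integral_eq_nn_integral nn)
  moreover have "(\<integral>r. u r * exponential_density 1 (r - t) \<partial>lborel) \<le> (\<integral>r. exponential_density 1 (r - t) \<partial>lborel)"
    by (rule integral_mono[OF i ki]) (simp add: nn u01 mult_left_le_one_le)
  ultimately show "(\<integral>r. u r * exponential_density 1 (r - t) \<partial>lborel) \<le> 1" by simp
  have "emeasure (density lborel (\<lambda>r. ennreal (exp (- r) * u r))) {t<..} = (\<integral>\<^sup>+r. ennreal (exp (- r) * u r) * indicator {t<..} r \<partial>lborel)"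
    by (rule emeasure_density) auto
  also have "\<dots> = (\<integral>\<^sup>+r. ennreal (exp (- t)) * ennreal (u r * exponential_density 1 (r - t)) \<partial>lborel)"
  proof (rule nn_integral_cong_AE, use AE_lborel_singleton[of t] in eventually_elim)
    fix r assume "r \<noteq> t"
    then show "ennreal (exp (- r) * u r) * indicator {t<..} r = ennreal (exp (- t)) * ennreal (u r * exponential_density 1 (r - t))"
      by (auto simp: indicator_def exponential_density_def ennreal_mult[symmetric] u01 exp_diff exp_minus field_simps)
  qed
  also have "\<dots> = ennreal (exp (- t)) * (\<integral>\<^sup>+r. ennreal (u r * exponential_density 1 (r - t)) \<partial>lborel)"
    by (rule nn_integral_cmult) measurable
  also have "\<dots> = ennreal (exp (- t) * (\<integral>r. u r * exponential_density 1 (r - t) \<partial>lborel))"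
    using nn_integral_eq_integral[OF i] by (simp add: nn u01 ennreal_mult)
  finally show "emeasure (density lborel (\<lambda>r. ennreal (exp (- r) * u r))) {t<..} = ennreal (exp (- t) * (\<integral>r. u r * exponential_density 1 (r - t) \<partial>lborel))" .
qed

text \<open>By the tail identity the smoothed function determines all tails of the measure with
  density \<open>exp (- r) * u r\<close>, hence \<open>u\<close> almost everywhere. The constant
  \<open>c\<close> has the same smoothing.\<close>

lemma exponential_kernel_constant:
  fixes u :: "real \<Rightarrow> real"
  assumes u[measurable]: "u \<in> borel_measurable borel" and u01: "\<And>r. 0 \<le> u r" "\<And>r. u r \<le> 1"
    and c: "\<And>t. (\<integral>r. u r * exponential_density 1 (r - t) \<partial>lborel) = c"
  shows "AE r in lborel. u r = c"
proof -
  have c01: "0 \<le> c" "c \<le> 1" using integral_exponential_kernel(2,3)[OF u u01, of 0] unfolding c by simp_all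
  have cm: "(\<lambda>_. c) \<in> borel_measurable borel" by simp
  have one: "(\<integral>r. (1::real) * exponential_density 1 (r - t) \<partial>lborel) = 1" for t
  proof -
    have "emeasure (density lborel (\<lambda>s. ennreal (exponential_density 1 s))) UNIV = 1"
      using prob_space.emeasure_space_1[OF prob_space_exponential_density[of 1]] by simp
    then have "(\<integral>\<^sup>+s. ennreal (exponential_density 1 s) \<partial>lborel) = 1" by (simp add: emeasure_density)
    then have "(\<integral>s. exponential_density 1 s \<partial>lborel) = 1" by (simp add: integral_eq_nn_integral exponential_density_nonneg)
    moreover have "(\<integral>s. exponential_density 1 s \<partial>lborel) = (\<integral>r. exponential_density 1 (- t + 1 * r) \<partial>lborel)"
      by (subst lborel_integral_real_affine[where c=1 and t="- t"]) auto
    ultimately show ?thesis by simp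
  qed
  have e: "emeasure (density lborel (\<lambda>r. ennreal (exp (- r) * u r))) {t<..} = ennreal (exp (- t) * c)" for t
    by (simp only: integral_exponential_kernel(4)[OF u u01] c)
  have e': "emeasure (density lborel (\<lambda>r. ennreal (exp (- r) * c))) {t<..} = ennreal (exp (- t) * c)" for t
    using one[of t] by (subst integral_exponential_kernel(4)[OF cm c01]) simp
  have "density lborel (\<lambda>r. ennreal (exp (- r) * u r)) = density lborel (\<lambda>r. ennreal (exp (- r) * c))"
    by (rule measure_eqI_lessThan) (simp_all add: e e')
  then have "AE r in lborel. ennreal (exp (- r) * u r) = ennreal (exp (- r) * c)"
    by (subst (asm) sigma_finite_measure.density_unique_iff[OF sigma_finite_lborel]) auto
  then show ?thesis by eventually_elim (simp add: u01 c01)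
qed

context bernoulli_growth
begin

lemma dg_eq_diag: "p \<in> space PN \<Longrightarrow> dg g p = diag g p"
  by (simp add: dg_apply diag_def)

lemma ergodic_dg: "ergodic G N b \<Longrightarrow> ergodic G PN dg"
  unfolding ergodic_def[of G "PN"]
proof (intro ballI impI)
  fix S assume erg: "ergodic G N b" and S: "S \<in> sets PN" and inv: "\<forall>g\<in>I. AE p in PN. dg g p \<in> S \<longleftrightarrow> p \<in> S"
  have "AE p in PN. diag g p \<in> S \<longleftrightarrow> p \<in> S" if "g \<in> I" for g
    using bspec[OF inv that] AE_space by eventually_elim (simp add: dg_eq_diag)
  then show "(AE p in PN. p \<in> S) \<or> (AE p in PN. p \<notin> S)" by (rule ergodic_diag[OF erg S])
qed

lemma nonsingular_dg: "nonsingular_action G PN dg"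
proof (rule nonsingular_actionI[OF group_action_dg dg_measurable])
  fix g A assume g: "g \<in> I" and A: "A \<in> null_sets PN"
  then have [measurable]: "A \<in> sets PN" by auto
  have "AE p in PN. diag g p \<notin> A" by (rule diag_AE[OF g _ AE_not_in[OF A]]) measurable
  then have "AE p in PN. p \<notin> dg g -` A \<inter> space PN"
    using AE_space by eventually_elim (simp add: dg_eq_diag)
  then show "dg g -` A \<inter> space PN \<in> null_sets PN"
    using measurable_sets[OF dg_measurable[OF g]] A by (subst AE_iff_null_sets) auto
qed

lemma AE_LapI: "AE t in lborel. R t \<Longrightarrow> AE t in Lap. R t"
  unfolding Lap_def by (subst AE_density) auto

lemma AE_sections_conv:
  assumes [measurable]: "Measurable.pred Z R" and R: "AE p in PN. AE t in lborel. R (fst p, snd p, t)"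
  shows "AE z in Z. R z"
proof -
  interpret L: prob_space Lap by (rule prob_space_Lap)
  interpret PN: prob_space "PN" by (rule prob_PN)
  interpret PNL: pair_sigma_finite "PN" Lap ..
  have m: "(\<lambda>q. (fst (fst q), snd (fst q), snd q)) \<in> measurable (PN \<Otimes>\<^sub>M Lap) Z" by measurable
  have "AE p in PN. AE t in Lap. R (fst p, snd p, t)"
    using R by eventually_elim (rule AE_LapI)
  moreover have "{q \<in> space (PN \<Otimes>\<^sub>M Lap). R (fst (fst q), snd (fst q), snd q)} \<in> sets (PN \<Otimes>\<^sub>M Lap)" by measurable
  ultimately have "AE q in PN \<Otimes>\<^sub>M Lap. R (fst (fst q), snd (fst q), snd q)"
    by (intro PNL.AE_pair_measure) auto
  moreover have pm: "{z \<in> space Z. R z} \<in> sets Z" by measurable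
  ultimately show ?thesis using AE_distr_iff[OF m pm] unfolding distr_assoc by simp
qed

text \<open>Exponential smoothing commutes with translations, makes the sections continuous, and turns only
  almost everywhere constant sections into constants.\<close>

definition smooth :: "((('g \<Rightarrow> real) \<times> 'y) \<times> real) set \<Rightarrow> ('g \<Rightarrow> real) \<times> 'y \<times> real \<Rightarrow> real" where
  "smooth A z = (\<integral>r. indicator A ((fst z, fst (snd z)), r) * exponential_density 1 (r - snd (snd z)) \<partial>lborel)"

context
  fixes A assumes A[measurable]: "A \<in> sets (PN \<Otimes>\<^sub>M (lborel :: real measure))"
begin

lemma section_measurable: "(\<lambda>r. indicator A (p, r) :: real) \<in> borel_measurable borel"
proof (cases "p \<in> space PN")
  case True
  then have "(\<lambda>r. indicator A (p, r) :: real) \<in> borel_measurable lborel" by measurable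
  then show ?thesis by simp
next
  case False
  then have "indicator A (p, r) = (0::real)" for r using sets.sets_into_space[OF A] by (auto simp: indicator_def space_pair_measure)
  then show ?thesis by simp
qed

lemma smooth_bounds: "0 \<le> smooth A z" "smooth A z \<le> 1"
  unfolding smooth_def by (rule integral_exponential_kernel(2,3)[OF section_measurable]; simp)+

lemma smooth_measurable: "smooth A \<in> borel_measurable Z"
proof -
  have "(\<lambda>(z, r). indicator A ((fst z, fst (snd z)), r) * exponential_density 1 (r - snd (snd z)) :: real) \<in> borel_measurable (Z \<Otimes>\<^sub>M lborel)"
    by measurable
  from lborel.borel_measurable_lebesgue_integral[OF this] show ?thesis unfolding smooth_def[abs_def] .
qed

lemma smooth_continuous: "sections_continuous (smooth A)"
  unfolding sections_continuous_def
proof (intro allI continuous_on_sequentiallyI)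
  fix x y and s :: "nat \<Rightarrow> real" and t assume s: "s \<longlonglongrightarrow> t"
  define u where "u = (\<lambda>r. indicator A ((x, y), r) :: real)"
  have u[measurable]: "u \<in> borel_measurable borel" unfolding u_def by (rule section_measurable)
  have u01: "0 \<le> u r" "u r \<le> 1" for r by (simp_all add: u_def)
  have "Bseq s" using s by (intro convergent_imp_Bseq convergentI)
  then obtain c0 where c0: "\<And>n. \<bar>s n\<bar> \<le> c0" by (auto simp: Bseq_def)
  define c where "c = c0 + \<bar>t\<bar>"
  have c: "\<bar>s n - t\<bar> \<le> c" for n using c0[of n] unfolding c_def by linarith
  have "(\<lambda>n. \<integral>r. u r * exponential_density 1 (r - s n) \<partial>lborel) \<longlonglongrightarrow> (\<integral>r. u r * exponential_density 1 (r - t) \<partial>lborel)"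
  \<comment> \<open>All kernels start at \<open>s n \<ge> t - c\<close> and
    \<open>s n \<le> t + c\<close>, so \<open>exp (2 * c)\<close> times the kernel that starts at
    \<open>t - c\<close> dominates them.\<close>
  proof (rule integral_dominated_convergence[where w="\<lambda>r. exp (2 * c) * (1 * exponential_density 1 (r - (t - c)))"])
    show "integrable lborel (\<lambda>r. exp (2 * c) * (1 * exponential_density 1 (r - (t - c))))"
      by (intro integrable_mult_right integral_exponential_kernel(1)) auto
    show "AE r in lborel. (\<lambda>n. u r * exponential_density 1 (r - s n)) \<longlonglongrightarrow> u r * exponential_density 1 (r - t)"
      \<comment> \<open>The kernel jumps at the excluded point.\<close>
      using AE_lborel_singleton[of t]
    proof eventually_elim
      case (elim r)
      have rs: "(\<lambda>n. r - s n) \<longlonglongrightarrow> r - t" by (intro tendsto_intros s)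
      have "(\<lambda>n. exponential_density 1 (r - s n)) \<longlonglongrightarrow> exponential_density 1 (r - t)"
      proof (cases "r < t")
        case True
        then have "\<forall>\<^sub>F n in sequentially. r - s n < 0" by (intro order_tendstoD(2)[OF rs]) simp
        then have "\<forall>\<^sub>F n in sequentially. exponential_density 1 (r - s n) = exponential_density 1 (r - t)"
          by eventually_elim (use True in \<open>simp add: exponential_density_def\<close>)
        then show ?thesis by (rule tendsto_eventually)
      next
        case False
        then have "0 < r - t" using elim by simp
        then have ev: "\<forall>\<^sub>F n in sequentially. 0 < r - s n" by (rule order_tendstoD(1)[OF rs])
        have "(\<lambda>n. exp (- (r - s n))) \<longlonglongrightarrow> exp (- (r - t))" by (intro tendsto_intros s)
        then have "(\<lambda>n. exponential_density 1 (r - s n)) \<longlonglongrightarrow> exp (- (r - t))"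
          by (rule Lim_transform_eventually) (use ev in \<open>eventually_elim, simp add: exponential_density_def\<close>)
        then show ?thesis using \<open>0 < r - t\<close> by (simp add: exponential_density_def)
      qed
      then show ?case by (intro tendsto_mult tendsto_const)
    qed
    show "AE r in lborel. norm (u r * exponential_density 1 (r - s n)) \<le> exp (2 * c) * (1 * exponential_density 1 (r - (t - c)))" for n
    proof (rule AE_I2)
      fix r
      have "exponential_density 1 (r - s n) \<le> exp (2 * c) * exponential_density 1 (r - (t - c))"
        using c[of n] by (auto simp: exponential_density_def exp_add[symmetric])
      moreover have "0 \<le> exponential_density 1 (r - s n)" by (rule exponential_density_nonneg) simp
      ultimately have "u r * exponential_density 1 (r - s n) \<le> 1 * (exp (2 * c) * exponential_density 1 (r - (t - c)))"
        using u01 by (intro mult_mono) auto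
      then show "norm (u r * exponential_density 1 (r - s n)) \<le> exp (2 * c) * (1 * exponential_density 1 (r - (t - c)))"
        using \<open>0 \<le> exponential_density 1 (r - s n)\<close> u01[of r] by simp
    qed
  qed auto
  then show "(\<lambda>n. smooth A (x, y, s n)) \<longlonglongrightarrow> smooth A (x, y, t)" by (simp add: smooth_def u_def)
qed

lemma smooth_invariant:
  assumes inv: "\<And>g. g \<in> I \<Longrightarrow> AE p in PN. AE t in lborel. (diag g p, t + ln (om g (fst p))) \<in> A \<longleftrightarrow> (p, t) \<in> A"
  shows "maharam_invariant (smooth A)"
  unfolding maharam_invariant_def
proof (intro conjI allI ballI smooth_measurable smooth_bounds)
  fix g assume g: "g \<in> I"
  note [measurable] = T_measurable[OF g] smooth_measurable
  show "AE z in Z. smooth A (T g z) = smooth A z"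
  proof (rule AE_sections_conv)
    show "AE p in PN. AE t in lborel. smooth A (T g (fst p, snd p, t)) = smooth A (fst p, snd p, t)"
      using inv[OF g]
    proof eventually_elim
      case (elim p)
      define l where "l = ln (om g (fst p))"
      have "smooth A (T g (fst p, snd p, t)) = smooth A (fst p, snd p, t)" for t
      proof -
        have "smooth A (T g (fst p, snd p, t)) = (\<integral>r. indicator A (diag g p, r) * exponential_density 1 (r - (t + l)) \<partial>lborel)"
          by (simp add: smooth_def T_def diag_def l_def)
        also have "\<dots> = (\<integral>r. indicator A (diag g p, l + 1 * r) * exponential_density 1 (l + 1 * r - (t + l)) \<partial>lborel)"
          by (subst lborel_integral_real_affine[where c=1 and t=l]) auto
        also have "\<dots> = (\<integral>r. indicator A (p, r) * exponential_density 1 (r - t) \<partial>lborel)"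
        proof (rule integral_cong_AE)
          show "AE r in lborel. indicator A (diag g p, l + 1 * r) * exponential_density 1 (l + 1 * r - (t + l)) = indicator A (p, r) * exponential_density 1 (r - t)"
            using elim by eventually_elim (simp add: l_def indicator_def add.commute)
          show "(\<lambda>r. indicator A (diag g p, l + 1 * r) * exponential_density 1 (l + 1 * r - (t + l))) \<in> borel_measurable lborel"
            using measurable_compose[OF _ section_measurable, of "\<lambda>r. l + 1 * r" borel] by measurable
          show "(\<lambda>r. indicator A (p, r) * exponential_density 1 (r - t)) \<in> borel_measurable lborel"
            using section_measurable by measurable
        qed
        finally show ?thesis by (simp add: smooth_def)
      qed
      then show ?case by simp
    qed
  qed measurable
qed

end

text \<open>Smoothing an invariant set gives an invariant function with continuous sections, which
  are constant by \<open>sections_constant\<close>. By \<open>exponential_kernel_constant\<close>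
  the sections of the set itself are then almost everywhere constant, so the set comes from an
  invariant set \<open>S\<close> of the diagonal product.\<close>

theorem maharam_ergodic:
  assumes erg: "ergodic G N b" and ns: "\<And>C. \<not> (\<lambda>h. (F h - C)\<^sup>2) summable_on I"
  shows "ergodic G (PN \<Otimes>\<^sub>M lborel) (maharam_extension G PN dg)"
  unfolding ergodic_def[of G "PN \<Otimes>\<^sub>M lborel"]
proof (intro ballI impI)
  interpret PN: prob_space "PN" by (rule prob_PN)
  interpret PNl: pair_sigma_finite "PN" "lborel :: real measure" ..
  fix A assume A[measurable]: "A \<in> sets (PN \<Otimes>\<^sub>M lborel)"
    and hyp: "\<forall>g\<in>I. AE z in PN \<Otimes>\<^sub>M lborel. maharam_extension G PN dg g z \<in> A \<longleftrightarrow> z \<in> A"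
  have inv: "AE p in PN. AE t in lborel. (diag g p, t + ln (om g (fst p))) \<in> A \<longleftrightarrow> (p, t) \<in> A" if g: "g \<in> I" for g
    using PNl.AE_pair[OF bspec[OF hyp g]] RN_deriv_dg[OF g] AE_space
  proof eventually_elim
    case (elim p)
    have "maharam_extension G PN dg g (p, t) = (diag g p, t + ln (om g (fst p)))" for t
      using elim(2,3) by (simp add: maharam_extension_def dg_eq_diag om_pos less_imp_le)
    with elim(1) show ?case by simp
  qed
  define Q where "Q = smooth A"
  have Q: "maharam_invariant Q" unfolding Q_def by (rule smooth_invariant[OF A inv])
  have c: "sections_continuous Q" unfolding Q_def by (rule smooth_continuous[OF A])
  note [measurable] = maharam_invariantD(1)[OF Q]
  have const: "AE p in PN. \<forall>t. Q (fst p, snd p, t) = Q (fst p, snd p, 0)" by (rule sections_constant[OF Q c erg ns])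
  have sec: "AE p in PN. AE t in lborel. indicator A (p, t) = Q (fst p, snd p, 0)"
    using const
  proof eventually_elim
    case (elim p)
    show ?case
      by (rule exponential_kernel_constant[OF section_measurable[OF A]]) (use elim in \<open>simp_all add: Q_def smooth_def\<close>)
  qed
  \<comment> \<open>By \<open>sec\<close> the constant value of a section is 0 or 1 almost
    everywhere; 1/2 separates the two.\<close>
  define S where "S = {p \<in> space PN. 1 / 2 < Q (fst p, snd p, 0)}"
  have S: "S \<in> sets PN" unfolding S_def by measurable
  have "AE p in PN. diag g p \<in> S \<longleftrightarrow> p \<in> S" if g: "g \<in> I" for g
    using AE_sections[OF maharam_invariantD(4)[OF Q g]] constant_sections_invariant[OF Q c g] const AE_space
  proof eventually_elim
    case (elim p)
    have "Q (fst (diag g p), snd (diag g p), 0 + ln (om g (fst p))) = Q (fst p, snd p, 0)"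
      by (rule continuous_AE_eq[OF sections_continuous_shift[OF c] sections_continuousD[OF c]]) (use elim(1) in \<open>simp add: T_def diag_def\<close>)
    moreover have "\<forall>t. Q (fst (diag g p), snd (diag g p), t) = Q (fst (diag g p), snd (diag g p), 0)" using elim(2,3) by blast
    ultimately have "Q (fst (diag g p), snd (diag g p), 0) = Q (fst p, snd p, 0)" by metis
    then show ?case using measurable_space[OF diag_measurable[OF g] elim(4)] elim(4) by (simp add: S_def)
  qed
  from ergodic_diag[OF erg S this]
  show "(AE z in PN \<Otimes>\<^sub>M lborel. z \<in> A) \<or> (AE z in PN \<Otimes>\<^sub>M lborel. z \<notin> A)"
  proof
    assume "AE p in PN. p \<in> S"
    with sec have "AE p in PN. AE t in lborel. (p, t) \<in> A"
    proof eventually_elim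
      case (elim p)
      from elim(1) show ?case by eventually_elim (rule ccontr, use elim(2) in \<open>simp add: S_def\<close>)
    qed
    moreover have "{z \<in> space (PN \<Otimes>\<^sub>M lborel). z \<in> A} \<in> sets (PN \<Otimes>\<^sub>M (lborel :: real measure))" by measurable
    ultimately have "AE z in PN \<Otimes>\<^sub>M lborel. z \<in> A" by (intro PNl.AE_pair_measure) auto
    then show ?thesis ..
  next
    assume "AE p in PN. p \<notin> S"
    with sec AE_space have "AE p in PN. AE t in lborel. (p, t) \<notin> A"
    proof eventually_elim
      case (elim p)
      from elim(1) show ?case by eventually_elim (rule notI, use elim(2,3) in \<open>simp add: S_def\<close>)
    qed
    moreover have "{z \<in> space (PN \<Otimes>\<^sub>M lborel). z \<notin> A} \<in> sets (PN \<Otimes>\<^sub>M (lborel :: real measure))" by measurable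
    ultimately have "AE z in PN \<Otimes>\<^sub>M lborel. z \<notin> A" by (intro PNl.AE_pair_measure) auto
    then show ?thesis ..
  qed
qed

end

section \<open>Types of the Bernoulli action\<close>

context bernoulli_growth
begin

text \<open>An invariant set of the Bernoulli factor pulls back to an invariant set of the diagonal
  product. It is applied with a one-point pmp action.\<close>

lemma ergodic_act:
  assumes erg: "ergodic G N b"
  shows "ergodic G P act"
  unfolding ergodic_def[of G P]
proof (intro ballI impI)
  interpret N: prob_space N by (rule prob_N)
  interpret PN: pair_sigma_finite P N ..
  fix S assume S[measurable]: "S \<in> sets P" and inv: "\<forall>g\<in>I. AE x in P. act g x \<in> S \<longleftrightarrow> x \<in> S"
  define S' where "S' = {p \<in> space PN. fst p \<in> S}"
  have S': "S' \<in> sets PN" unfolding S'_def by measurable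
  have "AE p in PN. dg g p \<in> S' \<longleftrightarrow> p \<in> S'" if g: "g \<in> I" for g
    using AE_fst[OF prob_N bspec[OF inv g]] AE_space
  proof eventually_elim
    case (elim p)
    then show ?case using measurable_space[OF dg_measurable[OF g] elim(2)] by (simp add: S'_def dg_apply)
  qed
  with ergodic_dg[OF erg] S' have "(AE p in PN. p \<in> S') \<or> (AE p in PN. p \<notin> S')"
    unfolding ergodic_def by blast
  then show "(AE x in P. x \<in> S) \<or> (AE x in P. x \<notin> S)"
  proof
    assume "AE p in PN. p \<in> S'"
    then have "AE p in PN. fst p \<in> S" by eventually_elim (simp add: S'_def)
    then show ?thesis using PN.AE_pair[of "\<lambda>p. fst p \<in> S"] by simp
  next
    assume "AE p in PN. p \<notin> S'"
    then have "AE p in PN. fst p \<notin> S" using AE_space by eventually_elim (simp add: S'_def)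
    then show ?thesis using PN.AE_pair[of "\<lambda>p. fst p \<notin> S"] by simp
  qed
qed

lemma type_III1_dg:
  assumes "ergodic G N b" "\<And>C. \<not> (\<lambda>h. (F h - C)\<^sup>2) summable_on I"
  shows "type_III1 G PN dg"
  unfolding type_III1_def by (intro conjI nonsingular_dg ergodic_dg maharam_ergodic assms)

end

section \<open>Nonatomicity, the invariant measure, and the conclusions under the growth
  condition\<close>

context bernoulli_shift
begin

text \<open>Restrict \<open>P\<close> to \<open>A\<close> and push it forward to coordinate
  \<open>\<one>\<close>. The image has no atoms, so its distribution function is continuous, and
  cutting at the level of half the mass splits \<open>A\<close>.\<close>

lemma nonatomic_P: "nonatomic P"
  unfolding nonatomic_def
proof (intro ballI impI)
  fix A assume A[measurable]: "A \<in> sets P" and A0: "0 < emeasure P A"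
  define \<nu> where "\<nu> = distr (density P (indicator A)) borel (\<lambda>x. x \<one>)"
  have cm[measurable]: "(\<lambda>x. x \<one>) \<in> borel_measurable P"
    using measurable_component_singleton[of \<one> I "sh F"] by (simp cong: measurable_cong_sets)
  have ne: "emeasure \<nu> U = emeasure P (A \<inter> {x\<in>space P. x \<one> \<in> U})" if [measurable]: "U \<in> sets borel" for U
  proof -
    have "emeasure \<nu> U = emeasure (density P (indicator A)) ((\<lambda>x. x \<one>) -` U \<inter> space P)"
      unfolding \<nu>_def by (subst emeasure_distr) auto
    also have "\<dots> = emeasure P (A \<inter> ((\<lambda>x. x \<one>) -` U \<inter> space P))"
    proof -
      have V: "(\<lambda>x. x \<one>) -` U \<inter> space P \<in> sets P" by measurable
      then have "emeasure (density P (indicator A)) ((\<lambda>x. x \<one>) -` U \<inter> space P) = (\<integral>\<^sup>+x. indicator (A \<inter> ((\<lambda>x. x \<one>) -` U \<inter> space P)) x \<partial>P)"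
        by (simp add: emeasure_density indicator_inter_arith)
      then show ?thesis using V by simp
    qed
    also have "(\<lambda>x. x \<one>) -` U \<inter> space P = {x\<in>space P. x \<one> \<in> U}" by auto
    finally show ?thesis .
  qed
  have sn: "sets \<nu> = sets borel" by (simp add: \<nu>_def)
  have tot: "emeasure \<nu> UNIV = emeasure P A"
    using ne[of UNIV] sets.sets_into_space[OF A] by (simp add: Int_absorb2)
  have "finite_measure \<nu>"
    using PP.P.emeasure_finite[of A] sets_eq_imp_space_eq[OF sn] tot by (intro finite_measureI) simp
  then interpret \<nu>: finite_borel_measure \<nu>
    using sn by (simp add: finite_borel_measure_def finite_borel_measure_axioms_def)
  have atom: "measure \<nu> {c} = 0" for c
  proof -
    have "AE u in sh F \<one>. u \<noteq> c" using AE_lborel_singleton[of c] by (subst AE_sh_iff) auto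
    then have "AE u in distr P (sh F \<one>) (\<lambda>x. x \<one>). u \<noteq> c" unfolding PP.PiM_component[OF one_closed] .
    from AE_distrD[OF _ this] have "AE x in P. x \<one> \<noteq> c" by simp
    then have "AE x in P. x \<notin> A \<inter> {x\<in>space P. x \<one> \<in> {c}}" by eventually_elim auto
    then have "emeasure P (A \<inter> {x\<in>space P. x \<one> \<in> {c}}) = 0" by (subst (asm) AE_iff_null_sets[symmetric]) auto
    then show ?thesis using ne[of "{c}"] by (simp add: measure_def)
  qed
  define m where "m = measure \<nu> UNIV"
  have m: "m > 0" using A0 tot \<nu>.emeasure_eq_measure[of UNIV] unfolding m_def by (metis ennreal_0 less_irrefl measure_nonneg order_le_less)
  have cont: "continuous_on UNIV (cdf \<nu>)"
    using atom \<nu>.isCont_cdf by (auto simp: continuous_on_eq_continuous_at)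
  have "(cdf \<nu> \<longlongrightarrow> m) at_top" using \<nu>.cdf_lim_at_top unfolding m_def sets_eq_imp_space_eq[OF sn] by simp
  then have "\<forall>\<^sub>F x in at_top. m / 2 < cdf \<nu> x" using m by (intro order_tendstoD(1)) auto
  then obtain b where b: "m / 2 < cdf \<nu> b" by (auto dest: eventually_happens)
  have "\<forall>\<^sub>F x in at_bot. cdf \<nu> x < m / 2" using m by (intro order_tendstoD(2)[OF \<nu>.cdf_lim_at_bot]) auto
  then obtain a where a: "cdf \<nu> a < m / 2" by (auto dest: eventually_happens)
  have "a \<le> b" using a b \<nu>.cdf_nondecreasing[of b a] by (cases "a \<le> b") auto
  then obtain c where c: "cdf \<nu> c = m / 2"
    using IVT'[of "cdf \<nu>" a "m / 2" b] a b continuous_on_subset[OF cont] by auto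
  define B where "B = A \<inter> {x\<in>space P. x \<one> \<in> {..c}}"
  have B: "B \<in> sets P" unfolding B_def by measurable
  have "emeasure P B = emeasure \<nu> {..c}" by (simp add: B_def ne)
  then have eB: "emeasure P B = ennreal (m / 2)" unfolding \<nu>.emeasure_eq_measure c[unfolded cdf_def] .
  have eA: "emeasure P A = ennreal m" using tot \<nu>.emeasure_eq_measure[of UNIV] by (simp add: m_def)
  have "emeasure P (A - B) = emeasure P A - emeasure P B"
    using B by (intro emeasure_Diff) (auto simp: B_def eB)
  also have "\<dots> = ennreal (m / 2)"
    unfolding eA eB by (subst ennreal_minus) (use m in auto)
  finally have "emeasure P (A - B) = ennreal (m / 2)" .
  then show "\<exists>B\<in>sets P. B \<subseteq> A \<and> 0 < emeasure P B \<and> 0 < emeasure P (A - B)"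
    using B eB m by (intro bexI[of _ B]) (auto simp: B_def)
qed

text \<open>All marginals coincide, so permuting the coordinates preserves the product.\<close>

lemma pmp_constant_shift: "pmp_action G (PiM I (sh (\<lambda>_. C))) act"
proof -
  have B: "bernoulli_shift \<phi> \<kappa> G (\<lambda>_. C) \<bar>C\<bar>"
    by (intro bernoulli_shift.intro shift_density_axioms group_axioms bernoulli_shift_axioms.intro) (simp_all add: countable_G)
  have a: "bernoulli_action G (sh (\<lambda>_. C)) = act"
    by (rule ext) (simp add: bernoulli_action_def space_PiM_sh)
  have d: "distr (PiM I (sh (\<lambda>_. C))) (PiM I (sh (\<lambda>_. C))) (act g) = PiM I (sh (\<lambda>_. C))" if g: "g \<in> I" for g
    using bernoulli_shift.distr_act[OF B inv_closed[OF g]] g by (simp add: a bernoulli_shift.tr_def[OF B, abs_def])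
  show ?thesis
    unfolding pmp_action_def
    using bernoulli_shift.group_action_act[OF B] bernoulli_shift.act_measurable[OF B] d
    by (simp add: a prob_space_PiM[OF prob_sh])
qed

text \<open>If \<open>F\<close> is square summable up to \<open>C\<close>, then \<open>P\<close> is
  equivalent to the product with constant shift \<open>C\<close>, which is invariant.\<close>

lemma type_II1_act:
  assumes erg: "ergodic G P act" and C: "(\<lambda>h. (F h - C)\<^sup>2) summable_on I"
  shows "type_II1 G P act"
  unfolding type_II1_def
proof (intro conjI exI[of _ "PiM I (sh (\<lambda>_. C))"])
  have C': "(\<lambda>h. (C - F h)\<^sup>2) summable_on I" using C by (simp add: power2_commute)
  show "absolutely_continuous P (PiM I (sh (\<lambda>_. C)))" by (rule PiM_sh_absolutely_continuous[OF C'])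
  show "absolutely_continuous (PiM I (sh (\<lambda>_. C))) P" by (rule PiM_sh_absolutely_continuous[OF C])
  show "sets (PiM I (sh (\<lambda>_. C))) = sets P" by (simp only: sets_PiM_sh)
qed (rule nonsingular_act erg nonatomic_P pmp_constant_shift)+

lemma pmp_unit: "pmp_action G (return (count_space UNIV) ()) (\<lambda>_ x. x)"
  unfolding pmp_action_def
proof (intro conjI ballI)
  show "group_action G (space (return (count_space UNIV) ())) (\<lambda>_ x. x)" by (rule group_actionI) auto
  show "prob_space (return (count_space UNIV) ())" by (rule prob_space_return) simp
  show "distr (return (count_space UNIV) ()) (return (count_space UNIV) ()) (\<lambda>x. x) = return (count_space UNIV) ()" by (rule distr_id)
qed simp

lemma ergodic_unit: "ergodic G (return (count_space UNIV) ()) (\<lambda>_ x. x)"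
  unfolding ergodic_def
proof (intro ballI impI)
  fix A :: "unit set"
  show "(AE x in return (count_space UNIV) (). x \<in> A) \<or> (AE x in return (count_space UNIV) (). x \<notin> A)"
    by (cases "() \<in> A") (auto intro!: AE_I2)
qed

lemma coboundary_iff: "coboundary G F \<longleftrightarrow> (\<exists>C. (\<lambda>h. (F h - C)\<^sup>2) summable_on I)"
proof
  assume "coboundary G F"
  then obtain C f where f: "(\<lambda>h. (f h)\<^sup>2) summable_on I" "\<And>h. h \<in> I \<Longrightarrow> F h = C + f h"
    unfolding coboundary_def square_summable_on_def by blast
  have "(\<lambda>h. (F h - C)\<^sup>2) summable_on I \<longleftrightarrow> (\<lambda>h. (f h)\<^sup>2) summable_on I" using f(2) by (intro summable_on_cong) simp
  then show "\<exists>C. (\<lambda>h. (F h - C)\<^sup>2) summable_on I" using f(1) by blast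
next
  assume "\<exists>C. (\<lambda>h. (F h - C)\<^sup>2) summable_on I"
  then obtain C where "(\<lambda>h. (F h - C)\<^sup>2) summable_on I" by blast
  then show "coboundary G F"
    unfolding coboundary_def square_summable_on_def by (intro exI[of _ C] exI[of _ "\<lambda>h. F h - C"]) simp
qed

text \<open>As \<open>\<delta>\<close> lies strictly below an upper limit, there are arbitrarily
  large radii with more than \<open>exp (\<delta> * s)\<close> elements. From an infinite ball a
  finite subset of sufficient size is taken.\<close>

lemma growth_sets:
  assumes \<delta>: "ereal \<delta> < poincare_exponent G (cocycle G F)" "0 \<le> \<delta>"
  shows "\<exists>S s. finite S \<and> S \<noteq> {} \<and> S \<subseteq> I \<and> (\<forall>g\<in>S. nrm g \<le> s) \<and> real n \<le> s \<and> exp (\<delta> * s) \<le> real (card S)"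
proof -
  let ?S = "\<lambda>s. {g \<in> I. (\<Sum>\<^sub>\<infinity>h\<in>I. (cocycle G F g h)\<^sup>2) \<le> s}"
  have "\<not> (\<forall>\<^sub>F s in at_top. log_card (?S s) / ereal s \<le> ereal \<delta>)"
    using Limsup_bounded[of "\<lambda>s. log_card (?S s) / ereal s" "ereal \<delta>" at_top] \<delta>(1)
    unfolding poincare_exponent_def by (auto simp: not_le[symmetric])
  then have "\<forall>N. \<exists>s\<ge>N. ereal \<delta> < log_card (?S s) / ereal s"
    unfolding eventually_at_top_linorder by (simp add: not_le)
  from this[rule_format, of "max 1 (real n)"]
  obtain s where s: "max 1 (real n) \<le> s" "ereal \<delta> < log_card (?S s) / ereal s" by blast
  have s0: "0 < s" using s(1) by simp
  have nrm: "nrm g \<le> s" if "g \<in> ?S s" for g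
  proof -
    \<comment> \<open>\<open>cocycle\<close> translates by \<open>inv g\<close>, whereas
      \<open>nrm\<close> translates by \<open>g\<close>.\<close>
    have "nrm (inv g) \<le> s" using that by (simp add: nrm_def cocycle_def)
    then show ?thesis using nrm_inv[of g] that by simp
  qed
  have "\<exists>S\<subseteq>?S s. finite S \<and> exp (\<delta> * s) \<le> real (card S)"
  proof (cases "finite (?S s)")
    case True
    then have "\<delta> * s < ln (real (card (?S s)))"
      using s(2) s0 by (simp add: log_card_def field_simps)
    moreover have "0 \<le> \<delta> * s" using \<delta>(2) s0 by simp
    \<comment> \<open>An empty ball is excluded because \<open>ln 0 = 0\<close> does not exceed the
      nonnegative number \<open>\<delta> * s\<close>.\<close>
    ultimately have "card (?S s) \<noteq> 0" by (metis ln_0 not_le of_nat_0)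
    then have c0: "0 < real (card (?S s))" by simp
    have "exp (\<delta> * s) < exp (ln (real (card (?S s))))" using \<open>\<delta> * s < _\<close> by simp
    then have "exp (\<delta> * s) \<le> real (card (?S s))" using c0 by simp
    then show ?thesis using True by blast
  next
    case False
    obtain k where k: "exp (\<delta> * s) \<le> real k" using real_arch_simple by blast
    obtain T where "finite T" "card T = k" "T \<subseteq> ?S s" using infinite_arbitrarily_large[OF False, of k] by blast
    then show ?thesis using k by blast
  qed
  then obtain S where S: "S \<subseteq> ?S s" "finite S" "exp (\<delta> * s) \<le> real (card S)" by blast
  have "0 < real (card S)" by (rule less_le_trans[OF exp_gt_zero S(3)])
  then have "S \<noteq> {}" by auto
  moreover have "S \<subseteq> I" "\<forall>g\<in>S. nrm g \<le> s" using S(1) nrm by blast+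
  ultimately show ?thesis using S s(1) by (intro exI[of _ S] exI[of _ s]) auto
qed

theorem bernoulli_conclusions:
  assumes gr: "ereal (9 / 2 * \<kappa>) < poincare_exponent G (cocycle G F)"
  shows "weakly_mixing TYPE('y) G P act \<and>
    (if coboundary G F then type_II1 G P act else stable_type_III1 TYPE('y) G P act)"
proof -
  obtain \<delta> where \<delta>: "9 / 2 * \<kappa> < \<delta>" "ereal \<delta> < poincare_exponent G (cocycle G F)"
    using ereal_dense2[OF gr] by auto
  have "0 \<le> \<delta>" using \<delta>(1) kappa by simp
  from growth_sets[OF \<delta>(2) this] obtain Ks rad where
    Ks: "\<And>n. finite (Ks n)" "\<And>n. Ks n \<noteq> {}" "\<And>n. Ks n \<subseteq> I" "\<And>n g. g \<in> Ks n \<Longrightarrow> nrm g \<le> rad n" "\<And>n. real n \<le> rad n" "\<And>n. exp (\<delta> * rad n) \<le> real (card (Ks n))"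
    by metis
  \<comment> \<open>Stated for an arbitrary type, since it is used for the one-point space and for
    \<open>'y\<close>.\<close>
  have BG: "bernoulli_growth \<phi> \<kappa> G F K N b Ks rad \<delta>" if "pmp_action G N b" for N :: "'z measure" and b
    by (intro bernoulli_growth.intro bernoulli_pmp.intro bernoulli_shift_axioms bernoulli_pmp_axioms.intro that bernoulli_growth_axioms.intro Ks \<delta>(1))
  have erg: "ergodic G P act" by (rule bernoulli_growth.ergodic_act[OF BG[OF pmp_unit] ergodic_unit])
  have wm: "weakly_mixing TYPE('y) G P act"
    unfolding weakly_mixing_def using nonsingular_act erg bernoulli_growth.ergodic_dg[OF BG] by blast
  show ?thesis
  proof (cases "coboundary G F")
    case True
    then show ?thesis using wm type_II1_act[OF erg] by (auto simp: coboundary_iff)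
  next
    case False
    then have "\<not> (\<lambda>h. (F h - C)\<^sup>2) summable_on I" for C by (auto simp: coboundary_iff)
    then have "stable_type_III1 TYPE('y) G P act"
      unfolding stable_type_III1_def using wm bernoulli_growth.type_III1_dg[OF BG] by blast
    with wm False show ?thesis by simp
  qed
qed

end

section \<open>Growth of the density\<close>

text \<open>The derivative of \<open>exp (- x\<^sup>2 / 2) * cosh x\<close> has the sign of
  \<open>sinh x - x * cosh x\<close>, which is nonpositive for \<open>x \<ge> 0\<close>.\<close>

lemma cosh_le_exp: "cosh x \<le> exp (x\<^sup>2 / 2)" for x :: real
proof -
  have pos: "cosh x \<le> exp (x\<^sup>2 / 2)" if x: "0 \<le> x" for x :: real
  proof -
    have s: "sinh y \<le> y * cosh y" if "0 \<le> y" for y :: real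
    proof -
      have "0 * cosh 0 - sinh 0 \<le> y * cosh y - sinh y"
        by (rule DERIV_nonneg_imp_nondecreasing[OF that])
          (auto intro!: exI derivative_eq_intros mult_nonneg_nonneg)
      then show ?thesis by simp
    qed
    have "exp (- x\<^sup>2 / 2) * cosh x \<le> exp (- 0\<^sup>2 / 2) * cosh 0"
    proof (rule DERIV_nonpos_imp_nonincreasing[OF x])
      fix y :: real assume y: "0 \<le> y" "y \<le> x"
      have "((\<lambda>x. exp (- x\<^sup>2 / 2) * cosh x) has_real_derivative exp (- y\<^sup>2 / 2) * (sinh y - y * cosh y)) (at y)"
        by (auto intro!: derivative_eq_intros simp: algebra_simps)
      moreover have "exp (- y\<^sup>2 / 2) * (sinh y - y * cosh y) \<le> 0" using s[OF y(1)] by (simp add: mult_le_0_iff)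
      ultimately show "\<exists>d. ((\<lambda>x. exp (- x\<^sup>2 / 2) * cosh x) has_real_derivative d) (at y) \<and> d \<le> 0" by blast
    qed
    then have "exp (- (x\<^sup>2 / 2)) * cosh x \<le> 1" by simp
    then show ?thesis by (simp add: exp_minus field_simps)
  qed
  show ?thesis using pos[of x] pos[of "- x"] by (cases "0 \<le> x") auto
qed

locale positive_density =
  fixes \<phi> :: "real \<Rightarrow> real"
  assumes cont: "continuous_on UNIV \<phi>" and pos: "\<And>t. 0 < \<phi> t" and int: "has_bochner_integral lborel \<phi> 1"
begin

lemma phi_measurable[measurable]: "\<phi> \<in> borel_measurable borel"
  by (rule borel_measurable_continuous_onI[OF cont])

lemma nn_integral_shift: "(\<integral>\<^sup>+t. ennreal (\<phi> (t + a)) \<partial>lborel) = 1"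
proof -
  have i: "integrable lborel \<phi>" "integral\<^sup>L lborel \<phi> = 1" using int by (auto simp: has_bochner_integral_iff)
  have "(\<integral>\<^sup>+t. ennreal (\<phi> t) \<partial>lborel) = 1" using i(2) by (subst nn_integral_eq_integral[OF i(1)]) (auto simp: pos less_imp_le)
  moreover have "(\<integral>\<^sup>+t. ennreal (\<phi> t) \<partial>lborel) = (\<integral>\<^sup>+t. ennreal (\<phi> (a + 1 * t)) \<partial>lborel)"
    by (subst nn_integral_real_affine[where c=1 and t=a]) auto
  ultimately show ?thesis by (simp add: add.commute)
qed

text \<open>The ratio r of the translates lies between exp (-B) and exp B, so r + 1/r is at most 2
  cosh B. Integrating against the translate by \<open>a\<close> gives
  \<open>?J + 1 \<le> 2 * cosh B\<close>. Adding the reciprocal cancels the first-order term, so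
  that the bound is quadratic in \<open>B\<close>; the pointwise bound r \<le> exp B alone would be
  linear.\<close>

lemma shift_density_lipschitz:
  assumes L: "M-lipschitz_on UNIV (\<lambda>t. ln (\<phi> t))"
  shows "shift_density \<phi> (M\<^sup>2)"
proof
  fix a b
  define B where "B = M * \<bar>a - b\<bar>"
  have B0: "0 \<le> B" using lipschitz_on_nonneg[OF L] by (simp add: B_def)
  have pt: "(\<phi> (t + a))\<^sup>2 / \<phi> (t + b) + \<phi> (t + b) \<le> 2 * cosh B * \<phi> (t + a)" for t
  proof -
    define E where "E = ln (\<phi> (t + a)) - ln (\<phi> (t + b))"
    have "\<bar>E\<bar> \<le> B" using lipschitz_onD[OF L, of "t + a" "t + b"] by (simp add: E_def B_def dist_real_def)
    then have "cosh \<bar>E\<bar> \<le> cosh B" by (subst cosh_real_nonneg_le_iff) (use B0 in auto)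
    moreover have "cosh \<bar>E\<bar> = cosh E" by (cases "0 \<le> E") auto
    moreover have "exp E + exp (- E) = 2 * cosh E" by (simp add: cosh_def)
    ultimately have "exp E + exp (- E) \<le> 2 * cosh B" by simp
    moreover have e1: "exp E = \<phi> (t + a) / \<phi> (t + b)" "exp (- E) = \<phi> (t + b) / \<phi> (t + a)"
      by (simp_all add: E_def exp_diff pos)
    ultimately have "(\<phi> (t + a) / \<phi> (t + b) + \<phi> (t + b) / \<phi> (t + a)) * \<phi> (t + a) \<le> 2 * cosh B * \<phi> (t + a)"
      using pos[of "t + a"] by (intro mult_right_mono) auto
    moreover have "(\<phi> (t + a) / \<phi> (t + b) + \<phi> (t + b) / \<phi> (t + a)) * \<phi> (t + a) = (\<phi> (t + a))\<^sup>2 / \<phi> (t + b) + \<phi> (t + b)"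
      using pos[of "t + a"] by (simp add: distrib_right power2_eq_square)
    ultimately show ?thesis by simp
  qed
  have nn: "0 \<le> (\<phi> (t + a))\<^sup>2 / \<phi> (t + b)" for t using pos[of "t + b"] by simp
  let ?J = "\<integral>\<^sup>+t. ennreal ((\<phi> (t + a))\<^sup>2 / \<phi> (t + b)) \<partial>lborel"
  have "?J + 1 = (\<integral>\<^sup>+t. ennreal ((\<phi> (t + a))\<^sup>2 / \<phi> (t + b)) + ennreal (\<phi> (t + b)) \<partial>lborel)"
    by (subst nn_integral_add) (simp_all add: nn_integral_shift)
  also have "\<dots> \<le> (\<integral>\<^sup>+t. ennreal (2 * cosh B) * ennreal (\<phi> (t + a)) \<partial>lborel)"
  proof (rule nn_integral_mono)
    fix t
    show "ennreal ((\<phi> (t + a))\<^sup>2 / \<phi> (t + b)) + ennreal (\<phi> (t + b)) \<le> ennreal (2 * cosh B) * ennreal (\<phi> (t + a))"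
      using ennreal_leI[OF pt[of t]] nn[of t] pos[of "t + b"] pos[of "t + a"] by (simp add: ennreal_mult)
  qed
  also have "\<dots> = ennreal (2 * cosh B)" by (simp add: nn_integral_cmult nn_integral_shift)
  finally have J: "?J + 1 \<le> ennreal (2 * cosh B)" .
  \<comment> \<open>With this \<open>y\<close>, both \<open>cosh B \<le> y\<close> and
    \<open>2 * y \<le> y\<^sup>2 + 1\<close> hold, and \<open>y\<^sup>2\<close> is the desired
    exponential.\<close>
  define y where "y = exp (B\<^sup>2 / 2)"
  have "2 * cosh B \<le> 2 * y" using cosh_le_exp[of B] by (simp add: y_def)
  also have "2 * y \<le> y\<^sup>2 + 1" using zero_le_power2[of "y - 1"] by (simp add: power2_eq_square algebra_simps)
  also have "y\<^sup>2 = exp (B\<^sup>2)" unfolding y_def by (simp add: exp_double[symmetric])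
  finally have "2 * cosh B \<le> exp (M\<^sup>2 * (a - b)\<^sup>2) + 1" by (simp add: B_def power_mult_distrib)
  from order_trans[OF J ennreal_leI[OF this]] have "?J + 1 \<le> ennreal (exp (M\<^sup>2 * (a - b)\<^sup>2)) + 1"
    by (simp add: ennreal_plus)
  then show "?J \<le> ennreal (exp (M\<^sup>2 * (a - b)\<^sup>2))" by (simp add: ennreal_add_left_cancel_le add.commute)
qed (use cont pos int in auto)

text \<open>A Lipschitz derivative bounds second differences of \<open>ln \<phi>\<close> by
  \<open>M * h\<^sup>2\<close>. At the equally spaced points \<open>t + b\<close>,
  \<open>t + a\<close> and \<open>t + (2 * a - b)\<close> this bounds the integrand by
  \<open>exp (M * (a - b)\<^sup>2)\<close> times a third translate of the density, which has
  integral 1.\<close>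

lemma shift_density_lipschitz_deriv:
  assumes d: "\<And>t. (\<lambda>t. ln (\<phi> t)) differentiable (at t)" and L: "M-lipschitz_on UNIV (deriv (\<lambda>t. ln (\<phi> t)))"
  shows "shift_density \<phi> M"
proof
  show M: "0 \<le> M" by (rule lipschitz_on_nonneg[OF L])
  define l where "l = (\<lambda>t. ln (\<phi> t))"
  have dl[derivative_intros]: "(l has_real_derivative deriv l t) (at t)" for t
    using d[of t] unfolding l_def by (simp add: DERIV_deriv_iff_real_differentiable)
  have Ll: "\<bar>deriv l s - deriv l t\<bar> \<le> M * \<bar>s - t\<bar>" for s t
    using lipschitz_onD[OF L, of s t] by (simp add: l_def dist_real_def)
  have mid0: "0 \<le> l (p + h) + l (p - h) - 2 * l p + M * h\<^sup>2" if h: "0 \<le> h" for p h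
  proof -
    have "l (p + 0) + l (p - 0) - 2 * l p + M * 0\<^sup>2 \<le> l (p + h) + l (p - h) - 2 * l p + M * h\<^sup>2"
    proof (rule DERIV_nonneg_imp_nondecreasing[OF h])
      fix x assume x: "0 \<le> x" "x \<le> h"
      have d1: "((\<lambda>x. l (p + x)) has_real_derivative deriv l (p + x)) (at x)"
      proof -
        have "((\<lambda>x. p + x) has_real_derivative 1) (at x)" by (auto intro!: derivative_eq_intros)
        from DERIV_chain2[OF dl this] show ?thesis by simp
      qed
      have d2: "((\<lambda>x. l (p - x)) has_real_derivative - deriv l (p - x)) (at x)"
      proof -
        have "((\<lambda>x. p - x) has_real_derivative - 1) (at x)" by (auto intro!: derivative_eq_intros)
        from DERIV_chain2[OF dl this] show ?thesis by simp
      qed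
      have "((\<lambda>x. l (p + x) + l (p - x) - 2 * l p + M * x\<^sup>2) has_real_derivative deriv l (p + x) - deriv l (p - x) + 2 * M * x) (at x)"
        by (rule derivative_eq_intros d1 d2 refl)+ simp
      moreover have "0 \<le> deriv l (p + x) - deriv l (p - x) + 2 * M * x" using Ll[of "p + x" "p - x"] x by simp
      ultimately show "\<exists>y. ((\<lambda>x. l (p + x) + l (p - x) - 2 * l p + M * x\<^sup>2) has_real_derivative y) (at x) \<and> 0 \<le> y" by blast
    qed
    then show ?thesis by simp
  qed
  have mid: "2 * l p - l (p - h) \<le> l (p + h) + M * h\<^sup>2" for p h
    using mid0[of h p] mid0[of "- h" p] by (cases "0 \<le> h") auto
  fix a b
  have pt: "(\<phi> (t + a))\<^sup>2 / \<phi> (t + b) \<le> exp (M * (a - b)\<^sup>2) * \<phi> (t + (2 * a - b))" for t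
  proof -
    have el: "exp (l s) = \<phi> s" for s by (simp add: l_def pos)
    have "exp (2 * l (t + a) - l (t + b)) \<le> exp (l (t + (2 * a - b)) + M * (a - b)\<^sup>2)"
      using mid[of "t + a" "a - b"] by (simp add: algebra_simps)
    then show ?thesis by (simp add: exp_diff exp_add exp_double el mult.commute)
  qed
  have "(\<integral>\<^sup>+t. ennreal ((\<phi> (t + a))\<^sup>2 / \<phi> (t + b)) \<partial>lborel) \<le> (\<integral>\<^sup>+t. ennreal (exp (M * (a - b)\<^sup>2)) * ennreal (\<phi> (t + (2 * a - b))) \<partial>lborel)"
    using pt pos by (intro nn_integral_mono) (simp add: ennreal_mult[symmetric] less_imp_le ennreal_leI)
  also have "\<dots> = ennreal (exp (M * (a - b)\<^sup>2))" by (simp add: nn_integral_cmult nn_integral_shift)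
  finally show "(\<integral>\<^sup>+t. ennreal ((\<phi> (t + a))\<^sup>2 / \<phi> (t + b)) \<partial>lborel) \<le> ennreal (exp (M * (a - b)\<^sup>2))" .
qed (use cont pos int in auto)

end

theorem theoremD:
  fixes G :: "('g, 'b) monoid_scheme"
    and \<phi> :: "real \<Rightarrow> real"
    and F :: "'g \<Rightarrow> real"
    and M :: real
  defines "\<mu> \<equiv> shifted_measure \<phi> F"
  defines "X \<equiv> PiM (carrier G) \<mu>"
  defines "a \<equiv> bernoulli_action G \<mu>"
  defines "c \<equiv> cocycle G F"
  assumes "group G" and "countable (carrier G)"
    and "continuous_on UNIV \<phi>" and "\<And>t. 0 < \<phi> t" and "has_bochner_integral lborel \<phi> 1"
    and "bounded (F ` carrier G)"
    and "\<And>g. g \<in> carrier G \<Longrightarrow> square_summable_on (c g) (carrier G)"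
  shows
    "(M-lipschitz_on UNIV (\<lambda>t. ln (\<phi> t)) \<longrightarrow>
        nonsingular_action G X a \<and>
        (ereal (9 * M\<^sup>2 / 2) < poincare_exponent G c \<longrightarrow>
           weakly_mixing TYPE('y) G X a \<and>
           (if coboundary G F then type_II1 G X a else stable_type_III1 TYPE('y) G X a))) \<and>
     ((\<forall>t. (\<lambda>t. ln (\<phi> t)) differentiable (at t)) \<and>
      M-lipschitz_on UNIV (deriv (\<lambda>t. ln (\<phi> t))) \<longrightarrow>
        nonsingular_action G X a \<and>
        (ereal (6 * M) < poincare_exponent G c \<and>
         (\<exists>\<alpha>>2. integrable lborel (\<lambda>t. \<bar>t\<bar> powr \<alpha> * \<phi> t)) \<longrightarrow>
           weakly_mixing TYPE('y) G X a \<and>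
           (if coboundary G F then type_II1 G X a else stable_type_III1 TYPE('y) G X a)))"
proof -
  interpret group G by fact
  interpret positive_density \<phi> using assms(7-9) by unfold_locales auto
  obtain K where K: "\<And>g. g \<in> carrier G \<Longrightarrow> \<bar>F g\<bar> \<le> K"
    using assms(10) by (auto simp: bounded_iff)
  \<comment> \<open>The hypothesis on \<open>c\<close> is used at \<open>inv g\<close>, which turns
    translation by the inverse into translation by \<open>g\<close>.\<close>
  have sq: "(\<lambda>h. (F (g \<otimes>\<^bsub>G\<^esub> h) - F h)\<^sup>2) summable_on carrier G" if "g \<in> carrier G" for g
    using assms(11)[OF inv_closed[OF that]] that by (simp add: square_summable_on_def c_def cocycle_def)
  have bs: "bernoulli_shift \<phi> \<kappa> G F K" if "shift_density \<phi> \<kappa>" for \<kappa>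
    by (intro bernoulli_shift.intro that group_axioms bernoulli_shift_axioms.intro assms(6) K sq)
  have ns: "nonsingular_action G X a" if "shift_density \<phi> \<kappa>" for \<kappa>
    unfolding X_def a_def \<mu>_def by (rule bernoulli_shift.nonsingular_act[OF bs[OF that]])
  have con: "weakly_mixing TYPE('y) G X a \<and> (if coboundary G F then type_II1 G X a else stable_type_III1 TYPE('y) G X a)"
    if "shift_density \<phi> \<kappa>" "ereal (9 / 2 * \<kappa>) < poincare_exponent G c" for \<kappa>
    using bernoulli_shift.bernoulli_conclusions[OF bs[OF that(1)], where 'y='y] that(2) unfolding X_def a_def \<mu>_def c_def by blast
  show ?thesis
  proof (intro conjI impI; (elim conjE)?)
    assume "M-lipschitz_on UNIV (\<lambda>t. ln (\<phi> t))"
    then have s: "shift_density \<phi> (M\<^sup>2)" by (rule shift_density_lipschitz)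
    show "nonsingular_action G X a" by (rule ns[OF s])
    assume "ereal (9 * M\<^sup>2 / 2) < poincare_exponent G c"
    then have "ereal (9 / 2 * M\<^sup>2) < poincare_exponent G c" by simp
    from con[OF s this] show "weakly_mixing TYPE('y) G X a" "if coboundary G F then type_II1 G X a else stable_type_III1 TYPE('y) G X a" by blast+
  next
    assume d: "\<forall>t. (\<lambda>t. ln (\<phi> t)) differentiable (at t)" and L: "M-lipschitz_on UNIV (deriv (\<lambda>t. ln (\<phi> t)))"
    have s: "shift_density \<phi> M" by (rule shift_density_lipschitz_deriv[OF _ L]) (use d in blast)
    show "nonsingular_action G X a" by (rule ns[OF s])
    assume p: "ereal (6 * M) < poincare_exponent G c"
    have "ereal (9 / 2 * M) \<le> ereal (6 * M)" using lipschitz_on_nonneg[OF L] by simp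
    then have "ereal (9 / 2 * M) < poincare_exponent G c" using p by (rule le_less_trans)
    from con[OF s this] show "weakly_mixing TYPE('y) G X a" "if coboundary G F then type_II1 G X a else stable_type_III1 TYPE('y) G X a" by blast+
  qed
qed

end
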